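(* Let $k\in\mathbb N=\{1,2,\ldots\}$. Then $\dot B_1^{k,\infty}(\mathbb R)\subseteq VC^k(\mathbb R)$, and $C^{k,\varepsilon}_{\mathrm{loc}}(\mathbb R)\subseteq VC^k(\mathbb R)$ for all $\varepsilon>0$.
   Context: Homogeneous Besov space: let $\eta\in C_c^\infty(\mathbb R)$ satisfy $0\le\eta\le1$, $\operatorname{supp}\eta\subseteq[-2,2]$, $\eta\equiv1$ on $[-1,1]$, and for $i\in\mathbb Z$ set $\eta_i(\xi):=\eta(2^{-i}\xi)-\eta(2^{-i+1}\xi)$. Write $\check g(x):=\frac1{2\pi}\int_{\mathbb R}e^{ix\xi}g(\xi)\,d\xi$. For a tempered distribution $f$ on $\mathbb R$, $\|f\|_{\dot B_1^{k,\infty}}:=\sum_{i\in\mathbb Z}2^{ik}\|\check\eta_i*f\|_{L^\infty}\in[0,\infty]$, and $\dot B_1^{k,\infty}(\mathbb R)$ is the set of tempered distributions $f$ with $\|f\|_{\dot B_1^{k,\infty}}<\infty$. (It is known that $\dot B_1^{k,\infty}(\mathbb R)\subseteq C^k(\mathbb R)$.) $C^{k,\varepsilon}_{\mathrm{loc}}(\mathbb R)$ is the space of $C^k$ functions $f:\mathbb R\to\mathbb C$ whose $k$-th derivative is locally $\varepsilon$-Hölder continuous, i.e. for each $r>0$ there is $c<\infty$ with $|f^{(k)}(x)-f^{(k)}(y)|\le c|x-y|^\varepsilon$ for $x,y\in[-r,r]$. Divided differences: $f^{[0]}:=f$ and, for distinct reals, $f^{[i]}(s_1,\ldots,s_{i+1}):=\frac{f^{[i-1]}(s_1,\ldots,s_i)-f^{[i-1]}(s_1,\ldots,s_{i-1},s_{i+1})}{s_i-s_{i+1}}$;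 if $f\in C^i(\mathbb R)$, then $f^{[i]}$ extends uniquely to a continuous function on $\mathbb R^{i+1}$, denoted the same way. Varopoulos norms: for $r>0$, $m\in\mathbb N$, and $\varphi$ continuous on (a set containing) $[-r,r]^m$, $\beta_{r,m}(\varphi)\in[0,\infty]$ is the infimum of $\sum_{n=1}^\infty\prod_{i=1}^m\|\varphi_{i,n}\|_{\ell^\infty([-r,r])}$ over all sequences $(\varphi_{i,n})_n$ of complex-valued continuous functions on $[-r,r]$, $i=1,\ldots,m$, for which this sum is finite and $\varphi(\boldsymbol\lambda)=\sum_n\varphi_{1,n}(\lambda_1)\cdots\varphi_{m,n}(\lambda_m)$ for all $\boldsymbol\lambda\in[-r,r]^m$ ($\infty$ if there are none). $\mathcal C_\beta^k(\mathbb R):=\{f\in C^k(\mathbb R):\beta_{r,i+1}(f^{[i]})<\infty\text{ for all }r>0,\ 0\le i\le k\}$, with the topology generated by the seminorms $f\mapsto\beta_{r,i+1}(f^{[i]})$ ($r>0$, $0\le i\le k$). It contains all polynomials, and $VC^k(\mathbb R)$ (the Varopoulos-$C^k$ functions) is the closure of the set $\mathbb C[\lambda]$ of polynomials in $\mathcal C_\beta^k(\mathbb R)$. *)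

theory Defs
  imports "HOL-Analysis.Analysis" "HOL-Probability.Essential_Supremum"
    "HOL-Computational_Algebra.Polynomial"
begin

definition nderiv :: "nat \<Rightarrow> (real \<Rightarrow> 'a::real_normed_vector) \<Rightarrow> real \<Rightarrow> 'a" where
  "nderiv n f = ((\<lambda>g x. vector_derivative g (at x)) ^^ n) f"

definition Ck :: "nat \<Rightarrow> (real \<Rightarrow> 'a::real_normed_vector) set" where
  "Ck k = {f. (\<forall>i<k. \<forall>x. nderiv i f differentiable (at x)) \<and> continuous_on UNIV (nderiv k f)}"

definition Cinf :: "(real \<Rightarrow> 'a::real_normed_vector) set" where
  "Cinf = (\<Inter>n. Ck n)"

definition seminorm_topology ::
    "(real \<Rightarrow> complex) set \<Rightarrow> ((real \<Rightarrow> complex) \<Rightarrow> ennreal) set \<Rightarrow> (real \<Rightarrow> complex) topology" where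
  "seminorm_topology S P = topology_generated_by
     (insert S {{g \<in> S. p (\<lambda>x. g x - f x) < ennreal e} |p f e. p \<in> P \<and> f \<in> S \<and> 0 < e})"

definition schwartz_seminorm :: "nat \<Rightarrow> nat \<Rightarrow> (real \<Rightarrow> complex) \<Rightarrow> ennreal" where
  "schwartz_seminorm a b \<phi> = (SUP x. ennreal (norm (of_real (x ^ a) * nderiv b \<phi> x)))"

definition schwartz :: "(real \<Rightarrow> complex) set" where
  "schwartz = {\<phi> \<in> Cinf. \<forall>a b. schwartz_seminorm a b \<phi> < \<infinity>}"

definition schwartz_topology :: "(real \<Rightarrow> complex) topology" where
  "schwartz_topology = seminorm_topology schwartz {schwartz_seminorm a b |a b. True}"

text \<open>The values of a tempered distribution outside the Schwartz space are irrelevant.\<close>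

definition tempered_distribution :: "((real \<Rightarrow> complex) \<Rightarrow> complex) \<Rightarrow> bool" where
  "tempered_distribution u \<longleftrightarrow>
     (\<forall>\<phi>\<in>schwartz. \<forall>\<psi>\<in>schwartz. u (\<lambda>x. \<phi> x + \<psi> x) = u \<phi> + u \<psi>) \<and>
     (\<forall>c. \<forall>\<phi>\<in>schwartz. u (\<lambda>x. c * \<phi> x) = c * u \<phi>) \<and>
     continuous_map schwartz_topology euclidean u"

text \<open>The tempered distribution \<open>u\<close> is the function \<open>f\<close>. A continuous \<open>f\<close> is
  determined by \<open>u\<close>.\<close>

definition represents :: "(real \<Rightarrow> complex) \<Rightarrow> ((real \<Rightarrow> complex) \<Rightarrow> complex) \<Rightarrow> bool" where
  "represents f u \<longleftrightarrow>
     (\<forall>\<phi>\<in>schwartz. integrable lborel (\<lambda>x. f x * \<phi> x) \<and>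
        u \<phi> = (\<integral>x. f x * \<phi> x \<partial>lborel))"

definition convolution ::
    "(real \<Rightarrow> complex) \<Rightarrow> ((real \<Rightarrow> complex) \<Rightarrow> complex) \<Rightarrow> real \<Rightarrow> complex" where
  "convolution \<psi> u x = u (\<lambda>y. \<psi> (x - y))"

definition cutoff :: "(real \<Rightarrow> real) \<Rightarrow> bool" where
  "cutoff \<eta> \<longleftrightarrow> \<eta> \<in> Cinf \<and> (\<forall>\<xi>. 0 \<le> \<eta> \<xi> \<and> \<eta> \<xi> \<le> 1) \<and>
     closure {\<xi>. \<eta> \<xi> \<noteq> 0} \<subseteq> {-2..2} \<and> (\<forall>\<xi>\<in>{-1..1}. \<eta> \<xi> = 1)"

definition dyadic :: "(real \<Rightarrow> real) \<Rightarrow> int \<Rightarrow> real \<Rightarrow> real" where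
  "dyadic \<eta> i \<xi> = \<eta> (2 powi (- i) * \<xi>) - \<eta> (2 powi (- i + 1) * \<xi>)"

definition inv_fourier :: "(real \<Rightarrow> complex) \<Rightarrow> real \<Rightarrow> complex" where
  "inv_fourier g x = 1 / (2 * of_real pi) *
     (\<integral>\<xi>. exp (\<i> * of_real x * of_real \<xi>) * g \<xi> \<partial>lborel)"

definition Linf_norm :: "(real \<Rightarrow> complex) \<Rightarrow> ennreal" where
  "Linf_norm g = esssup lborel (\<lambda>x. ennreal (norm (g x)))"

definition besov_norm ::
    "(real \<Rightarrow> real) \<Rightarrow> nat \<Rightarrow> ((real \<Rightarrow> complex) \<Rightarrow> complex) \<Rightarrow> ennreal" where
  "besov_norm \<eta> k u =
     (\<Sum>\<^sub>\<infinity>i\<in>(UNIV :: int set). ennreal (2 powi (i * int k)) *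
        Linf_norm (convolution (inv_fourier (\<lambda>\<xi>. of_real (dyadic \<eta> i \<xi>))) u))"

definition besov :: "(real \<Rightarrow> real) \<Rightarrow> nat \<Rightarrow> ((real \<Rightarrow> complex) \<Rightarrow> complex) set" where
  "besov \<eta> k = {u. tempered_distribution u \<and> besov_norm \<eta> k u < \<infinity>}"

definition Ck_holder_loc :: "nat \<Rightarrow> real \<Rightarrow> (real \<Rightarrow> complex) set" where
  "Ck_holder_loc k \<epsilon> = {f \<in> Ck k. \<forall>r>0. \<exists>c. \<forall>x\<in>{-r..r}. \<forall>y\<in>{-r..r}.
     norm (nderiv k f x - nderiv k f y) \<le> c * \<bar>x - y\<bar> powr \<epsilon>}"

text \<open>A point of the (i+1)-dimensional space is a function on \<open>{..i}\<close>, so that indices are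
  shifted by one: \<open>s j\<close> is the argument usually written with subscript \<open>j + 1\<close>.\<close>

fun divdiff_raw :: "nat \<Rightarrow> (real \<Rightarrow> complex) \<Rightarrow> (nat \<Rightarrow> real) \<Rightarrow> complex" where
  "divdiff_raw 0 f s = f (s 0)"
| "divdiff_raw (Suc i) f s =
     (divdiff_raw i f s - divdiff_raw i f (s(i := s (Suc i)))) / of_real (s i - s (Suc i))"

text \<open>The continuous extension to the whole space. Points with pairwise distinct entries are
  dense, so any two choices agree on \<open>topspace (powertop_real {..i})\<close>, and only
  the values there are ever used.\<close>

definition divdiff :: "nat \<Rightarrow> (real \<Rightarrow> complex) \<Rightarrow> (nat \<Rightarrow> real) \<Rightarrow> complex" where
  "divdiff i f = (SOME \<phi>. continuous_map (powertop_real {..i}) euclidean \<phi> \<and>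
     (\<forall>s \<in> topspace (powertop_real {..i}). inj_on s {..i} \<longrightarrow> \<phi> s = divdiff_raw i f s))"

definition sup_norm_on :: "real set \<Rightarrow> (real \<Rightarrow> complex) \<Rightarrow> ennreal" where
  "sup_norm_on A g = (SUP x\<in>A. ennreal (norm (g x)))"

definition varopoulos_norm :: "real \<Rightarrow> nat \<Rightarrow> ((nat \<Rightarrow> real) \<Rightarrow> complex) \<Rightarrow> ennreal" where
  "varopoulos_norm r m \<phi> = Inf {\<Sum>n. \<Prod>i<m. sup_norm_on {-r..r} (\<Phi> i n) |\<Phi>.
     (\<forall>i<m. \<forall>n. continuous_on {-r..r} (\<Phi> i n)) \<and>
     (\<Sum>n. \<Prod>i<m. sup_norm_on {-r..r} (\<Phi> i n)) < \<infinity> \<and>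
     (\<forall>s \<in> {..<m} \<rightarrow>\<^sub>E {-r..r}. (\<lambda>n. \<Prod>i<m. \<Phi> i n (s i)) sums \<phi> s)}"

definition C_beta :: "nat \<Rightarrow> (real \<Rightarrow> complex) set" where
  "C_beta k = {f \<in> Ck k. \<forall>r>0. \<forall>i\<le>k. varopoulos_norm r (i + 1) (divdiff i f) < \<infinity>}"

definition C_beta_topology :: "nat \<Rightarrow> (real \<Rightarrow> complex) topology" where
  "C_beta_topology k = seminorm_topology (C_beta k)
     {\<lambda>f. varopoulos_norm r (i + 1) (divdiff i f) |r i. 0 < r \<and> i \<le> k}"

definition VC :: "nat \<Rightarrow> (real \<Rightarrow> complex) set" where
  "VC k = C_beta_topology k closure_of {\<lambda>x. poly p (of_real x) |p. True}"

end

theory Submission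
  imports Defs
    "HOL-Library.Nat_Bijection"
    "HOL-Probability.Characteristic_Functions"
    "HOL-Real_Asymp.Real_Asymp"
    "HOL-Complex_Analysis.Complex_Analysis"
    "HOL-Probability.Sinc_Integral"
begin

text \<open>
  For functions whose Taylor coefficients have geometric bounds on a real
  neighbourhood there is an elementary bound on Varopoulos norms: if
  \<open>norm (c l) \<le> A / (12 h)\<^sup>l\<close> for the coefficients at every real centre, then the divided difference of order
  \<open>d\<close> has an expansion into products of one-variable functions of total mass at most \<open>C A / h\<^sup>d\<close>
  (\<open>analytic_criterion\<close>). The two halves of the theorem are reduced to this by writing a function as a polynomially
  approximable part plus a convergent series of analytic functions on finer and finer scales.

  The analytic bound. Cut the line into blocks of length \<open>h\<close>. If all variables lie in neighbouring
  blocks, the power series at the centre of the block can be differenced term by term. If two variables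
  \<open>x, y\<close> lie in distant blocks, the recursion \<open>(x - y) f[x, y, \<dots>] = f[x, \<dots>] - f[y, \<dots>]\<close> removes one
  variable at the price of the kernel \<open>1 / (x - y)\<close> restricted to distant blocks. In block coordinates this
  is a Toeplitz kernel. Its leading part is the discrete Hilbert kernel \<open>1 / (m - n)\<close>, which is a bounded
  multiplier for expansions in product form because up to an absolutely summable error it is a
  sawtooth, whose Fourier coefficients have an absolute sum that does not depend on the period. The
  other parts are absolutely summable themselves.

  Hoelder functions. The Taylor polynomials of \<open>f\<close> at nodes of mesh \<open>\<delta>\<close> are glued by translates of the
  entire function \<open>1 - exp (- exp z)\<close> into one entire function. Refining the mesh from \<open>\<delta>\<close> to \<open>\<delta> / 2\<close>
  changes it by \<open>O(\<delta>\<^sup>k\<^sup>+\<^sup>\<epsilon>)\<close> on discs of radius comparable to \<open>\<delta>\<close> around the interval, so by the bound the divided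
  differences of order at most \<open>k\<close> change by \<open>O(\<delta>\<^sup>\<epsilon>)\<close>, which sums over dyadic meshes. Entire functions
  are approximated by their Taylor polynomials (\<open>holder_poly_approximable\<close>).

  Besov functions. Bernstein's inequality shows that the dyadic piece \<open>g\<close> of frequency \<open>2\<^sup>i\<close> has
  \<open>l\<close>-th derivative at most \<open>(B 2\<^sup>i)\<^sup>l\<close> times its supremum norm, so its divided differences of order
  at most \<open>k\<close> have expansions of mass \<open>O(2\<^sup>i\<^sup>k)\<close> times that norm, and these are summable by hypothesis. The
  partial sums are smooth, and their \<open>k\<close>-th derivatives are locally Lipschitz, so they fall under the
  Hoelder case. That the sum represents the distribution is the convergence of an approximate identity
  (\<open>besov_represented\<close>).

  Finally, approximation of all divided differences up to order \<open>k\<close> by those of polynomials means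
  membership in the closure, because the tensor expansions, given at distinct nodes only, extend to
  all nodes by continuity (\<open>VC_criterion\<close>).
\<close>

section \<open>Tensor expansions on a cube\<close>

text \<open>A quantitative form of the Varopoulos norm for functions of the variables \<open>s i\<close>, \<open>i \<in> I\<close>.
  The expansion is demanded only at points with pairwise distinct entries. At these points a
  divided difference is a finite linear combination of function values, so that no continuous
  extension is involved; as the sum of the expansion is continuous, nothing is lost.\<close>

definition tensor_bound ::
    "real \<Rightarrow> nat set \<Rightarrow> ((nat \<Rightarrow> real) \<Rightarrow> complex) \<Rightarrow> real \<Rightarrow> bool" where
  "tensor_bound r I \<phi> B \<longleftrightarrow> (\<exists>(a :: nat \<Rightarrow> complex) \<Phi>.
     (\<forall>i\<in>I. \<forall>n. continuous_on {-r..r} (\<Phi> i n) \<and> (\<forall>x\<in>{-r..r}. norm (\<Phi> i n x) \<le> (1::real))) \<and>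
     summable (\<lambda>n. norm (a n)) \<and> (\<Sum>n. norm (a n)) \<le> B \<and>
     (\<forall>s. (\<forall>i\<in>I. s i \<in> {-r..r}) \<and> inj_on s I \<longrightarrow> (\<lambda>n. a n * (\<Prod>i\<in>I. \<Phi> i n (s i))) sums \<phi> s))"

lemma tensor_boundI:
  fixes a :: "nat \<Rightarrow> complex"
  assumes "\<And>i n. i \<in> I \<Longrightarrow> continuous_on {-r..r} (\<Phi> i n)"
    and "\<And>i n x. i \<in> I \<Longrightarrow> x \<in> {-r..r} \<Longrightarrow> norm (\<Phi> i n x) \<le> 1"
    and "summable (\<lambda>n. norm (a n))" "(\<Sum>n. norm (a n)) \<le> B"
    and "\<And>s. (\<And>i. i \<in> I \<Longrightarrow> s i \<in> {-r..r}) \<Longrightarrow> inj_on s I \<Longrightarrow>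
           (\<lambda>n. a n * (\<Prod>i\<in>I. \<Phi> i n (s i))) sums \<phi> s"
  shows "tensor_bound r I \<phi> B"
  unfolding tensor_bound_def using assms by (intro exI[of _ a] exI[of _ \<Phi>]) blast

lemma tensor_boundE:
  assumes "tensor_bound r I \<phi> B"
  obtains a :: "nat \<Rightarrow> complex" and \<Phi> where
    "\<And>i n. i \<in> I \<Longrightarrow> continuous_on {-r..r} (\<Phi> i n)"
    "\<And>i n x. i \<in> I \<Longrightarrow> x \<in> {-r..r} \<Longrightarrow> norm (\<Phi> i n x) \<le> 1"
    "summable (\<lambda>n. norm (a n))" "(\<Sum>n. norm (a n)) \<le> B"
    "\<And>s. (\<And>i. i \<in> I \<Longrightarrow> s i \<in> {-r..r}) \<Longrightarrow> inj_on s I \<Longrightarrow>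
           (\<lambda>n. a n * (\<Prod>i\<in>I. \<Phi> i n (s i))) sums \<phi> s"
  using assms unfolding tensor_bound_def by blast

text \<open>Expansions are indexed by one natural number, so a series of expansions has to be
  re-indexed along an enumeration of pairs.\<close>

lemma double_sums_prod_decode:
  fixes f :: "nat \<Rightarrow> nat \<Rightarrow> complex"
  assumes f: "\<And>n. summable (\<lambda>k. norm (f n k))" "\<And>n. (\<Sum>k. norm (f n k)) \<le> B n"
    and B: "summable B"
  shows "summable (\<lambda>p. norm (case prod_decode p of (n, k) \<Rightarrow> f n k))"
    and "(\<Sum>p. norm (case prod_decode p of (n, k) \<Rightarrow> f n k)) \<le> (\<Sum>n. B n)"
    and "(\<lambda>p. case prod_decode p of (n, k) \<Rightarrow> f n k) sums (\<Sum>n. \<Sum>k. f n k)"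
proof -
  define S where "S n = (\<Sum>k. norm (f n k))" for n
  have S0: "0 \<le> S n" for n unfolding S_def by (intro suminf_nonneg f) simp
  have S: "summable S"
    by (rule summable_comparison_test'[OF B, of 0]) (use f S0 in \<open>auto simp: S_def\<close>)
  have hs: "((\<lambda>k. norm (f n k)) has_sum S n) UNIV" for n
    unfolding S_def by (intro sums_nonneg_imp_has_sum summable_sums f) simp
  have Son: "(S has_sum (\<Sum>n. S n)) UNIV"
    by (intro sums_nonneg_imp_has_sum summable_sums S S0)
  have on: "(\<lambda>(n, k). norm (f n k)) summable_on (UNIV \<times> UNIV)"
    by (rule summable_on_SigmaI[where g = S]) (use hs Son in \<open>auto simp: summable_on_def\<close>)
  have "((\<lambda>(n, k). norm (f n k)) has_sum (\<Sum>n. S n)) (UNIV \<times> UNIV)"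
    by (rule has_sum_SigmaI[where g = S]) (use hs Son on in auto)
  then have hn: "((\<lambda>p. (\<lambda>(n, k). norm (f n k)) (prod_decode p)) has_sum (\<Sum>n. S n)) UNIV"
    by (subst has_sum_reindex_bij_betw[OF bij_prod_decode]) simp
  then have sn: "(\<lambda>p. norm (case prod_decode p of (n, k) \<Rightarrow> f n k)) sums (\<Sum>n. S n)"
    by (subst (asm) has_sum_cong[where g = "\<lambda>p. norm (case prod_decode p of (n, k) \<Rightarrow> f n k)"])
       (auto dest: has_sum_imp_sums split: prod.splits)
  show "summable (\<lambda>p. norm (case prod_decode p of (n, k) \<Rightarrow> f n k))"
    using sn by (rule sums_summable)
  have "(\<Sum>n. S n) \<le> (\<Sum>n. B n)" by (intro suminf_le S B) (use f in \<open>simp add: S_def\<close>)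
  then show "(\<Sum>p. norm (case prod_decode p of (n, k) \<Rightarrow> f n k)) \<le> (\<Sum>n. B n)"
    using sn by (simp add: sums_iff)
  have fs: "((\<lambda>k. f n k) has_sum (\<Sum>k. f n k)) UNIV" for n
    using f(1) by (intro norm_summable_imp_has_sum summable_sums) (auto dest: summable_norm_cancel)
  have nle: "norm (\<Sum>k. f n k) \<le> S n" for n unfolding S_def by (rule summable_norm) (rule f)
  have gs: "((\<lambda>n. \<Sum>k. f n k) has_sum (\<Sum>n. \<Sum>k. f n k)) UNIV"
  proof (intro norm_summable_imp_has_sum summable_sums)
    show "summable (\<lambda>n. norm (\<Sum>k. f n k))"
      by (rule summable_comparison_test'[OF S, of 0]) (use nle in auto)
    then show "summable (\<lambda>n. \<Sum>k. f n k)" by (rule summable_norm_cancel)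
  qed
  have "(\<lambda>(n, k). f n k) summable_on (UNIV \<times> UNIV)"
    by (rule abs_summable_summable) (use on in \<open>simp add: case_prod_unfold\<close>)
  then have "((\<lambda>(n, k). f n k) has_sum (\<Sum>n. \<Sum>k. f n k)) (UNIV \<times> UNIV)"
    by (intro has_sum_SigmaI[where g = "\<lambda>n. \<Sum>k. f n k"]) (use fs gs in auto)
  then have "((\<lambda>p. (\<lambda>(n, k). f n k) (prod_decode p)) has_sum (\<Sum>n. \<Sum>k. f n k)) UNIV"
    by (subst has_sum_reindex_bij_betw[OF bij_prod_decode]) simp
  then show "(\<lambda>p. case prod_decode p of (n, k) \<Rightarrow> f n k) sums (\<Sum>n. \<Sum>k. f n k)"
    by (rule has_sum_imp_sums)
qed

lemma tensor_bound_nonneg: "tensor_bound r I \<phi> B \<Longrightarrow> 0 \<le> B"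
  unfolding tensor_bound_def using suminf_nonneg order_trans norm_ge_zero by blast

lemma tensor_bound_mono:
  assumes V: "tensor_bound r I \<phi> B" and "B \<le> C"
  shows "tensor_bound r I \<phi> C"
proof -
  obtain a :: "nat \<Rightarrow> complex" and \<Phi> where
    w: "\<And>i n. i \<in> I \<Longrightarrow> continuous_on {-r..r} (\<Phi> i n)"
       "\<And>i n x. i \<in> I \<Longrightarrow> x \<in> {-r..r} \<Longrightarrow> norm (\<Phi> i n x) \<le> 1"
    and a: "summable (\<lambda>n. norm (a n))" "(\<Sum>n. norm (a n)) \<le> B"
    and s: "\<And>s. (\<And>i. i \<in> I \<Longrightarrow> s i \<in> {-r..r}) \<Longrightarrow> inj_on s I \<Longrightarrow>
           (\<lambda>n. a n * (\<Prod>i\<in>I. \<Phi> i n (s i))) sums \<phi> s"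
    by (rule tensor_boundE[OF V]) blast
  show ?thesis
    by (rule tensor_boundI[where a = a and \<Phi> = \<Phi>]) (use w a s assms(2) in auto)
qed

lemma tensor_bound_cong:
  assumes "tensor_bound r I \<phi> B"
    and "\<And>s. (\<And>i. i \<in> I \<Longrightarrow> s i \<in> {-r..r}) \<Longrightarrow> inj_on s I \<Longrightarrow> \<phi> s = \<psi> s"
  shows "tensor_bound r I \<psi> B"
proof -
  obtain a :: "nat \<Rightarrow> complex" and \<Phi> where
    w: "\<And>i n. i \<in> I \<Longrightarrow> continuous_on {-r..r} (\<Phi> i n)"
       "\<And>i n x. i \<in> I \<Longrightarrow> x \<in> {-r..r} \<Longrightarrow> norm (\<Phi> i n x) \<le> 1"
    and a: "summable (\<lambda>n. norm (a n))" "(\<Sum>n. norm (a n)) \<le> B"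
    and s: "\<And>s. (\<And>i. i \<in> I \<Longrightarrow> s i \<in> {-r..r}) \<Longrightarrow> inj_on s I \<Longrightarrow>
           (\<lambda>n. a n * (\<Prod>i\<in>I. \<Phi> i n (s i))) sums \<phi> s"
    by (rule tensor_boundE[OF assms(1)]) blast
  show ?thesis
    by (rule tensor_boundI[where a = a and \<Phi> = \<Phi>]) (use w a s assms(2) in auto)
qed

text \<open>All estimates below are assembled from absolutely convergent series of expansions.\<close>

lemma tensor_bound_sums:
  assumes V: "\<And>n. tensor_bound r I (\<phi> n) (B n)" and B: "summable B"
    and \<psi>: "\<And>s. (\<And>i. i \<in> I \<Longrightarrow> s i \<in> {-r..r}) \<Longrightarrow> inj_on s I \<Longrightarrow> (\<lambda>n. \<phi> n s) sums \<psi> s"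
  shows "tensor_bound r I \<psi> (\<Sum>n. B n)"
proof -
  define P where "P n a \<Phi> \<longleftrightarrow> (\<forall>i\<in>I. \<forall>k::nat. continuous_on {-r..r} (\<Phi> i k) \<and>
      (\<forall>x\<in>{-r..r}. norm (\<Phi> i k x :: complex) \<le> 1)) \<and>
     summable (\<lambda>k. norm (a k :: complex)) \<and> (\<Sum>k. norm (a k)) \<le> B n \<and>
     (\<forall>s. (\<forall>i\<in>I. s i \<in> {-r..r}) \<and> inj_on s I \<longrightarrow>
        (\<lambda>k. a k * (\<Prod>i\<in>I. \<Phi> i k (s i))) sums \<phi> n s)" for n a \<Phi>
  have "\<forall>n. \<exists>a \<Phi>. P n a \<Phi>"
    using V unfolding tensor_bound_def P_def by blast
  then obtain a \<Phi> where P: "\<And>n. P n (a n) (\<Phi> n)" by metis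
  have c: "\<And>n i k. i \<in> I \<Longrightarrow> continuous_on {-r..r} (\<Phi> n i k)"
    and b: "\<And>n i k x. i \<in> I \<Longrightarrow> x \<in> {-r..r} \<Longrightarrow> norm (\<Phi> n i k x) \<le> 1"
    and a: "\<And>n. summable (\<lambda>k. norm (a n k))" "\<And>n. (\<Sum>k. norm (a n k)) \<le> B n"
    and s: "\<And>n s. (\<And>i. i \<in> I \<Longrightarrow> s i \<in> {-r..r}) \<Longrightarrow> inj_on s I \<Longrightarrow>
       (\<lambda>k. a n k * (\<Prod>i\<in>I. \<Phi> n i k (s i))) sums \<phi> n s"
    using P unfolding P_def by simp_all
  note D = double_sums_prod_decode[OF a B]
  show ?thesis
  proof (rule tensor_boundI[where a = "\<lambda>p. case prod_decode p of (n, k) \<Rightarrow> a n k"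
        and \<Phi> = "\<lambda>i p. case prod_decode p of (n, k) \<Rightarrow> \<Phi> n i k"])
    show "(\<lambda>p. (case prod_decode p of (n, k) \<Rightarrow> a n k) *
        (\<Prod>i\<in>I. (case prod_decode p of (n, k) \<Rightarrow> \<Phi> n i k) (t i))) sums \<psi> t"
      if t: "\<And>i. i \<in> I \<Longrightarrow> t i \<in> {-r..r}" "inj_on t I" for t
    proof -
    have le: "norm (a n k * (\<Prod>i\<in>I. \<Phi> n i k (t i))) \<le> norm (a n k)" for n k
      using prod_mono[of I "\<lambda>i. norm (\<Phi> n i k (t i))" "\<lambda>_. 1"] b t(1)
      by (auto simp: norm_mult prod_norm[symmetric] intro!: mult_left_le)
    have sm: "summable (\<lambda>k. norm (a n k * (\<Prod>i\<in>I. \<Phi> n i k (t i))))" for n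
      by (rule summable_comparison_test'[OF a(1), of 0]) (use le in auto)
    have "(\<Sum>k. norm (a n k * (\<Prod>i\<in>I. \<Phi> n i k (t i)))) \<le> B n" for n
      using suminf_le[OF le sm a(1)] a(2) order_trans by blast
    from double_sums_prod_decode(3)[OF sm this B]
    have "(\<lambda>p. case prod_decode p of (n, k) \<Rightarrow> a n k * (\<Prod>i\<in>I. \<Phi> n i k (t i))) sums
        (\<Sum>n. \<Sum>k. a n k * (\<Prod>i\<in>I. \<Phi> n i k (t i)))" .
    moreover have "(\<Sum>n. \<Sum>k. a n k * (\<Prod>i\<in>I. \<Phi> n i k (t i))) = \<psi> t"
      using s[OF t] \<psi>[OF t] by (simp add: sums_iff)
    ultimately show ?thesis
      by (simp add: case_prod_unfold)
    qed
    show "continuous_on {-r..r} (case prod_decode p of (n, k) \<Rightarrow> \<Phi> n i k)" if "i \<in> I" for i p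
      using c[OF that] by (simp add: case_prod_unfold)
    show "norm ((case prod_decode p of (n, k) \<Rightarrow> \<Phi> n i k) x) \<le> 1" if "i \<in> I" "x \<in> {-r..r}" for i p x
      using b[OF that] by (simp add: case_prod_unfold)
  qed (use D in blast)+
qed

lemma tensor_bound_elementary:
  assumes "\<And>i. i \<in> I \<Longrightarrow> continuous_on {-r..r} (u i)"
    and "\<And>i x. i \<in> I \<Longrightarrow> x \<in> {-r..r} \<Longrightarrow> norm (u i x) \<le> 1"
  shows "tensor_bound r I (\<lambda>s. c * (\<Prod>i\<in>I. u i (s i))) (norm c)"
proof (rule tensor_boundI[where a = "\<lambda>n. if n = 0 then c else 0" and \<Phi> = "\<lambda>i _. u i"])
  have "(\<lambda>n::nat. norm (if n = 0 then c else 0)) sums norm c"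
    using sums_single[of 0 "\<lambda>_. norm c"] by (simp add: if_distrib cong: if_cong)
  then show "summable (\<lambda>n::nat. norm (if n = 0 then c else 0))"
    "(\<Sum>n::nat. norm (if n = 0 then c else 0)) \<le> norm c"
    by (auto simp: sums_iff)
  show "(\<lambda>n::nat. (if n = 0 then c else 0) * (\<Prod>i\<in>I. u i (s i))) sums (c * (\<Prod>i\<in>I. u i (s i)))" for s
    using sums_single[of 0 "\<lambda>_. c * (\<Prod>i\<in>I. u i (s i))"]
    by (simp add: if_distrib if_distribR cong: if_cong)
qed (use assms in auto)

lemma tensor_bound_zero: "tensor_bound r I (\<lambda>_. 0) 0"
  using tensor_bound_elementary[of I r "\<lambda>_ _. 0" 0] by simp

lemma tensor_bound_const: "tensor_bound r I (\<lambda>_. c) (norm c)"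
  using tensor_bound_elementary[of I r "\<lambda>_ _. 1" c] by simp

lemma tensor_bound_mult_elementary:
  assumes u: "\<And>i. i \<in> I \<Longrightarrow> continuous_on {-r..r} (u i)"
    "\<And>i x. i \<in> I \<Longrightarrow> x \<in> {-r..r} \<Longrightarrow> norm (u i x) \<le> 1"
    and V: "tensor_bound r I \<psi> B"
  shows "tensor_bound r I (\<lambda>s. c * (\<Prod>i\<in>I. u i (s i)) * \<psi> s) (norm c * B)"
proof -
  obtain a :: "nat \<Rightarrow> complex" and \<Phi> where
    w: "\<And>i n. i \<in> I \<Longrightarrow> continuous_on {-r..r} (\<Phi> i n)"
       "\<And>i n x. i \<in> I \<Longrightarrow> x \<in> {-r..r} \<Longrightarrow> norm (\<Phi> i n x) \<le> 1"
    and a: "summable (\<lambda>n. norm (a n))" "(\<Sum>n. norm (a n)) \<le> B"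
    and s: "\<And>s. (\<And>i. i \<in> I \<Longrightarrow> s i \<in> {-r..r}) \<Longrightarrow> inj_on s I \<Longrightarrow>
           (\<lambda>n. a n * (\<Prod>i\<in>I. \<Phi> i n (s i))) sums \<psi> s"
    by (rule tensor_boundE[OF V]) blast
  show ?thesis
  proof (rule tensor_boundI[where a = "\<lambda>n. c * a n" and \<Phi> = "\<lambda>i n x. u i x * \<Phi> i n x"])
    show "norm (u i x * \<Phi> i n x) \<le> 1" if "i \<in> I" "x \<in> {-r..r}" for i n x
      using mult_mono[OF u(2)[OF that] w(2)[OF that]] by (simp add: norm_mult)
    show "(\<Sum>n. norm (c * a n)) \<le> norm c * B"
      using a by (simp add: norm_mult suminf_mult mult_left_mono)
    show "(\<lambda>n. c * a n * (\<Prod>i\<in>I. u i (s i) * \<Phi> i n (s i))) sums (c * (\<Prod>i\<in>I. u i (s i)) * \<psi> s)"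
      if "\<And>i. i \<in> I \<Longrightarrow> s i \<in> {-r..r}" "inj_on s I" for s
      using sums_mult[OF s[OF that], of "c * (\<Prod>i\<in>I. u i (s i))"] 
      by (simp add: prod.distrib mult_ac)
  qed (use u w a in \<open>auto intro!: continuous_intros summable_mult simp: norm_mult\<close>)
qed

lemma tensor_bound_cmult: "tensor_bound r I \<phi> B \<Longrightarrow> tensor_bound r I (\<lambda>s. c * \<phi> s) (norm c * B)"
  using tensor_bound_mult_elementary[of I r "\<lambda>_ _. 1" \<phi> B c] by simp

text \<open>Expanding one factor and multiplying each of its elementary tensors into the other
  makes the bound submultiplicative.\<close>

lemma tensor_bound_mult:
  assumes V: "tensor_bound r I \<phi> A" and \<psi>: "tensor_bound r I \<psi> B"
  shows "tensor_bound r I (\<lambda>s. \<phi> s * \<psi> s) (A * B)"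
proof -
  obtain a :: "nat \<Rightarrow> complex" and \<Phi> where
    w: "\<And>i n. i \<in> I \<Longrightarrow> continuous_on {-r..r} (\<Phi> i n)"
       "\<And>i n x. i \<in> I \<Longrightarrow> x \<in> {-r..r} \<Longrightarrow> norm (\<Phi> i n x) \<le> 1"
    and a: "summable (\<lambda>n. norm (a n))" "(\<Sum>n. norm (a n)) \<le> A"
    and s: "\<And>s. (\<And>i. i \<in> I \<Longrightarrow> s i \<in> {-r..r}) \<Longrightarrow> inj_on s I \<Longrightarrow>
           (\<lambda>n. a n * (\<Prod>i\<in>I. \<Phi> i n (s i))) sums \<phi> s"
    by (rule tensor_boundE[OF V]) blast
  have "tensor_bound r I (\<lambda>s. \<phi> s * \<psi> s) (\<Sum>n. norm (a n) * B)"
  proof (rule tensor_bound_sums[where \<phi> = "\<lambda>n s. a n * (\<Prod>i\<in>I. \<Phi> i n (s i)) * \<psi> s"])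
    show "tensor_bound r I (\<lambda>s. a n * (\<Prod>i\<in>I. \<Phi> i n (s i)) * \<psi> s) (norm (a n) * B)" for n
      by (rule tensor_bound_mult_elementary) (use w \<psi> in auto)
  qed (use a s in \<open>auto intro!: sums_mult2 summable_mult2\<close>)
  then show ?thesis
    by (rule tensor_bound_mono)
       (use a tensor_bound_nonneg[OF \<psi>] in \<open>simp add: suminf_mult2[symmetric] mult_right_mono\<close>)
qed

lemma tensor_bound_add:
  assumes "tensor_bound r I \<phi> A" "tensor_bound r I \<psi> B"
  shows "tensor_bound r I (\<lambda>s. \<phi> s + \<psi> s) (A + B)"
proof -
  define F where "F n = (if n = 0 then \<phi> else if n = 1 then \<psi> else (\<lambda>_. 0))" for n :: nat
  define b where "b n = (if n = 0 then A else if n = 1 then B else 0)" for n :: nat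
  have b: "b sums (A + B)"
    using sums_finite[of "{0,1}" b] by (simp add: b_def)
  have "tensor_bound r I (\<lambda>s. \<phi> s + \<psi> s) (\<Sum>n. b n)"
  proof (rule tensor_bound_sums[where \<phi> = F])
    show "tensor_bound r I (F n) (b n)" for n
      using assms tensor_bound_zero by (simp add: F_def b_def)
    show "(\<lambda>n. F n s) sums (\<phi> s + \<psi> s)" for s
      using sums_finite[of "{0,1}" "\<lambda>n. F n s"] by (simp add: F_def)
  qed (use b in \<open>simp add: sums_iff\<close>)
  with b show ?thesis by (simp add: sums_iff)
qed

lemma tensor_bound_diff:
  assumes "tensor_bound r I \<phi> A" "tensor_bound r I \<psi> B"
  shows "tensor_bound r I (\<lambda>s. \<phi> s - \<psi> s) (A + B)"
  using tensor_bound_add[OF assms(1) tensor_bound_cmult[OF assms(2), of "-1"]] by simp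

lemma tensor_bound_sum:
  assumes "finite K" "\<And>k. k \<in> K \<Longrightarrow> tensor_bound r I (\<phi> k) (B k)"
  shows "tensor_bound r I (\<lambda>s. \<Sum>k\<in>K. \<phi> k s) (\<Sum>k\<in>K. B k)"
  using assms by (induction K rule: finite_induct) (auto intro: tensor_bound_zero tensor_bound_add)

lemma tensor_bound_sum_list:
  assumes "\<And>k. k \<in> set ks \<Longrightarrow> tensor_bound r I (\<phi> k) B" "0 \<le> B"
  shows "tensor_bound r I (\<lambda>s. \<Sum>k\<leftarrow>ks. \<phi> k s) (of_nat (length ks) * B)"
  using assms(1) 
proof (induction ks)
  case (Cons k ks)
  then have "tensor_bound r I (\<lambda>s. \<phi> k s + (\<Sum>k\<leftarrow>ks. \<phi> k s)) (B + of_nat (length ks) * B)"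
    by (intro tensor_bound_add) auto
  then show ?case by (simp add: algebra_simps)
qed (use tensor_bound_zero in simp)

lemma tensor_bound_prod:
  assumes "finite K" "\<And>k. k \<in> K \<Longrightarrow> tensor_bound r I (\<phi> k) (B k)"
  shows "tensor_bound r I (\<lambda>s. \<Prod>k\<in>K. \<phi> k s) (\<Prod>k\<in>K. B k)"
  using assms
proof (induction K rule: finite_induct)
  case empty
  then show ?case using tensor_bound_const[of r I 1] by simp
qed (auto intro: tensor_bound_mult)

text \<open>The factors of the new variables are constantly one.\<close>

lemma tensor_bound_lift:
  assumes V: "tensor_bound r I \<phi> B" and "I \<subseteq> J" "finite J"
  shows "tensor_bound r J \<phi> B"
proof -
  obtain a :: "nat \<Rightarrow> complex" and \<Phi> where
    w: "\<And>i n. i \<in> I \<Longrightarrow> continuous_on {-r..r} (\<Phi> i n)"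
       "\<And>i n x. i \<in> I \<Longrightarrow> x \<in> {-r..r} \<Longrightarrow> norm (\<Phi> i n x) \<le> 1"
    and a: "summable (\<lambda>n. norm (a n))" "(\<Sum>n. norm (a n)) \<le> B"
    and s: "\<And>s. (\<And>i. i \<in> I \<Longrightarrow> s i \<in> {-r..r}) \<Longrightarrow> inj_on s I \<Longrightarrow>
           (\<lambda>n. a n * (\<Prod>i\<in>I. \<Phi> i n (s i))) sums \<phi> s"
    by (rule tensor_boundE[OF V]) blast
  show ?thesis
  proof (rule tensor_boundI[where a = a and \<Phi> = "\<lambda>i. if i \<in> I then \<Phi> i else (\<lambda>_ _. 1)"])
    fix t assume t: "\<And>i. i \<in> J \<Longrightarrow> t i \<in> {-r..r}" "inj_on t J"
    have "(\<Prod>i\<in>J. (if i \<in> I then \<Phi> i else (\<lambda>_ _. 1)) n (t i)) = (\<Prod>i\<in>I. \<Phi> i n (t i))" for n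
      by (rule prod.mono_neutral_cong_right) (use assms in auto)
    then show "(\<lambda>n. a n * (\<Prod>i\<in>J. (if i \<in> I then \<Phi> i else (\<lambda>_ _. 1)) n (t i))) sums \<phi> t"
      using s[of t] t assms(2) by (auto intro: inj_on_subset)
  qed (use w a in auto)
qed

lemma tensor_bound_single:
  assumes "continuous_on {-r..r} u" "\<And>x. x \<in> {-r..r} \<Longrightarrow> norm (u x) \<le> K" "0 \<le> K"
  shows "tensor_bound r {i} (\<lambda>s. u (s i)) K"
proof (cases "K = 0")
  case True
  then have "u x = 0" if "x \<in> {-r..r}" for x using assms(2)[OF that] by simp
  then show ?thesis using tensor_bound_zero[of r "{i}"] True by (auto elim!: tensor_bound_cong)
next
  case False
  then have "tensor_bound r {i} (\<lambda>s. of_real K * (\<Prod>j\<in>{i}. u (s j) / of_real K)) (norm (of_real K :: complex))"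
    using assms by (intro tensor_bound_elementary continuous_intros) (auto simp: norm_divide)
  then show ?thesis using False assms by simp
qed

text \<open>Expansions do not see dilations, so that estimates at scale \<open>h\<close> can be reduced to unit scale.\<close>

lemma tensor_bound_scale:
  assumes V: "tensor_bound (r * c) I \<phi> B" and c: "c > 0"
  shows "tensor_bound r I (\<lambda>s. \<phi> (\<lambda>i. s i * c)) B"
proof -
  obtain a :: "nat \<Rightarrow> complex" and \<Phi> where
    w: "\<And>i n. i \<in> I \<Longrightarrow> continuous_on {-(r*c)..r*c} (\<Phi> i n)"
       "\<And>i n x. i \<in> I \<Longrightarrow> x \<in> {-(r*c)..r*c} \<Longrightarrow> norm (\<Phi> i n x) \<le> 1"
    and a: "summable (\<lambda>n. norm (a n))" "(\<Sum>n. norm (a n)) \<le> B"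
    and s: "\<And>s. (\<And>i. i \<in> I \<Longrightarrow> s i \<in> {-(r*c)..r*c}) \<Longrightarrow> inj_on s I \<Longrightarrow>
           (\<lambda>n. a n * (\<Prod>i\<in>I. \<Phi> i n (s i))) sums \<phi> s"
    by (rule tensor_boundE[OF V]) blast
  have in_cube: "x * c \<in> {-(r*c)..r*c}" if "x \<in> {-r..r}" for x
    using that c mult_right_mono[of "-r" x c] mult_right_mono[of x r c] by auto
  show ?thesis
  proof (rule tensor_boundI[where a = a and \<Phi> = "\<lambda>i n x. \<Phi> i n (x * c)"])
    show "continuous_on {-r..r} (\<lambda>x. \<Phi> i n (x * c))" if "i \<in> I" for i n
      by (rule continuous_on_compose2[OF w(1)[OF that]]) (use in_cube in \<open>auto intro!: continuous_intros\<close>)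
  next
    fix t assume t: "\<And>i. i \<in> I \<Longrightarrow> t i \<in> {-r..r}" "inj_on t I"
    have "inj_on (\<lambda>i. t i * c) I" using t(2) c by (auto simp: inj_on_def)
    with in_cube t(1) show "(\<lambda>n. a n * (\<Prod>i\<in>I. \<Phi> i n (t i * c))) sums \<phi> (\<lambda>i. t i * c)"
      by (intro s) auto
  qed (use w a in_cube in auto)
qed

section \<open>Divided differences over finite sets of nodes\<close>

text \<open>At distinct nodes a divided difference depends only on the set of nodes; in this form
  its symmetry needs no proof, and any two nodes can play the role of the last two.\<close>

definition ddset :: "(real \<Rightarrow> complex) \<Rightarrow> real set \<Rightarrow> complex" where
  "ddset f X = (\<Sum>x\<in>X. f x / (\<Prod>y\<in>X-{x}. of_real (x - y)))"

lemma ddset_single [simp]: "ddset f {x} = f x"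
  by (simp add: ddset_def)

lemma ddset_remove:
  assumes "finite X" "b \<in> X"
  shows "ddset f (X - {b}) = (\<Sum>x\<in>X. of_real (x - b) * (f x / (\<Prod>y\<in>X-{x}. of_real (x - y))))"
proof -
  have "(\<Sum>x\<in>X. of_real (x - b) * (f x / (\<Prod>y\<in>X-{x}. of_real (x - y)))) =
      (\<Sum>x\<in>X-{b}. of_real (x - b) * (f x / (\<Prod>y\<in>X-{x}. of_real (x - y))))"
    using assms by (subst sum.remove[of X b]) auto
  also have "\<dots> = (\<Sum>x\<in>X-{b}. f x / (\<Prod>y\<in>X-{b}-{x}. of_real (x - y)))"
  proof (rule sum.cong)
    fix x assume x: "x \<in> X - {b}"
    have "(\<Prod>y\<in>X-{x}. of_real (x - y)) = of_real (x - b) * (\<Prod>y\<in>X-{x}-{b}. of_real (x - y) :: complex)"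
      by (rule prod.remove) (use x assms in auto)
    moreover have "X - {x} - {b} = X - {b} - {x}" by blast
    ultimately show "of_real (x - b) * (f x / (\<Prod>y\<in>X-{x}. of_real (x - y))) =
        f x / (\<Prod>y\<in>X-{b}-{x}. of_real (x - y))"
      using x by (simp del: of_real_diff)
  qed simp
  finally show ?thesis by (simp add: ddset_def)
qed

text \<open>Multiplied out in this way, the recursion also holds for equal \<open>a\<close> and \<open>b\<close>.\<close>

lemma ddset_rec:
  assumes "finite X" "a \<in> X" "b \<in> X"
  shows "of_real (a - b) * ddset f X = ddset f (X - {b}) - ddset f (X - {a})"
proof -
  define w where "w x = f x / (\<Prod>y\<in>X-{x}. of_real (x - y))" for x
  have "ddset f (X - {b}) - ddset f (X - {a}) = (\<Sum>x\<in>X. of_real (x - b) * w x - of_real (x - a) * w x)"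
    unfolding ddset_remove[OF assms(1,2)] ddset_remove[OF assms(1,3)] w_def by (rule sum_subtractf[symmetric])
  also have "\<dots> = (\<Sum>x\<in>X. of_real (a - b) * w x)"
    by (rule sum.cong) (simp_all add: algebra_simps)
  finally show ?thesis by (simp only: ddset_def w_def sum_distrib_left)
qed

lemma ddset_const:
  assumes "finite X" "card X \<ge> 2"
  shows "ddset (\<lambda>_. c) X = 0"
  using assms
proof (induction "card X" arbitrary: X rule: less_induct)
  case less
  have "\<exists>a\<in>X. \<exists>b\<in>X. a \<noteq> b"
    using less.prems card_le_Suc0_iff_eq[of X] by force
  then obtain a b where a: "a \<in> X" and b: "b \<in> X" "a \<noteq> b" by blast
  have eq: "ddset (\<lambda>_. c) (X - {b}) = ddset (\<lambda>_. c) (X - {a})"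
  proof (cases "card X = 2")
    case True
    have "{a, b} = X" by (rule card_subset_eq) (use True a b less.prems in auto)
    then have "X - {b} = {a}" "X - {a} = {b}" using b by auto
    then show ?thesis by simp
  next
    case False
    then show ?thesis using less a b by (simp add: card_Diff_singleton)
  qed
  show ?case using ddset_rec[OF less.prems(1) a b(1), of "\<lambda>_. c"] eq b by (simp del: of_real_diff)
qed

lemma ddset_add: "ddset (\<lambda>x. f x + g x) X = ddset f X + ddset g X"
  by (simp add: ddset_def sum.distrib add_divide_distrib)

lemma ddset_diff: "ddset (\<lambda>x. f x - g x) X = ddset f X - ddset g X"
  by (simp add: ddset_def sum_subtractf diff_divide_distrib)

lemma ddset_cmult: "ddset (\<lambda>x. c * f x) X = c * ddset f X"
  by (simp add: ddset_def sum_distrib_left)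

lemma ddset_sum: "ddset (\<lambda>x. \<Sum>k\<in>K. f k x) X = (\<Sum>k\<in>K. ddset (f k) X)"
  unfolding ddset_def by (subst sum.swap) (simp add: sum_divide_distrib)

lemma ddset_sums:
  assumes "\<And>x. x \<in> X \<Longrightarrow> (\<lambda>n. f n x) sums g x"
  shows "(\<lambda>n. ddset (f n) X) sums ddset g X"
  unfolding ddset_def by (intro sums_sum sums_divide assms)

lemma ddset_cong: "(\<And>x. x \<in> X \<Longrightarrow> f x = g x) \<Longrightarrow> ddset f X = ddset g X"
  by (simp add: ddset_def)

lemma ddset_scale:
  assumes "c \<noteq> 0" "finite X"
  shows "ddset (\<lambda>x. f (x * c)) X = of_real c ^ (card X - 1) * ddset f ((\<lambda>x. x * c) ` X)"
proof -
  have inj: "inj_on (\<lambda>x. x * c) A" for A using assms by (auto simp: inj_on_def)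
  have "f (x * c) / (\<Prod>y\<in>X-{x}. of_real (x - y)) = of_real c ^ (card X - 1) *
     (f (x * c) / (\<Prod>y\<in>(\<lambda>x. x * c) ` X - {x * c}. of_real (x * c - y)))" if "x \<in> X" for x
  proof -
    have "(\<lambda>x. x * c) ` X - {x * c} = (\<lambda>x. x * c) ` (X - {x})" using assms by auto
    then have "(\<Prod>y\<in>(\<lambda>x. x * c) ` X - {x * c}. of_real (x * c - y) :: complex)
       = (\<Prod>y\<in>X-{x}. of_real c * of_real (x - y))"
      by (simp add: prod.reindex[OF inj] algebra_simps)
    also have "\<dots> = of_real c ^ (card X - 1) * (\<Prod>y\<in>X-{x}. of_real (x - y))"
      using that assms by (simp add: prod.distrib)
    finally show ?thesis using assms by simp
  qed
  then show ?thesis unfolding ddset_def by (simp add: sum.reindex[OF inj] sum_distrib_left)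
qed

text \<open>A node can be absorbed into a difference quotient; this drives inductions on the set of nodes.\<close>

lemma ddset_insert:
  assumes "finite X" "X \<noteq> {}" "x \<notin> X"
  shows "ddset f (insert x X) = ddset (\<lambda>y. (f y - f x) / of_real (y - x)) X"
proof -
  have "card (insert x X) \<ge> 2" using assms by (simp add: Suc_le_eq card_gt_0_iff)
  then have "ddset (\<lambda>_. f x) (insert x X) = 0" by (intro ddset_const) (use assms in auto)
  then have "ddset f (insert x X) = ddset (\<lambda>y. f y - f x) (insert x X)"
    using ddset_diff[of f "\<lambda>_. f x"] by simp
  also have "\<dots> = (\<Sum>y\<in>X. (f y - f x) / (\<Prod>z\<in>insert x X-{y}. of_real (y - z)))"
    unfolding ddset_def using assms by (subst sum.insert) auto
  also have "\<dots> = (\<Sum>y\<in>X. (f y - f x) / of_real (y - x) / (\<Prod>z\<in>X-{y}. of_real (y - z)))"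
  proof (rule sum.cong)
    fix y assume y: "y \<in> X"
    then have "insert x X - {y} = insert x (X - {y})" using assms by auto
    then show "(f y - f x) / (\<Prod>z\<in>insert x X-{y}. of_real (y - z)) =
        (f y - f x) / of_real (y - x) / (\<Prod>z\<in>X-{y}. of_real (y - z))"
      using assms by (simp del: of_real_diff)
  qed simp
  finally show ?thesis by (simp add: ddset_def)
qed

text \<open>A divided difference of \<open>(y - m)\<^sup>l\<close> is the complete homogeneous polynomial in the shifted
  nodes. Listing its monomials, with repetitions allowed, avoids any bookkeeping of exponents:
  only their number and their degree matter.\<close>

lemma ddset_power:
  assumes "finite I" "I \<noteq> {}"
  shows "\<exists>as :: (nat \<Rightarrow> nat) list. length as \<le> (l + 1) ^ card I \<and> (\<forall>\<alpha>\<in>set as. (\<Sum>i\<in>I. \<alpha> i) \<le> l) \<and>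
    (\<forall>s m. inj_on s I \<longrightarrow> ddset (\<lambda>y. of_real (y - m) ^ l) (s ` I) =
       (\<Sum>\<alpha>\<leftarrow>as. \<Prod>i\<in>I. of_real (s i - m) ^ \<alpha> i))"
  using assms
proof (induction I arbitrary: l rule: finite_ne_induct)
  case (singleton i)
  show ?case by (intro exI[of _ "[\<lambda>_. l]"]) auto
next
  case (insert i I)
  define P where "P l as \<longleftrightarrow> length as \<le> (l + 1) ^ card I \<and> (\<forall>\<alpha>\<in>set as. (\<Sum>i\<in>I. \<alpha> i) \<le> l) \<and>
    (\<forall>s m. inj_on s I \<longrightarrow> ddset (\<lambda>y. of_real (y - m) ^ l) (s ` I) =
       (\<Sum>\<alpha>\<leftarrow>as. \<Prod>i\<in>I. of_real (s i - m) ^ \<alpha> i))" for l and as :: "(nat \<Rightarrow> nat) list"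
  have "\<exists>as. P l as" for l using insert.IH unfolding P_def by blast
  then obtain as where "\<And>l. P l (as l)" by metis
  then have as: "\<And>l. length (as l) \<le> (l + 1) ^ card I"
    "\<And>l \<alpha>. \<alpha> \<in> set (as l) \<Longrightarrow> (\<Sum>i\<in>I. \<alpha> i) \<le> l"
    "\<And>l s m. inj_on s I \<Longrightarrow> ddset (\<lambda>y. of_real (y - m) ^ l) (s ` I) =
       (\<Sum>\<alpha>\<leftarrow>as l. \<Prod>i\<in>I. of_real (s i - m) ^ \<alpha> i)"
    unfolding P_def by blast+
  define bs where "bs p = map (\<lambda>\<alpha>. \<alpha>(i := p)) (as (l - 1 - p))" for p
  have card: "card (insert i I) = Suc (card I)" using insert by simp
  have "length (concat (map bs [0..<l])) = (\<Sum>p\<leftarrow>[0..<l]. length (as (l - 1 - p)))"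
    by (simp add: length_concat bs_def o_def)
  also have "\<dots> \<le> (\<Sum>p\<leftarrow>[0..<l]. (l + 1) ^ card I)"
    by (intro sum_list_mono order_trans[OF as(1)] power_mono) auto
  also have "\<dots> \<le> (l + 1) ^ card (insert i I)" unfolding card by (simp add: sum_list_triv)
  finally have 1: "length (concat (map bs [0..<l])) \<le> (l + 1) ^ card (insert i I)" .
  have 2: "(\<Sum>j\<in>insert i I. \<alpha> j) \<le> l" if "\<alpha> \<in> set (concat (map bs [0..<l]))" for \<alpha>
  proof -
    from that obtain p \<beta> where p: "p < l" "\<beta> \<in> set (as (l - 1 - p))" "\<alpha> = \<beta>(i := p)"
      by (auto simp: bs_def)
    have "(\<Sum>j\<in>I. \<alpha> j) = (\<Sum>j\<in>I. \<beta> j)" by (rule sum.cong) (use p insert in auto)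
    then show ?thesis using as(2)[OF p(2)] p insert by simp
  qed
  have 3: "ddset (\<lambda>y. of_real (y - m) ^ l) (s ` insert i I) =
       (\<Sum>\<alpha>\<leftarrow>concat (map bs [0..<l]). \<Prod>j\<in>insert i I. of_real (s j - m) ^ \<alpha> j)"
    if inj: "inj_on s (insert i I)" for s m
  proof -
    have ni: "s i \<notin> s ` I" "inj_on s I" using inj insert by auto
    have "ddset (\<lambda>y. of_real (y - m) ^ l) (s ` insert i I) =
       ddset (\<lambda>y. (of_real (y - m) ^ l - of_real (s i - m) ^ l) / of_real (y - s i)) (s ` I)"
      using ddset_insert[of "s ` I" "s i"] insert ni by simp
    also have "\<dots> = ddset (\<lambda>y. \<Sum>p<l. of_real (s i - m) ^ p * of_real (y - m) ^ (l - 1 - p)) (s ` I)"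
    proof (rule ddset_cong)
      fix y assume "y \<in> s ` I"
      then have "y \<noteq> s i" using ni(1) by blast
      then show "(of_real (y - m) ^ l - of_real (s i - m) ^ l) / of_real (y - s i) =
         (\<Sum>p<l. of_real (s i - m) ^ p * (of_real (y - m) :: complex) ^ (l - 1 - p))"
        using diff_power_eq_sum[of "of_real (s i - m) :: complex"]
          power_diff_sumr2[of "of_real (s i - m) :: complex" l "of_real (y - m)"]
        by (simp add: divide_simps) (simp add: algebra_simps)
    qed
    also have "\<dots> = (\<Sum>p<l. of_real (s i - m) ^ p * ddset (\<lambda>y. of_real (y - m) ^ (l - 1 - p)) (s ` I))"
      by (simp add: ddset_sum ddset_cmult del: of_real_diff)
    also have "\<dots> = (\<Sum>p\<leftarrow>[0..<l]. of_real (s i - m) ^ p *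
        (\<Sum>\<alpha>\<leftarrow>as (l - 1 - p). \<Prod>j\<in>I. of_real (s j - m) ^ \<alpha> j))"
      by (simp add: as(3)[OF ni(2)] sum_list_distinct_conv_sum_set atLeast0LessThan del: of_real_diff)
    also have "\<dots> = (\<Sum>p\<leftarrow>[0..<l]. \<Sum>\<alpha>\<leftarrow>bs p. \<Prod>j\<in>insert i I. of_real (s j - m) ^ \<alpha> j)"
    proof -
      have "(\<Prod>j\<in>I. of_real (s j - m) ^ (\<alpha>(i := p)) j) = (\<Prod>j\<in>I. of_real (s j - m) ^ \<alpha> j :: complex)" for \<alpha> p
        by (rule prod.cong) (use insert in auto)
      then show ?thesis using insert
        by (simp add: bs_def o_def sum_list_const_mult del: of_real_diff)
    qed
    also have "\<dots> = (\<Sum>\<alpha>\<leftarrow>concat (map bs [0..<l]). \<Prod>j\<in>insert i I. of_real (s j - m) ^ \<alpha> j)"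
    proof -
      have "sum_list (concat xss) = sum_list (map sum_list xss)" for xss :: "complex list list"
        by (induction xss) auto
      then show ?thesis by (simp add: map_concat o_def)
    qed
    finally show ?thesis .
  qed
  show ?case by (intro exI[of _ "concat (map bs [0..<l])"]) (use 1 2 3 in blast)
qed

section \<open>Diagonal and Toeplitz multipliers\<close>

definition unit_root :: "nat \<Rightarrow> int \<Rightarrow> complex" where
  "unit_root M d = cis (2 * pi * of_int d / of_nat M)"

lemma norm_unit_root [simp]: "norm (unit_root M d) = 1"
  by (simp add: unit_root_def)

lemma unit_root_add: "unit_root M (d + e) = unit_root M d * unit_root M e"
  by (simp add: unit_root_def cis_mult ring_distribs add_divide_distrib)

lemma unit_root_0 [simp]: "unit_root M 0 = 1"
  by (simp add: unit_root_def)

lemma unit_root_mult_nat: "unit_root M (int t * d) = unit_root M d ^ t"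
  by (induction t) (simp_all add: unit_root_add distrib_right)

lemma unit_root_mult_diff:
  "unit_root M (int t * m) * unit_root M (int t * (- n)) = unit_root M (int t * (m - n))"
  unfolding unit_root_add[symmetric] by (simp add: right_diff_distrib)

lemma unit_root_power:
  assumes "M > 0"
  shows "unit_root M d ^ M = 1"
proof -
  have "unit_root M d ^ M = cis (real M * (2 * pi * of_int d / of_nat M))"
    unfolding unit_root_def by (rule Complex.DeMoivre)
  also have "\<dots> = cis (2 * pi * of_int d)" using assms by simp
  also have "\<dots> = 1" by (rule cis_multiple_2pi) simp
  finally show ?thesis .
qed

lemma unit_root_neq_1:
  assumes "d \<noteq> 0" "\<bar>d\<bar> < int M"
  shows "unit_root M d \<noteq> 1"
proof
  assume "unit_root M d = 1"
  then have "cos (2 * pi * of_int d / of_nat M) = 1"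
    by (simp add: unit_root_def complex_eq_iff)
  then obtain n :: int where "2 * pi * of_int d / of_nat M = of_int n * 2 * pi"
    by (auto simp: cos_one_2pi_int)
  moreover have "M > 0" using assms by linarith
  ultimately have "of_int d = of_int n * (of_nat M :: real)"
    by (simp add: field_simps)
  then have d: "d = n * int M" by (metis of_int_eq_iff of_int_mult of_int_of_nat_eq)
  then have "n \<noteq> 0" using assms by auto
  then have "1 * int M \<le> \<bar>n\<bar> * int M" by (intro mult_right_mono) auto
  then show False using assms d by (simp add: abs_mult)
qed

lemma sum_unit_root:
  assumes "\<bar>d\<bar> < int M"
  shows "(\<Sum>t<M. unit_root M (int t * d)) = (if d = 0 then of_nat M else 0)"
  using assms unit_root_neq_1[of d M] unit_root_power[of M d]
  by (simp add: unit_root_mult_nat geometric_sum)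

text \<open>The diagonal part of a tensor product of sums is an average of elementary tensors twisted
  by characters. So a family of blocks costs no more than a single one,
  provided that at each point the blocks have bounded total mass.\<close>

lemma tensor_bound_diagonal:
  fixes a :: "nat \<Rightarrow> int \<Rightarrow> real \<Rightarrow> complex" and Z :: "int set"
  assumes I: "finite I" "I \<noteq> {}" and Z: "finite Z"
    and a: "\<And>i m. i \<in> I \<Longrightarrow> m \<in> Z \<Longrightarrow> continuous_on {-r..r} (a i m)"
      "\<And>i x. i \<in> I \<Longrightarrow> x \<in> {-r..r} \<Longrightarrow> (\<Sum>m\<in>Z. norm (a i m x)) \<le> K i"
      "\<And>i. i \<in> I \<Longrightarrow> 0 \<le> K i"
    and c: "\<And>m. m \<in> Z \<Longrightarrow> norm (c m) \<le> C" "0 \<le> C"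
  shows "tensor_bound r I (\<lambda>s. \<Sum>m\<in>Z. c m * (\<Prod>i\<in>I. a i m (s i))) (C * (\<Prod>i\<in>I. K i))"
  using I a c
proof (induction I arbitrary: c rule: finite_ne_induct)
  case (singleton i)
  have "tensor_bound r {i} (\<lambda>s. (\<lambda>x. \<Sum>m\<in>Z. c m * a i m x) (s i)) (C * K i)"
  proof (rule tensor_bound_single)
    fix x assume x: "x \<in> {-r..r}"
    have "norm (\<Sum>m\<in>Z. c m * a i m x) \<le> (\<Sum>m\<in>Z. C * norm (a i m x))"
      by (intro sum_norm_le) (auto simp: norm_mult intro!: mult_right_mono singleton)
    also have "\<dots> \<le> C * K i"
      unfolding sum_distrib_left[symmetric] by (intro mult_left_mono singleton x) simp
    finally show "norm (\<Sum>m\<in>Z. c m * a i m x) \<le> C * K i" .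
  qed (use singleton in \<open>auto intro!: continuous_intros\<close>)
  then show ?case by simp
next
  case (insert i I)
  have "\<exists>N::nat. \<forall>m\<in>Z. \<bar>m\<bar> \<le> int N"
  proof -
    have "finite (abs ` Z)" using Z by simp
    then have "\<forall>m\<in>Z. \<bar>m\<bar> \<le> int (nat (Max (insert 0 (abs ` Z))))" by (auto intro: Max_ge)
    then show ?thesis ..
  qed
  then obtain N :: nat where N: "\<And>m. m \<in> Z \<Longrightarrow> \<bar>m\<bar> \<le> int N" by blast
  \<comment> \<open>all differences of indices in \<open>Z\<close> are less than \<open>M\<close> in modulus, so the characters separate them\<close>
  define M where "M = 2 * N + 1"
  have M: "M > 0" "\<bar>m - n\<bar> < int M" if "m \<in> Z" "n \<in> Z" for m n
    using N[OF that(1)] N[OF that(2)] unfolding M_def by arith+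
  have M0: "M > 0" by (simp add: M_def)
  define P where "P t s = (\<Sum>m\<in>Z. (c m * unit_root M (int t * m)) * (\<Prod>j\<in>I. a j m (s j)))" for t s
  define Q where "Q t x = (\<Sum>n\<in>Z. unit_root M (int t * (- n)) * a i n x)" for t x
  have fin: "finite (insert i I)" using insert by simp
  have P: "tensor_bound r (insert i I) (P t) (C * (\<Prod>j\<in>I. K j))" for t
    unfolding P_def
    by (rule tensor_bound_lift[OF insert.IH]) (use insert fin in \<open>auto simp: norm_mult\<close>)
  have Q: "tensor_bound r (insert i I) (\<lambda>s. Q t (s i)) (K i)" for t
  proof (rule tensor_bound_lift[OF tensor_bound_single])
    fix x assume x: "x \<in> {-r..r}"
    have "norm (Q t x) \<le> (\<Sum>n\<in>Z. norm (a i n x))"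
      unfolding Q_def by (intro sum_norm_le) (auto simp: norm_mult)
    then show "norm (Q t x) \<le> K i" using insert.prems(2)[of i x] x by simp
  qed (use insert in \<open>auto simp: Q_def intro!: continuous_intros\<close>)
  have "tensor_bound r (insert i I) (\<lambda>s. \<Sum>t<M. (1 / of_nat M) * (P t s * Q t (s i)))
     (\<Sum>t<M. norm (1 / of_nat M :: complex) * (C * (\<Prod>j\<in>I. K j) * K i))"
    by (intro tensor_bound_sum tensor_bound_cmult tensor_bound_mult P Q) simp
  moreover have "(\<Sum>t<M. norm (1 / of_nat M :: complex) * (C * (\<Prod>j\<in>I. K j) * K i)) =
      C * (\<Prod>j\<in>insert i I. K j)"
    using M0 insert by (simp add: norm_divide)
  moreover have "(\<Sum>t<M. (1 / of_nat M) * (P t s * Q t (s i))) =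
      (\<Sum>m\<in>Z. c m * (\<Prod>j\<in>insert i I. a j m (s j)))" for s
  proof -
    define p where "p m = c m * (\<Prod>j\<in>I. a j m (s j))" for m
    have "(\<Sum>t<M. (1 / of_nat M) * (P t s * Q t (s i))) =
      (\<Sum>t<M. \<Sum>m\<in>Z. \<Sum>n\<in>Z. (1 / of_nat M) * (p m * a i n (s i) * unit_root M (int t * (m - n))))"
      unfolding P_def Q_def sum_product unfolding sum_distrib_left p_def
      by (intro sum.cong refl) (simp only: unit_root_mult_diff[symmetric] mult_ac)
    also have "\<dots> = (\<Sum>m\<in>Z. \<Sum>t<M. \<Sum>n\<in>Z. (1 / of_nat M) * (p m * a i n (s i) * unit_root M (int t * (m - n))))"
      by (rule sum.swap)
    also have "\<dots> = (\<Sum>m\<in>Z. \<Sum>n\<in>Z. \<Sum>t<M. (1 / of_nat M) * (p m * a i n (s i) * unit_root M (int t * (m - n))))"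
      by (intro sum.cong refl sum.swap)
    also have "\<dots> = (\<Sum>m\<in>Z. \<Sum>n\<in>Z. if m = n then p m * a i n (s i) else 0)"
    proof (intro sum.cong refl)
      fix m n assume mn: "m \<in> Z" "n \<in> Z"
      have "(\<Sum>t<M. (1 / of_nat M) * (p m * a i n (s i) * unit_root M (int t * (m - n)))) =
          (1 / of_nat M) * (p m * a i n (s i)) * (\<Sum>t<M. unit_root M (int t * (m - n)))"
        by (simp add: sum_distrib_left mult.assoc)
      then show "(\<Sum>t<M. (1 / of_nat M) * (p m * a i n (s i) * unit_root M (int t * (m - n)))) =
          (if m = n then p m * a i n (s i) else 0)"
        using M0 by (simp add: sum_unit_root[OF M(2)[OF mn]])
    qed
    also have "\<dots> = (\<Sum>m\<in>Z. p m * a i m (s i))"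
      using Z by simp
    finally show ?thesis using insert by (simp add: p_def mult_ac)
  qed
  ultimately show ?case by (simp only:)
qed

text \<open>Shifting one of the two indices moves any diagonal to the main one.\<close>

lemma tensor_bound_shifted_diagonal:
  fixes A B :: "int \<Rightarrow> real \<Rightarrow> complex"
  assumes pq: "p \<noteq> q" and Z: "finite Z"
    and cont: "\<And>m. m \<in> Z \<Longrightarrow> continuous_on {-r..r} (A m)" "\<And>m. m \<in> Z \<Longrightarrow> continuous_on {-r..r} (B m)"
    and A: "\<And>x. x \<in> {-r..r} \<Longrightarrow> (\<Sum>m\<in>Z. norm (A m x)) \<le> 1"
    and B: "\<And>x. x \<in> {-r..r} \<Longrightarrow> (\<Sum>m\<in>Z. norm (B m x)) \<le> 1"
  shows "tensor_bound r {p, q}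
    (\<lambda>s. \<Sum>m\<in>Z. \<Sum>n\<in>Z. if m - n = d then A m (s p) * B n (s q) else 0) 1"
proof -
  define a where "a i m = (if i = p then A m else if m - d \<in> Z then B (m - d) else (\<lambda>_. 0))" for i m
  have "tensor_bound r {p, q} (\<lambda>s. \<Sum>m\<in>Z. 1 * (\<Prod>i\<in>{p, q}. a i m (s i))) (1 * (\<Prod>i\<in>{p, q}. 1))"
  proof (rule tensor_bound_diagonal)
    show "continuous_on {-r..r} (a i m)" if "m \<in> Z" for i m using cont that by (auto simp: a_def)
    fix i x assume x: "x \<in> {-r..r}"
    have "(\<Sum>m\<in>Z. norm ((if m - d \<in> Z then B (m - d) else (\<lambda>_. 0)) x)) =
        (\<Sum>m\<in>{m\<in>Z. m - d \<in> Z}. norm (B (m - d) x))"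
      by (rule sum.mono_neutral_cong_right) (use Z in auto)
    also have "\<dots> = (\<Sum>n\<in>(\<lambda>m. m - d) ` {m\<in>Z. m - d \<in> Z}. norm (B n x))"
      by (subst sum.reindex) (auto simp: inj_on_def)
    also have "\<dots> \<le> (\<Sum>n\<in>Z. norm (B n x))" by (rule sum_mono2) (use Z in auto)
    also note B[OF x]
    finally show "(\<Sum>m\<in>Z. norm (a i m x)) \<le> 1" using A[OF x] by (cases "i = p") (simp_all add: a_def)
  qed (use Z in auto)
  moreover have "1 * (\<Prod>i\<in>{p, q}. a i m (s i)) = (\<Sum>n\<in>Z. if m - n = d then A m (s p) * B n (s q) else 0)"
    for s m
  proof -
    have "(\<Sum>n\<in>Z. if m - n = d then A m (s p) * B n (s q) else 0) =
        (\<Sum>n\<in>Z. if n = m - d then A m (s p) * B n (s q) else 0)"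
      by (intro sum.cong) auto
    then show ?thesis using pq Z by (simp add: a_def)
  qed
  ultimately show ?thesis by simp
qed

text \<open>A Toeplitz kernel is a sum of shifted diagonals.\<close>

lemma tensor_bound_toeplitz:
  fixes A B :: "int \<Rightarrow> real \<Rightarrow> complex"
  assumes "p \<noteq> q" "finite Z"
    and "\<And>m. m \<in> Z \<Longrightarrow> continuous_on {-r..r} (A m)" "\<And>m. m \<in> Z \<Longrightarrow> continuous_on {-r..r} (B m)"
    and "\<And>x. x \<in> {-r..r} \<Longrightarrow> (\<Sum>m\<in>Z. norm (A m x)) \<le> 1"
    and "\<And>x. x \<in> {-r..r} \<Longrightarrow> (\<Sum>m\<in>Z. norm (B m x)) \<le> 1"
    and D: "finite D" "\<And>m n. m \<in> Z \<Longrightarrow> n \<in> Z \<Longrightarrow> m - n \<in> D" "(\<Sum>d\<in>D. norm (t d)) \<le> T"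
  shows "tensor_bound r {p, q} (\<lambda>s. \<Sum>m\<in>Z. \<Sum>n\<in>Z. t (m - n) * (A m (s p) * B n (s q))) T"
proof -
  have "tensor_bound r {p, q}
    (\<lambda>s. \<Sum>d\<in>D. t d * (\<Sum>m\<in>Z. \<Sum>n\<in>Z. if m - n = d then A m (s p) * B n (s q) else 0))
    (\<Sum>d\<in>D. norm (t d) * 1)"
    by (intro tensor_bound_sum tensor_bound_cmult tensor_bound_shifted_diagonal assms)
  moreover have "(\<Sum>d\<in>D. t d * (\<Sum>m\<in>Z. \<Sum>n\<in>Z. if m - n = d then A m (s p) * B n (s q) else 0)) =
     (\<Sum>m\<in>Z. \<Sum>n\<in>Z. t (m - n) * (A m (s p) * B n (s q)))" for s
  proof -
    have "(\<Sum>d\<in>D. t d * (\<Sum>m\<in>Z. \<Sum>n\<in>Z. if m - n = d then A m (s p) * B n (s q) else 0)) =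
       (\<Sum>m\<in>Z. \<Sum>d\<in>D. \<Sum>n\<in>Z. if m - n = d then t d * (A m (s p) * B n (s q)) else 0)"
      unfolding sum_distrib_left by (subst sum.swap) (intro sum.cong refl, simp)
    also have "\<dots> = (\<Sum>m\<in>Z. \<Sum>n\<in>Z. \<Sum>d\<in>D. if m - n = d then t d * (A m (s p) * B n (s q)) else 0)"
      by (intro sum.cong refl sum.swap)
    also have "\<dots> = (\<Sum>m\<in>Z. \<Sum>n\<in>Z. t (m - n) * (A m (s p) * B n (s q)))"
      using D(1,2) by (intro sum.cong refl) simp
    finally show ?thesis .
  qed
  ultimately show ?thesis using D(3) by (auto intro: tensor_bound_mono)
qed

text \<open>The discrete sawtooth. Its Fourier coefficients grow linearly over a period and have moduli of sum
  at most \<open>\<pi>\<close>, while for nonzero \<open>d\<close> that are small against \<open>M\<close> it is close to \<open>1 / d\<close>. This is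
  what makes the Hilbert kernel a bounded multiplier.\<close>

definition sawtooth :: "nat \<Rightarrow> int \<Rightarrow> complex" where
  "sawtooth M d = (\<Sum>t<M. (2 * pi * \<i> / of_nat M ^ 2 * of_nat t) * unit_root M (int t * d))"

lemma sum_sawtooth_coeff: "M > 0 \<Longrightarrow> (\<Sum>t<M. norm (2 * pi * \<i> / of_nat M ^ 2 * of_nat t)) \<le> pi"
proof -
  assume M: "M > 0"
  have "(\<Sum>t<M. norm (2 * pi * \<i> / of_nat M ^ 2 * of_nat t)) = 2 * pi / of_nat M ^ 2 * (\<Sum>t<M. of_nat t)"
    by (simp add: norm_mult norm_divide norm_power sum_distrib_left)
  also have "(\<Sum>t<n. of_nat t :: real) \<le> of_nat n ^ 2 / 2" for n
    by (induction n) (auto simp: power2_eq_square field_simps)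
  then have "2 * pi / of_nat M ^ 2 * (\<Sum>t<M. of_nat t) \<le> 2 * pi / of_nat M ^ 2 * (of_nat M ^ 2 / 2)"
    by (intro mult_left_mono) auto
  also have "\<dots> = pi" using M by simp
  finally show ?thesis .
qed

lemma norm_sawtooth_le: "M > 0 \<Longrightarrow> norm (sawtooth M d) \<le> pi"
  unfolding sawtooth_def
  by (rule order_trans[OF sum_norm_le sum_sawtooth_coeff]) (simp add: norm_mult norm_divide norm_power)

text \<open>If \<open>z\<^sup>M = 1\<close> and \<open>z \<noteq> 1\<close>, then \<open>\<Sum>t<M. t z\<^sup>t = M / (z - 1)\<close>.\<close>

lemma sawtooth_eq:
  assumes "d \<noteq> 0" "\<bar>d\<bar> < int M"
  shows "sawtooth M d = 2 * pi * \<i> / of_nat M / (unit_root M d - 1)"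
proof -
  have M: "M > 0" using assms by linarith
  define w where "w = unit_root M d"
  have w: "w \<noteq> 1" "w ^ M = 1" "(\<Sum>t<M. w ^ t) = 0"
    using unit_root_neq_1[OF assms] unit_root_power[OF M] sum_unit_root[OF assms(2)] assms(1)
    by (simp_all add: w_def unit_root_mult_nat)
  have "(w - 1) * (\<Sum>t<n. of_nat t * w ^ t) = of_nat n * w ^ n - w * (\<Sum>t<n. w ^ t)" for n
    by (induction n) (simp_all add: algebra_simps)
  from this[of M] have "(\<Sum>t<M. of_nat t * w ^ t) = of_nat M / (w - 1)"
    using w by (simp add: field_simps)
  moreover have "sawtooth M d = 2 * pi * \<i> / of_nat M ^ 2 * (\<Sum>t<M. of_nat t * w ^ t)"
    unfolding sawtooth_def w_def sum_distrib_left
    by (intro sum.cong refl) (simp only: unit_root_mult_nat mult.assoc)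
  ultimately show ?thesis using M by (simp add: w_def power2_eq_square)
qed

lemma sawtooth_approx:
  assumes d: "d \<noteq> 0" and M: "2 * pi * \<bar>of_int d\<bar> \<le> of_nat M" "M > 0"
  shows "norm (1 / of_int d - sawtooth M d) \<le> 2 * pi / of_nat M"
proof -
  define \<theta> where "\<theta> = 2 * pi * of_int d / of_nat M"
  have th: "\<theta> \<noteq> 0" "\<bar>\<theta>\<bar> \<le> 1" using assms by (auto simp: \<theta>_def abs_mult divide_simps)
  have "1 * \<bar>real_of_int d\<bar> < 2 * pi * \<bar>real_of_int d\<bar>"
    using d pi_gt3 by (intro mult_strict_right_mono) auto
  then have lt: "\<bar>d\<bar> < int M" using M by linarith
  define e where "e = unit_root M d - 1"
  have u: "unit_root M d = exp (\<i> * \<theta>)"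
    by (simp only: unit_root_def \<theta>_def cis_conv_exp)
  have e: "norm (e - \<i> * \<theta>) \<le> \<theta>\<^sup>2 / 2"
  proof -
    have "norm (exp (\<i> * \<theta>) - (1 + \<i> * \<theta>)) \<le> \<theta>\<^sup>2 / 2"
      using iexp_approx1[of \<theta> 1] by (simp add: power2_eq_square)
    moreover have "e - \<i> * \<theta> = exp (\<i> * \<theta>) - (1 + \<i> * \<theta>)"
      using u by (simp add: e_def)
    ultimately show ?thesis by (simp only:)
  qed
  have "\<theta>\<^sup>2 / 2 \<le> \<bar>\<theta>\<bar> / 2"
    using mult_left_mono[OF th(2), of "\<bar>\<theta>\<bar>"] by (simp add: power2_eq_square abs_mult[symmetric])
  then have ne: "norm e \<ge> \<bar>\<theta>\<bar> / 2"
    using e norm_triangle_ineq2[of "\<i> * \<theta>" e] by (simp add: norm_mult norm_minus_commute)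
  have e0: "e \<noteq> 0" using ne th by auto
  have "1 / of_int d - sawtooth M d = (e - \<i> * \<theta>) / (of_int d * e)"
    unfolding sawtooth_eq[OF d lt] e_def[symmetric] \<theta>_def using d e0 M(2)
    by (simp add: field_simps)
  also have "norm \<dots> \<le> (\<theta>\<^sup>2 / 2) / (\<bar>of_int d\<bar> * (\<bar>\<theta>\<bar> / 2))"
    unfolding norm_divide norm_mult norm_of_int using e ne d th
    by (intro frac_le mult_left_mono mult_pos_pos) auto
  also have "\<dots> = 2 * pi / of_nat M"
    using d th M by (simp add: power2_eq_square) (simp add: \<theta>_def abs_mult)
  finally show ?thesis .
qed

text \<open>Each character of \<open>m - n\<close> is a product of a function of \<open>m\<close> and a function of \<open>n\<close>, so the cost is
  the sum of the moduli of the Fourier coefficients. Splitting into diagonals instead would cost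
  a divergent harmonic sum.\<close>

lemma tensor_bound_sawtooth:
  fixes A B :: "int \<Rightarrow> real \<Rightarrow> complex"
  assumes M: "M > 0" and pq: "p \<noteq> q" and Z: "finite Z"
    and cont: "\<And>m. m \<in> Z \<Longrightarrow> continuous_on {-r..r} (A m)" "\<And>m. m \<in> Z \<Longrightarrow> continuous_on {-r..r} (B m)"
    and A: "\<And>x. x \<in> {-r..r} \<Longrightarrow> (\<Sum>m\<in>Z. norm (A m x)) \<le> 1"
    and B: "\<And>x. x \<in> {-r..r} \<Longrightarrow> (\<Sum>m\<in>Z. norm (B m x)) \<le> 1"
  shows "tensor_bound r {p, q} (\<lambda>s. \<Sum>m\<in>Z. \<Sum>n\<in>Z. sawtooth M (m - n) * (A m (s p) * B n (s q))) pi"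
proof -
  define \<tau> where "\<tau> t = 2 * pi * \<i> / of_nat M ^ 2 * of_nat t" for t :: nat
  have single: "tensor_bound r {p, q} (\<lambda>s. (\<lambda>x. \<Sum>m\<in>Z. u m * C m x) (s i)) 1"
    if "i \<in> {p, q}" "\<And>m. norm (u m) = 1" "\<And>x. x \<in> {-r..r} \<Longrightarrow> (\<Sum>m\<in>Z. norm (C m x)) \<le> 1"
      "\<And>m. m \<in> Z \<Longrightarrow> continuous_on {-r..r} (C m)" for i u C
  proof (rule tensor_bound_lift[OF tensor_bound_single])
    fix x assume "x \<in> {-r..r}"
    then show "norm (\<Sum>m\<in>Z. u m * C m x) \<le> 1"
      using that(2,3) by (intro order_trans[OF norm_sum]) (simp add: norm_mult)
  qed (use that Z in \<open>auto intro!: continuous_intros\<close>)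
  have "tensor_bound r {p, q} (\<lambda>s. \<Sum>t<M. \<tau> t * ((\<Sum>m\<in>Z. unit_root M (int t * m) * A m (s p)) *
     (\<Sum>n\<in>Z. unit_root M (int t * (- n)) * B n (s q)))) (\<Sum>t<M. norm (\<tau> t) * (1 * 1))"
    by (intro tensor_bound_sum tensor_bound_cmult tensor_bound_mult single A B cont) auto
  moreover have "(\<Sum>t<M. norm (\<tau> t) * (1 * 1)) \<le> pi"
    using sum_sawtooth_coeff[OF M] by (simp add: \<tau>_def)
  moreover have "(\<Sum>t<M. \<tau> t * ((\<Sum>m\<in>Z. unit_root M (int t * m) * A m (s p)) *
     (\<Sum>n\<in>Z. unit_root M (int t * (- n)) * B n (s q)))) =
     (\<Sum>m\<in>Z. \<Sum>n\<in>Z. sawtooth M (m - n) * (A m (s p) * B n (s q)))" for s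
  proof -
    have "(\<Sum>t<M. \<tau> t * ((\<Sum>m\<in>Z. unit_root M (int t * m) * A m (s p)) *
     (\<Sum>n\<in>Z. unit_root M (int t * (- n)) * B n (s q)))) =
      (\<Sum>t<M. \<Sum>m\<in>Z. \<Sum>n\<in>Z. \<tau> t * unit_root M (int t * (m - n)) * (A m (s p) * B n (s q)))"
      unfolding sum_product unfolding sum_distrib_left
      by (intro sum.cong refl) (simp only: unit_root_mult_diff[symmetric] mult_ac)
    also have "\<dots> = (\<Sum>m\<in>Z. \<Sum>t<M. \<Sum>n\<in>Z. \<tau> t * unit_root M (int t * (m - n)) * (A m (s p) * B n (s q)))"
      by (rule sum.swap)
    also have "\<dots> = (\<Sum>m\<in>Z. \<Sum>n\<in>Z. \<Sum>t<M. \<tau> t * unit_root M (int t * (m - n)) * (A m (s p) * B n (s q)))"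
      by (intro sum.cong refl sum.swap)
    finally show ?thesis by (simp add: sawtooth_def \<tau>_def sum_distrib_right)
  qed
  ultimately show ?thesis by (auto intro: tensor_bound_mono)
qed

lemma sum_far_inverse_squares: "(\<Sum>d = 3..K. 1 / real d ^ 2) \<le> 1 / 2"
proof -
  have "(\<Sum>d = 3..K. 1 / real d ^ 2) \<le> 1 / 2 - 1 / real K" if "K \<ge> 2" using that
  proof (induction K rule: dec_induct)
    case (step n)
    have "1 / real (Suc n) ^ 2 \<le> 1 / (real n * real (Suc n))"
      using step by (intro divide_left_mono) (auto simp: power2_eq_square)
    also have "\<dots> = 1 / real n - 1 / real (Suc n)"
      using step by (simp add: field_simps)
    finally have "1 / real (Suc n) ^ 2 \<le> 1 / real n - 1 / real (Suc n)" .
    then show ?case using step by simp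
  qed simp
  moreover have "1 / 2 - 1 / real K \<le> 1 / 2" by simp
  ultimately show ?thesis by (cases "K \<ge> 2") (blast intro: order_trans, simp)
qed

text \<open>The kernels \<open>1 / (m - n)\<^sup>l\<^sup>+\<^sup>1\<close> that arise when \<open>1 / (x - y)\<close> is expanded on distant blocks.\<close>

definition far_power :: "nat \<Rightarrow> int \<Rightarrow> complex" where
  "far_power l d = (if \<bar>d\<bar> \<ge> 3 then 1 / of_int d ^ (l + 1) else 0)"

text \<open>For \<open>l > 0\<close> the coefficients are summable; for \<open>l = 0\<close> they differ from the sawtooth by
  a summable sequence.\<close>

lemma tensor_bound_far_power:
  fixes A B :: "int \<Rightarrow> real \<Rightarrow> complex"
  assumes pq: "p \<noteq> q" and Z: "Z = {-int N..int N}"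
    and cont: "\<And>m. m \<in> Z \<Longrightarrow> continuous_on {-r..r} (A m)" "\<And>m. m \<in> Z \<Longrightarrow> continuous_on {-r..r} (B m)"
    and A: "\<And>x. x \<in> {-r..r} \<Longrightarrow> (\<Sum>m\<in>Z. norm (A m x)) \<le> 1"
    and B: "\<And>x. x \<in> {-r..r} \<Longrightarrow> (\<Sum>m\<in>Z. norm (B m x)) \<le> 1"
  shows "tensor_bound r {p, q} (\<lambda>s. \<Sum>m\<in>Z. \<Sum>n\<in>Z. far_power l (m - n) * (A m (s p) * B n (s q)))
     (7 * pi / 3 ^ l)"
proof -
  define D where "D = {-(2 * int N)..2 * int N}"
  have fin: "finite Z" "finite D" by (simp_all add: Z D_def)
  have D: "m - n \<in> D" if "m \<in> Z" "n \<in> Z" for m n using that by (simp add: Z D_def)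
  show ?thesis
  proof (cases l)
    case 0
    \<comment> \<open>the period exceeds \<open>2 \<pi>\<close> times every occurring difference, with room to make the total error at most \<open>\<pi>\<close>\<close>
    define M where "M = 16 * N + 16"
    have M: "M > 0" by (simp add: M_def)
    have "(\<Sum>d\<in>D. norm (far_power 0 d - sawtooth M d)) \<le>
        (\<Sum>d\<in>D. 2 * pi / of_nat M + (if d \<in> {-2..2} then pi else 0))"
    proof (rule sum_mono)
      fix d assume "d \<in> D"
      then have "\<bar>real_of_int d\<bar> \<le> 2 * real N" by (auto simp: D_def)
      then have "2 * pi * \<bar>real_of_int d\<bar> \<le> (2 * 4) * (2 * real N)"
        using pi_less_4 by (intro mult_mono) auto
      then have "2 * pi * \<bar>of_int d\<bar> \<le> of_nat M" by (simp add: M_def)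
      then show "norm (far_power 0 d - sawtooth M d) \<le> 2 * pi / of_nat M + (if d \<in> {-2..2} then pi else 0)"
        using sawtooth_approx[of d M] norm_sawtooth_le[OF M, of d] M
        by (cases "\<bar>d\<bar> \<ge> 3") (auto simp: far_power_def intro: order_trans[of _ pi])
    qed
    also have "\<dots> = of_nat (card D) * (2 * pi / of_nat M) + (\<Sum>d\<in>D \<inter> {-2..2}. pi)"
      unfolding sum.distrib sum.inter_restrict[OF fin(2)] by simp
    also have "\<dots> \<le> pi + (\<Sum>d\<in>{-2..2::int}. pi)"
    proof (intro add_mono sum_mono2)
      have "card D = 4 * N + 1" by (simp add: D_def)
      then show "of_nat (card D) * (2 * pi / of_nat M) \<le> pi"
        by (simp add: M_def divide_simps)
    qed auto
    also have "\<dots> = 6 * pi" by simp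
    finally have e: "(\<Sum>d\<in>D. norm (far_power 0 d - sawtooth M d)) \<le> 6 * pi" .
    have "tensor_bound r {p, q} (\<lambda>s.
        (\<Sum>m\<in>Z. \<Sum>n\<in>Z. (far_power 0 (m - n) - sawtooth M (m - n)) * (A m (s p) * B n (s q))) +
        (\<Sum>m\<in>Z. \<Sum>n\<in>Z. sawtooth M (m - n) * (A m (s p) * B n (s q)))) (6 * pi + pi)"
      by (intro tensor_bound_add tensor_bound_sawtooth M pq fin cont A B
          tensor_bound_toeplitz[where t = "\<lambda>d. far_power 0 d - sawtooth M d" and D = D] D e)
    then show ?thesis by (simp add: 0 sum.distrib[symmetric] distrib_right[symmetric])
  next
    case (Suc l')
    define g where "g d = (if \<bar>d\<bar> \<ge> 3 then 1 / real_of_int d ^ 2 else 0)" for d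
    have g_minus: "g (- d) = g d" for d by (simp add: g_def)
    have "(\<Sum>d\<in>{-int K..int K}. g d) = 2 * (\<Sum>d = 3..K. 1 / real d ^ 2)" for K
    proof (induction K)
      case (Suc K)
      have "{-int (Suc K)..int (Suc K)} = insert (-int (Suc K)) (insert (int (Suc K)) {-int K..int K})"
        by auto
      then have "(\<Sum>d\<in>{-int (Suc K)..int (Suc K)}. g d) =
          g (-int (Suc K)) + (g (int (Suc K)) + (\<Sum>d\<in>{-int K..int K}. g d))"
        by simp
      moreover have "g (-int (Suc K)) = g (int (Suc K))" by (rule g_minus)
      moreover have "g (int (Suc K)) = (if 3 \<le> Suc K then 1 / real (Suc K) ^ 2 else 0)"
        by (simp add: g_def)
      ultimately show ?case using Suc.IH by (simp del: of_nat_Suc)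
    qed (simp add: g_def)
    from this[of "2 * N"] have g: "(\<Sum>d\<in>D. g d) \<le> 1"
      using sum_far_inverse_squares[of "2 * N"] by (simp add: D_def)
    have "norm (far_power l d) \<le> g d * (1 / 3 ^ l')" for d
    proof (cases "\<bar>d\<bar> \<ge> 3")
      case True
      then have "3 \<le> \<bar>real_of_int d\<bar>" by linarith
      then have pw: "(3::real) ^ l' \<le> \<bar>real_of_int d\<bar> ^ l'" by (intro power_mono) auto
      show ?thesis
      proof -
        have "norm (far_power l d) = 1 / (\<bar>real_of_int d\<bar> ^ 2 * \<bar>real_of_int d\<bar> ^ l')"
          using True by (simp add: far_power_def Suc norm_divide norm_power norm_mult power2_eq_square mult.assoc)
        also have "\<dots> \<le> 1 / (\<bar>real_of_int d\<bar> ^ 2 * 3 ^ l')"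
          using pw True by (intro divide_left_mono mult_left_mono mult_pos_pos) auto
        finally show ?thesis using True by (simp add: g_def)
      qed
    qed (simp add: far_power_def g_def)
    then have "(\<Sum>d\<in>D. norm (far_power l d)) \<le> (\<Sum>d\<in>D. g d) * (1 / 3 ^ l')"
      unfolding sum_distrib_right by (rule sum_mono)
    also have "\<dots> \<le> 1 * (1 / 3 ^ l')" by (intro mult_right_mono g) simp
    also have "\<dots> \<le> 7 * pi / 3 ^ l" using pi_gt3 by (simp add: Suc divide_simps)
    finally have "(\<Sum>d\<in>D. norm (far_power l d)) \<le> 7 * pi / 3 ^ l" .
    then show ?thesis by (intro tensor_bound_toeplitz[where D = D] pq fin cont A B D)
  qed
qed

section \<open>Divided differences of analytic functions\<close>

text \<open>Blocks of unit length. The hats form a partition of unity subordinate to them; a plateau is one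
  up to distance \<open>5\<close> from the centre of its block and vanishes from distance \<open>6\<close> on.\<close>

definition hat :: "int \<Rightarrow> real \<Rightarrow> real" where
  "hat m x = max 0 (1 - \<bar>x - of_int m\<bar>)"

definition plateau :: "int \<Rightarrow> real \<Rightarrow> real" where
  "plateau m x = max 0 (min 1 (6 - \<bar>x - of_int m\<bar>))"

lemma hat_nonneg [simp]: "0 \<le> hat m x"
  by (simp add: hat_def)

lemma continuous_on_hat [continuous_intros]: "continuous_on S (hat m)"
  unfolding hat_def by (intro continuous_intros)

lemma continuous_on_plateau [continuous_intros]: "continuous_on S (plateau m)"
  unfolding plateau_def by (intro continuous_intros)

lemma hat_nonzero: "hat m x \<noteq> 0 \<Longrightarrow> \<bar>x - of_int m\<bar> < 1"
  by (simp add: hat_def max_def split: if_splits)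

lemma plateau_nonzero: "plateau m x \<noteq> 0 \<Longrightarrow> \<bar>x - of_int m\<bar> < 6"
  by (simp add: plateau_def max_def min_def split: if_splits)

lemma sum_hat:
  assumes "\<bar>x\<bar> \<le> real N - 1"
  shows "(\<Sum>m\<in>{-int N..int N}. hat m x) = 1"
proof -
  have f: "of_int \<lfloor>x\<rfloor> \<le> x" "x < of_int \<lfloor>x\<rfloor> + 1" by linarith+
  have "{\<lfloor>x\<rfloor>, \<lfloor>x\<rfloor> + 1} \<subseteq> {-int N..int N}" using assms f by auto linarith+
  moreover have "hat m x = 0" if "m \<notin> {\<lfloor>x\<rfloor>, \<lfloor>x\<rfloor> + 1}" for m
  proof -
    from that have "m + 1 \<le> \<lfloor>x\<rfloor> \<or> \<lfloor>x\<rfloor> + 2 \<le> m" by auto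
    then have "of_int m + 1 \<le> real_of_int \<lfloor>x\<rfloor> \<or> real_of_int \<lfloor>x\<rfloor> + 2 \<le> of_int m" by linarith
    then have "1 \<le> \<bar>x - of_int m\<bar>" using f by linarith
    then show ?thesis by (simp add: hat_def)
  qed
  ultimately have "(\<Sum>m\<in>{-int N..int N}. hat m x) = (\<Sum>m\<in>{\<lfloor>x\<rfloor>, \<lfloor>x\<rfloor> + 1}. hat m x)"
    by (intro sum.mono_neutral_right) auto
  also have "\<dots> = 1" proof -
    have "x - of_int \<lfloor>x\<rfloor> \<le> 1" using f by linarith
    then show ?thesis using f by (simp add: hat_def max_def) linarith
  qed
  finally show ?thesis .
qed

lemma sum_hat_power_le:
  assumes "\<bar>x\<bar> \<le> real N - 1"
  shows "(\<Sum>m\<in>{-int N..int N}. norm (of_real (hat m x) * of_real (x - of_int m) ^ k :: complex)) \<le> 1"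
proof -
  have "norm (of_real (hat m x) * of_real (x - of_int m) ^ k :: complex) \<le> hat m x" for m
  proof (cases "\<bar>x - of_int m\<bar> \<le> 1")
    case True
    then have "\<bar>x - of_int m\<bar> ^ k \<le> 1" by (intro power_le_one) auto
    then show ?thesis using mult_left_mono[of _ 1 "hat m x"]
      by (simp add: norm_mult norm_power del: of_real_diff)
  qed (simp add: hat_def)
  then have "(\<Sum>m\<in>{-int N..int N}. norm (of_real (hat m x) * of_real (x - of_int m) ^ k :: complex)) \<le>
     (\<Sum>m\<in>{-int N..int N}. hat m x)" by (rule sum_mono)
  with sum_hat[OF assms] show ?thesis by simp
qed

lemma sum_plateau_power_le:
  assumes "finite Z"
  shows "(\<Sum>m\<in>Z. norm (of_real (plateau m x) * of_real (x - of_int m) ^ k :: complex)) \<le> 13 * 6 ^ k"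
proof -
  have le: "norm (of_real (plateau m x) * of_real (x - of_int m) ^ k :: complex) \<le>
      (if m \<in> {\<lceil>x\<rceil> - 6..\<lfloor>x\<rfloor> + 6} then 6 ^ k else 0)" for m
  proof (cases "\<bar>x - of_int m\<bar> < 6")
    case True
    then have m: "m \<in> {\<lceil>x\<rceil> - 6..\<lfloor>x\<rfloor> + 6}" by auto linarith+
    have "plateau m x * \<bar>x - of_int m\<bar> ^ k \<le> 1 * 6 ^ k"
      using True by (intro mult_mono power_mono) (auto simp: plateau_def)
    then show ?thesis using m
      by (simp add: norm_mult norm_power plateau_def del: of_real_diff)
  qed (simp add: plateau_def)
  have "(\<Sum>m\<in>Z. norm (of_real (plateau m x) * of_real (x - of_int m) ^ k :: complex)) \<le>
     (\<Sum>m\<in>Z. if m \<in> {\<lceil>x\<rceil> - 6..\<lfloor>x\<rfloor> + 6} then 6 ^ k else 0)"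
    by (rule sum_mono) (rule le)
  also have "\<dots> = (\<Sum>m\<in>Z \<inter> {\<lceil>x\<rceil> - 6..\<lfloor>x\<rfloor> + 6}. 6 ^ k)"
    by (rule sum.inter_restrict[symmetric]) (rule assms)
  also have "\<dots> \<le> (\<Sum>m\<in>{\<lceil>x\<rceil> - 6..\<lfloor>x\<rfloor> + 6}. 6 ^ k)"
    by (rule sum_mono2) auto
  also have "\<dots> = real (card {\<lceil>x\<rceil> - 6..\<lfloor>x\<rfloor> + 6}) * 6 ^ k" by simp
  also have "\<dots> \<le> 13 * 6 ^ k"
  proof (rule mult_right_mono)
    have "\<lfloor>x\<rfloor> \<le> \<lceil>x\<rceil>" by linarith
    then have "card {\<lceil>x\<rceil> - 6..\<lfloor>x\<rfloor> + 6} \<le> 13" by (simp add: nat_le_iff)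
    then show "real (card {\<lceil>x\<rceil> - 6..\<lfloor>x\<rfloor> + 6}) \<le> 13" by linarith
  qed simp
  finally show ?thesis .
qed

text \<open>The partition of unity in two variables, split into pairs of neighbouring and of distant blocks.\<close>

definition near :: "nat \<Rightarrow> real \<Rightarrow> real \<Rightarrow> complex" where
  "near N x y = (\<Sum>m\<in>{-int N..int N}. \<Sum>n\<in>{-int N..int N}.
     (if \<bar>m - n\<bar> \<le> 2 then 1 else 0) * (of_real (hat m x) * of_real (hat n y)))"

definition far :: "nat \<Rightarrow> real \<Rightarrow> real \<Rightarrow> complex" where
  "far N x y = (\<Sum>m\<in>{-int N..int N}. \<Sum>n\<in>{-int N..int N}.
     (if \<bar>m - n\<bar> \<ge> 3 then 1 else 0) * (of_real (hat m x) * of_real (hat n y)))"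

lemma near_plus_far:
  assumes "\<bar>x\<bar> \<le> real N - 1" "\<bar>y\<bar> \<le> real N - 1"
  shows "near N x y + far N x y = 1"
proof -
  have "near N x y + far N x y =
     (\<Sum>m\<in>{-int N..int N}. \<Sum>n\<in>{-int N..int N}. of_real (hat m x) * of_real (hat n y))"
    unfolding near_def far_def sum.distrib[symmetric] by (intro sum.cong refl) auto
  also have "\<dots> = of_real (\<Sum>m\<in>{-int N..int N}. hat m x) * of_real (\<Sum>n\<in>{-int N..int N}. hat n y)"
    by (simp add: sum_product)
  finally show ?thesis using assms by (simp only: sum_hat) simp
qed

text \<open>Hats whose numbers differ by at most two have supports within distance \<open>4\<close>. So the plateau of
  the block of \<open>x\<close>, which is one up to distance \<open>5\<close>, may be inserted next to a near factor.\<close>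

lemma near_eq_0:
  assumes "\<bar>x - of_int m\<bar> < 1" "\<bar>y - of_int m\<bar> \<ge> 5"
  shows "near N x y = 0"
  unfolding near_def
proof (intro sum.neutral ballI)
  fix k l :: int
  show "(if \<bar>k - l\<bar> \<le> 2 then 1 else 0) * (of_real (hat k x) * of_real (hat l y)) = (0::complex)"
  proof (rule ccontr)
    assume "\<not> ?thesis"
    then have "\<bar>x - of_int k\<bar> < 1" "\<bar>y - of_int l\<bar> < 1" "\<bar>k - l\<bar> \<le> 2"
      by (auto simp: hat_def max_def split: if_splits)
    moreover from this(3) have "\<bar>real_of_int k - real_of_int l\<bar> \<le> 2" by linarith
    ultimately show False using assms by linarith
  qed
qed

text \<open>Only the five diagonals \<open>m - n \<in> {-2..2}\<close> occur.\<close>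

lemma tensor_bound_near:
  assumes "p \<noteq> q" "r \<le> real N - 1"
  shows "tensor_bound r {p, q} (\<lambda>s. near N (s p) (s q)) 5"
  unfolding near_def
proof (rule tensor_bound_toeplitz[where D = "{-(2 * int N)..2 * int N}"
      and t = "\<lambda>d. if \<bar>d\<bar> \<le> 2 then 1 else 0"])
  have "(\<Sum>d\<in>{-(2 * int N)..2 * int N}. norm (if \<bar>d\<bar> \<le> 2 then 1 else 0 :: complex)) =
     (\<Sum>d\<in>{-(2 * int N)..2 * int N}. if d \<in> {-2..2} then 1 else 0)"
    by (intro sum.cong) auto
  also have "\<dots> = (\<Sum>d\<in>{-(2 * int N)..2 * int N} \<inter> {-2..2}. 1)"
    by (rule sum.inter_restrict[symmetric]) simp
  also have "\<dots> \<le> (\<Sum>d\<in>{-2..2::int}. 1)" by (rule sum_mono2) auto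
  finally show "(\<Sum>d\<in>{-(2 * int N)..2 * int N}. norm (if \<bar>d\<bar> \<le> 2 then 1 else 0 :: complex)) \<le> 5" by simp
  show "(\<Sum>m\<in>{-int N..int N}. norm (of_real (hat m x) :: complex)) \<le> 1" if "x \<in> {-r..r}" for x
  proof -
    have "\<bar>x\<bar> \<le> real N - 1" using that assms(2) by auto
    then show ?thesis using sum_hat_power_le[of x N 0] by simp
  qed
  then show "(\<Sum>m\<in>{-int N..int N}. norm (of_real (hat m x) :: complex)) \<le> 1" if "x \<in> {-r..r}" for x
    using that .
qed (use assms in \<open>auto intro!: continuous_intros\<close>)

text \<open>On a pair of far blocks \<open>1 / (x - y)\<close> is a geometric series in the positions inside the
  blocks, whose coefficients depend only on the difference of the block numbers. The terms are
  Toeplitz multipliers whose bounds decay like \<open>(2 / 3)\<^sup>l\<close>.\<close>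

lemma tensor_bound_far_kernel:
  assumes pq: "p \<noteq> q" and r: "r \<le> real N - 1"
  shows "tensor_bound r {p, q} (\<lambda>s. far N (s p) (s q) / of_real (s p - s q)) (21 * pi)"
proof -
  define Z where "Z = {-int N..int N}"
  define A where "A k m x = (of_real (hat m x) * of_real (x - of_int m) ^ k :: complex)" for k m and x :: real
  define T where "T l k s = (\<Sum>m\<in>Z. \<Sum>n\<in>Z. far_power l (m - n) * (A k m (s p) * A (l - k) n (s q)))"
    for l k and s :: "nat \<Rightarrow> real"
  have A: "(\<Sum>m\<in>Z. norm (A k m x)) \<le> 1" if "x \<in> {-r..r}" for k x
  proof -
    have "\<bar>x\<bar> \<le> real N - 1" using that r by auto
    then show ?thesis using sum_hat_power_le[of x N k] by (simp add: Z_def A_def)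
  qed
  have T: "tensor_bound r {p, q} (T l k) (7 * pi / 3 ^ l)" for l k
    unfolding T_def
    by (rule tensor_bound_far_power) (use pq A in \<open>auto simp: Z_def A_def intro!: continuous_intros\<close>)
  have L: "tensor_bound r {p, q} (\<lambda>s. \<Sum>k\<le>l. (of_nat (l choose k) * (- 1) ^ k) * T l k s)
     (7 * pi * (2 / 3) ^ l)" for l
  proof -
    have "tensor_bound r {p, q} (\<lambda>s. \<Sum>k\<le>l. (of_nat (l choose k) * (- 1) ^ k) * T l k s)
      (\<Sum>k\<le>l. norm (of_nat (l choose k) * (- 1) ^ k :: complex) * (7 * pi / 3 ^ l))"
      by (intro tensor_bound_sum tensor_bound_cmult T) simp
    also have "(\<Sum>k\<le>l. norm (of_nat (l choose k) * (- 1) ^ k :: complex) * (7 * pi / 3 ^ l)) =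
        real (\<Sum>k\<le>l. l choose k) * (7 * pi / 3 ^ l)"
      by (simp add: norm_mult norm_power sum_distrib_right sum_divide_distrib)
    also have "\<dots> = 7 * pi * (2 / 3) ^ l"
      by (simp only: choose_row_sum) (simp add: power_divide)
    finally show ?thesis .
  qed
  have "(\<lambda>l. 7 * pi * (2 / 3) ^ l) sums (7 * pi * (1 / (1 - 2 / 3)))"
    by (intro sums_mult geometric_sums) simp
  then have S: "summable (\<lambda>l. 7 * pi * (2 / 3) ^ l)" "(\<Sum>l. 7 * pi * (2 / 3) ^ l) = 21 * pi"
    by (auto simp: sums_iff)
  have "tensor_bound r {p, q} (\<lambda>s. far N (s p) (s q) / of_real (s p - s q)) (\<Sum>l. 7 * pi * (2 / 3) ^ l)"
  proof (rule tensor_bound_sums[OF L S(1)])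
    fix s :: "nat \<Rightarrow> real"
    define x y where "x = s p" and "y = s q"
    define h :: "int \<Rightarrow> int \<Rightarrow> complex" where "h m n = of_real (hat m x) * of_real (hat n y)" for m n
    have block: "(\<lambda>l. far_power l (m - n) * (h m n * of_real ((y - of_int n) - (x - of_int m)) ^ l)) sums
       ((if \<bar>m - n\<bar> \<ge> 3 then 1 else 0) * h m n / of_real (x - y))" for m n
    proof (cases "\<bar>m - n\<bar> \<ge> 3 \<and> h m n \<noteq> 0")
      case True
      then have uv: "\<bar>x - of_int m\<bar> < 1" "\<bar>y - of_int n\<bar> < 1"
        by (auto simp: h_def hat_def max_def split: if_splits)
      define d w where "d = (of_int (m - n) :: real)" and "w = (y - of_int n) - (x - of_int m)"
      have d: "\<bar>d\<bar> \<ge> 3" "\<bar>w\<bar> < 2" "x - y = d - w" using True uv by (auto simp: d_def w_def)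
      then have lt: "\<bar>w / d\<bar> < 1" by (simp add: abs_divide divide_simps)
      have "(\<lambda>l. h m n / of_real d * (of_real (w / d)) ^ l) sums (h m n / of_real d * (1 / (1 - of_real (w / d))))"
        by (intro sums_mult geometric_sums) (use lt in \<open>simp add: norm_divide abs_divide\<close>)
      moreover have "h m n / of_real d * (1 / (1 - of_real (w / d))) = h m n / of_real (x - y)"
      proof -
        have "1 - of_real (w / d) = (of_real (d - w) / of_real d :: complex)"
          using d by (simp add: divide_simps)
        then show ?thesis using d by (simp del: of_real_diff)
      qed
      moreover have "h m n / of_real d * (of_real (w / d)) ^ l =
          far_power l (m - n) * (h m n * of_real w ^ l)" for l
        using True by (simp add: far_power_def d_def power_divide del: of_int_diff)
      ultimately show ?thesis using True unfolding w_def by simp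
    qed (auto simp: far_power_def)
    have "(\<lambda>l. \<Sum>m\<in>Z. \<Sum>n\<in>Z. far_power l (m - n) * (h m n * of_real ((y - of_int n) - (x - of_int m)) ^ l)) sums
       (\<Sum>m\<in>Z. \<Sum>n\<in>Z. (if \<bar>m - n\<bar> \<ge> 3 then 1 else 0) * h m n / of_real (x - y))"
      by (intro sums_sum block)
    moreover have "(\<Sum>m\<in>Z. \<Sum>n\<in>Z. (if \<bar>m - n\<bar> \<ge> 3 then 1 else 0) * h m n / of_real (x - y)) =
        far N x y / of_real (x - y)"
      by (simp add: far_def Z_def h_def sum_divide_distrib del: of_real_diff)
    moreover have "(\<Sum>m\<in>Z. \<Sum>n\<in>Z. far_power l (m - n) * (h m n * of_real ((y - of_int n) - (x - of_int m)) ^ l)) =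
        (\<Sum>k\<le>l. (of_nat (l choose k) * (- 1) ^ k) * T l k s)" for l
    proof -
      have bin: "h m n * of_real ((y - of_int n) - (x - of_int m)) ^ l =
         (\<Sum>k\<le>l. (of_nat (l choose k) * (- 1) ^ k) * (A k m x * A (l - k) n y))" for m n
      proof -
        have b: "(of_real ((y - of_int n) - (x - of_int m)) :: complex) =
          - of_real (x - of_int m) + of_real (y - of_int n)" by simp
        have "(of_real ((y - of_int n) - (x - of_int m)) :: complex) ^ l = (\<Sum>k\<le>l. of_nat (l choose k) * (- of_real (x - of_int m)) ^ k * of_real (y - of_int n) ^ (l - k))"
          unfolding b by (rule binomial_ring)
        then show ?thesis
          by (simp only: sum_distrib_left) (intro sum.cong refl,
            simp add: A_def h_def power_minus[of "of_real (x - of_int m)"] mult_ac del: of_real_diff)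
      qed
      have "(\<Sum>m\<in>Z. \<Sum>n\<in>Z. far_power l (m - n) * (h m n * of_real ((y - of_int n) - (x - of_int m)) ^ l)) =
        (\<Sum>m\<in>Z. \<Sum>n\<in>Z. \<Sum>k\<le>l. (of_nat (l choose k) * (- 1) ^ k) *
           (far_power l (m - n) * (A k m x * A (l - k) n y)))"
        unfolding bin sum_distrib_left by (intro sum.cong refl) (simp only: mult_ac)
      also have "\<dots> = (\<Sum>m\<in>Z. \<Sum>k\<le>l. \<Sum>n\<in>Z. (of_nat (l choose k) * (- 1) ^ k) *
           (far_power l (m - n) * (A k m x * A (l - k) n y)))"
        by (intro sum.cong refl sum.swap)
      also have "\<dots> = (\<Sum>k\<le>l. \<Sum>m\<in>Z. \<Sum>n\<in>Z. (of_nat (l choose k) * (- 1) ^ k) *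
           (far_power l (m - n) * (A k m x * A (l - k) n y)))"
        by (rule sum.swap)
      finally show ?thesis by (simp only: T_def sum_distrib_left x_def y_def)
    qed
    ultimately show "(\<lambda>l. \<Sum>k\<le>l. (of_nat (l choose k) * (- 1) ^ k) * T l k s) sums
        (far N (s p) (s q) / of_real (s p - s q))"
      by (simp only: x_def y_def)
  qed
  with S show ?thesis by simp
qed

text \<open>The hypothesis under which blocks of unit length work: Taylor expansions with uniform
  coefficient bounds at the integers.\<close>

definition unit_analytic :: "real \<Rightarrow> real \<Rightarrow> (real \<Rightarrow> complex) \<Rightarrow> bool" where
  "unit_analytic r A g \<longleftrightarrow> (\<forall>m::int. \<bar>of_int m\<bar> < r + 1 \<longrightarrow> (\<exists>c. (\<forall>l. norm (c l) \<le> A / 12 ^ l) \<and>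
     (\<forall>x\<in>{-r..r}. \<bar>x - of_int m\<bar> \<le> 6 \<longrightarrow> (\<lambda>l. c l * of_real (x - of_int m) ^ l) sums g x)))"

definition near_const :: "nat \<Rightarrow> real" where
  "near_const d = (\<Sum>l. real (l + 1) ^ d * 13 ^ d * (1 / 2) ^ l)"

lemma summable_near_const: "summable (\<lambda>l. real (l + 1) ^ d * 13 ^ d * (1 / 2) ^ l)"
proof -
  have "summable (\<lambda>l. real (l + 1) ^ d * (1 / 2) ^ l)"
  proof (rule summable_comparison_test_bigo)
    show "summable (\<lambda>l. norm ((3 / 4 :: real) ^ l))" by simp
    show "(\<lambda>l. real (l + 1) ^ d * (1 / 2) ^ l) \<in> O(\<lambda>l. (3 / 4) ^ l)" by real_asymp
  qed
  from summable_mult[OF this, of "13 ^ d"] show ?thesis by (simp add: mult_ac)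
qed

lemma sum_list_sum_swap:
  fixes f :: "'a \<Rightarrow> 'b \<Rightarrow> 'c::comm_monoid_add"
  shows "(\<Sum>x\<leftarrow>xs. \<Sum>m\<in>Z. f x m) = (\<Sum>m\<in>Z. \<Sum>x\<leftarrow>xs. f x m)"
  by (induction xs) (simp_all add: sum.distrib)

text \<open>The power series at the centre of the common block is differenced term by term. Its \<open>l\<close>-th term
  has at most \<open>(l + 1)\<^sup>d\<close> monomials (\<open>d\<close> the number of variables), each of size \<open>6\<^sup>l\<close> on the plateaus against
  coefficients of size \<open>12\<^sup>-\<^sup>l\<close>.\<close>

lemma tensor_bound_near_diagonal:
  assumes I: "finite I" "p \<in> I" and r: "r \<le> real N - 1" and A: "0 \<le> A" and g: "unit_analytic r A g"
  shows "tensor_bound r I (\<lambda>s. (\<Sum>m\<in>{-int N..int N}. of_real (hat m (s p)) *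
     (\<Prod>b\<in>I-{p}. of_real (plateau m (s b)))) * ddset g (s ` I)) (near_const (card I) * A)"
proof -
  define Z where "Z = {-int N..int N}"
  have "\<exists>c. (\<forall>l. norm (c l) \<le> A / 12 ^ l) \<and> (\<bar>real_of_int m\<bar> < r + 1 \<longrightarrow>
     (\<forall>x\<in>{-r..r}. \<bar>x - of_int m\<bar> \<le> 6 \<longrightarrow> (\<lambda>l. c l * of_real (x - of_int m) ^ l) sums g x))" for m :: int
  proof (cases "\<bar>real_of_int m\<bar> < r + 1")
    case False
    then show ?thesis using A by (intro exI[of _ "\<lambda>_. 0"]) simp
  qed (use g in \<open>auto simp: unit_analytic_def\<close>)
  then obtain c where c: "\<And>m l. norm (c m l) \<le> A / 12 ^ l"
    "\<And>m x. \<bar>real_of_int m\<bar> < r + 1 \<Longrightarrow> x \<in> {-r..r} \<Longrightarrow> \<bar>x - of_int m\<bar> \<le> 6 \<Longrightarrow>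
        (\<lambda>l. c m l * of_real (x - of_int m) ^ l) sums g x"
    by metis
  have "I \<noteq> {}" using I by auto
  define P where "P l as \<longleftrightarrow> length as \<le> (l + 1) ^ card I \<and> (\<forall>\<alpha>\<in>set as. (\<Sum>i\<in>I. \<alpha> i) \<le> l) \<and>
    (\<forall>s m. inj_on s I \<longrightarrow> ddset (\<lambda>y. of_real (y - m) ^ l) (s ` I) =
       (\<Sum>\<alpha>\<leftarrow>as. \<Prod>i\<in>I. of_real (s i - m) ^ \<alpha> i))" for l and as :: "(nat \<Rightarrow> nat) list"
  have "\<exists>as. P l as" for l using ddset_power[OF I(1) \<open>I \<noteq> {}\<close>] unfolding P_def by blast
  then obtain as where "\<And>l. P l (as l)" by metis
  then have as: "\<And>l. length (as l) \<le> (l + 1) ^ card I"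
    "\<And>l \<alpha>. \<alpha> \<in> set (as l) \<Longrightarrow> (\<Sum>i\<in>I. \<alpha> i) \<le> l"
    "\<And>l s m. inj_on s I \<Longrightarrow> ddset (\<lambda>y. of_real (y - m) ^ l) (s ` I) =
       (\<Sum>\<alpha>\<leftarrow>as l. \<Prod>i\<in>I. of_real (s i - m) ^ \<alpha> i)"
    unfolding P_def by blast+
  define h where "h i m x = (if i = p then hat m x else plateau m x)" for i m x
  define a where "a \<alpha> i m x = (of_real (h i m x) * of_real (x - of_int m) ^ \<alpha> i :: complex)"
    for \<alpha> :: "nat \<Rightarrow> nat" and i m x
  define F where "F l s = (\<Sum>\<alpha>\<leftarrow>as l. \<Sum>m\<in>Z. c m l * (\<Prod>i\<in>I. a \<alpha> i m (s i)))" for l s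
  define w where "w m s = (\<Prod>i\<in>I. of_real (h i m (s i)) :: complex)" for m s
  have monomial: "tensor_bound r I (\<lambda>s. \<Sum>m\<in>Z. c m l * (\<Prod>i\<in>I. a \<alpha> i m (s i))) (A / 12 ^ l * (13 ^ card I * 6 ^ l))"
    if "\<alpha> \<in> set (as l)" for l \<alpha>
  proof -
    have "tensor_bound r I (\<lambda>s. \<Sum>m\<in>Z. c m l * (\<Prod>i\<in>I. a \<alpha> i m (s i)))
       (A / 12 ^ l * (\<Prod>i\<in>I. 13 * 6 ^ \<alpha> i))"
    proof (rule tensor_bound_diagonal)
      show "continuous_on {-r..r} (a \<alpha> i m)" for i m
        unfolding a_def h_def by (cases "i = p") (auto intro!: continuous_intros)
      fix i x assume x: "x \<in> {-r..r}"
      then have "\<bar>x\<bar> \<le> real N - 1" using r by auto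
      from sum_hat_power_le[OF this, of "\<alpha> i"]
      have "(\<Sum>m\<in>Z. norm (of_real (hat m x) * of_real (x - of_int m) ^ \<alpha> i :: complex)) \<le> 13 * 6 ^ \<alpha> i"
        unfolding Z_def by (rule order_trans) (use one_le_power[of "6::real" "\<alpha> i"] in linarith)
      then show "(\<Sum>m\<in>Z. norm (a \<alpha> i m x)) \<le> 13 * 6 ^ \<alpha> i"
        using sum_plateau_power_le[of Z x "\<alpha> i"] by (cases "i = p") (simp_all add: a_def h_def Z_def)
    qed (use I c A \<open>I \<noteq> {}\<close> in \<open>auto simp: Z_def\<close>)
    moreover have "(\<Prod>i\<in>I. 13 * 6 ^ \<alpha> i) \<le> (13 ^ card I * 6 ^ l :: real)"
      using as(2)[OF that] by (simp add: prod.distrib power_sum[symmetric] power_increasing)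
    ultimately show ?thesis
      using A by (elim tensor_bound_mono) (intro mult_left_mono, simp_all)
  qed
  have F: "tensor_bound r I (F l) (real (l + 1) ^ card I * 13 ^ card I * (1 / 2) ^ l * A)" for l
  proof -
    have t: "tensor_bound r I (F l) (of_nat (length (as l)) * (A / 12 ^ l * (13 ^ card I * 6 ^ l)))"
      unfolding F_def by (rule tensor_bound_sum_list[OF monomial]) (use A in auto)
    have "of_nat (length (as l)) * (A / 12 ^ l * (13 ^ card I * 6 ^ l)) \<le>
        real (l + 1) ^ card I * (A / 12 ^ l * (13 ^ card I * 6 ^ l))"
      using A as(1)[of l] by (intro mult_right_mono) (auto simp del: of_nat_Suc simp flip: of_nat_power)
    moreover have "real (l + 1) ^ card I * (A / 12 ^ l * (13 ^ card I * 6 ^ l)) =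
        real (l + 1) ^ card I * 13 ^ card I * (6 / 12) ^ l * A"
      by (simp only: power_divide) simp
    ultimately show ?thesis by (intro tensor_bound_mono[OF t]) simp
  qed
  have S: "summable (\<lambda>l. real (l + 1) ^ card I * 13 ^ card I * (1 / 2) ^ l * A)"
    by (rule summable_mult2[OF summable_near_const])
  have "tensor_bound r I (\<lambda>s. (\<Sum>m\<in>Z. w m s) * ddset g (s ` I))
     (\<Sum>l. real (l + 1) ^ card I * 13 ^ card I * (1 / 2) ^ l * A)"
  proof (rule tensor_bound_sums[OF F S])
    fix s :: "nat \<Rightarrow> real"
    assume s: "\<And>i. i \<in> I \<Longrightarrow> s i \<in> {-r..r}" "inj_on s I"
    have "F l s = (\<Sum>m\<in>Z. w m s * ddset (\<lambda>y. c m l * of_real (y - of_int m) ^ l) (s ` I))" for l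
      unfolding F_def sum_list_sum_swap ddset_cmult as(3)[OF s(2)] w_def a_def prod.distrib
      by (simp add: sum_list_const_mult mult_ac)
    moreover have "(\<lambda>l. w m s * ddset (\<lambda>y. c m l * of_real (y - of_int m) ^ l) (s ` I)) sums
        (w m s * ddset g (s ` I))" for m
    proof (cases "w m s = 0")
      case False
      then have nz: "h i m (s i) \<noteq> 0" if "i \<in> I" for i
        using that I by (auto simp: w_def)
      then have near: "\<bar>s i - of_int m\<bar> \<le> 6" if "i \<in> I" for i
        using nz[OF that] hat_nonzero[of m "s i"] plateau_nonzero[of m "s i"]
        by (cases "i = p") (simp_all add: h_def)
      have "\<bar>s p - of_int m\<bar> < 1"
        using nz[OF I(2)] hat_nonzero[of m "s p"] by (simp add: h_def)
      then have "\<bar>real_of_int m\<bar> < r + 1" using s(1)[OF I(2)] by auto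
      then have "(\<lambda>l. c m l * of_real (y - of_int m) ^ l) sums g y" if "y \<in> s ` I" for y
        using that s(1) near by (intro c) auto
      then show ?thesis by (intro sums_mult ddset_sums)
    qed simp
    ultimately show "(\<lambda>l. F l s) sums ((\<Sum>m\<in>Z. w m s) * ddset g (s ` I))"
      by (simp only: sum_distrib_right) (intro sums_sum)
  qed
  moreover have "(\<Sum>l. real (l + 1) ^ card I * 13 ^ card I * (1 / 2) ^ l * A) = near_const (card I) * A"
    unfolding near_const_def by (rule suminf_mult2[OF summable_near_const, symmetric])
  moreover have "w m s = of_real (hat m (s p)) * (\<Prod>b\<in>I-{p}. of_real (plateau m (s b)))" for m s
    unfolding w_def using I by (subst prod.remove[of I p]) (auto simp: h_def intro!: prod.cong)
  ultimately show ?thesis by (simp only: Z_def)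
qed

text \<open>Splitting off pairs of variables that are far apart leaves the part where all variables
  lie in a common block. On far pairs the recursion trades one variable for the bounded far
  kernel, so the bound for one variable less applies; on the common block the power series
  applies.\<close>

lemma unit_criterion_step:
  assumes IH: "\<And>J. finite J \<Longrightarrow> card J = d \<Longrightarrow> d > 0 \<Longrightarrow> tensor_bound r J (\<lambda>s. ddset g (s ` J)) (C * A)"
    and A: "0 \<le> A" and C: "0 \<le> C" and g: "unit_analytic r A g" and I: "finite I" "card I = Suc d"
  shows "tensor_bound r I (\<lambda>s. ddset g (s ` I))
    ((5 ^ d * near_const (Suc d) + d * (5 ^ d * (21 * pi) * (2 * C))) * A)"
proof -
  obtain p where p: "p \<in> I" using I by fastforce
  define Q where "Q = I - {p}"
  have Q: "finite Q" "card Q = d" "Q \<subseteq> I" "p \<notin> Q" using I p by (auto simp: Q_def)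
  define N where "N = nat \<lceil>r\<rceil> + 1"
  have N: "r \<le> real N - 1" unfolding N_def by linarith
  have bd: "\<bar>x\<bar> \<le> real N - 1" if "x \<in> {-r..r}" for x using that N by auto
  \<comment> \<open>the factors saying that the variables in \<open>Q - B\<close> are near the variable \<open>p\<close>; the induction removes them one by one\<close>
  define n where "n B s = (\<Prod>b\<in>Q-B. near N (s p) (s b))" for B and s :: "nat \<Rightarrow> real"
  have nb: "tensor_bound r I (n B) (5 ^ d)" for B
  proof -
    have "tensor_bound r I (n B) (\<Prod>b\<in>Q-B. 5)"
      unfolding n_def
      by (intro tensor_bound_prod tensor_bound_lift[OF tensor_bound_near[OF _ N]]) (use I Q p in auto)
    moreover have "card (Q - B) \<le> d" using Q by (metis Diff_subset card_mono)
    then have "(\<Prod>b\<in>Q-B. 5) \<le> (5::real) ^ d" by (simp add: power_increasing)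
    ultimately show ?thesis by (rule tensor_bound_mono)
  qed
  have claim: "tensor_bound r I (\<lambda>s. n B s * ddset g (s ` I))
     ((5 ^ d * near_const (Suc d) + card B * (5 ^ d * (21 * pi) * (2 * C))) * A)"
    if "finite B" "B \<subseteq> Q" for B
    using that
  proof (induction B rule: finite_induct)
    case empty
    define w where "w m s = of_real (hat m (s p)) * (\<Prod>b\<in>I-{p}. of_real (plateau m (s b)) :: complex)"
      for m s
    have "tensor_bound r I (\<lambda>s. n {} s * ((\<Sum>m\<in>{-int N..int N}. w m s) * ddset g (s ` I)))
       (5 ^ d * (near_const (card I) * A))"
      unfolding w_def by (intro tensor_bound_mult nb tensor_bound_near_diagonal) (use I p N A g in auto)
    moreover have "n {} s * ((\<Sum>m\<in>{-int N..int N}. w m s) * ddset g (s ` I)) = n {} s * ddset g (s ` I)"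
      if s: "\<And>i. i \<in> I \<Longrightarrow> s i \<in> {-r..r}" for s
    proof -
      have "n {} s * w m s = n {} s * of_real (hat m (s p))" for m
      proof (cases "n {} s * of_real (hat m (s p)) = 0")
        case False
        then have "\<bar>s p - of_int m\<bar> < 1" by (auto simp: hat_def max_def split: if_splits)
        moreover have "near N (s p) (s b) \<noteq> 0" if "b \<in> Q" for b
          using False that Q by (auto simp: n_def)
        ultimately have "\<bar>s b - of_int m\<bar> < 5" if "b \<in> Q" for b
          using near_eq_0[of "s p" m "s b" N] that by force
        then have "plateau m (s b) = 1" if "b \<in> Q" for b
          using that by (fastforce simp: plateau_def)
        then show ?thesis by (simp add: w_def Q_def)
      qed (auto simp: w_def)
      then have "n {} s * (\<Sum>m\<in>{-int N..int N}. w m s) = n {} s * of_real (\<Sum>m\<in>{-int N..int N}. hat m (s p))"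
        unfolding sum_distrib_left of_real_sum by (intro sum.cong refl)
      also have "(\<Sum>m\<in>{-int N..int N}. hat m (s p)) = 1"
        by (rule sum_hat) (use bd s p in auto)
      finally show ?thesis by (simp add: mult.assoc[symmetric])
    qed
    ultimately have "tensor_bound r I (\<lambda>s. n {} s * ddset g (s ` I)) (5 ^ d * (near_const (card I) * A))"
      by (rule tensor_bound_cong)
    then show ?case using I by (simp add: mult.assoc)
  next
    case (insert b B)
    have b: "b \<in> Q" "b \<in> I" "b \<noteq> p" "d > 0" using insert Q by (auto simp: card_gt_0_iff)
    have sub: "tensor_bound r I (\<lambda>s. ddset g (s ` (I - {i}))) (C * A)" if "i \<in> I" for i
      by (rule tensor_bound_lift[OF IH]) (use I b that in auto)
    \<comment> \<open>dropping one near factor \<open>1 - far\<close> adds a term with a far factor, to which the recursion applies\<close>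
    have "tensor_bound r I (\<lambda>s. n B s * ddset g (s ` I) + n (insert b B) s *
        (far N (s p) (s b) / of_real (s p - s b)) * (ddset g (s ` (I - {b})) - ddset g (s ` (I - {p}))))
      ((5 ^ d * near_const (Suc d) + card B * (5 ^ d * (21 * pi) * (2 * C))) * A +
       5 ^ d * (21 * pi) * (C * A + C * A))"
      by (intro tensor_bound_add tensor_bound_mult tensor_bound_diff nb sub
          tensor_bound_lift[OF tensor_bound_far_kernel[OF _ N]] insert.IH) (use b p I insert.prems in auto)
    moreover have "n B s * ddset g (s ` I) + n (insert b B) s *
        (far N (s p) (s b) / of_real (s p - s b)) * (ddset g (s ` (I - {b})) - ddset g (s ` (I - {p}))) =
        n (insert b B) s * ddset g (s ` I)"
      if s: "\<And>i. i \<in> I \<Longrightarrow> s i \<in> {-r..r}" "inj_on s I" for s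
    proof -
      have ne: "s p \<noteq> s b" using s(2) p b by (auto dest: inj_onD)
      have im: "s ` (I - {i}) = s ` I - {s i}" if "i \<in> I" for i
        using inj_on_image_set_diff[OF s(2), of I "{i}"] that by auto
      have eq: "of_real (s p - s b) * ddset g (s ` I) = ddset g (s ` (I - {b})) - ddset g (s ` (I - {p}))"
        using ddset_rec[of "s ` I" "s p" "s b" g] p b I by (simp add: im)
      have "far N (s p) (s b) / of_real (s p - s b) * (ddset g (s ` (I - {b})) - ddset g (s ` (I - {p}))) =
          far N (s p) (s b) * ddset g (s ` I)"
        unfolding eq[symmetric] using ne by (simp del: of_real_diff)
      moreover have "n B s = near N (s p) (s b) * n (insert b B) s"
      proof -
        have "Q - insert b B = (Q - B) - {b}" by blast
        moreover have "b \<in> Q - B" using b(1) insert.hyps(2) by blast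
        ultimately show ?thesis unfolding n_def using Q(1) by (simp only: prod.remove[of "Q - B" b] finite_Diff)
      qed
      moreover have "near N (s p) (s b) = 1 - far N (s p) (s b)"
        using near_plus_far[OF bd[OF s(1)[OF p]] bd[OF s(1)[OF b(2)]]] by (simp add: eq_diff_eq)
      ultimately show ?thesis by (simp only: mult.assoc) (simp add: left_diff_distrib right_diff_distrib mult_ac)
    qed
    ultimately have "tensor_bound r I (\<lambda>s. n (insert b B) s * ddset g (s ` I))
      ((5 ^ d * near_const (Suc d) + card B * (5 ^ d * (21 * pi) * (2 * C))) * A +
       5 ^ d * (21 * pi) * (C * A + C * A))"
      by (rule tensor_bound_cong)
    then show ?case using insert.hyps by (simp add: algebra_simps)
  qed
  from claim[of Q] show ?thesis using Q by (simp add: n_def)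
qed

lemma near_const_nonneg: "0 \<le> near_const d"
  unfolding near_const_def by (intro suminf_nonneg summable_near_const) simp

lemma unit_criterion:
  "\<exists>C\<ge>0. \<forall>r g A I. finite I \<and> card I = Suc d \<and> 0 \<le> A \<and> unit_analytic r A g \<longrightarrow>
     tensor_bound r I (\<lambda>s. ddset g (s ` I)) (C * A)"
proof (induction d)
  case 0
  have "tensor_bound r I (\<lambda>s. ddset g (s ` I)) (near_const 1 * A)"
    if "finite I" "card I = Suc 0" "0 \<le> A" "unit_analytic r A g" for r g A I
    using unit_criterion_step[of 0 r g 0 A I] that by simp
  then show ?case using near_const_nonneg by (intro exI[of _ "near_const 1"]) simp
next
  case (Suc d)
  then obtain C where C: "0 \<le> C" "\<And>r g A I. finite I \<Longrightarrow> card I = Suc d \<Longrightarrow> 0 \<le> A \<Longrightarrow> unit_analytic r A g \<Longrightarrow>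
     tensor_bound r I (\<lambda>s. ddset g (s ` I)) (C * A)" by blast
  define K where "K = 5 ^ Suc d * near_const (Suc (Suc d)) + Suc d * (5 ^ Suc d * (21 * pi) * (2 * C))"
  have "tensor_bound r I (\<lambda>s. ddset g (s ` I)) (K * A)"
    if "finite I" "card I = Suc (Suc d)" "0 \<le> A" "unit_analytic r A g" for r g A I
    unfolding K_def by (rule unit_criterion_step) (use that C in auto)
  moreover have "0 \<le> K"
    unfolding K_def using near_const_nonneg C by (intro add_nonneg_nonneg mult_nonneg_nonneg) auto
  ultimately show ?case by (intro exI[of _ K]) simp
qed

text \<open>The criterion at scale \<open>h\<close>: the order \<open>d\<close> of the divided difference costs \<open>h\<^sup>-\<^sup>d\<close>.\<close>

theorem analytic_criterion:
  "\<exists>C\<ge>0. \<forall>r g A h I. finite I \<and> card I = Suc d \<and> 0 \<le> A \<and> 0 < h \<and>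
     (\<forall>a. \<bar>a\<bar> < r + h \<longrightarrow> (\<exists>c. (\<forall>l. norm (c l) \<le> A / (12 * h) ^ l) \<and>
       (\<forall>x\<in>{-r..r}. \<bar>x - a\<bar> \<le> 6 * h \<longrightarrow> (\<lambda>l. c l * of_real (x - a) ^ l) sums g x))) \<longrightarrow>
     tensor_bound r I (\<lambda>s. ddset g (s ` I)) (C * (A / h ^ d))"
proof -
  obtain C where C: "0 \<le> C" "\<And>r g A I. finite I \<Longrightarrow> card I = Suc d \<Longrightarrow> 0 \<le> A \<Longrightarrow> unit_analytic r A g \<Longrightarrow>
     tensor_bound r I (\<lambda>s. ddset g (s ` I)) (C * A)"
    using unit_criterion[of d] by blast
  have "tensor_bound r I (\<lambda>s. ddset g (s ` I)) (C * (A / h ^ d))"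
    if I: "finite I" "card I = Suc d" and A: "0 \<le> A" and h: "0 < h"
      and g: "\<And>a. \<bar>a\<bar> < r + h \<Longrightarrow> \<exists>c. (\<forall>l. norm (c l) \<le> A / (12 * h) ^ l) \<and>
       (\<forall>x\<in>{-r..r}. \<bar>x - a\<bar> \<le> 6 * h \<longrightarrow> (\<lambda>l. c l * of_real (x - a) ^ l) sums g x)" for r g A h I
  proof -
    define G where "G y = g (y * h)" for y
    have "unit_analytic (r * (1 / h)) A G"
      unfolding unit_analytic_def
    proof (intro allI impI)
      fix m :: int assume m: "\<bar>real_of_int m\<bar> < r * (1 / h) + 1"
      then have "\<bar>of_int m * h\<bar> < r + h" using h by (simp add: abs_mult field_simps)
      from g[OF this] obtain c where c: "\<And>l. norm (c l) \<le> A / (12 * h) ^ l"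
        "\<And>x. x \<in> {-r..r} \<Longrightarrow> \<bar>x - of_int m * h\<bar> \<le> 6 * h \<Longrightarrow> (\<lambda>l. c l * of_real (x - of_int m * h) ^ l) sums g x"
        by blast
      show "\<exists>c. (\<forall>l. norm (c l) \<le> A / 12 ^ l) \<and> (\<forall>x\<in>{-(r * (1 / h))..r * (1 / h)}. \<bar>x - of_int m\<bar> \<le> 6 \<longrightarrow>
          (\<lambda>l. c l * of_real (x - of_int m) ^ l) sums G x)"
      proof (intro exI[of _ "\<lambda>l. c l * of_real h ^ l"] conjI allI ballI impI)
        show "norm (c l * of_real h ^ l) \<le> A / 12 ^ l" for l
          using mult_right_mono[OF c(1)[of l], of "h ^ l"] h
          by (simp add: norm_mult norm_power power_mult_distrib)
        fix x assume x: "x \<in> {-(r * (1 / h))..r * (1 / h)}" "\<bar>x - of_int m\<bar> \<le> 6"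
        have "x * h - of_int m * h = (x - of_int m) * h" by (simp add: algebra_simps)
        moreover from this have "\<bar>x * h - of_int m * h\<bar> \<le> 6 * h"
          using x h by (simp add: abs_mult)
        moreover have "x * h \<in> {-r..r}" using x h by (simp add: field_simps)
        ultimately show "(\<lambda>l. c l * of_real h ^ l * of_real (x - of_int m) ^ l) sums G x"
          using c(2)[of "x * h"] by (simp add: G_def power_mult_distrib mult_ac)
      qed
    qed
    then have "tensor_bound (r * (1 / h)) I (\<lambda>s. ddset G (s ` I)) (C * A)"
      by (intro C I A)
    from tensor_bound_cmult[OF tensor_bound_scale[OF this], of "of_real (1 / h) ^ d"]
    have "tensor_bound r I (\<lambda>s. of_real (1 / h) ^ d * ddset G ((\<lambda>i. s i * (1 / h)) ` I))
       (norm (of_real (1 / h) ^ d :: complex) * (C * A))" using h by simp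
    then have "tensor_bound r I (\<lambda>s. ddset g (s ` I)) (norm (of_real (1 / h) ^ d :: complex) * (C * A))"
    proof (rule tensor_bound_cong)
      fix s :: "nat \<Rightarrow> real" assume "inj_on s I"
      then have "card (s ` I) - 1 = d" using I by (simp add: card_image)
      moreover have "(\<lambda>i. s i * (1 / h)) ` I = (\<lambda>x. x * (1 / h)) ` (s ` I)" by (simp add: image_image)
      moreover have "(\<lambda>x. G (x * (1 / h))) = g" using h by (simp add: G_def fun_eq_iff)
      ultimately show "of_real (1 / h) ^ d * ddset G ((\<lambda>i. s i * (1 / h)) ` I) = ddset g (s ` I)"
        using ddset_scale[of "1 / h" "s ` I" G] h I by simp
    qed
    moreover have "norm (of_real (1 / h) ^ d :: complex) * (C * A) = C * (A / h ^ d)"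
      using h by (simp add: norm_power norm_divide power_divide)
    ultimately show ?thesis by simp
  qed
  with C(1) show ?thesis by (intro exI[of _ C]) simp
qed

section \<open>Entire functions\<close>

text \<open>Cauchy's estimates supply the Taylor coefficients for the criterion.\<close>

lemma entire_criterion:
  "\<exists>C\<ge>0. \<forall>r g A h I. finite I \<and> card I = Suc d \<and> 0 \<le> A \<and> 0 < h \<and> g holomorphic_on UNIV \<and>
     (\<forall>a z. \<bar>a\<bar> < r + h \<longrightarrow> norm (z - of_real a) \<le> 12 * h \<longrightarrow> norm (g z) \<le> A) \<longrightarrow>
     tensor_bound r I (\<lambda>s. ddset (\<lambda>x. g (of_real x)) (s ` I)) (C * (A / h ^ d))"
proof -
  obtain C where C: "0 \<le> C" "\<forall>r g A h I. finite I \<and> card I = Suc d \<and> 0 \<le> A \<and> 0 < h \<and>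
     (\<forall>a. \<bar>a\<bar> < r + h \<longrightarrow> (\<exists>c. (\<forall>l. norm (c l) \<le> A / (12 * h) ^ l) \<and>
       (\<forall>x\<in>{-r..r}. \<bar>x - a\<bar> \<le> 6 * h \<longrightarrow> (\<lambda>l. c l * of_real (x - a) ^ l) sums g x))) \<longrightarrow>
     tensor_bound r I (\<lambda>s. ddset g (s ` I)) (C * (A / h ^ d))"
    using analytic_criterion[of d] by blast
  have "tensor_bound r I (\<lambda>s. ddset (\<lambda>x. g (of_real x)) (s ` I)) (C * (A / h ^ d))"
    if I: "finite I" "card I = Suc d" "0 \<le> A" and h: "0 < h" and g: "g holomorphic_on UNIV"
      and b: "\<And>a z. \<bar>a\<bar> < r + h \<Longrightarrow> norm (z - of_real a) \<le> 12 * h \<Longrightarrow> norm (g z) \<le> A"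
    for r g A h I
  proof (rule C(2)[rule_format], intro conjI allI impI)
    fix a :: real assume a: "\<bar>a\<bar> < r + h"
    define c where "c l = (deriv ^^ l) g (of_real a) / fact l" for l
    show "\<exists>c. (\<forall>l. norm (c l) \<le> A / (12 * h) ^ l) \<and>
       (\<forall>x\<in>{-r..r}. \<bar>x - a\<bar> \<le> 6 * h \<longrightarrow> (\<lambda>l. c l * of_real (x - a) ^ l) sums g (of_real x))"
    proof (intro exI[of _ c] conjI allI ballI impI)
      fix l
      have "norm ((deriv ^^ l) g (of_real a)) \<le> fact l * A / (12 * h) ^ l"
        by (rule Cauchy_inequality) (use h b[OF a] g in
          \<open>auto intro: holomorphic_on_subset holomorphic_on_imp_continuous_on simp: norm_minus_commute\<close>)
      from divide_right_mono[OF this, of "fact l"] show "norm (c l) \<le> A / (12 * h) ^ l"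
        by (simp add: c_def norm_divide)
    next
      fix x assume "\<bar>x - a\<bar> \<le> 6 * h"
      then have "of_real x \<in> ball (of_real a :: complex) (12 * h)"
        using h by (simp add: dist_norm norm_minus_commute flip: of_real_diff)
      from holomorphic_power_series[OF holomorphic_on_subset[OF g] this]
      show "(\<lambda>l. c l * of_real (x - a) ^ l) sums g (of_real x)"
        by (simp add: c_def)
    qed
  qed (use I h in auto)
  with C(1) show ?thesis by (intro exI[of _ C]) simp
qed

text \<open>Membership in the closure of the polynomials, expressed through expansions at distinct nodes.\<close>

definition poly_approximable :: "nat \<Rightarrow> (real \<Rightarrow> complex) \<Rightarrow> bool" where
  "poly_approximable k f \<longleftrightarrow> (\<forall>r>0. \<forall>e>0. \<exists>p. \<forall>i\<le>k.
     tensor_bound r {..i} (\<lambda>s. ddset (\<lambda>x. f x - poly p (of_real x)) (s ` {..i})) e)"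

lemma poly_of_coeffs:
  fixes c :: "nat \<Rightarrow> complex"
  shows "\<exists>p. \<forall>z. poly p z = (\<Sum>l<n. c l * z ^ l)"
proof (induction n)
  case (Suc n)
  then obtain p where "\<forall>z. poly p z = (\<Sum>l<n. c l * z ^ l)" by blast
  then show ?case by (intro exI[of _ "p + monom (c n) n"]) (simp add: poly_monom)
qed (auto intro: exI[of _ 0])

lemma entire_uniform_poly:
  assumes g: "g holomorphic_on UNIV" and R: "0 < R" and e: "0 < e"
  shows "\<exists>p. \<forall>z. norm z \<le> R \<longrightarrow> norm (g z - poly p z) \<le> e"
proof -
  have "continuous_on (cball 0 (2 * R)) g"
    using g holomorphic_on_imp_continuous_on holomorphic_on_subset by blast
  then have "bounded (g ` cball 0 (2 * R))"
    by (intro compact_imp_bounded compact_continuous_image) auto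
  then obtain B where B: "0 < B" "\<And>z. norm z \<le> 2 * R \<Longrightarrow> norm (g z) \<le> B"
    by (auto simp: bounded_pos)
  define c where "c l = (deriv ^^ l) g 0 / fact l" for l
  have c: "norm (c l) \<le> B / (2 * R) ^ l" for l
  proof -
    have "norm ((deriv ^^ l) g 0) \<le> fact l * B / (2 * R) ^ l"
      by (rule Cauchy_inequality)
        (use R B g in \<open>auto intro: holomorphic_on_subset holomorphic_on_imp_continuous_on\<close>)
    from divide_right_mono[OF this, of "fact l"] show ?thesis by (simp add: c_def norm_divide)
  qed
  obtain n where n: "(1 / 2) ^ n < e / (2 * B)"
    using real_arch_pow_inv[of "e / (2 * B)" "1 / 2"] e B by auto
  obtain p where p: "\<And>z. poly p z = (\<Sum>l<n. c l * z ^ l)" using poly_of_coeffs[of c n] by blast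
  show ?thesis
  proof (intro exI[of _ p] allI impI)
    fix z :: complex assume z: "norm z \<le> R"
    have "z \<in> ball 0 (2 * R)" using z R by simp
    from holomorphic_power_series[OF holomorphic_on_subset[OF g] this]
    have "(\<lambda>l. c l * z ^ l) sums g z" by (simp add: c_def)
    from sums_split_initial_segment[OF this, of n]
    have s: "(\<lambda>l. c (l + n) * z ^ (l + n)) sums (g z - poly p z)" by (simp add: p)
    have le: "norm (c (l + n) * z ^ (l + n)) \<le> B * (1 / 2) ^ n * (1 / 2) ^ l" for l
    proof -
      have "norm (c (l + n) * z ^ (l + n)) \<le> B / (2 * R) ^ (l + n) * R ^ (l + n)"
        unfolding norm_mult norm_power using z R B by (intro mult_mono c power_mono) auto
      also have "\<dots> = B * (1 / 2) ^ n * (1 / 2) ^ l"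
        using R by (simp add: power_mult_distrib power_add power_divide)
      finally show ?thesis .
    qed
    have g2: "(\<lambda>l. B * (1 / 2) ^ n * (1 / 2) ^ l) sums (B * (1 / 2) ^ n * 2)"
      using sums_mult[OF geometric_sums[of "1 / 2 :: real"], of "B * (1 / 2) ^ n"] by simp
    have "norm (g z - poly p z) \<le> B * (1 / 2) ^ n * 2"
      using norm_suminf_le[OF le sums_summable[OF g2]] s g2 by (simp add: sums_iff)
    also have "\<dots> \<le> e" using n B by (simp add: field_simps)
    finally show "norm (g z - poly p z) \<le> e" .
  qed
qed

text \<open>Taylor polynomials converge uniformly on complex discs, and at the scale \<open>h = r\<close> the criterion turns
  uniform smallness on a disc into smallness of all divided differences.\<close>

lemma entire_poly_approximable:
  assumes g: "g holomorphic_on UNIV"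
  shows "poly_approximable k (\<lambda>x. g (of_real x))"
  unfolding poly_approximable_def
proof (intro allI impI)
  fix r e :: real assume r: "0 < r" and e: "0 < e"
  have "\<forall>d. \<exists>C\<ge>0. \<forall>r g A h I. finite I \<and> card I = Suc d \<and> 0 \<le> A \<and> 0 < h \<and> g holomorphic_on UNIV \<and>
     (\<forall>a z. \<bar>a\<bar> < r + h \<longrightarrow> norm (z - of_real a) \<le> 12 * h \<longrightarrow> norm (g z) \<le> A) \<longrightarrow>
     tensor_bound r I (\<lambda>s. ddset (\<lambda>x. g (of_real x)) (s ` I)) (C * (A / h ^ d))"
    using entire_criterion by blast
  then obtain C where C: "\<And>d. 0 \<le> C d" "\<And>d r g A h I. finite I \<and> card I = Suc d \<and> 0 \<le> A \<and> 0 < h \<and> g holomorphic_on UNIV \<and>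
     (\<forall>a z. \<bar>a\<bar> < r + h \<longrightarrow> norm (z - of_real a) \<le> 12 * h \<longrightarrow> norm (g z) \<le> A) \<Longrightarrow>
     tensor_bound r I (\<lambda>s. ddset (\<lambda>x. g (of_real x)) (s ` I)) (C d * (A / h ^ d))"
    by metis
  define K where "K = (\<Sum>d\<le>k. C d / r ^ d) + 1"
  have K: "K > 0" unfolding K_def using C r by (intro add_nonneg_pos sum_nonneg) auto
  obtain p where p: "\<And>z. norm z \<le> 14 * r \<Longrightarrow> norm (g z - poly p z) \<le> e / K"
    using entire_uniform_poly[OF g, of "14 * r" "e / K"] r e K by auto
  show "\<exists>p. \<forall>i\<le>k. tensor_bound r {..i} (\<lambda>s. ddset (\<lambda>x. g (of_real x) - poly p (of_real x)) (s ` {..i})) e"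
  proof (intro exI[of _ p] allI impI)
    fix i assume i: "i \<le> k"
    have "tensor_bound r {..i} (\<lambda>s. ddset (\<lambda>x. (\<lambda>z. g z - poly p z) (of_real x)) (s ` {..i})) (C i * (e / K / r ^ i))"
    proof (rule C(2), intro conjI allI impI)
      show "(\<lambda>z. g z - poly p z) holomorphic_on UNIV" by (intro holomorphic_intros g)
      fix a and z :: complex assume "\<bar>a\<bar> < r + r" "norm (z - of_real a) \<le> 12 * r"
      then have "norm z \<le> 14 * r" using norm_triangle_ineq[of "z - of_real a" "of_real a"] by simp
      then show "norm (g z - poly p z) \<le> e / K" by (rule p)
    qed (use e K r in auto)
    moreover have "C i / r ^ i \<le> K"
      unfolding K_def using member_le_sum[of i "{..k}" "\<lambda>d. C d / r ^ d"] i C r by force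
    from mult_right_mono[OF this, of "e / K"] have "C i * (e / K / r ^ i) \<le> e" using K e
      by (simp add: mult_ac)
    ultimately show "tensor_bound r {..i} (\<lambda>s. ddset (\<lambda>x. g (of_real x) - poly p (of_real x)) (s ` {..i})) e"
      by (auto intro: tensor_bound_mono)
  qed
qed

lemma poly_approximable_close:
  assumes "\<And>r e. 0 < r \<Longrightarrow> 0 < e \<Longrightarrow> \<exists>g. poly_approximable k g \<and>
     (\<forall>i\<le>k. tensor_bound r {..i} (\<lambda>s. ddset (\<lambda>x. f x - g x) (s ` {..i})) e)"
  shows "poly_approximable k f"
  unfolding poly_approximable_def
proof (intro allI impI)
  fix r e :: real assume "0 < r" "0 < e"
  then obtain g where g: "poly_approximable k g"
    "\<And>i. i \<le> k \<Longrightarrow> tensor_bound r {..i} (\<lambda>s. ddset (\<lambda>x. f x - g x) (s ` {..i})) (e / 2)"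
    using assms[of r "e / 2"] by auto
  then obtain p where p: "\<And>i. i \<le> k \<Longrightarrow>
      tensor_bound r {..i} (\<lambda>s. ddset (\<lambda>x. g x - poly p (of_real x)) (s ` {..i})) (e / 2)"
    using \<open>0 < r\<close> \<open>0 < e\<close> unfolding poly_approximable_def by (meson half_gt_zero)
  show "\<exists>p. \<forall>i\<le>k. tensor_bound r {..i} (\<lambda>s. ddset (\<lambda>x. f x - poly p (of_real x)) (s ` {..i})) e"
  proof (intro exI[of _ p] allI impI)
    fix i assume "i \<le> k"
    from tensor_bound_add[OF g(2)[OF this] p[OF this]]
    show "tensor_bound r {..i} (\<lambda>s. ddset (\<lambda>x. f x - poly p (of_real x)) (s ` {..i})) e"
      by (simp add: ddset_add[symmetric])
  qed
qed

section \<open>Iterated derivatives\<close>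

lemma nderiv_0 [simp]: "nderiv 0 f = f"
  by (simp add: nderiv_def)

lemma nderiv_Suc: "nderiv (Suc n) f x = vector_derivative (nderiv n f) (at x)"
  by (simp add: nderiv_def)

lemma nderiv_eqI:
  assumes "F 0 = f" "\<And>i x. i < k \<Longrightarrow> (F i has_vector_derivative F (Suc i) x) (at x)" "n \<le> k"
  shows "nderiv n f = F n"
  using assms(3)
proof (induction n)
  case (Suc n)
  then have "nderiv n f = F n" by simp
  then show ?case
    using assms(2)[of n] Suc.prems by (intro ext) (simp add: nderiv_Suc vector_derivative_at)
qed (use assms(1) in simp)

lemma CkI:
  assumes "F 0 = f" "\<And>i x. i < k \<Longrightarrow> (F i has_vector_derivative F (Suc i) x) (at x)"
    and "continuous_on UNIV (F k)"
  shows "f \<in> Ck k"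
proof -
  have eq: "nderiv n f = F n" if "n \<le> k" for n using nderiv_eqI[of F f k n] assms that by simp
  show ?thesis unfolding Ck_def using assms(2,3)
    by (auto simp: eq has_vector_derivative_def differentiable_def intro!: exI)
qed

lemma Ck_continuous_nderiv: "f \<in> Ck k \<Longrightarrow> i \<le> k \<Longrightarrow> continuous_on UNIV (nderiv i f)"
  by (cases "i = k") (auto simp: Ck_def intro!: continuous_at_imp_continuous_on differentiable_imp_continuous_within)

lemma Ck_has_derivative:
  fixes f :: "real \<Rightarrow> 'a::real_normed_vector"
  assumes "f \<in> Ck k" "i < k"
  shows "(nderiv i f has_vector_derivative nderiv (Suc i) f x) (at x)"
  using assms unfolding Ck_def by (auto simp: nderiv_Suc vector_derivative_works)

lemma Ck_mono: "f \<in> Ck k \<Longrightarrow> i \<le> k \<Longrightarrow> f \<in> Ck i"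
  by (rule CkI[of "\<lambda>n. nderiv n f"]) (auto intro: Ck_has_derivative Ck_continuous_nderiv)

lemma Ck_nderiv_1: "f \<in> Ck (Suc k) \<Longrightarrow> nderiv 1 f \<in> Ck k"
  by (rule CkI[of "\<lambda>n. nderiv (Suc n) f"])
    (auto intro!: Ck_has_derivative[of f "Suc k"] Ck_continuous_nderiv[of f "Suc k"])

lemma Ck_add:
  assumes "f \<in> Ck k" "g \<in> Ck k"
  shows "(\<lambda>x. f x + g x) \<in> Ck k" "n \<le> k \<Longrightarrow> nderiv n (\<lambda>x. f x + g x) = (\<lambda>x. nderiv n f x + nderiv n g x)"
proof -
  let ?F = "\<lambda>n x. nderiv n f x + nderiv n g x"
  have d: "(?F i has_vector_derivative ?F (Suc i) x) (at x)" if "i < k" for i x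
    using that assms by (intro has_vector_derivative_add Ck_has_derivative)
  show "(\<lambda>x. f x + g x) \<in> Ck k"
    by (rule CkI[of ?F, OF _ d]) (auto intro!: continuous_on_add Ck_continuous_nderiv assms)
  show "n \<le> k \<Longrightarrow> nderiv n (\<lambda>x. f x + g x) = ?F n"
    by (rule nderiv_eqI[of ?F, OF _ d]) auto
qed

lemma Ck_cmult:
  fixes f :: "real \<Rightarrow> complex"
  assumes "f \<in> Ck k"
  shows "(\<lambda>x. c * f x) \<in> Ck k" "n \<le> k \<Longrightarrow> nderiv n (\<lambda>x. c * f x) = (\<lambda>x. c * nderiv n f x)"
proof -
  let ?F = "\<lambda>n x. c * nderiv n f x"
  have d: "(?F i has_vector_derivative ?F (Suc i) x) (at x)" if "i < k" for i x
    using that assms by (intro has_vector_derivative_mult_right Ck_has_derivative)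
  show "(\<lambda>x. c * f x) \<in> Ck k"
    by (rule CkI[of ?F, OF _ d]) (auto intro!: continuous_on_mult continuous_on_const Ck_continuous_nderiv assms)
  show "n \<le> k \<Longrightarrow> nderiv n (\<lambda>x. c * f x) = ?F n"
    by (rule nderiv_eqI[of ?F, OF _ d]) auto
qed

lemma Ck_diff:
  fixes f :: "real \<Rightarrow> complex"
  assumes "f \<in> Ck k" "g \<in> Ck k"
  shows "(\<lambda>x. f x - g x) \<in> Ck k"
  using Ck_add(1)[OF assms(1) Ck_cmult(1)[OF assms(2), of "-1"]] by simp

lemma Ck_poly: "(\<lambda>x. poly p (of_real x) :: complex) \<in> Ck k"
  by (rule CkI[of "\<lambda>n x. poly ((pderiv ^^ n) p) (of_real x)"])
    (auto intro!: has_vector_derivative_real_field poly_DERIV continuous_intros)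

section \<open>Functions with a Hoelder continuous derivative\<close>

lemma vector_derivative_bound:
  fixes f :: "real \<Rightarrow> complex"
  assumes "convex S" "\<And>t. t \<in> S \<Longrightarrow> (f has_vector_derivative f' t) (at t within S)"
    "\<And>t. t \<in> S \<Longrightarrow> norm (f' t) \<le> B" "x \<in> S" "y \<in> S"
  shows "norm (f x - f y) \<le> B * \<bar>x - y\<bar>"
proof -
  have "norm (f x - f y) \<le> B * norm (x - y)"
  proof (rule differentiable_bound[OF assms(1)])
    show "(f has_derivative (\<lambda>h. h *\<^sub>R f' t)) (at t within S)" if "t \<in> S" for t
      using assms(2)[OF that] by (simp add: has_vector_derivative_def)
    show "onorm (\<lambda>h. h *\<^sub>R f' t) \<le> B" if "t \<in> S" for t
      using assms(3)[OF that] by (intro onorm_le) (simp add: mult.commute[of B] mult_left_mono)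
  qed (use assms in auto)
  then show ?thesis by simp
qed

lemma norm_div_fact_le: "norm (w / fact k) \<le> norm (w :: complex)"
  using divide_left_mono[of 1 "fact k" "norm w"] by (simp add: norm_divide fact_ge_1)

definition taylor :: "nat \<Rightarrow> (real \<Rightarrow> complex) \<Rightarrow> real \<Rightarrow> complex \<Rightarrow> complex" where
  "taylor k f a z = (\<Sum>l\<le>k. nderiv l f a * (z - of_real a) ^ l / fact l)"

lemma holomorphic_taylor [holomorphic_intros]: "taylor k f a holomorphic_on S"
  unfolding taylor_def by (intro holomorphic_intros) auto

lemma has_vector_derivative_power_diff:
  fixes z :: complex
  shows "((\<lambda>t. (z - of_real t) ^ Suc l / fact (Suc l)) has_vector_derivative
     (- ((z - of_real t) ^ l / fact l))) (at t within S)"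
proof (rule has_vector_derivative_real_field)
  have "((\<lambda>w. (z - w) ^ Suc l / fact (Suc l)) has_field_derivative
     (- (of_nat (Suc l) * (z - of_real t) ^ l) / fact (Suc l))) (at (of_real t))"
    by (auto simp del: power_Suc of_nat_Suc fact_Suc intro!: derivative_eq_intros)
  then show "((\<lambda>w. (z - w) ^ Suc l / fact (Suc l)) has_field_derivative
     (- ((z - of_real t) ^ l / fact l))) (at (of_real t))"
    by (simp del: of_nat_Suc)
qed

lemma taylor_sum_derivative:
  fixes F :: "nat \<Rightarrow> real \<Rightarrow> complex"
  assumes F: "\<And>l. l \<le> n \<Longrightarrow> (F l has_vector_derivative F (Suc l) t) (at t)"
  shows "((\<lambda>t. \<Sum>l\<le>n. F l t * ((z - of_real t) ^ l / fact l)) has_vector_derivative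
     F (Suc n) t * ((z - of_real t) ^ n / fact n)) (at t)"
  using F
proof (induction n)
  case (Suc n)
  have "((\<lambda>t. F (Suc n) t * ((z - of_real t) ^ Suc n / fact (Suc n))) has_vector_derivative
     F (Suc n) t * (- ((z - of_real t) ^ n / fact n)) + F (Suc (Suc n)) t * ((z - of_real t) ^ Suc n / fact (Suc n))) (at t)"
    by (intro has_vector_derivative_mult has_vector_derivative_power_diff Suc.prems) simp
  from has_vector_derivative_add[OF Suc.IH this] Suc.prems show ?case by simp
qed simp

text \<open>As a function of the centre, the Taylor polynomial has the derivative of its last term only;
  comparing the top coefficient with its value at \<open>a\<close> brings in the modulus of continuity.\<close>

lemma taylor_diff:
  assumes f: "f \<in> Ck (Suc k)" and H: "0 \<le> H" and \<epsilon>: "0 < \<epsilon>"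
    and hold: "\<And>x y. x \<in> S \<Longrightarrow> y \<in> S \<Longrightarrow> norm (nderiv (Suc k) f x - nderiv (Suc k) f y) \<le> H * \<bar>x - y\<bar> powr \<epsilon>"
    and S: "closed_segment a b \<subseteq> S"
    and R: "\<And>t. t \<in> closed_segment a b \<Longrightarrow> norm (z - of_real t) \<le> R"
  shows "norm (taylor (Suc k) f b z - taylor (Suc k) f a z) \<le>
     H * \<bar>b - a\<bar> powr \<epsilon> * (\<bar>b - a\<bar> * R ^ k + R ^ Suc k)"
proof -
  define E where "E = H * \<bar>b - a\<bar> powr \<epsilon>"
  have E: "0 \<le> E" using H by (simp add: E_def)
  have R0: "0 \<le> R" using R[of a] norm_ge_zero order_trans by blast
  have hold': "norm (nderiv (Suc k) f t - nderiv (Suc k) f a) \<le> E" if "t \<in> closed_segment a b" for t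
  proof -
    have "\<bar>t - a\<bar> \<le> \<bar>b - a\<bar>" using that by (auto simp: closed_segment_eq_real_ivl split: if_splits)
    then have "\<bar>t - a\<bar> powr \<epsilon> \<le> \<bar>b - a\<bar> powr \<epsilon>" using \<epsilon> by (intro powr_mono2) auto
    then have "H * \<bar>t - a\<bar> powr \<epsilon> \<le> E" unfolding E_def using H by (rule mult_left_mono)
    moreover have "norm (nderiv (Suc k) f t - nderiv (Suc k) f a) \<le> H * \<bar>t - a\<bar> powr \<epsilon>"
      by (rule hold) (use that S in auto)
    ultimately show ?thesis by linarith
  qed
  define G where "G t = (\<Sum>l\<le>k. nderiv l f t * ((z - of_real t) ^ l / fact l)) +
     nderiv (Suc k) f a * ((z - of_real t) ^ Suc k / fact (Suc k))" for t
  define G' where "G' t = (nderiv (Suc k) f t - nderiv (Suc k) f a) * ((z - of_real t) ^ k / fact k)" for t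
  have 1: "norm (G b - G a) \<le> E * R ^ k * \<bar>b - a\<bar>"
  proof (rule vector_derivative_bound)
    fix t assume t: "t \<in> closed_segment a b"
    have "(G has_vector_derivative (nderiv (Suc k) f t * ((z - of_real t) ^ k / fact k) +
        nderiv (Suc k) f a * (- ((z - of_real t) ^ k / fact k)))) (at t)"
      unfolding G_def
      by (intro has_vector_derivative_add has_vector_derivative_mult_right
          has_vector_derivative_power_diff taylor_sum_derivative Ck_has_derivative[OF f]) simp
    then have "(G has_vector_derivative G' t) (at t)"
      by (simp add: G'_def left_diff_distrib diff_divide_distrib)
    then show "(G has_vector_derivative G' t) (at t within closed_segment a b)"
      by (rule has_vector_derivative_at_within)
    have "norm (G' t) \<le> norm (nderiv (Suc k) f t - nderiv (Suc k) f a) * norm (z - of_real t) ^ k"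
      unfolding G'_def norm_mult norm_power[symmetric] by (intro mult_left_mono norm_div_fact_le) simp
    also have "\<dots> \<le> E * R ^ k" by (intro mult_mono power_mono hold' R t E) auto
    finally show "norm (G' t) \<le> E * R ^ k" .
  qed auto
  have 2: "taylor (Suc k) f b z - taylor (Suc k) f a z = G b - G a +
     (nderiv (Suc k) f b - nderiv (Suc k) f a) * ((z - of_real b) ^ Suc k / fact (Suc k))"
    by (simp add: taylor_def G_def left_diff_distrib diff_divide_distrib del: power_Suc fact_Suc)
  have 3: "norm ((nderiv (Suc k) f b - nderiv (Suc k) f a) * ((z - of_real b) ^ Suc k / fact (Suc k))) \<le> E * R ^ Suc k"
  proof -
    have "norm ((z - of_real b) ^ Suc k / fact (Suc k)) \<le> norm (z - of_real b) ^ Suc k"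
      unfolding norm_power[symmetric] by (rule norm_div_fact_le)
    also have "\<dots> \<le> R ^ Suc k" by (intro power_mono R) auto
    finally show ?thesis unfolding norm_mult by (intro mult_mono hold' E) auto
  qed
  have "norm (taylor (Suc k) f b z - taylor (Suc k) f a z) \<le> E * R ^ k * \<bar>b - a\<bar> + E * R ^ Suc k"
    unfolding 2 by (rule order_trans[OF norm_triangle_ineq add_mono[OF 1 3]])
  then show ?thesis by (simp add: E_def algebra_simps)
qed

text \<open>The Gumbel function: an entire function that tends to \<open>0\<close> and \<open>1\<close> exponentially along the strip
  of half-width \<open>1\<close>. Its translates glue Taylor polynomials into one entire function.\<close>

definition gumbel :: "complex \<Rightarrow> complex" where
  "gumbel z = 1 - exp (- exp z)"

lemma holomorphic_gumbel: "gumbel holomorphic_on S"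
  unfolding gumbel_def by (intro holomorphic_intros)

lemma Re_exp_strip:
  assumes "\<bar>Im z\<bar> \<le> 1"
  shows "exp (Re z) / 2 \<le> Re (exp z)"
proof -
  have "cos (pi / 3) \<le> cos \<bar>Im z\<bar>"
    using assms pi_gt3 by (intro cos_monotone_0_pi_le) auto
  then have "1 / 2 \<le> cos (Im z)" by (simp add: cos_60)
  then have "exp (Re z) * (1 / 2) \<le> exp (Re z) * cos (Im z)" by (intro mult_left_mono) auto
  then show ?thesis by (simp add: Re_exp)
qed

lemma norm_gumbel_le:
  assumes "\<bar>Im z\<bar> \<le> 1"
  shows "norm (gumbel z) \<le> exp (Re z)"
proof -
  have "norm (exp (- exp z) - exp (- 0)) \<le> 1 * norm (- exp z - (- 0))"
  proof (rule field_differentiable_bound[of "{w. Re w \<le> 0}" exp exp])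
    show "convex {w. Re w \<le> 0}" by (rule convex_halfspace_Re_le)
    show "- exp z \<in> {w. Re w \<le> 0}" using Re_exp_strip[OF assms] exp_gt_zero[of "Re z"]
      by (simp del: exp_gt_zero)
    show "(exp has_field_derivative exp w) (at w within {w. Re w \<le> 0})" for w :: complex
      by (rule DERIV_subset[OF DERIV_exp]) simp
  qed auto
  then show ?thesis by (simp add: gumbel_def norm_minus_commute)
qed

lemma norm_one_minus_gumbel_le:
  assumes "\<bar>Im z\<bar> \<le> 1"
  shows "norm (1 - gumbel z) \<le> 2 * exp (- Re z)"
proof -
  have "norm (1 - gumbel z) = exp (- Re (exp z))" by (simp add: gumbel_def)
  also have "\<dots> \<le> exp (- (exp (Re z) / 2))" using Re_exp_strip[OF assms] by simp
  also have "\<dots> = 1 / exp (exp (Re z) / 2)" by (simp add: exp_minus field_simps)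
  also have "\<dots> \<le> 1 / (exp (Re z) / 2)"
  proof (rule divide_left_mono)
    show "exp (Re z) / 2 \<le> exp (exp (Re z) / 2)"
      using exp_ge_add_one_self[of "exp (Re z) / 2"] by linarith
  qed simp_all
  also have "\<dots> = 2 * exp (- Re z)" by (simp add: exp_minus field_simps)
  finally show ?thesis .
qed

text \<open>A telescoping sum of the Taylor polynomials at \<open>n + 1\<close> equidistant nodes of \<open>[-r, r]\<close>, in which each
  increment is switched on near its node.\<close>

definition glued :: "nat \<Rightarrow> (real \<Rightarrow> complex) \<Rightarrow> real \<Rightarrow> nat \<Rightarrow> complex \<Rightarrow> complex" where
  "glued k f r n z = taylor k f (- r) z + (\<Sum>m<n.
     (taylor k f (- r + real (Suc m) * (2 * r / n)) z - taylor k f (- r + real m * (2 * r / n)) z) *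
     gumbel ((z - of_real (- r + real m * (2 * r / n))) / of_real (2 * r / n)))"

lemma holomorphic_glued: "r > 0 \<Longrightarrow> n > 0 \<Longrightarrow> glued k f r n holomorphic_on S"
  unfolding glued_def
  by (intro holomorphic_intros holomorphic_on_compose[OF _ holomorphic_gumbel, unfolded o_def]) auto

definition glue_const :: "nat \<Rightarrow> real" where
  "glue_const k = (\<Sum>j. (6 + real j) ^ k * exp (- real j))"

lemma summable_glue_const: "summable (\<lambda>j. (6 + real j) ^ k * exp (- real j))"
proof (rule summable_comparison_test_bigo)
  have "norm (exp (- real j / 2)) = exp (- 1 / 2) ^ j" for j
    by (simp flip: exp_of_nat_mult)
  then show "summable (\<lambda>j. norm (exp (- real j / 2)))" by (simp add: summable_geometric)
  show "(\<lambda>j. (6 + real j) ^ k * exp (- real j)) \<in> O(\<lambda>j. exp (- real j / 2))" by real_asymp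
qed

lemma sum_glue_const_le:
  "(\<Sum>m<n. (6 + \<bar>real m - real m0\<bar>) ^ k * exp (- \<bar>real m - real m0\<bar>)) \<le> 2 * glue_const k"
proof -
  define w where "w j = (6 + real j) ^ k * exp (- real j)" for j
  have fin: "(\<Sum>j\<in>J. w j) \<le> glue_const k" if "finite J" for J
    unfolding glue_const_def w_def by (rule sum_le_suminf[OF summable_glue_const that]) simp
  have "(\<Sum>m<n. (6 + \<bar>real m - real m0\<bar>) ^ k * exp (- \<bar>real m - real m0\<bar>)) \<le>
      (\<Sum>m\<in>{..m0} \<union> {m0..<n}. (6 + \<bar>real m - real m0\<bar>) ^ k * exp (- \<bar>real m - real m0\<bar>))"
    by (rule sum_mono2) auto
  also have "\<dots> \<le> (\<Sum>m\<in>{..m0}. (6 + \<bar>real m - real m0\<bar>) ^ k * exp (- \<bar>real m - real m0\<bar>)) +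
      (\<Sum>m\<in>{m0..<n}. (6 + \<bar>real m - real m0\<bar>) ^ k * exp (- \<bar>real m - real m0\<bar>))"
    by (subst sum.union_inter[symmetric]) (auto intro!: sum_nonneg add_increasing2)
  also have "(\<Sum>m\<in>{..m0}. (6 + \<bar>real m - real m0\<bar>) ^ k * exp (- \<bar>real m - real m0\<bar>)) =
      (\<Sum>m\<in>{..m0}. w (m0 - m))"
    by (intro sum.cong refl) (auto simp: w_def of_nat_diff)
  also have "\<dots> = (\<Sum>j\<in>(\<lambda>m. m0 - m) ` {..m0}. w j)"
    by (subst sum.reindex) (auto simp: inj_on_def)
  also have "\<dots> \<le> glue_const k" by (rule fin) simp
  also have "(\<Sum>m\<in>{m0..<n}. (6 + \<bar>real m - real m0\<bar>) ^ k * exp (- \<bar>real m - real m0\<bar>)) =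
      (\<Sum>m\<in>{m0..<n}. w (m - m0))"
    by (intro sum.cong refl) (auto simp: w_def of_nat_diff)
  also have "\<dots> = (\<Sum>j\<in>(\<lambda>m. m - m0) ` {m0..<n}. w j)"
    by (subst sum.reindex) (auto simp: inj_on_def)
  also have "\<dots> \<le> glue_const k" by (rule fin) simp
  finally show ?thesis by simp
qed

text \<open>Near a node the glued function stays within \<open>O(\<delta>\<^sup>k\<^sup>+\<^sup>\<epsilon>)\<close> of the Taylor polynomial at
  that node: the jumps between neighbouring polynomials grow polynomially with the distance, and
  the switching functions decay exponentially.\<close>

lemma glued_near_taylor:
  assumes f: "f \<in> Ck (Suc k)" and H: "0 \<le> H" and \<epsilon>: "0 < \<epsilon>" and r: "0 < r" and n: "0 < n"
    and hold: "\<And>x y. x \<in> {-r..r} \<Longrightarrow> y \<in> {-r..r} \<Longrightarrow>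
      norm (nderiv (Suc k) f x - nderiv (Suc k) f y) \<le> H * \<bar>x - y\<bar> powr \<epsilon>"
    and \<delta>: "\<delta> = 2 * r / n" and m0: "m0 \<le> n"
    and z: "\<bar>Re z - (- r + real m0 * \<delta>)\<bar> \<le> 4 * \<delta>" "\<bar>Im z\<bar> \<le> \<delta>"
  shows "norm (glued (Suc k) f r n z - taylor (Suc k) f (- r + real m0 * \<delta>) z) \<le>
     8 * exp 4 * glue_const (Suc k) * H * \<delta> ^ Suc k * \<delta> powr \<epsilon>"
proof -
  define a where "a m = - r + real m * \<delta>" for m
  define T where "T m = taylor (Suc k) f (a m) z" for m
  define S where "S m = gumbel ((z - of_real (a m)) / of_real \<delta>)" for m
  have d0: "0 < \<delta>" using r n by (simp add: \<delta>)
  have nd: "real n * \<delta> = 2 * r" using n by (simp add: \<delta>)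
  have a_in: "a m \<in> {-r..r}" if "m \<le> n" for m
  proof -
    have "real m * \<delta> \<le> real n * \<delta>" using that d0 by (intro mult_right_mono) auto
    then show ?thesis using nd d0 by (simp add: a_def)
  qed
  have jump: "norm (T (Suc m) - T m) \<le> 2 * H * \<delta> ^ Suc k * \<delta> powr \<epsilon> * (6 + \<bar>real m - real m0\<bar>) ^ Suc k"
    if m: "m < n" for m
  proof -
    \<comment> \<open>bounds the distance from \<open>z\<close> to the interval between the nodes \<open>m\<close> and \<open>m + 1\<close>\<close>
    define R where "R = \<delta> * (6 + \<bar>real m - real m0\<bar>)"
    have ad: "a (Suc m) - a m = \<delta>" by (simp add: a_def algebra_simps)
    have seg: "closed_segment (a m) (a (Suc m)) = {a m..a (Suc m)}"
      using ad d0 by (intro closed_segment_eq_real_ivl1) simp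
    have "norm (T (Suc m) - T m) \<le> H * \<bar>a (Suc m) - a m\<bar> powr \<epsilon> * (\<bar>a (Suc m) - a m\<bar> * R ^ k + R ^ Suc k)"
      unfolding T_def
    proof (rule taylor_diff[OF f H \<epsilon>, of "{-r..r}"])
      show "closed_segment (a m) (a (Suc m)) \<subseteq> {-r..r}"
        unfolding seg using a_in[of m] a_in[of "Suc m"] m by auto
      fix t assume "t \<in> closed_segment (a m) (a (Suc m))"
      then have t: "a m \<le> t" "t \<le> a m + \<delta>" using ad by (auto simp: seg)
      have "\<bar>a m - a m0\<bar> = \<delta> * \<bar>real m - real m0\<bar>"
        using d0 by (simp add: a_def abs_mult flip: left_diff_distrib)
      moreover have "norm (z - of_real t) \<le> \<bar>Re z - t\<bar> + \<bar>Im z\<bar>"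
        using cmod_le[of "z - of_real t"] by simp
      moreover have "\<bar>Re z - a m0\<bar> \<le> 4 * \<delta>" using z(1) by (simp add: a_def)
      moreover have "R = 6 * \<delta> + \<delta> * \<bar>real m - real m0\<bar>" by (simp add: R_def algebra_simps)
      ultimately show "norm (z - of_real t) \<le> R" using t z(2) by linarith
    qed (use hold in auto)
    also have "\<dots> = H * \<delta> powr \<epsilon> * (\<delta> * R ^ k + R ^ Suc k)" using ad d0 by simp
    also have "\<dots> \<le> H * \<delta> powr \<epsilon> * (2 * R ^ Suc k)"
    proof (intro mult_left_mono)
      have "\<delta> * 1 \<le> R" unfolding R_def using d0 by (intro mult_left_mono) auto
      then have "\<delta> * R ^ k \<le> R * R ^ k" using d0 by (intro mult_right_mono) auto
      then show "\<delta> * R ^ k + R ^ Suc k \<le> 2 * R ^ Suc k" by simp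
    qed (use H in auto)
    finally show ?thesis by (simp add: R_def power_mult_distrib mult_ac)
  qed
  have switch: "norm (S m - (if m < m0 then 1 else 0)) \<le> 2 * exp 4 * exp (- \<bar>real m - real m0\<bar>)" for m
  proof -
    define w where "w = (z - of_real (a m)) / of_real \<delta>"
    have Im: "\<bar>Im w\<bar> \<le> 1" using z(2) d0 by (simp add: w_def abs_divide)
    have "Re w = (Re z - a m0) / \<delta> + (real m0 - real m)"
      using d0 by (simp add: w_def a_def field_simps)
    moreover have "\<bar>(Re z - a m0) / \<delta>\<bar> \<le> 4"
      using z(1) d0 by (simp add: a_def abs_divide divide_le_eq)
    ultimately have Re: "\<bar>Re w - (real m0 - real m)\<bar> \<le> 4" by simp
    show ?thesis
    proof (cases "m < m0")
      case True
      have "norm (S m - 1) \<le> 2 * exp (- Re w)"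
        using norm_one_minus_gumbel_le[OF Im] by (simp add: S_def w_def norm_minus_commute)
      also have "\<dots> \<le> 2 * exp (4 + - \<bar>real m - real m0\<bar>)"
        using True Re by (intro mult_left_mono) auto
      finally show ?thesis using True by (simp add: exp_add)
    next
      case False
      have "norm (S m) \<le> exp (Re w)"
        using norm_gumbel_le[OF Im] by (simp add: S_def w_def)
      also have "\<dots> \<le> exp (4 + - \<bar>real m - real m0\<bar>)" using False Re by simp
      also have "\<dots> \<le> 2 * exp (4 + - \<bar>real m - real m0\<bar>)" by simp
      finally show ?thesis using False by (simp add: exp_add)
    qed
  qed
  have "(\<Sum>m<n. (T (Suc m) - T m) * (if m < m0 then 1 else 0)) = (\<Sum>m<m0. T (Suc m) - T m)"
    using m0 by (intro sum.mono_neutral_cong_right) auto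
  also have "\<dots> = T m0 - T 0" by (rule sum_lessThan_telescope)
  finally have tel: "(\<Sum>m<n. (T (Suc m) - T m) * (if m < m0 then 1 else 0)) = T m0 - T 0" .
  have "glued (Suc k) f r n z = T 0 + (\<Sum>m<n. (T (Suc m) - T m) * S m)"
    by (simp add: glued_def T_def S_def a_def \<delta>)
  then have "glued (Suc k) f r n z - T m0 =
      (\<Sum>m<n. (T (Suc m) - T m) * (S m - (if m < m0 then 1 else 0)))"
    unfolding right_diff_distrib sum_subtractf tel by simp
  also have "norm \<dots> \<le> (\<Sum>m<n. (2 * H * \<delta> ^ Suc k * \<delta> powr \<epsilon> * (6 + \<bar>real m - real m0\<bar>) ^ Suc k) *
       (2 * exp 4 * exp (- \<bar>real m - real m0\<bar>)))"
  proof (rule sum_norm_le)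
    fix m assume "m \<in> {..<n}"
    then show "norm ((T (Suc m) - T m) * (S m - (if m < m0 then 1 else 0))) \<le>
       (2 * H * \<delta> ^ Suc k * \<delta> powr \<epsilon> * (6 + \<bar>real m - real m0\<bar>) ^ Suc k) *
       (2 * exp 4 * exp (- \<bar>real m - real m0\<bar>))"
      unfolding norm_mult using H d0
      by (intro mult_mono[OF jump switch]) (auto intro!: mult_nonneg_nonneg)
  qed
  also have "\<dots> = 4 * exp 4 * H * \<delta> ^ Suc k * \<delta> powr \<epsilon> *
      (\<Sum>m<n. (6 + \<bar>real m - real m0\<bar>) ^ Suc k * exp (- \<bar>real m - real m0\<bar>))"
    unfolding sum_distrib_left by (intro sum.cong refl) (simp only: mult_ac)
  also have "\<dots> \<le> 4 * exp 4 * H * \<delta> ^ Suc k * \<delta> powr \<epsilon> * (2 * glue_const (Suc k))"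
    using H d0 by (intro mult_left_mono sum_glue_const_le mult_nonneg_nonneg) auto
  finally show ?thesis by (simp add: T_def a_def mult_ac)
qed

lemma nearest_node:
  assumes "x \<in> {-r..r}" "0 < r" "0 < n" "\<delta> = 2 * r / real n"
  shows "\<exists>m\<le>n. \<bar>x - (- r + real m * \<delta>)\<bar> \<le> \<delta>"
proof -
  have d0: "0 < \<delta>" using assms by simp
  define y where "y = (x + r) / \<delta>"
  have y: "0 \<le> y" "y \<le> real n" "x = - r + y * \<delta>"
    using assms d0 by (auto simp: y_def field_simps)
  have "\<bar>y - real (nat \<lfloor>y\<rfloor>)\<bar> \<le> 1" using y(1) by linarith
  then have "\<bar>y - real (nat \<lfloor>y\<rfloor>)\<bar> * \<delta> \<le> 1 * \<delta>" using d0 by (intro mult_right_mono) auto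
  moreover have "x - (- r + real (nat \<lfloor>y\<rfloor>) * \<delta>) = (y - real (nat \<lfloor>y\<rfloor>)) * \<delta>"
    using y(3) by (simp add: algebra_simps)
  moreover have "nat \<lfloor>y\<rfloor> \<le> n" using y by linarith
  ultimately show ?thesis using d0 by (intro exI[of _ "nat \<lfloor>y\<rfloor>"]) (simp add: abs_mult)
qed

lemma taylor_self: "taylor k f x (of_real x) = f x"
  unfolding taylor_def by (simp add: sum.delta' nderiv_def sum.atMost_shift)

text \<open>The differences of consecutive glued functions are entire and of size \<open>\<delta>\<^sup>k\<^sup>+\<^sup>\<epsilon>\<close> at scale
  \<open>\<delta>\<close>, so by the criterion their divided differences of order at most \<open>k\<close> form a geometric
  series.\<close>

theorem holder_poly_approximable:
  assumes f: "f \<in> Ck_holder_loc (Suc k) \<epsilon>" and \<epsilon>: "0 < \<epsilon>"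
  shows "poly_approximable (Suc k) f"
proof (rule poly_approximable_close)
  fix r e :: real assume r: "0 < r" and e: "0 < e"
  have fk: "f \<in> Ck (Suc k)" using f by (simp add: Ck_holder_loc_def)
  from f r have "\<exists>c. \<forall>x\<in>{-r..r}. \<forall>y\<in>{-r..r}.
      norm (nderiv (Suc k) f x - nderiv (Suc k) f y) \<le> c * \<bar>x - y\<bar> powr \<epsilon>"
    by (simp add: Ck_holder_loc_def)
  then obtain c where "\<forall>x\<in>{-r..r}. \<forall>y\<in>{-r..r}.
      norm (nderiv (Suc k) f x - nderiv (Suc k) f y) \<le> c * \<bar>x - y\<bar> powr \<epsilon>" ..
  then have c: "\<And>x y. x \<in> {-r..r} \<Longrightarrow> y \<in> {-r..r} \<Longrightarrow>
      norm (nderiv (Suc k) f x - nderiv (Suc k) f y) \<le> c * \<bar>x - y\<bar> powr \<epsilon>" by simp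
  define H where "H = max c 0"
  have H: "norm (nderiv (Suc k) f x - nderiv (Suc k) f y) \<le> H * \<bar>x - y\<bar> powr \<epsilon>"
    if "x \<in> {-r..r}" "y \<in> {-r..r}" for x y
    using c[OF that] mult_right_mono[of c H "\<bar>x - y\<bar> powr \<epsilon>"] by (auto simp: H_def)
  have H0: "0 \<le> H" by (simp add: H_def)
  define \<delta> where "\<delta> i = 2 * r / real (2 ^ i)" for i
  have d0: "0 < \<delta> i" "\<delta> i \<le> 2 * r" for i using r by (auto simp: \<delta>_def divide_le_eq)
  have dS: "\<delta> (Suc i) = \<delta> i / 2" for i by (simp add: \<delta>_def)
  define P where "P = 8 * exp 4 * glue_const (Suc k) * H"
  have "0 \<le> glue_const (Suc k)" unfolding glue_const_def
    by (intro suminf_nonneg summable_glue_const) simp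
  then have P0: "0 \<le> P" using H0 by (simp add: P_def)
  define G where "G i = glued (Suc k) f r (2 ^ i)" for i
  have hG: "G i holomorphic_on UNIV" for i unfolding G_def by (rule holomorphic_glued) (use r in auto)
  have near: "norm (G i z - taylor (Suc k) f (- r + real m * \<delta> i) z) \<le> P * (\<delta> i ^ Suc k * \<delta> i powr \<epsilon>)"
    if "m \<le> 2 ^ i" "\<bar>Re z - (- r + real m * \<delta> i)\<bar> \<le> 4 * \<delta> i" "\<bar>Im z\<bar> \<le> \<delta> i" for i m z
    using glued_near_taylor[OF fk H0 \<epsilon> r _ H \<delta>_def that] by (simp add: G_def P_def mult_ac)
  have step: "norm (G (Suc i) z - G i z) \<le> 2 * P * (\<delta> i ^ Suc k * \<delta> i powr \<epsilon>)"
    if a: "\<bar>a\<bar> < r + \<delta> i / 48" "norm (z - of_real a) \<le> 12 * (\<delta> i / 48)" for i a z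
  proof -
    \<comment> \<open>the centre may lie slightly outside the interval; \<open>x\<close> is the closest point of the interval\<close>
    define x where "x = max (- r) (min r a)"
    have x: "x \<in> {-r..r}" using r by (auto simp: x_def)
    have ax: "\<bar>a - x\<bar> \<le> \<delta> i / 48"
      using r a(1) d0(1)[of i] unfolding x_def max_def min_def by (simp split: if_splits) linarith
    obtain m where m: "m \<le> 2 ^ i" "\<bar>x - (- r + real m * \<delta> i)\<bar> \<le> \<delta> i"
      using nearest_node[OF x r, of "2 ^ i" "\<delta> i"] by (auto simp: \<delta>_def)
    have z: "\<bar>Re z - a\<bar> \<le> \<delta> i / 4" "\<bar>Im z\<bar> \<le> \<delta> i / 4"
      using abs_Re_le_cmod[of "z - of_real a"] abs_Im_le_cmod[of "z - of_real a"] a(2) by auto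
    have Re: "\<bar>Re z - (- r + real m * \<delta> i)\<bar> \<le> 2 * \<delta> i" using z(1) ax m(2) d0[of i] by linarith
    \<comment> \<open>the node is also a node of the finer mesh, so both functions are close to the same Taylor polynomial\<close>
    have "real (2 * m) * \<delta> (Suc i) = real m * \<delta> i" by (simp add: dS)
    then have "norm (G (Suc i) z - taylor (Suc k) f (- r + real m * \<delta> i) z) \<le>
        P * (\<delta> (Suc i) ^ Suc k * \<delta> (Suc i) powr \<epsilon>)"
      using near[of "2 * m" "Suc i" z] m Re z(2) d0[of i] by (simp add: dS)
    also have "\<dots> \<le> P * (\<delta> i ^ Suc k * \<delta> i powr \<epsilon>)"
      using d0[of i] P0 \<epsilon> by (intro mult_left_mono mult_mono power_mono powr_mono2) (auto simp: dS)
    finally have "norm (G (Suc i) z - taylor (Suc k) f (- r + real m * \<delta> i) z) \<le>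
        P * (\<delta> i ^ Suc k * \<delta> i powr \<epsilon>)" .
    moreover have "norm (G i z - taylor (Suc k) f (- r + real m * \<delta> i) z) \<le> P * (\<delta> i ^ Suc k * \<delta> i powr \<epsilon>)"
      by (rule near) (use m Re z d0[of i] in auto)
    ultimately show ?thesis
      using norm_triangle_ineq4[of "G (Suc i) z - taylor (Suc k) f (- r + real m * \<delta> i) z"
          "G i z - taylor (Suc k) f (- r + real m * \<delta> i) z"] by simp
  qed
  \<comment> \<open>the ratio of the geometric series\<close>
  define q where "q = (1 / 2) powr \<epsilon>"
  have q: "0 < q" "q < 1" using \<epsilon> powr_less_mono2[of \<epsilon> "1 / 2" 1] by (auto simp: q_def)
  have dq: "\<delta> i powr \<epsilon> = (2 * r) powr \<epsilon> * q ^ i" for i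
  proof -
    have "\<delta> i = (2 * r) * (1 / 2) ^ i" by (simp add: \<delta>_def power_divide)
    moreover have "((1 / 2 :: real) ^ i) powr \<epsilon> = q ^ i"
      unfolding q_def by (simp add: powr_power powr_powr mult.commute flip: powr_realpow)
    ultimately show ?thesis using r by (simp add: powr_mult)
  qed
  have lim: "(\<lambda>i. G i (of_real x)) \<longlonglongrightarrow> f x" if x: "x \<in> {-r..r}" for x
  proof -
    have b: "norm (G i (of_real x) - f x) \<le> (P + 2 * H) * ((2 * r) ^ Suc k * (2 * r) powr \<epsilon>) * q ^ i" for i
    proof -
      obtain m where m: "m \<le> 2 ^ i" "\<bar>x - (- r + real m * \<delta> i)\<bar> \<le> \<delta> i"
        using nearest_node[OF x r, of "2 ^ i" "\<delta> i"] by (auto simp: \<delta>_def)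
      define a where "a = - r + real m * \<delta> i"
      have ax: "\<bar>x - a\<bar> \<le> \<delta> i" using m by (simp add: a_def)
      have "real m * \<delta> i \<le> real (2 ^ i) * \<delta> i" using m d0[of i] by (intro mult_right_mono) auto
      then have a: "a \<in> {-r..r}" using d0[of i] by (simp add: a_def \<delta>_def)
      have 1: "norm (G i (of_real x) - taylor (Suc k) f a (of_real x)) \<le> P * (\<delta> i ^ Suc k * \<delta> i powr \<epsilon>)"
        unfolding a_def by (rule near) (use m d0[of i] in auto)
      have "norm (taylor (Suc k) f x (of_real x) - taylor (Suc k) f a (of_real x)) \<le>
         H * \<bar>x - a\<bar> powr \<epsilon> * (\<bar>x - a\<bar> * \<delta> i ^ k + \<delta> i ^ Suc k)"
      proof (rule taylor_diff[OF fk H0 \<epsilon>, of "{-r..r}"])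
        show "closed_segment a x \<subseteq> {-r..r}" by (rule closed_segment_subset) (use a x in auto)
        fix t assume "t \<in> closed_segment a x"
        then have "\<bar>x - t\<bar> \<le> \<bar>x - a\<bar>" by (auto simp: closed_segment_eq_real_ivl split: if_splits)
        then show "norm (of_real x - of_real t :: complex) \<le> \<delta> i"
          using ax by (simp flip: of_real_diff)
      qed (use H in auto)
      also have "\<dots> \<le> H * \<delta> i powr \<epsilon> * (\<delta> i * \<delta> i ^ k + \<delta> i ^ Suc k)"
        using ax d0[of i] H0 \<epsilon> by (intro mult_mono add_mono powr_mono2 mult_right_mono mult_left_mono) auto
      finally have 2: "norm (f x - taylor (Suc k) f a (of_real x)) \<le> 2 * H * (\<delta> i ^ Suc k * \<delta> i powr \<epsilon>)"
        by (simp add: taylor_self mult_ac)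
      have "norm (G i (of_real x) - f x) \<le> (P + 2 * H) * (\<delta> i ^ Suc k * \<delta> i powr \<epsilon>)"
        using norm_triangle_ineq4[of "G i (of_real x) - taylor (Suc k) f a (of_real x)"
            "f x - taylor (Suc k) f a (of_real x)"] 1 2 by (simp add: distrib_right)
      also have "\<dots> \<le> (P + 2 * H) * ((2 * r) ^ Suc k * \<delta> i powr \<epsilon>)"
        using d0[of i] P0 H0 by (intro mult_left_mono mult_right_mono power_mono) auto
      finally show ?thesis by (simp add: dq mult_ac)
    qed
    have "(\<lambda>i. (P + 2 * H) * ((2 * r) ^ Suc k * (2 * r) powr \<epsilon>) * q ^ i) \<longlonglongrightarrow> 0"
      using LIMSEQ_power_zero[of q] q by (intro tendsto_mult_right_zero) auto
    from Lim_null_comparison[OF eventuallyI[OF b] this]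
    have "(\<lambda>i. G i (of_real x) - f x) \<longlonglongrightarrow> 0" .
    then show ?thesis by (simp add: LIM_zero_iff)
  qed
  have "\<forall>d. \<exists>C\<ge>0. \<forall>r g A h I. finite I \<and> card I = Suc d \<and> 0 \<le> A \<and> 0 < h \<and> g holomorphic_on UNIV \<and>
     (\<forall>a z. \<bar>a\<bar> < r + h \<longrightarrow> norm (z - of_real a) \<le> 12 * h \<longrightarrow> norm (g z) \<le> A) \<longrightarrow>
     tensor_bound r I (\<lambda>s. ddset (\<lambda>x. g (of_real x)) (s ` I)) (C * (A / h ^ d))"
    using entire_criterion by blast
  then obtain C where C: "\<And>d. 0 \<le> C d" "\<And>d r g A h I. finite I \<and> card I = Suc d \<and> 0 \<le> A \<and> 0 < h \<and> g holomorphic_on UNIV \<and>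
     (\<forall>a z. \<bar>a\<bar> < r + h \<longrightarrow> norm (z - of_real a) \<le> 12 * h \<longrightarrow> norm (g z) \<le> A) \<Longrightarrow>
     tensor_bound r I (\<lambda>s. ddset (\<lambda>x. g (of_real x)) (s ` I)) (C d * (A / h ^ d))"
    by metis
  define Kj where "Kj j = C j * (2 * P * 48 ^ j * (2 * r) ^ (Suc k - j) * (2 * r) powr \<epsilon>)" for j
  define K where "K = (\<Sum>j\<le>Suc k. Kj j)"
  have Kj: "0 \<le> Kj j" for j using C P0 r by (simp add: Kj_def)
  have block: "tensor_bound r {..j} (\<lambda>s. ddset (\<lambda>x. G (Suc i) (of_real x) - G i (of_real x)) (s ` {..j})) (K * q ^ i)"
    if j: "j \<le> Suc k" for i j
  proof -
    have t: "tensor_bound r {..j} (\<lambda>s. ddset (\<lambda>x. (\<lambda>z. G (Suc i) z - G i z) (of_real x)) (s ` {..j}))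
      (C j * (2 * P * (\<delta> i ^ Suc k * \<delta> i powr \<epsilon>) / (\<delta> i / 48) ^ j))"
      by (rule C(2)) (use step d0[of i] P0 hG in \<open>auto intro!: holomorphic_intros\<close>)
    have e: "2 * P * (\<delta> i ^ Suc k * \<delta> i powr \<epsilon>) / (\<delta> i / 48) ^ j = 2 * P * 48 ^ j * \<delta> i ^ (Suc k - j) * \<delta> i powr \<epsilon>"
    proof -
      have "\<delta> i ^ Suc k = \<delta> i ^ (Suc k - j) * \<delta> i ^ j" using j by (simp flip: power_add)
      then show ?thesis using d0(1)[of i] by (simp add: power_divide del: power_Suc)
    qed
    have "C j * (2 * P * 48 ^ j * \<delta> i ^ (Suc k - j) * \<delta> i powr \<epsilon>) \<le> Kj j * q ^ i"
    proof -
      have "C j * (2 * P * 48 ^ j * \<delta> i ^ (Suc k - j) * \<delta> i powr \<epsilon>) \<le>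
          C j * (2 * P * 48 ^ j * (2 * r) ^ (Suc k - j) * \<delta> i powr \<epsilon>)"
        using C(1) P0 d0[of i] by (intro mult_left_mono mult_right_mono power_mono) auto
      also have "\<dots> = Kj j * q ^ i" by (simp only: dq Kj_def mult_ac)
      finally show ?thesis .
    qed
    also have "Kj j * q ^ i \<le> K * q ^ i"
      unfolding K_def using member_le_sum[of j "{..Suc k}" Kj] j Kj q by (intro mult_right_mono) auto
    finally show ?thesis using t unfolding e by (rule tensor_bound_mono[rotated])
  qed
  have "(\<lambda>i. K * q ^ i / (1 - q)) \<longlonglongrightarrow> 0"
    using LIMSEQ_power_zero[of q] q
    by (intro tendsto_divide_zero tendsto_mult_right_zero) auto
  then have "eventually (\<lambda>i. K * q ^ i / (1 - q) < e) sequentially"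
    using e by (rule order_tendstoD)
  then obtain N where N: "K * q ^ N / (1 - q) < e" by (auto simp: eventually_sequentially)
  show "\<exists>g. poly_approximable (Suc k) g \<and>
     (\<forall>i\<le>Suc k. tensor_bound r {..i} (\<lambda>s. ddset (\<lambda>x. f x - g x) (s ` {..i})) e)"
  proof (intro exI[of _ "\<lambda>x. G N (of_real x)"] conjI allI impI entire_poly_approximable hG)
    fix j assume j: "j \<le> Suc k"
    have g: "(\<lambda>i. K * q ^ (N + i)) sums (K * q ^ N * (1 / (1 - q)))"
      using sums_mult[OF geometric_sums[of q], of "K * q ^ N"] q by (simp add: power_add mult.assoc)
    have "tensor_bound r {..j} (\<lambda>s. ddset (\<lambda>x. f x - G N (of_real x)) (s ` {..j})) (\<Sum>i. K * q ^ (N + i))"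
    proof (rule tensor_bound_sums[OF block[OF j] sums_summable[OF g]])
      fix s :: "nat \<Rightarrow> real" assume s: "\<And>i. i \<in> {..j} \<Longrightarrow> s i \<in> {-r..r}"
      show "(\<lambda>i. ddset (\<lambda>x. G (Suc (N + i)) (of_real x) - G (N + i) (of_real x)) (s ` {..j})) sums
          ddset (\<lambda>x. f x - G N (of_real x)) (s ` {..j})"
      proof (rule ddset_sums)
        fix x assume "x \<in> s ` {..j}"
        then have "(\<lambda>i. G (i + N) (of_real x)) \<longlonglongrightarrow> f x"
          using s lim by (intro LIMSEQ_ignore_initial_segment) auto
        from telescope_sums[OF this]
        show "(\<lambda>i. G (Suc (N + i)) (of_real x) - G (N + i) (of_real x)) sums (f x - G N (of_real x))"
          by (simp add: add.commute)
      qed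
    qed
    then show "tensor_bound r {..j} (\<lambda>s. ddset (\<lambda>x. f x - G N (of_real x)) (s ` {..j})) e"
      by (rule tensor_bound_mono) (use g N in \<open>simp add: sums_iff\<close>)
  qed
qed

section \<open>Continuous extension of divided differences\<close>

lemma divdiff_raw_eq_ddset: "inj_on s {..i} \<Longrightarrow> divdiff_raw i f s = ddset f (s ` {..i})"
proof (induction i arbitrary: s)
  case (Suc i)
  define X where "X = s ` {..Suc i}"
  have ins: "{..i} = insert i {..<i}" by auto
  have ne: "s i \<noteq> s (Suc i)" using Suc.prems by (auto dest: inj_onD)
  have inj: "inj_on s {..i}" using Suc.prems by (rule inj_on_subset) auto
  have "{..Suc i} - {Suc i} = {..i}" by auto
  then have X1: "s ` {..i} = X - {s (Suc i)}"
    unfolding X_def using inj_on_image_set_diff[OF Suc.prems, of "{..Suc i}" "{Suc i}"] by auto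
  have "{..Suc i} - {i} = insert (Suc i) {..<i}" by auto
  then have X2: "(s(i := s (Suc i))) ` {..i} = X - {s i}"
    unfolding X_def using inj_on_image_set_diff[OF Suc.prems, of "{..Suc i}" "{i}"] by (auto simp: ins)
  have "s y \<noteq> s (Suc i)" if "y \<le> i" for y
    using inj_onD[OF Suc.prems, of y "Suc i"] that by auto
  with inj have inj2: "inj_on (s(i := s (Suc i))) {..i}"
    by (auto simp: inj_on_def) metis+
  have eq: "of_real (s i - s (Suc i)) * ddset f X = ddset f (X - {s (Suc i)}) - ddset f (X - {s i})"
    by (rule ddset_rec) (auto simp: X_def)
  show ?case
    unfolding divdiff_raw.simps Suc.IH[OF inj] Suc.IH[OF inj2] X1 X2 eq[symmetric] X_def[symmetric]
    using ne by (simp del: of_real_diff)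
qed simp

text \<open>The Hermite--Genocchi formula as a recursion in the order, peeling off one node.\<close>

fun hermite_genocchi :: "nat \<Rightarrow> (real \<Rightarrow> complex) \<Rightarrow> (nat \<Rightarrow> real) \<Rightarrow> complex" where
  "hermite_genocchi 0 f s = f (s 0)"
| "hermite_genocchi (Suc i) f s = integral {0..1}
     (\<lambda>t. of_real t ^ i * hermite_genocchi i (nderiv 1 f) (\<lambda>j. s 0 + t * (s (Suc j) - s 0)))"

lemma continuous_on_hermite_genocchi:
  "f \<in> Ck i \<Longrightarrow> continuous_on UNIV (hermite_genocchi i f)"
proof (induction i arbitrary: f)
  case 0
  then have "continuous_on UNIV f" by (simp add: Ck_def)
  then have "continuous_on UNIV (\<lambda>s :: nat \<Rightarrow> real. f (s 0))"
    by (rule continuous_on_compose2) auto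
  moreover have "hermite_genocchi 0 f = (\<lambda>s. f (s 0))" by auto
  ultimately show ?case by simp
next
  case (Suc i)
  have c: "continuous_on UNIV (hermite_genocchi i (nderiv 1 f))"
    by (intro Suc.IH Ck_nderiv_1 Suc.prems)
  have coord: "continuous_on A (\<lambda>z :: (nat \<Rightarrow> real) \<times> real. fst z j)" for A j
    by (rule continuous_on_compose2[OF continuous_on_product_coordinates[of j] continuous_on_fst]) auto
  have "continuous_on (UNIV \<times> cbox 0 (1::real)) (\<lambda>z. of_real (snd z) ^ i *
      hermite_genocchi i (nderiv 1 f) (\<lambda>j. fst z 0 + snd z * (fst z (Suc j) - fst z 0)))"
    by (intro continuous_on_mult continuous_on_power continuous_on_of_real continuous_on_snd
        continuous_on_id continuous_on_compose2[OF c] continuous_on_coordinatewise_then_product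
        continuous_on_add continuous_on_diff coord) auto
  then have "continuous_on UNIV (\<lambda>s. integral (cbox 0 1) (\<lambda>t. of_real t ^ i *
      hermite_genocchi i (nderiv 1 f) (\<lambda>j. s 0 + t * (s (Suc j) - s 0))))"
    by (intro integral_continuous_on_param) (simp add: case_prod_unfold)
  moreover have "hermite_genocchi (Suc i) f = (\<lambda>s. integral (cbox 0 1) (\<lambda>t. of_real t ^ i *
      hermite_genocchi i (nderiv 1 f) (\<lambda>j. s 0 + t * (s (Suc j) - s 0))))" by auto
  ultimately show ?case by simp
qed

lemma continuous_on_hermite_genocchi_path:
  assumes "f \<in> Ck i" "\<And>j. continuous_on S (\<lambda>t. \<gamma> t j)"
  shows "continuous_on S (\<lambda>t. hermite_genocchi i f (\<gamma> t))"
  by (rule continuous_on_compose2[OF continuous_on_hermite_genocchi[OF assms(1)]])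
    (auto intro: continuous_on_coordinatewise_then_product assms(2))

text \<open>The first order is the fundamental theorem of calculus. For higher orders the difference quotient
  in the last node is taken under the integral, where for \<open>t \<noteq> 0\<close> the contracted nodes are again
  distinct, with differences \<open>t\<close> times the original ones.\<close>

lemma divdiff_raw_eq_hermite_genocchi:
  "f \<in> Ck i \<Longrightarrow> inj_on s {..i} \<Longrightarrow> divdiff_raw i f s = hermite_genocchi i f s"
proof (induction i arbitrary: f s rule: less_induct)
  case (less i)
  consider "i = 0" | "i = 1" | k where "i = Suc (Suc k)"
    by (metis One_nat_def not0_implies_Suc)
  then show ?case
  proof cases
    case 1
    then show ?thesis by simp
  next
    case 2
    have ne: "s 0 \<noteq> s 1" using less.prems 2 by (auto dest: inj_onD)
    have "((\<lambda>t. of_real (s 1 - s 0) * nderiv 1 f (s 0 + t * (s 1 - s 0))) has_integral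
        (f (s 0 + 1 * (s 1 - s 0)) - f (s 0 + 0 * (s 1 - s 0)))) {0..1}"
    proof (rule fundamental_theorem_of_calculus)
      fix t :: real
      have "((\<lambda>t. s 0 + t * (s 1 - s 0)) has_vector_derivative (s 1 - s 0)) (at t within {0..1})"
        by (auto intro!: derivative_eq_intros)
      moreover have "(f has_vector_derivative nderiv 1 f (s 0 + t * (s 1 - s 0)))
          (at (s 0 + t * (s 1 - s 0)) within (\<lambda>t. s 0 + t * (s 1 - s 0)) ` {0..1})"
        using Ck_has_derivative[of f 1 0] less.prems 2
        by (auto intro: has_vector_derivative_at_within)
      ultimately have "(f \<circ> (\<lambda>t. s 0 + t * (s 1 - s 0)) has_vector_derivative
          (s 1 - s 0) *\<^sub>R nderiv 1 f (s 0 + t * (s 1 - s 0))) (at t within {0..1})"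
        by (rule vector_diff_chain_within)
      then show "((\<lambda>t. f (s 0 + t * (s 1 - s 0))) has_vector_derivative
          of_real (s 1 - s 0) * nderiv 1 f (s 0 + t * (s 1 - s 0))) (at t within {0..1})"
        by (simp add: o_def scaleR_conv_of_real del: of_real_diff)
    qed simp
    then have "of_real (s 1 - s 0) * integral {0..1} (\<lambda>t. nderiv 1 f (s 0 + t * (s 1 - s 0))) = f (s 1) - f (s 0)"
      by (simp add: has_integral_iff)
    then have "integral {0..1} (\<lambda>t. nderiv 1 f (s 0 + t * (s 1 - s 0))) = (f (s 1) - f (s 0)) / of_real (s 1 - s 0)"
      using ne by (simp add: field_simps)
    also have "\<dots> = (f (s 0) - f (s 1)) / of_real (s 0 - s 1)"
      by (metis minus_diff_eq minus_divide_divide of_real_minus)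
    finally show ?thesis using 2 by simp
  next
    case (3 k)
    define D where "D = nderiv 1 f"
    define s' where "s' = s(Suc k := s (Suc (Suc k)))"
    define \<sigma> where "\<sigma> u t j = u 0 + t * (u (Suc j) - u 0)" for u :: "nat \<Rightarrow> real" and t j
    have ne: "s (Suc k) \<noteq> s (Suc (Suc k))" using less.prems 3 by (auto dest: inj_onD)
    have f: "f \<in> Ck (Suc (Suc k))" using less.prems 3 by simp
    have D: "D \<in> Ck (Suc k)" "D \<in> Ck k"
      unfolding D_def using Ck_nderiv_1[OF f] by (auto intro: Ck_mono)
    have inj: "inj_on s {..Suc (Suc k)}" using less.prems 3 by simp
    have inj1: "inj_on s {..Suc k}" using inj by (rule inj_on_subset) auto
    have "s y \<noteq> s (Suc (Suc k))" if "y \<le> Suc k" for y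
      using inj_onD[OF inj, of y "Suc (Suc k)"] that by auto
    with inj1 have inj2: "inj_on s' {..Suc k}" by (auto simp: s'_def inj_on_def) metis+
    have int: "(\<lambda>t. of_real t ^ n * hermite_genocchi m D (\<sigma> u t)) integrable_on {0..1}"
      if "D \<in> Ck m" for u n m
      using that unfolding \<sigma>_def
      by (intro integrable_continuous_real continuous_intros continuous_on_hermite_genocchi_path)
    have "divdiff_raw i f s = (hermite_genocchi (Suc k) f s - hermite_genocchi (Suc k) f s') / of_real (s (Suc k) - s (Suc (Suc k)))"
      using less.IH[of "Suc k" f s] less.IH[of "Suc k" f s'] Ck_mono[OF f, of "Suc k"] inj1 inj2 3
      by (simp add: s'_def[symmetric])
    also have "hermite_genocchi (Suc k) f s - hermite_genocchi (Suc k) f s' =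
       integral {0..1} (\<lambda>t. of_real t ^ k * hermite_genocchi k D (\<sigma> s t) - of_real t ^ k * hermite_genocchi k D (\<sigma> s' t))"
    proof -
      have "hermite_genocchi (Suc k) f u = integral {0..1} (\<lambda>t. of_real t ^ k * hermite_genocchi k D (\<sigma> u t))" for u
        by (simp only: hermite_genocchi.simps(2)[of k f u] D_def \<sigma>_def[abs_def])
      then show ?thesis by (simp only: integral_diff[OF int[OF D(2)] int[OF D(2)]])
    qed
    also have "\<dots> = integral {0..1} (\<lambda>t. of_real (s (Suc k) - s (Suc (Suc k))) *
        (of_real t ^ Suc k * hermite_genocchi (Suc k) D (\<sigma> s t)))"
    proof (rule integral_spike[of "{0}"])
      fix t :: real assume t: "t \<in> {0..1} - {0}"
      have i1: "inj_on (\<sigma> s t) {..Suc k}"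
      proof (rule inj_onI)
        fix a b assume ab: "a \<in> {..Suc k}" "b \<in> {..Suc k}" "\<sigma> s t a = \<sigma> s t b"
        then have "s (Suc a) = s (Suc b)" using t by (simp add: \<sigma>_def)
        then show "a = b" using inj ab by (auto dest: inj_onD)
      qed
      have i2: "inj_on (\<sigma> s t) {..k}" using i1 by (rule inj_on_subset) auto
      have s't: "\<sigma> s' t j = (if j = k then \<sigma> s t (Suc k) else \<sigma> s t j)" if "j \<le> k" for j
        using that by (auto simp: \<sigma>_def s'_def)
      have im: "\<sigma> s' t ` {..k} = (\<sigma> s t)(k := \<sigma> s t (Suc k)) ` {..k}"
        by (rule image_cong) (auto simp: s't)
      have "\<sigma> s t y \<noteq> \<sigma> s t (Suc k)" if "y \<le> k" for y
        using inj_onD[OF i1, of y "Suc k"] that by auto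
      with i2 have i4: "inj_on ((\<sigma> s t)(k := \<sigma> s t (Suc k))) {..k}"
        by (auto simp: inj_on_def) metis+
      have "inj_on (\<sigma> s' t) {..k} \<longleftrightarrow> inj_on ((\<sigma> s t)(k := \<sigma> s t (Suc k))) {..k}"
        by (rule inj_on_cong) (auto simp: s't)
      with i4 have i3: "inj_on (\<sigma> s' t) {..k}" by blast
      have "hermite_genocchi k D (\<sigma> s t) - hermite_genocchi k D (\<sigma> s' t) =
          divdiff_raw k D (\<sigma> s t) - divdiff_raw k D ((\<sigma> s t)(k := \<sigma> s t (Suc k)))"
        using less.IH[of k D "\<sigma> s t"] less.IH[of k D "\<sigma> s' t"] 3 D i2 i3 i4
        by (simp add: divdiff_raw_eq_ddset im)
      also have "\<dots> = of_real (\<sigma> s t k - \<sigma> s t (Suc k)) * divdiff_raw (Suc k) D (\<sigma> s t)"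
      proof -
        have "\<sigma> s t k \<noteq> \<sigma> s t (Suc k)" using i1 by (auto dest: inj_onD)
        then show ?thesis by (simp del: of_real_diff)
      qed
      also have "\<sigma> s t k - \<sigma> s t (Suc k) = t * (s (Suc k) - s (Suc (Suc k)))"
        by (simp add: \<sigma>_def algebra_simps)
      also have "divdiff_raw (Suc k) D (\<sigma> s t) = hermite_genocchi (Suc k) D (\<sigma> s t)"
        by (rule less.IH) (use 3 D i1 in auto)
      finally show "of_real (s (Suc k) - s (Suc (Suc k))) * (of_real t ^ Suc k * hermite_genocchi (Suc k) D (\<sigma> s t)) =
          of_real t ^ k * hermite_genocchi k D (\<sigma> s t) - of_real t ^ k * hermite_genocchi k D (\<sigma> s' t)"
        by (simp only: right_diff_distrib[symmetric]) (simp only: of_real_mult power_Suc mult_ac)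
    qed simp
    also have "\<dots> = of_real (s (Suc k) - s (Suc (Suc k))) * hermite_genocchi i f s"
    proof -
      have "hermite_genocchi i f s = integral {0..1} (\<lambda>t. of_real t ^ Suc k * hermite_genocchi (Suc k) D (\<sigma> s t))"
        by (simp only: 3 hermite_genocchi.simps(2)[of "Suc k" f s] D_def \<sigma>_def[abs_def])
      then show ?thesis by (simp only: integral_mult_right)
    qed
    finally show ?thesis using ne by (simp del: of_real_diff)
  qed
qed

lemma eventually_inj_on_path:
  fixes s w :: "nat \<Rightarrow> real"
  assumes w: "inj_on w I" and I: "finite I"
  shows "eventually (\<lambda>t. inj_on (\<lambda>j. s j + t * (w j - s j)) I) (at 0)"
proof -
  have "eventually (\<lambda>t. s j + t * (w j - s j) \<noteq> s l + t * (w l - s l)) (at 0)"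
    if "j \<in> I" "l \<in> I" "j \<noteq> l" for j l
  proof (cases "s j = s l")
    case True
    have "eventually (\<lambda>t::real. t \<noteq> 0) (at 0)" by (simp add: eventually_at_filter)
    then show ?thesis
      by eventually_elim (use True w that in \<open>auto dest: inj_onD\<close>)
  next
    case False
    have "((\<lambda>t. (s j + t * (w j - s j)) - (s l + t * (w l - s l))) \<longlongrightarrow> s j - s l) (at 0)"
      by (auto intro!: tendsto_eq_intros)
    then have "eventually (\<lambda>t. (s j + t * (w j - s j)) - (s l + t * (w l - s l)) \<noteq> 0) (at 0)"
      using False by (intro tendsto_imp_eventually_ne) auto
    then show ?thesis by eventually_elim auto
  qed
  then have "eventually (\<lambda>t. j \<noteq> l \<longrightarrow> s j + t * (w j - s j) \<noteq> s l + t * (w l - s l)) (at 0)"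
    if "j \<in> I" "l \<in> I" for j l
    using that by (cases "j = l") auto
  then have "eventually (\<lambda>t. \<forall>j\<in>I. \<forall>l\<in>I. j \<noteq> l \<longrightarrow> s j + t * (w j - s j) \<noteq> s l + t * (w l - s l)) (at 0)"
    using I by (intro eventually_ball_finite ballI) auto
  then show ?thesis by eventually_elim (auto simp: inj_on_def)
qed

text \<open>From any point a segment towards a point with distinct entries meets coincidences only at
  finitely many parameters, so a function that is continuous along it is determined by the raw
  divided differences.\<close>

lemma hermite_genocchi_eqI:
  assumes f: "f \<in> Ck i" and w: "inj_on w {..i}"
    and \<psi>: "continuous_on {0..1} (\<lambda>t. \<psi> (\<lambda>j. s j + t * (w j - s j)))"
    and eq: "\<And>t. 0 \<le> t \<Longrightarrow> t \<le> 1 \<Longrightarrow> inj_on (\<lambda>j. s j + t * (w j - s j)) {..i} \<Longrightarrow>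
       \<psi> (\<lambda>j. s j + t * (w j - s j)) = divdiff_raw i f (\<lambda>j. s j + t * (w j - s j))"
  shows "\<psi> s = hermite_genocchi i f s"
proof -
  define \<gamma> where "\<gamma> t j = s j + t * (w j - s j)" for t j
  have "continuous_on {0..1} (\<lambda>t. hermite_genocchi i f (\<gamma> t))"
    unfolding \<gamma>_def by (intro continuous_on_hermite_genocchi_path f continuous_intros)
  then have 1: "((\<lambda>t. hermite_genocchi i f (\<gamma> t)) \<longlongrightarrow> hermite_genocchi i f (\<gamma> 0)) (at 0 within {0..1})"
    by (simp add: continuous_on_def)
  have 2: "((\<lambda>t. \<psi> (\<gamma> t)) \<longlongrightarrow> \<psi> (\<gamma> 0)) (at 0 within {0..1})"
    using \<psi>[unfolded continuous_on_def, rule_format, of 0] by (simp add: \<gamma>_def[abs_def])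
  have "eventually (\<lambda>t. inj_on (\<gamma> t) {..i}) (at 0 within {0..1})"
    using eventually_inj_on_path[OF w, of s] unfolding \<gamma>_def
    by (auto elim: filter_leD[OF at_le, rotated])
  moreover have "eventually (\<lambda>t. t \<in> {0..1}) (at (0::real) within {0..1})"
    by (simp add: eventually_at_filter)
  ultimately have "eventually (\<lambda>t. hermite_genocchi i f (\<gamma> t) = \<psi> (\<gamma> t)) (at 0 within {0..1})"
  proof eventually_elim
    case (elim t)
    then show ?case
      using eq[of t] divdiff_raw_eq_hermite_genocchi[OF f, of "\<gamma> t"] by (simp add: \<gamma>_def[abs_def])
  qed
  from tendsto_cong[OF this] 1 have "((\<lambda>t. \<psi> (\<gamma> t)) \<longlongrightarrow> hermite_genocchi i f (\<gamma> 0)) (at 0 within {0..1})" by simp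
  moreover have "at (0::real) within {0..1} \<noteq> bot" by (simp add: trivial_limit_within islimpt_Icc)
  ultimately have "\<psi> (\<gamma> 0) = hermite_genocchi i f (\<gamma> 0)" using 2 tendsto_unique by blast
  moreover have "\<gamma> 0 = s" by (simp add: \<gamma>_def fun_eq_iff)
  ultimately show ?thesis by simp
qed

text \<open>The Hermite--Genocchi integral is one continuous extension, and any other agrees with it.\<close>

lemma divdiff_eq_hermite_genocchi:
  assumes f: "f \<in> Ck i" and s: "s \<in> topspace (powertop_real {..i})"
  shows "divdiff i f s = hermite_genocchi i f s"
proof -
  let ?P = "\<lambda>\<phi>. continuous_map (powertop_real {..i}) euclidean \<phi> \<and>
     (\<forall>s \<in> topspace (powertop_real {..i}). inj_on s {..i} \<longrightarrow> \<phi> s = divdiff_raw i f s)"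
  have "continuous_map (powertop_real {..i}) euclidean (\<lambda>s :: nat \<Rightarrow> real. s j)" for j
  proof (cases "j \<in> {..i}")
    case True
    then show ?thesis by (rule continuous_map_product_projection)
  next
    case False
    have "continuous_map (powertop_real {..i}) euclidean (\<lambda>_. undefined :: real)" by simp
    then show ?thesis
      by (rule continuous_map_eq) (use False in \<open>auto simp: PiE_iff extensional_def\<close>)
  qed
  then have "continuous_map (powertop_real {..i}) (powertop_real UNIV) (\<lambda>s. s)"
    by (simp add: continuous_map_componentwise_UNIV)
  then have id: "continuous_map (powertop_real {..i}) euclidean (\<lambda>s. s)"
    by (simp add: euclidean_product_topology)
  have "continuous_map euclidean euclidean (hermite_genocchi i f)"
    using continuous_on_hermite_genocchi[OF f] by simp
  from continuous_map_compose[OF id this]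
  have "?P (hermite_genocchi i f)"
    by (auto simp: o_def divdiff_raw_eq_hermite_genocchi[OF f])
  then have "?P (divdiff i f)" unfolding divdiff_def by (rule someI[of ?P])
  then have D: "continuous_map (powertop_real {..i}) euclidean (divdiff i f)"
    "\<And>s. s \<in> topspace (powertop_real {..i}) \<Longrightarrow> inj_on s {..i} \<Longrightarrow> divdiff i f s = divdiff_raw i f s"
    by blast+
  define w where "w j = (if j \<in> {..i} then real j else undefined)" for j
  have ext: "(\<lambda>j. s j + t * (w j - s j)) \<in> topspace (powertop_real {..i})" for t
    using s by (auto simp: w_def PiE_iff extensional_def)
  show ?thesis
  proof (rule hermite_genocchi_eqI[OF f])
    show "inj_on w {..i}" by (auto simp: w_def inj_on_def)
    have "continuous_map euclideanreal (powertop_real {..i}) (\<lambda>t j. s j + t * (w j - s j))"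
      unfolding continuous_map_componentwise using ext
      by (auto simp: PiE_iff intro!: continuous_intros)
    from continuous_map_compose[OF this D(1)]
    have "continuous_on UNIV (\<lambda>t. divdiff i f (\<lambda>j. s j + t * (w j - s j)))"
      by (simp add: o_def)
    then show "continuous_on {0..1} (\<lambda>t. divdiff i f (\<lambda>j. s j + t * (w j - s j)))"
      by (rule continuous_on_subset) simp
  qed (use D(2) ext in blast)
qed

lemma hermite_genocchi_add:
  assumes f: "f \<in> Ck i" and g: "g \<in> Ck i"
  shows "hermite_genocchi i (\<lambda>x. f x + g x) s = hermite_genocchi i f s + hermite_genocchi i g s"
proof (rule hermite_genocchi_eqI[OF Ck_add(1)[OF f g], symmetric])
  show "inj_on real {..i}" by simp
  show "continuous_on {0..1} (\<lambda>t. hermite_genocchi i f (\<lambda>j. s j + t * (real j - s j)) +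
      hermite_genocchi i g (\<lambda>j. s j + t * (real j - s j)))"
    by (intro continuous_on_add continuous_on_hermite_genocchi_path f g continuous_intros)
  fix t assume "inj_on (\<lambda>j. s j + t * (real j - s j)) {..i}"
  then show "hermite_genocchi i f (\<lambda>j. s j + t * (real j - s j)) + hermite_genocchi i g (\<lambda>j. s j + t * (real j - s j)) =
      divdiff_raw i (\<lambda>x. f x + g x) (\<lambda>j. s j + t * (real j - s j))"
    by (simp add: divdiff_raw_eq_hermite_genocchi[OF f, symmetric] divdiff_raw_eq_hermite_genocchi[OF g, symmetric]
        divdiff_raw_eq_ddset ddset_add)
qed

section \<open>Varopoulos norms\<close>

lemma prod_mono_ennreal:
  fixes f g :: "'a \<Rightarrow> ennreal"
  assumes "finite A" "\<And>i. i \<in> A \<Longrightarrow> f i \<le> g i"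
  shows "prod f A \<le> prod g A"
  using assms by (induction A rule: finite_induct) (auto intro: mult_mono)

text \<open>An expansion known at points with distinct entries holds on the whole cube, because both
  sides are continuous along a segment towards a point with distinct entries.\<close>

lemma varopoulos_norm_le:
  assumes V: "tensor_bound r {..i} (\<lambda>s. ddset f (s ` {..i})) B" and r: "0 < r" and f: "f \<in> Ck i"
  shows "varopoulos_norm r (i + 1) (divdiff i f) \<le> ennreal B"
proof -
  obtain a :: "nat \<Rightarrow> complex" and \<Phi> where
    w: "\<And>j n. j \<in> {..i} \<Longrightarrow> continuous_on {-r..r} (\<Phi> j n)"
       "\<And>j n x. j \<in> {..i} \<Longrightarrow> x \<in> {-r..r} \<Longrightarrow> norm (\<Phi> j n x) \<le> 1"
    and a: "summable (\<lambda>n. norm (a n))" "(\<Sum>n. norm (a n)) \<le> B"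
    and s: "\<And>s. (\<And>j. j \<in> {..i} \<Longrightarrow> s j \<in> {-r..r}) \<Longrightarrow> inj_on s {..i} \<Longrightarrow>
           (\<lambda>n. a n * (\<Prod>j\<in>{..i}. \<Phi> j n (s j))) sums ddset f (s ` {..i})"
    by (rule tensor_boundE[OF V]) blast
  have split: "{..<i + 1} = insert 0 {0<..i}" "{..i} = insert 0 {0<..i}" by auto
  define \<Psi> where "\<Psi> j n x = (if j = 0 then a n * \<Phi> 0 n x else \<Phi> j n x)" for j n x
  have prod: "(\<Prod>j<i + 1. \<Psi> j n (u j)) = a n * (\<Prod>j\<in>{..i}. \<Phi> j n (u j))" for n u
    unfolding split by (simp add: \<Psi>_def)
  have sup: "sup_norm_on {-r..r} (\<Psi> j n) \<le> (if j = 0 then ennreal (norm (a n)) else 1)" if "j \<le> i" for j n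
    unfolding sup_norm_on_def
  proof (rule SUP_least)
    fix x assume x: "x \<in> {-r..r}"
    show "ennreal (norm (\<Psi> j n x)) \<le> (if j = 0 then ennreal (norm (a n)) else 1)"
      using w(2)[of j x n] that x
      by (auto simp: \<Psi>_def norm_mult ennreal_le_1 intro!: ennreal_leI mult_left_le)
  qed
  have le: "(\<Prod>j<i + 1. sup_norm_on {-r..r} (\<Psi> j n)) \<le> ennreal (norm (a n))" for n
  proof -
    have "(\<Prod>j<i + 1. sup_norm_on {-r..r} (\<Psi> j n)) \<le> (\<Prod>j<i + 1. if j = 0 then ennreal (norm (a n)) else 1)"
      by (intro prod_mono_ennreal) (use sup in auto)
    also have "\<dots> = ennreal (norm (a n))" unfolding split by simp
    finally show ?thesis .
  qed
  have "(\<Sum>n. \<Prod>j<i + 1. sup_norm_on {-r..r} (\<Psi> j n)) \<le> (\<Sum>n. ennreal (norm (a n)))"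
    by (intro suminf_le le) auto
  also have "\<dots> = ennreal (\<Sum>n. norm (a n))" by (rule suminf_ennreal2) (use a in auto)
  also have "\<dots> \<le> ennreal B" using a(2) by (rule ennreal_leI)
  finally have tot: "(\<Sum>n. \<Prod>j<i + 1. sup_norm_on {-r..r} (\<Psi> j n)) \<le> ennreal B" .
  have bound: "norm (a n * (\<Prod>j\<in>{..i}. \<Phi> j n (u j))) \<le> norm (a n)" if "\<And>j. j \<le> i \<Longrightarrow> u j \<in> {-r..r}" for u n
    unfolding norm_mult prod_norm[symmetric]
    by (intro mult_left_le prod_le_1) (use w(2) that in auto)
  have sums: "(\<lambda>n. \<Prod>j<i + 1. \<Psi> j n (u j)) sums divdiff i f u" if u: "u \<in> {..<i + 1} \<rightarrow>\<^sub>E {-r..r}" for u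
  proof -
    have uj: "u j \<in> {-r..r}" if "j \<le> i" for j using u that by (auto simp: PiE_iff)
    have top: "u \<in> topspace (powertop_real {..i})" using u by (auto simp: PiE_iff lessThan_Suc_atMost)
    define v where "v j = r * (real j / real (i + 1))" for j
    have v: "v j \<in> {-r..r}" if "j \<le> i" for j
      using that r by (auto simp: v_def divide_le_eq mult_left_le intro: order_trans[of _ 0])
    have path: "u j + t * (v j - u j) \<in> {-r..r}" if "j \<le> i" "0 \<le> t" "t \<le> 1" for j t
    proof -
      have "(1 - t) * u j + t * v j \<in> {-r..r}"
        using convexD[OF convex_real_interval(5)[of "-r" r] uj[OF that(1)] v[OF that(1)], of "1 - t" t] that by simp
      then show ?thesis by (simp add: algebra_simps)
    qed
    define \<psi> where "\<psi> u = (\<Sum>n. a n * (\<Prod>j\<in>{..i}. \<Phi> j n (u j)))" for u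
    have "\<psi> u = hermite_genocchi i f u"
    proof (rule hermite_genocchi_eqI[OF f])
      show "inj_on v {..i}" using r by (auto simp: v_def inj_on_def)
      have "uniform_limit {0..1} (\<lambda>N t. \<Sum>n<N. a n * (\<Prod>j\<in>{..i}. \<Phi> j n (u j + t * (v j - u j))))
          (\<lambda>t. \<Sum>n. a n * (\<Prod>j\<in>{..i}. \<Phi> j n (u j + t * (v j - u j)))) sequentially"
        by (rule Weierstrass_m_test[OF _ a(1)]) (rule bound, use path in auto)
      moreover have "continuous_on {0..1} (\<lambda>t. \<Sum>n<N. a n * (\<Prod>j\<in>{..i}. \<Phi> j n (u j + t * (v j - u j))))" for N
        by (intro continuous_on_sum continuous_on_mult continuous_on_const continuous_on_prod
            continuous_on_compose2[OF w(1)] continuous_intros) (use path in auto)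
      ultimately show "continuous_on {0..1} (\<lambda>t. \<psi> (\<lambda>j. u j + t * (v j - u j)))"
        unfolding \<psi>_def by (intro uniform_limit_theorem[OF always_eventually]) auto
      fix t :: real assume t: "0 \<le> t" "t \<le> 1" "inj_on (\<lambda>j. u j + t * (v j - u j)) {..i}"
      then show "\<psi> (\<lambda>j. u j + t * (v j - u j)) = divdiff_raw i f (\<lambda>j. u j + t * (v j - u j))"
        using s[of "\<lambda>j. u j + t * (v j - u j)"] path unfolding \<psi>_def
        by (simp add: divdiff_raw_eq_ddset sums_iff)
    qed
    moreover have "summable (\<lambda>n. a n * (\<Prod>j\<in>{..i}. \<Phi> j n (u j)))"
      by (rule summable_norm_cancel, rule summable_comparison_test'[OF a(1), of 0])
        (use bound[of u] uj in simp)
    ultimately show ?thesis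
      unfolding prod divdiff_eq_hermite_genocchi[OF f top] \<psi>_def by (simp add: sums_iff)
  qed
  show ?thesis
    unfolding varopoulos_norm_def
  proof (rule order_trans[OF Inf_lower tot], rule CollectI, rule exI[of _ \<Psi>], intro conjI allI impI ballI)
    show "continuous_on {-r..r} (\<Psi> j n)" if "j < i + 1" for j n
      using w(1)[of j n] w(1)[of 0 n] that by (cases "j = 0") (auto simp: \<Psi>_def intro!: continuous_intros)
    show "(\<Sum>n. \<Prod>j<i + 1. sup_norm_on {-r..r} (\<Psi> j n)) < \<infinity>"
      using tot by (rule order.strict_trans1) simp
  qed (use sums in auto)
qed

lemma complex_sums_if:
  fixes f g :: "nat \<Rightarrow> complex"
  assumes "g sums x" "f sums y"
  shows "(\<lambda>n. if even n then f (n div 2) else g ((n - 1) div 2)) sums (x + y)"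
  using sums_if[of "\<lambda>n. Re (g n)" "Re x" "\<lambda>n. Re (f n)" "Re y"]
    sums_if[of "\<lambda>n. Im (g n)" "Im x" "\<lambda>n. Im (f n)" "Im y"] assms
  unfolding sums_complex_iff if_distrib[of Re] if_distrib[of Im] by simp

text \<open>The triangle inequality in the form in which balls of the seminorm topology use it:
  interleave two expansions.\<close>

lemma varopoulos_norm_less_add:
  assumes \<phi>1: "varopoulos_norm r m \<phi>1 < ennreal x" and \<phi>2: "varopoulos_norm r m \<phi>2 < ennreal y"
    and eq: "\<And>s. s \<in> {..<m} \<rightarrow>\<^sub>E {-r..r} \<Longrightarrow> \<phi> s = \<phi>1 s + \<phi>2 s"
  shows "varopoulos_norm r m \<phi> < ennreal (x + y)"
proof -
  define N where "N \<Phi> n = (\<Prod>i<m. sup_norm_on {-r..r} (\<Phi> i n))" for \<Phi> :: "nat \<Rightarrow> nat \<Rightarrow> real \<Rightarrow> complex" and n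
  define ok where "ok \<Phi> \<psi> \<longleftrightarrow> (\<forall>i<m. \<forall>n. continuous_on {-r..r} (\<Phi> i n)) \<and> (\<Sum>n. N \<Phi> n) < \<infinity> \<and>
     (\<forall>s \<in> {..<m} \<rightarrow>\<^sub>E {-r..r}. (\<lambda>n. \<Prod>i<m. \<Phi> i n (s i)) sums \<psi> s)"
    for \<Phi> :: "nat \<Rightarrow> nat \<Rightarrow> real \<Rightarrow> complex" and \<psi>
  have V: "varopoulos_norm r m \<psi> = Inf {\<Sum>n. N \<Phi> n |\<Phi>. ok \<Phi> \<psi>}" for \<psi>
    by (simp add: varopoulos_norm_def N_def ok_def)
  obtain \<Phi>1 where \<Phi>1: "ok \<Phi>1 \<phi>1" "(\<Sum>n. N \<Phi>1 n) < ennreal x"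
    using \<phi>1 unfolding V Inf_less_iff by blast
  obtain \<Phi>2 where \<Phi>2: "ok \<Phi>2 \<phi>2" "(\<Sum>n. N \<Phi>2 n) < ennreal y"
    using \<phi>2 unfolding V Inf_less_iff by blast
  have pos: "0 < x" "0 < y"
    using \<phi>1 \<phi>2 by (metis ennreal_eq_0_iff linorder_not_less not_less_zero)+
  define \<Phi> where "\<Phi> i n = (if even n then \<Phi>1 i (n div 2) else \<Phi>2 i ((n - 1) div 2))" for i n
  have N: "N \<Phi> n = (if even n then N \<Phi>1 (n div 2) else N \<Phi>2 ((n - 1) div 2))" for n
    by (simp add: N_def \<Phi>_def)
  have partial: "(\<Sum>n<2 * M. N \<Phi> n) = (\<Sum>n<M. N \<Phi>1 n) + (\<Sum>n<M. N \<Phi>2 n)" for M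
    by (induction M) (simp_all add: N add_ac)
  have le: "(\<Sum>n. N \<Phi> n) \<le> (\<Sum>n. N \<Phi>1 n) + (\<Sum>n. N \<Phi>2 n)"
  proof (rule suminf_le_const)
    fix M
    have "(\<Sum>n<M. N \<Phi> n) \<le> (\<Sum>n<2 * M. N \<Phi> n)" by (rule sum_mono2) auto
    also have "\<dots> \<le> (\<Sum>n. N \<Phi>1 n) + (\<Sum>n. N \<Phi>2 n)"
      unfolding partial by (intro add_mono sum_le_suminf) auto
    finally show "(\<Sum>n<M. N \<Phi> n) \<le> (\<Sum>n. N \<Phi>1 n) + (\<Sum>n. N \<Phi>2 n)" .
  qed auto
  have "ok \<Phi> \<phi>"
    unfolding ok_def
  proof (intro conjI allI impI ballI)
    show "continuous_on {-r..r} (\<Phi> i n)" if "i < m" for i n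
      using \<Phi>1(1) \<Phi>2(1) that by (simp add: \<Phi>_def ok_def)
    show "(\<Sum>n. N \<Phi> n) < \<infinity>"
      using le \<Phi>1(1) \<Phi>2(1) by (auto simp: ok_def intro: order.strict_trans1)
    fix s assume s: "s \<in> {..<m} \<rightarrow>\<^sub>E {-r..r}"
    have "(\<lambda>n. if even n then (\<Prod>i<m. \<Phi>1 i (n div 2) (s i)) else (\<Prod>i<m. \<Phi>2 i ((n - 1) div 2) (s i)))
        sums (\<phi>2 s + \<phi>1 s)"
      using \<Phi>1(1) \<Phi>2(1) s by (intro complex_sums_if) (auto simp: ok_def)
    moreover have "(\<lambda>n. if even n then (\<Prod>i<m. \<Phi>1 i (n div 2) (s i)) else (\<Prod>i<m. \<Phi>2 i ((n - 1) div 2) (s i))) =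
        (\<lambda>n. \<Prod>i<m. \<Phi> i n (s i))"
      by (auto simp: \<Phi>_def)
    ultimately show "(\<lambda>n. \<Prod>i<m. \<Phi> i n (s i)) sums \<phi> s"
      using eq[OF s] by (simp add: add.commute)
  qed
  then have "varopoulos_norm r m \<phi> \<le> (\<Sum>n. N \<Phi> n)" unfolding V by (intro Inf_lower) blast
  also note le
  also have "(\<Sum>n. N \<Phi>1 n) + (\<Sum>n. N \<Phi>2 n) < ennreal x + ennreal y"
    using \<Phi>1(2) \<Phi>2(2) by (rule add_strict_mono)
  also have "\<dots> = ennreal (x + y)" using pos by simp
  finally show ?thesis .
qed

section \<open>Topologies given by seminorms\<close>

text \<open>A triangle inequality for differences, in terms of radii of balls. It is demanded only inside \<open>S\<close>,
  since a seminorm may be meaningful only there.\<close>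

definition triangle_family :: "(real \<Rightarrow> complex) set \<Rightarrow> ((real \<Rightarrow> complex) \<Rightarrow> ennreal) set \<Rightarrow> bool" where
  "triangle_family S P \<longleftrightarrow> (\<forall>p\<in>P. \<forall>f\<in>S. \<forall>g\<in>S. \<forall>h\<in>S. \<forall>x y.
     p (\<lambda>z. f z - g z) < ennreal x \<longrightarrow> p (\<lambda>z. g z - h z) < ennreal y \<longrightarrow>
     p (\<lambda>z. f z - h z) < ennreal (x + y))"

text \<open>The generating sets are balls around arbitrary centres; the triangle inequality turns
  them into balls around a given point.\<close>

lemma seminorm_topology_ball:
  assumes tri: "triangle_family S P"
    and U: "openin (seminorm_topology S P) U" and h: "h \<in> U"
  shows "\<exists>Q \<delta>. finite Q \<and> Q \<subseteq> P \<and> 0 < \<delta> \<and> {g \<in> S. \<forall>p\<in>Q. p (\<lambda>z. g z - h z) < ennreal \<delta>} \<subseteq> U"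
proof -
  have "generate_topology_on (insert S {{g \<in> S. p (\<lambda>x. g x - f x) < ennreal e} |p f e. p \<in> P \<and> f \<in> S \<and> 0 < e}) U"
    using U unfolding seminorm_topology_def by (rule openin_topology_generated_by)
  then show ?thesis using h
  proof (induction rule: generate_topology_on.induct)
    case (Int a b)
    then obtain Q1 \<delta>1 Q2 \<delta>2 where 1: "finite Q1" "Q1 \<subseteq> P" "0 < \<delta>1" "{g \<in> S. \<forall>p\<in>Q1. p (\<lambda>z. g z - h z) < ennreal \<delta>1} \<subseteq> a"
      and 2: "finite Q2" "Q2 \<subseteq> P" "0 < \<delta>2" "{g \<in> S. \<forall>p\<in>Q2. p (\<lambda>z. g z - h z) < ennreal \<delta>2} \<subseteq> b"
      by auto
    have "ennreal (min \<delta>1 \<delta>2) \<le> ennreal \<delta>1" "ennreal (min \<delta>1 \<delta>2) \<le> ennreal \<delta>2"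
      by (auto intro: ennreal_leI)
    then have "{g \<in> S. \<forall>p\<in>Q1 \<union> Q2. p (\<lambda>z. g z - h z) < ennreal (min \<delta>1 \<delta>2)} \<subseteq> a \<inter> b"
      using 1(4) 2(4) by (auto dest: order.strict_trans2)
    then show ?case using 1 2 by (intro exI[of _ "Q1 \<union> Q2"] exI[of _ "min \<delta>1 \<delta>2"]) auto
  next
    case (UN K)
    then obtain k where k: "k \<in> K" "h \<in> k" by blast
    from UN.IH[OF k] obtain Q \<delta> where "finite Q" "Q \<subseteq> P" "0 < \<delta>"
      "{g \<in> S. \<forall>p\<in>Q. p (\<lambda>z. g z - h z) < ennreal \<delta>} \<subseteq> k" by blast
    then show ?case using k by (intro exI[of _ Q] exI[of _ \<delta>]) blast
  next
    case (Basis s)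
    consider "s = S" | p f e where "p \<in> P" "f \<in> S" "0 < e" "s = {g \<in> S. p (\<lambda>x. g x - f x) < ennreal e}"
      using Basis.hyps by blast
    then show ?case
    proof cases
      case 1
      then show ?thesis by (intro exI[of _ "{}"] exI[of _ 1]) auto
    next
      case (2 p f e)
      then have h: "h \<in> S" "p (\<lambda>x. h x - f x) < ennreal e" using Basis.prems by auto
      obtain \<rho> where \<rho>: "0 \<le> \<rho>" "p (\<lambda>x. h x - f x) < ennreal \<rho>" "\<rho> < e"
      proof -
        obtain c where c: "p (\<lambda>x. h x - f x) < c" "c < ennreal e" using dense[OF h(2)] by blast
        then have "c < top" by (meson ennreal_less_top order.strict_trans)
        then have "c = ennreal (enn2real c)" by simp
        with c show ?thesis using that[of "enn2real c"] by (metis enn2real_nonneg ennreal_less_iff)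
      qed
      have "{g \<in> S. \<forall>q\<in>{p}. q (\<lambda>z. g z - h z) < ennreal (e - \<rho>)} \<subseteq> s"
        using tri[unfolded triangle_family_def, rule_format, of p _ h f "e - \<rho>" \<rho>] 2 h \<rho> by auto
      then show ?thesis using 2 \<rho> by (intro exI[of _ "{p}"] exI[of _ "e - \<rho>"]) auto
    qed
  qed simp
qed

lemma divdiff_diff_decompose:
  assumes "f \<in> Ck i" "g \<in> Ck i" "h \<in> Ck i" "s \<in> topspace (powertop_real {..i})"
  shows "divdiff i (\<lambda>z. f z - h z) s = divdiff i (\<lambda>z. f z - g z) s + divdiff i (\<lambda>z. g z - h z) s"
  unfolding divdiff_eq_hermite_genocchi[OF Ck_diff[OF assms(1,3)] assms(4)]
    divdiff_eq_hermite_genocchi[OF Ck_diff[OF assms(1,2)] assms(4)]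
    divdiff_eq_hermite_genocchi[OF Ck_diff[OF assms(2,3)] assms(4)]
  using hermite_genocchi_add[OF Ck_diff[OF assms(1,2)] Ck_diff[OF assms(2,3)], of s] by simp

lemma tensor_bound_radius_mono:
  assumes V: "tensor_bound r I \<phi> B" and "r' \<le> r"
  shows "tensor_bound r' I \<phi> B"
proof -
  obtain a :: "nat \<Rightarrow> complex" and \<Phi> where
    w: "\<And>i n. i \<in> I \<Longrightarrow> continuous_on {-r..r} (\<Phi> i n)"
       "\<And>i n x. i \<in> I \<Longrightarrow> x \<in> {-r..r} \<Longrightarrow> norm (\<Phi> i n x) \<le> 1"
    and a: "summable (\<lambda>n. norm (a n))" "(\<Sum>n. norm (a n)) \<le> B"
    and s: "\<And>s. (\<And>i. i \<in> I \<Longrightarrow> s i \<in> {-r..r}) \<Longrightarrow> inj_on s I \<Longrightarrow>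
           (\<lambda>n. a n * (\<Prod>i\<in>I. \<Phi> i n (s i))) sums \<phi> s"
    by (rule tensor_boundE[OF V]) blast
  have sub: "{-r'..r'} \<subseteq> {-r..r}" using assms(2) by auto
  show ?thesis
  proof (rule tensor_boundI[where a = a and \<Phi> = \<Phi>])
    show "continuous_on {-r'..r'} (\<Phi> i n)" if "i \<in> I" for i n
      using w(1)[OF that] sub by (rule continuous_on_subset)
    show "norm (\<Phi> i n x) \<le> 1" if "i \<in> I" "x \<in> {-r'..r'}" for i n x
      using w(2)[of i x n] that sub by blast
    show "(\<lambda>n. a n * (\<Prod>i\<in>I. \<Phi> i n (t i))) sums \<phi> t"
      if "\<And>i. i \<in> I \<Longrightarrow> t i \<in> {-r'..r'}" "inj_on t I" for t
      using s[of t] that sub by blast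
  qed (use a in auto)
qed

lemma poly_tensor_bound:
  assumes r: "0 < r"
  shows "\<exists>B. tensor_bound r {..i} (\<lambda>s. ddset (\<lambda>x. poly p (of_real x)) (s ` {..i})) B"
proof -
  obtain C where C: "0 \<le> C" "\<And>r g A h I. finite I \<and> card I = Suc i \<and> 0 \<le> A \<and> 0 < h \<and> g holomorphic_on UNIV \<and>
     (\<forall>a z. \<bar>a\<bar> < r + h \<longrightarrow> norm (z - of_real a) \<le> 12 * h \<longrightarrow> norm (g z) \<le> A) \<Longrightarrow>
     tensor_bound r I (\<lambda>s. ddset (\<lambda>x. g (of_real x)) (s ` I)) (C * (A / h ^ i))"
    using entire_criterion[of i] by blast
  have "bounded (poly p ` cball 0 (14 * r))"
    by (intro compact_imp_bounded compact_continuous_image continuous_intros) simp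
  then obtain A where A: "0 < A" "\<And>z. norm z \<le> 14 * r \<Longrightarrow> norm (poly p z) \<le> A"
    by (auto simp: bounded_pos)
  have "tensor_bound r {..i} (\<lambda>s. ddset (\<lambda>x. poly p (of_real x)) (s ` {..i})) (C * (A / r ^ i))"
  proof (rule C(2), intro conjI allI impI)
    fix a and z :: complex assume "\<bar>a\<bar> < r + r" "norm (z - of_real a) \<le> 12 * r"
    then have "norm z \<le> 14 * r" using norm_triangle_ineq[of "z - of_real a" "of_real a"] by simp
    then show "norm (poly p z) \<le> A" by (rule A)
  qed (use A r in \<open>auto intro!: holomorphic_intros\<close>)
  then show ?thesis ..
qed

text \<open>A neighbourhood of \<open>f\<close> contains a finite intersection of balls; a polynomial that is close enough
  on the largest of their cubes lies in all of them. The same approximation puts \<open>f\<close> itself into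
  the space, since polynomials have finite norms.\<close>

theorem VC_criterion:
  assumes f: "f \<in> Ck k" and approx: "poly_approximable k f"
  shows "f \<in> VC k"
proof -
  define pol where "pol p x = (poly p (of_real x) :: complex)" for p x
  have finite_norm: "varopoulos_norm r (i + 1) (divdiff i g) < \<infinity>"
    if "tensor_bound r {..i} (\<lambda>s. ddset g (s ` {..i})) B" "0 < r" "g \<in> Ck i" for r i g B
    using varopoulos_norm_le[OF that] by (rule order.strict_trans1) simp
  have fC: "f \<in> C_beta k"
    unfolding C_beta_def
  proof (intro CollectI conjI f allI impI)
    fix r :: real and i assume r: "0 < r" and i: "i \<le> k"
    obtain p where p: "tensor_bound r {..i} (\<lambda>s. ddset (\<lambda>x. f x - poly p (of_real x)) (s ` {..i})) 1"
      using approx[unfolded poly_approximable_def, rule_format, OF r, of 1] i by auto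
    obtain B where B: "tensor_bound r {..i} (\<lambda>s. ddset (\<lambda>x. poly p (of_real x)) (s ` {..i})) B"
      using poly_tensor_bound[OF r] by blast
    from tensor_bound_add[OF p B] have "tensor_bound r {..i} (\<lambda>s. ddset f (s ` {..i})) (1 + B)"
      by (simp add: ddset_add[symmetric])
    then show "varopoulos_norm r (i + 1) (divdiff i f) < \<infinity>"
      by (rule finite_norm) (use r Ck_mono[OF f i] in auto)
  qed
  have pC: "pol p \<in> C_beta k" for p
    unfolding C_beta_def
  proof (intro CollectI conjI allI impI)
    show "pol p \<in> Ck k" unfolding pol_def by (rule Ck_poly)
    fix r :: real and i assume r: "0 < r"
    show "varopoulos_norm r (i + 1) (divdiff i (pol p)) < \<infinity>"
      using poly_tensor_bound[OF r, of i p] finite_norm[OF _ r Ck_poly] unfolding pol_def by blast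
  qed
  define P where "P = {\<lambda>f. varopoulos_norm r (i + 1) (divdiff i f) |r i. 0 < r \<and> i \<le> k}"
  have "p (\<lambda>z. f z - h z) < ennreal (x + y)"
    if "p \<in> P" "f \<in> C_beta k" "g \<in> C_beta k" "h \<in> C_beta k"
      "p (\<lambda>z. f z - g z) < ennreal x" "p (\<lambda>z. g z - h z) < ennreal y" for p f g h x y
  proof -
    from that(1) obtain r i where ri: "p = (\<lambda>f. varopoulos_norm r (i + 1) (divdiff i f))" "i \<le> k"
      by (auto simp: P_def)
    have C: "f \<in> Ck i" "g \<in> Ck i" "h \<in> Ck i" using that ri Ck_mono by (auto simp: C_beta_def)
    show ?thesis unfolding ri
      by (rule varopoulos_norm_less_add[OF that(5,6)[unfolded ri] divdiff_diff_decompose[OF C]])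
        (auto simp: PiE_iff lessThan_Suc_atMost)
  qed
  then have tri: "triangle_family (C_beta k) P" unfolding triangle_family_def by blast
  have "\<exists>p. pol p \<in> U" if U: "openin (C_beta_topology k) U" "f \<in> U" for U
  proof -
    obtain Q \<delta> where Q: "finite Q" "Q \<subseteq> P" "0 < \<delta>"
      "{g \<in> C_beta k. \<forall>p\<in>Q. p (\<lambda>z. g z - f z) < ennreal \<delta>} \<subseteq> U"
      using seminorm_topology_ball[OF tri U(1)[unfolded C_beta_topology_def P_def[symmetric]] U(2)] by blast
    have "\<exists>r>0. \<forall>p\<in>Q. \<exists>r' i. 0 < r' \<and> r' \<le> r \<and> i \<le> k \<and> p = (\<lambda>f. varopoulos_norm r' (i + 1) (divdiff i f))"
      using Q(1,2)
    proof (induction Q rule: finite_induct)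
      case (insert p Q)
      then obtain r where r: "0 < r" "\<forall>p\<in>Q. \<exists>r' i. 0 < r' \<and> r' \<le> r \<and> i \<le> k \<and> p = (\<lambda>f. varopoulos_norm r' (i + 1) (divdiff i f))"
        by blast
      obtain r' i where "0 < r'" "i \<le> k" "p = (\<lambda>f. varopoulos_norm r' (i + 1) (divdiff i f))"
        using insert.prems by (auto simp: P_def)
      then have "\<exists>r'' i. 0 < r'' \<and> r'' \<le> max r r' \<and> i \<le> k \<and> p = (\<lambda>f. varopoulos_norm r'' (i + 1) (divdiff i f))"
        by (intro exI[of _ r'] exI[of _ i]) auto
      moreover have "\<exists>r'' i. 0 < r'' \<and> r'' \<le> max r r' \<and> i \<le> k \<and> q = (\<lambda>f. varopoulos_norm r'' (i + 1) (divdiff i f))"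
        if q: "q \<in> Q" for q
      proof -
        obtain r'' i where "0 < r''" "r'' \<le> r" "i \<le> k" "q = (\<lambda>f. varopoulos_norm r'' (i + 1) (divdiff i f))"
          using r(2)[rule_format, OF q] by blast
        then show ?thesis by (intro exI[of _ r''] exI[of _ i]) auto
      qed
      ultimately show ?case using r(1) by (intro exI[of _ "max r r'"]) auto
    qed (auto intro: exI[of _ 1])
    then obtain r where r: "0 < r" "\<And>p. p \<in> Q \<Longrightarrow> \<exists>r' i. 0 < r' \<and> r' \<le> r \<and> i \<le> k \<and> p = (\<lambda>f. varopoulos_norm r' (i + 1) (divdiff i f))"
      by blast
    obtain p where p: "\<And>i. i \<le> k \<Longrightarrow> tensor_bound r {..i} (\<lambda>s. ddset (\<lambda>x. f x - pol p x) (s ` {..i})) (\<delta> / 2)"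
      using approx[unfolded poly_approximable_def, rule_format, OF r(1), of "\<delta> / 2"] Q(3) by (auto simp: pol_def)
    have "pol p \<in> {g \<in> C_beta k. \<forall>q\<in>Q. q (\<lambda>z. g z - f z) < ennreal \<delta>}"
    proof (intro CollectI conjI ballI pC)
      fix q assume "q \<in> Q"
      from r(2)[OF this] obtain r' i where q: "0 < r'" "r' \<le> r" "i \<le> k" "q = (\<lambda>f. varopoulos_norm r' (i + 1) (divdiff i f))"
        by blast
      have "tensor_bound r' {..i} (\<lambda>s. (-1) * ddset (\<lambda>x. f x - pol p x) (s ` {..i})) (norm (-1 :: complex) * (\<delta> / 2))"
        by (intro tensor_bound_cmult tensor_bound_radius_mono[OF p] q)
      then have "tensor_bound r' {..i} (\<lambda>s. ddset (\<lambda>z. pol p z - f z) (s ` {..i})) (\<delta> / 2)"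
        unfolding ddset_cmult[symmetric] by simp
      then have "varopoulos_norm r' (i + 1) (divdiff i (\<lambda>z. pol p z - f z)) \<le> ennreal (\<delta> / 2)"
      proof (rule varopoulos_norm_le[OF _ q(1)])
        show "(\<lambda>z. pol p z - f z) \<in> Ck i"
          unfolding pol_def by (intro Ck_diff Ck_poly Ck_mono[OF f q(3)])
      qed
      also have "\<dots> < ennreal \<delta>" using Q(3) by (intro ennreal_lessI) auto
      finally show "q (\<lambda>z. pol p z - f z) < ennreal \<delta>" unfolding q .
    qed
    with Q(4) show ?thesis by blast
  qed
  moreover have "f \<in> topspace (C_beta_topology k)"
    using fC unfolding C_beta_topology_def seminorm_topology_def by auto
  ultimately show ?thesis
    unfolding VC_def in_closure_of pol_def by blast
qed

section \<open>Schwartz functions and tempered distributions\<close>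

lemma schwartzI:
  fixes F :: "nat \<Rightarrow> real \<Rightarrow> complex"
  assumes F0: "F 0 = \<phi>" and F: "\<And>n x. (F n has_vector_derivative F (Suc n) x) (at x)"
    and b: "\<And>a b. \<exists>c. \<forall>x. (1 + \<bar>x\<bar>) ^ a * norm (F b x) \<le> c"
  shows "\<phi> \<in> schwartz" "nderiv n \<phi> = F n"
proof -
  have cont: "continuous_on UNIV (F n)" for n
    by (intro continuous_at_imp_continuous_on ballI has_vector_derivative_continuous[OF F])
  show nd: "nderiv n \<phi> = F n" for n by (rule nderiv_eqI[of F \<phi> n, OF F0]) (use F in auto)
  have "\<phi> \<in> Ck n" for n by (rule CkI[of F, OF F0]) (use F cont in auto)
  moreover have "schwartz_seminorm a b \<phi> < \<infinity>" for a b
  proof -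
    obtain c where c: "\<And>x. (1 + \<bar>x\<bar>) ^ a * norm (F b x) \<le> c" using b by blast
    have "norm (of_real (x ^ a) * nderiv b \<phi> x) \<le> c" for x
    proof -
      have "\<bar>x\<bar> ^ a * norm (F b x) \<le> (1 + \<bar>x\<bar>) ^ a * norm (F b x)"
        by (intro mult_right_mono power_mono) auto
      with c[of x] show ?thesis by (simp add: nd norm_mult norm_power)
    qed
    then have "schwartz_seminorm a b \<phi> \<le> ennreal c"
      unfolding schwartz_seminorm_def by (intro SUP_least ennreal_leI)
    then show ?thesis by (rule order.strict_trans1) simp
  qed
  ultimately show "\<phi> \<in> schwartz" by (simp add: schwartz_def Cinf_def)
qed

lemma schwartz_Ck: "\<phi> \<in> schwartz \<Longrightarrow> \<phi> \<in> Ck k"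
  by (simp add: schwartz_def Cinf_def)

lemma schwartz_has_derivative:
  "\<phi> \<in> schwartz \<Longrightarrow> (nderiv n \<phi> has_vector_derivative nderiv (Suc n) \<phi> x) (at x)"
  by (rule Ck_has_derivative[OF schwartz_Ck[of _ "Suc n"]]) auto

lemma schwartz_continuous: "\<phi> \<in> schwartz \<Longrightarrow> continuous_on S (nderiv n \<phi>)"
  by (rule continuous_on_subset[OF Ck_continuous_nderiv[OF schwartz_Ck[of \<phi> n], of n]]) auto

lemma one_plus_power_le: "0 \<le> (t::real) \<Longrightarrow> (1 + t) ^ a \<le> 2 ^ a * (1 + t ^ a)"
proof -
  assume t: "0 \<le> t"
  have "(1 + t) ^ a \<le> (2 * max 1 t) ^ a" using t by (intro power_mono) auto
  also have "\<dots> = 2 ^ a * max 1 t ^ a" by (simp add: power_mult_distrib)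
  also have "max 1 t ^ a \<le> 1 + t ^ a" using t by (cases "t \<le> 1") (auto simp: max_def)
  finally show ?thesis by simp
qed

lemma schwartz_bound1:
  assumes "\<phi> \<in> schwartz"
  shows "\<exists>c. \<forall>x. \<bar>x\<bar> ^ a * norm (nderiv b \<phi> x) \<le> c"
proof -
  have fin: "schwartz_seminorm a b \<phi> < top" using assms by (simp add: schwartz_def)
  have "\<bar>x\<bar> ^ a * norm (nderiv b \<phi> x) \<le> enn2real (schwartz_seminorm a b \<phi>)" for x
  proof -
    have "ennreal (norm (of_real (x ^ a) * nderiv b \<phi> x)) \<le> schwartz_seminorm a b \<phi>"
      unfolding schwartz_seminorm_def by (rule SUP_upper) simp
    also have "\<dots> = ennreal (enn2real (schwartz_seminorm a b \<phi>))" using fin by simp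
    finally show ?thesis by (simp add: norm_mult norm_power)
  qed
  then show ?thesis by blast
qed

text \<open>The weight \<open>1 + \<bar>x\<bar>\<close> is submultiplicative under translations, which \<open>\<bar>x\<bar>\<close> is not.\<close>

lemma schwartz_bound:
  assumes "\<phi> \<in> schwartz"
  shows "\<exists>K\<ge>0. \<forall>b\<le>M. \<forall>x. (1 + \<bar>x\<bar>) ^ N * norm (nderiv b \<phi> x) \<le> K"
proof -
  have "\<exists>c. \<forall>x. (1 + \<bar>x\<bar>) ^ N * norm (nderiv b \<phi> x) \<le> c" for b
  proof -
    obtain c0 where c0: "\<forall>x. \<bar>x\<bar> ^ 0 * norm (nderiv b \<phi> x) \<le> c0"
      using schwartz_bound1[OF assms, of 0 b] ..
    obtain c1 where c1: "\<forall>x. \<bar>x\<bar> ^ N * norm (nderiv b \<phi> x) \<le> c1"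
      using schwartz_bound1[OF assms, of N b] ..
    note c = c0[rule_format] c1[rule_format]
    have "(1 + \<bar>x\<bar>) ^ N * norm (nderiv b \<phi> x) \<le> 2 ^ N * (c0 + c1)" for x
    proof -
      have "(1 + \<bar>x\<bar>) ^ N * norm (nderiv b \<phi> x) \<le> 2 ^ N * (1 + \<bar>x\<bar> ^ N) * norm (nderiv b \<phi> x)"
        by (intro mult_right_mono one_plus_power_le) auto
      also have "\<dots> = 2 ^ N * (\<bar>x\<bar> ^ 0 * norm (nderiv b \<phi> x) + \<bar>x\<bar> ^ N * norm (nderiv b \<phi> x))"
        by (simp add: algebra_simps)
      also have "\<dots> \<le> 2 ^ N * (c0 + c1)" by (intro mult_left_mono add_mono c) simp
      finally show ?thesis .
    qed
    then show ?thesis by blast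
  qed
  then obtain c where c: "\<And>b x. (1 + \<bar>x\<bar>) ^ N * norm (nderiv b \<phi> x) \<le> c b" by metis
  have c0: "0 \<le> c b" for b
  proof -
    have "norm (nderiv b \<phi> 0) \<le> c b" using c[of 0 b] by simp
    then show ?thesis using norm_ge_zero order_trans by blast
  qed
  have "(1 + \<bar>x\<bar>) ^ N * norm (nderiv b \<phi> x) \<le> (\<Sum>b\<le>M. c b)" if "b \<le> M" for b x
  proof -
    have "c b \<le> (\<Sum>b\<le>M. c b)" by (rule member_le_sum) (use that c0 in auto)
    with c[of x b] show ?thesis by linarith
  qed
  moreover have "0 \<le> (\<Sum>b\<le>M. c b)" by (intro sum_nonneg c0)
  ultimately show ?thesis by (intro exI[of _ "\<Sum>b\<le>M. c b"]) simp
qed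

lemma schwartz_zero: "(\<lambda>_. 0) \<in> schwartz"
proof (rule schwartzI(1)[of "\<lambda>_ _. 0"])
  show "\<exists>c. \<forall>x. (1 + \<bar>x\<bar>) ^ a * norm (0 :: complex) \<le> c" for a
    by (intro exI[of _ 0]) simp
qed auto

lemma schwartz_cmult:
  assumes "\<phi> \<in> schwartz"
  shows "(\<lambda>x. c * \<phi> x) \<in> schwartz" "nderiv n (\<lambda>x. c * \<phi> x) = (\<lambda>x. c * nderiv n \<phi> x)"
proof -
  let ?F = "\<lambda>n x. c * nderiv n \<phi> x"
  have d: "(?F n has_vector_derivative ?F (Suc n) x) (at x)" for n x
    by (intro has_vector_derivative_mult_right schwartz_has_derivative assms)
  have b: "\<exists>k. \<forall>x. (1 + \<bar>x\<bar>) ^ a * norm (?F b x) \<le> k" for a b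
  proof -
    obtain K where K: "\<And>x. (1 + \<bar>x\<bar>) ^ a * norm (nderiv b \<phi> x) \<le> K"
      using schwartz_bound[OF assms, of b a] by blast
    have "(1 + \<bar>x\<bar>) ^ a * norm (?F b x) \<le> norm c * K" for x
      using mult_left_mono[OF K[of x], of "norm c"] by (simp add: norm_mult mult_ac)
    then show ?thesis by blast
  qed
  show "(\<lambda>x. c * \<phi> x) \<in> schwartz" "nderiv n (\<lambda>x. c * \<phi> x) = ?F n"
    by (rule schwartzI[of ?F, OF _ d b]; simp)+
qed

lemma schwartz_add:
  assumes "\<phi> \<in> schwartz" "\<psi> \<in> schwartz"
  shows "(\<lambda>x. \<phi> x + \<psi> x) \<in> schwartz" "nderiv n (\<lambda>x. \<phi> x + \<psi> x) = (\<lambda>x. nderiv n \<phi> x + nderiv n \<psi> x)"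
proof -
  let ?F = "\<lambda>n x. nderiv n \<phi> x + nderiv n \<psi> x"
  have d: "(?F n has_vector_derivative ?F (Suc n) x) (at x)" for n x
    by (intro has_vector_derivative_add schwartz_has_derivative assms)
  have b: "\<exists>k. \<forall>x. (1 + \<bar>x\<bar>) ^ a * norm (?F b x) \<le> k" for a b
  proof -
    obtain K L where K: "\<And>x. (1 + \<bar>x\<bar>) ^ a * norm (nderiv b \<phi> x) \<le> K"
      and L: "\<And>x. (1 + \<bar>x\<bar>) ^ a * norm (nderiv b \<psi> x) \<le> L"
      using schwartz_bound[OF assms(1), of b a] schwartz_bound[OF assms(2), of b a] by blast
    have "(1 + \<bar>x\<bar>) ^ a * norm (?F b x) \<le> K + L" for x
    proof -
      have "(1 + \<bar>x\<bar>) ^ a * norm (?F b x) \<le> (1 + \<bar>x\<bar>) ^ a * (norm (nderiv b \<phi> x) + norm (nderiv b \<psi> x))"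
        by (intro mult_left_mono norm_triangle_ineq) auto
      also have "\<dots> \<le> K + L" using K[of x] L[of x] by (simp add: distrib_left)
      finally show ?thesis .
    qed
    then show ?thesis by blast
  qed
  show "(\<lambda>x. \<phi> x + \<psi> x) \<in> schwartz" "nderiv n (\<lambda>x. \<phi> x + \<psi> x) = ?F n"
    by (rule schwartzI[of ?F, OF _ d b]; simp)+
qed

lemma schwartz_diff:
  assumes "\<phi> \<in> schwartz" "\<psi> \<in> schwartz"
  shows "(\<lambda>x. \<phi> x - \<psi> x) \<in> schwartz" "nderiv n (\<lambda>x. \<phi> x - \<psi> x) = (\<lambda>x. nderiv n \<phi> x - nderiv n \<psi> x)"
  using schwartz_add[OF assms(1) schwartz_cmult(1)[OF assms(2), of "-1"]]
    schwartz_cmult(2)[OF assms(2), of _ "-1"] by simp_all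

lemma schwartz_sum:
  assumes "finite K" "\<And>k. k \<in> K \<Longrightarrow> \<phi> k \<in> schwartz"
  shows "(\<lambda>x. \<Sum>k\<in>K. \<phi> k x) \<in> schwartz \<and> (\<forall>n. nderiv n (\<lambda>x. \<Sum>k\<in>K. \<phi> k x) = (\<lambda>x. \<Sum>k\<in>K. nderiv n (\<phi> k) x))"
  using assms
proof (induction K rule: finite_induct)
  case empty
  have "nderiv n (\<lambda>_. 0 :: complex) = (\<lambda>_. 0)" for n
  proof (rule schwartzI(2)[of "\<lambda>_ _. 0"])
    show "\<exists>c. \<forall>x. (1 + \<bar>x\<bar>) ^ a * norm (0 :: complex) \<le> c" for a
      by (intro exI[of _ 0]) simp
  qed auto
  then show ?case by (simp add: schwartz_zero)
next
  case (insert k K)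
  then have IH: "(\<lambda>x. \<Sum>k\<in>K. \<phi> k x) \<in> schwartz" "\<And>n. nderiv n (\<lambda>x. \<Sum>k\<in>K. \<phi> k x) = (\<lambda>x. \<Sum>k\<in>K. nderiv n (\<phi> k) x)"
    by auto
  show ?case using schwartz_add[OF insert.prems[of k] IH(1)] insert.hyps by (simp add: IH(2))
qed

lemma weight_mult: "1 + \<bar>y\<bar> \<le> (1 + \<bar>x\<bar>) * (1 + \<bar>x - y\<bar>)" for x y :: real
proof -
  have "1 + \<bar>y\<bar> \<le> 1 + \<bar>x\<bar> + \<bar>x - y\<bar>" by arith
  also have "\<dots> \<le> (1 + \<bar>x\<bar>) * (1 + \<bar>x - y\<bar>)" by (simp add: algebra_simps)
  finally show ?thesis .
qed

lemma weight_mult_power: "(1 + \<bar>y\<bar>) ^ N \<le> (1 + \<bar>x\<bar>) ^ N * (1 + \<bar>x - y\<bar>) ^ N" for x y :: real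
  unfolding power_mult_distrib[symmetric] by (intro power_mono weight_mult) auto

lemma schwartz_reflect:
  assumes "\<psi> \<in> schwartz"
  shows "(\<lambda>y. \<psi> (x - y)) \<in> schwartz" "nderiv n (\<lambda>y. \<psi> (x - y)) = (\<lambda>y. (- 1) ^ n * nderiv n \<psi> (x - y))"
proof -
  let ?F = "\<lambda>n y. (- 1) ^ n * nderiv n \<psi> (x - y)"
  have d: "(?F n has_vector_derivative ?F (Suc n) y) (at y)" for n y
  proof -
    have "((\<lambda>y. x - y) has_vector_derivative (- 1)) (at y)" by (auto intro!: derivative_eq_intros)
    from vector_diff_chain_at[OF this schwartz_has_derivative[OF assms, of n "x - y"]]
    have "((\<lambda>y. nderiv n \<psi> (x - y)) has_vector_derivative - nderiv (Suc n) \<psi> (x - y)) (at y)"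
      by (simp add: o_def)
    from has_vector_derivative_mult_right[OF this, of "(- 1) ^ n"] show ?thesis by simp
  qed
  have b: "\<exists>k. \<forall>y. (1 + \<bar>y\<bar>) ^ a * norm (?F b y) \<le> k" for a b
  proof -
    obtain K where K: "\<And>x. (1 + \<bar>x\<bar>) ^ a * norm (nderiv b \<psi> x) \<le> K"
      using schwartz_bound[OF assms, of b a] by blast
    have "(1 + \<bar>y\<bar>) ^ a * norm (?F b y) \<le> (1 + \<bar>x\<bar>) ^ a * K" for y
    proof -
      have "(1 + \<bar>y\<bar>) ^ a * norm (?F b y) \<le> (1 + \<bar>x\<bar>) ^ a * (1 + \<bar>x - y\<bar>) ^ a * norm (?F b y)"
        by (intro mult_right_mono weight_mult_power) auto
      also have "\<dots> = (1 + \<bar>x\<bar>) ^ a * ((1 + \<bar>x - y\<bar>) ^ a * norm (nderiv b \<psi> (x - y)))"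
        by (simp add: norm_mult norm_power)
      also have "\<dots> \<le> (1 + \<bar>x\<bar>) ^ a * K" by (intro mult_left_mono K) auto
      finally show ?thesis .
    qed
    then show ?thesis by blast
  qed
  show "(\<lambda>y. \<psi> (x - y)) \<in> schwartz" "nderiv n (\<lambda>y. \<psi> (x - y)) = ?F n"
    by (rule schwartzI[of ?F, OF _ d b]; simp)+
qed

lemma schwartz_nderiv:
  assumes "\<psi> \<in> schwartz"
  shows "nderiv l \<psi> \<in> schwartz" "nderiv n (nderiv l \<psi>) = nderiv (n + l) \<psi>"
proof -
  let ?F = "\<lambda>n. nderiv (n + l) \<psi>"
  have d: "(?F n has_vector_derivative ?F (Suc n) x) (at x)" for n x
    using schwartz_has_derivative[OF assms, of "n + l" x] by simp
  have b: "\<exists>k. \<forall>x. (1 + \<bar>x\<bar>) ^ a * norm (?F b x) \<le> k" for a b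
    using schwartz_bound[OF assms, of "b + l" a] by blast
  show "nderiv l \<psi> \<in> schwartz" "nderiv n (nderiv l \<psi>) = ?F n"
    by (rule schwartzI[of ?F, OF _ d b]; simp)+
qed

lemma tempered_add:
  "tempered_distribution u \<Longrightarrow> \<phi> \<in> schwartz \<Longrightarrow> \<psi> \<in> schwartz \<Longrightarrow> u (\<lambda>x. \<phi> x + \<psi> x) = u \<phi> + u \<psi>"
  by (simp add: tempered_distribution_def)

lemma tempered_cmult:
  "tempered_distribution u \<Longrightarrow> \<phi> \<in> schwartz \<Longrightarrow> u (\<lambda>x. c * \<phi> x) = c * u \<phi>"
  by (simp add: tempered_distribution_def)

lemma tempered_diff:
  "tempered_distribution u \<Longrightarrow> \<phi> \<in> schwartz \<Longrightarrow> \<psi> \<in> schwartz \<Longrightarrow> u (\<lambda>x. \<phi> x - \<psi> x) = u \<phi> - u \<psi>"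
  using tempered_add[of u \<phi> "\<lambda>x. - 1 * \<psi> x"] tempered_cmult[of u \<psi> "-1"] schwartz_cmult(1)[of \<psi> "-1"] by simp

lemma tempered_sum:
  assumes "tempered_distribution u" "finite K" "\<And>k. k \<in> K \<Longrightarrow> \<phi> k \<in> schwartz"
  shows "u (\<lambda>x. \<Sum>k\<in>K. \<phi> k x) = (\<Sum>k\<in>K. u (\<phi> k))"
  using assms(2,3)
proof (induction K rule: finite_induct)
  case empty
  show ?case using tempered_cmult[OF assms(1) schwartz_zero, of 0] by simp
next
  case (insert k K)
  then show ?case using tempered_add[OF assms(1), of "\<phi> k" "\<lambda>x. \<Sum>k\<in>K. \<phi> k x"] schwartz_sum[of K \<phi>] by simp
qed

lemma triangle_family_schwartz: "triangle_family schwartz {schwartz_seminorm a b |a b. True}"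
  unfolding triangle_family_def
proof (intro ballI allI impI)
  fix p f g h x y
  assume p: "p \<in> {schwartz_seminorm a b |a b. True}" and S: "f \<in> schwartz" "g \<in> schwartz" "h \<in> schwartz"
    and fg: "p (\<lambda>z. f z - g z) < ennreal x" and gh: "p (\<lambda>z. g z - h z) < ennreal y"
  obtain a b where ab: "p = schwartz_seminorm a b" using p by blast
  have pos: "0 < x" "0 < y"
    using fg gh by (metis ennreal_eq_0_iff linorder_not_less not_less_zero)+
  have "p (\<lambda>z. f z - h z) \<le> p (\<lambda>z. f z - g z) + p (\<lambda>z. g z - h z)"
    unfolding ab schwartz_seminorm_def
  proof (rule SUP_least)
    fix z :: real
    have "nderiv b (\<lambda>z. f z - h z) z = nderiv b (\<lambda>z. f z - g z) z + nderiv b (\<lambda>z. g z - h z) z"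
      by (simp add: schwartz_diff(2) S)
    then have "norm (of_real (z ^ a) * nderiv b (\<lambda>z. f z - h z) z) \<le>
        norm (of_real (z ^ a) * nderiv b (\<lambda>z. f z - g z) z) + norm (of_real (z ^ a) * nderiv b (\<lambda>z. g z - h z) z)"
      by (simp add: distrib_left norm_triangle_ineq)
    then have "ennreal (norm (of_real (z ^ a) * nderiv b (\<lambda>z. f z - h z) z)) \<le>
        ennreal (norm (of_real (z ^ a) * nderiv b (\<lambda>z. f z - g z) z)) +
        ennreal (norm (of_real (z ^ a) * nderiv b (\<lambda>z. g z - h z) z))"
      by (simp add: ennreal_leI flip: ennreal_plus)
    also have "\<dots> \<le> (SUP x. ennreal (norm (of_real (x ^ a) * nderiv b (\<lambda>z. f z - g z) x))) +
        (SUP x. ennreal (norm (of_real (x ^ a) * nderiv b (\<lambda>z. g z - h z) x)))"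
      by (intro add_mono SUP_upper) auto
    finally show "ennreal (norm (of_real (z ^ a) * nderiv b (\<lambda>z. f z - h z) z)) \<le>
        (SUP x. ennreal (norm (of_real (x ^ a) * nderiv b (\<lambda>z. f z - g z) x))) +
        (SUP x. ennreal (norm (of_real (x ^ a) * nderiv b (\<lambda>z. g z - h z) x)))" .
  qed
  also have "\<dots> < ennreal x + ennreal y" using fg gh by (rule add_strict_mono)
  also have "\<dots> = ennreal (x + y)" using pos by simp
  finally show "p (\<lambda>z. f z - h z) < ennreal (x + y)" .
qed

text \<open>Continuity at zero provides finitely many seminorms whose common ball is mapped into the unit disc;
  homogeneity makes this an estimate.\<close>

lemma tempered_bound:
  assumes u: "tempered_distribution u"
  obtains C N where "0 \<le> C" "\<And>\<phi> c. \<phi> \<in> schwartz \<Longrightarrow> 0 \<le> c \<Longrightarrow>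
    (\<And>b x. b \<le> N \<Longrightarrow> (1 + \<bar>x\<bar>) ^ N * norm (nderiv b \<phi> x) \<le> c) \<Longrightarrow> norm (u \<phi>) \<le> C * c"
proof -
  have top: "topspace schwartz_topology = schwartz"
    unfolding schwartz_topology_def seminorm_topology_def by auto
  have u0: "u (\<lambda>_. 0) = 0" using tempered_cmult[OF u schwartz_zero, of 0] by simp
  have "continuous_map schwartz_topology euclidean u" using u by (simp add: tempered_distribution_def)
  then have "openin schwartz_topology {\<phi> \<in> topspace schwartz_topology. u \<phi> \<in> ball 0 1}"
    by (rule openin_continuous_map_preimage) simp
  then have open_U: "openin (seminorm_topology schwartz {schwartz_seminorm a b |a b. True}) {\<phi> \<in> schwartz. u \<phi> \<in> ball 0 1}"
    unfolding top unfolding schwartz_topology_def .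
  have "(\<lambda>_. 0) \<in> {\<phi> \<in> schwartz. u \<phi> \<in> ball 0 1}" using schwartz_zero u0 by simp
  from seminorm_topology_ball[OF triangle_family_schwartz open_U this]
  obtain Q \<delta> where Q: "finite Q" "Q \<subseteq> {schwartz_seminorm a b |a b. True}" "0 < \<delta>"
    "{g \<in> schwartz. \<forall>p\<in>Q. p (\<lambda>z. g z - 0) < ennreal \<delta>} \<subseteq> {\<phi> \<in> schwartz. u \<phi> \<in> ball 0 1}"
    by blast
  have "\<exists>N. \<forall>p\<in>Q. \<exists>a b. a \<le> N \<and> b \<le> N \<and> p = schwartz_seminorm a b"
    using Q(1,2)
  proof (induction Q rule: finite_induct)
    case (insert p Q)
    then obtain N where N: "\<forall>p\<in>Q. \<exists>a b. a \<le> N \<and> b \<le> N \<and> p = schwartz_seminorm a b" by blast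
    obtain a b where ab: "p = schwartz_seminorm a b" using insert.prems by blast
    have "\<exists>a b. a \<le> max N (max a' b') \<and> b \<le> max N (max a' b') \<and> q = schwartz_seminorm a b" if q: "q \<in> Q" for q a' b'
    proof -
      obtain a b where "a \<le> N" "b \<le> N" "q = schwartz_seminorm a b" using N[rule_format, OF q] by blast
      then show ?thesis by (intro exI[of _ a] exI[of _ b]) auto
    qed
    moreover have "\<exists>a' b'. a' \<le> max N (max a b) \<and> b' \<le> max N (max a b) \<and> p = schwartz_seminorm a' b'"
      using ab by (intro exI[of _ a] exI[of _ b]) auto
    ultimately show ?case by (intro exI[of _ "max N (max a b)"]) blast
  qed auto
  then obtain N where N: "\<And>p. p \<in> Q \<Longrightarrow> \<exists>a b. a \<le> N \<and> b \<le> N \<and> p = schwartz_seminorm a b" by blast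
  have small: "norm (u \<phi>) < 1" if S: "\<phi> \<in> schwartz" and c: "0 \<le> c" "c < \<delta>"
    and b: "\<And>b x. b \<le> N \<Longrightarrow> (1 + \<bar>x\<bar>) ^ N * norm (nderiv b \<phi> x) \<le> c" for \<phi> c
  proof -
    have "p \<phi> < ennreal \<delta>" if pQ: "p \<in> Q" for p
    proof -
      obtain a b' where ab: "a \<le> N" "b' \<le> N" "p = schwartz_seminorm a b'" using N[OF pQ] by blast
      have "norm (of_real (x ^ a) * nderiv b' \<phi> x) \<le> c" for x
      proof -
        have "\<bar>x\<bar> ^ a \<le> (1 + \<bar>x\<bar>) ^ a" by (intro power_mono) auto
        also have "\<dots> \<le> (1 + \<bar>x\<bar>) ^ N" using ab(1) by (intro power_increasing) auto
        finally have "\<bar>x\<bar> ^ a * norm (nderiv b' \<phi> x) \<le> (1 + \<bar>x\<bar>) ^ N * norm (nderiv b' \<phi> x)"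
          by (rule mult_right_mono) simp
        with b[OF ab(2), of x] show ?thesis by (simp add: norm_mult norm_power)
      qed
      then have "p \<phi> \<le> ennreal c" unfolding ab schwartz_seminorm_def by (intro SUP_least ennreal_leI)
      also have "\<dots> < ennreal \<delta>" using c by (intro ennreal_lessI) auto
      finally show ?thesis .
    qed
    then have "\<phi> \<in> {\<phi> \<in> schwartz. u \<phi> \<in> ball 0 1}" using Q(4) S by auto
    then show ?thesis by simp
  qed
  have pos: "norm (u \<phi>) \<le> 2 / \<delta> * c" if S: "\<phi> \<in> schwartz" and c: "0 < c"
    and b: "\<And>b x. b \<le> N \<Longrightarrow> (1 + \<bar>x\<bar>) ^ N * norm (nderiv b \<phi> x) \<le> c" for \<phi> c
  proof -
    define t where "t = \<delta> / (2 * c)"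
    have t: "0 < t" "t * c = \<delta> / 2" using Q(3) c by (auto simp: t_def)
    have "norm (u (\<lambda>x. of_real t * \<phi> x)) < 1"
    proof (rule small[of _ "\<delta> / 2"])
      show "(\<lambda>x. of_real t * \<phi> x) \<in> schwartz" by (rule schwartz_cmult(1)[OF S])
      fix b' x assume "b' \<le> N"
      have "(1 + \<bar>x\<bar>) ^ N * norm (nderiv b' (\<lambda>x. of_real t * \<phi> x) x) =
          t * ((1 + \<bar>x\<bar>) ^ N * norm (nderiv b' \<phi> x))"
        using t(1) by (simp add: schwartz_cmult(2)[OF S] norm_mult)
      also have "\<dots> \<le> t * c" using t(1) by (intro mult_left_mono b \<open>b' \<le> N\<close>) auto
      finally show "(1 + \<bar>x\<bar>) ^ N * norm (nderiv b' (\<lambda>x. of_real t * \<phi> x) x) \<le> \<delta> / 2"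
        using t(2) by simp
    qed (use Q(3) in auto)
    then have "t * norm (u \<phi>) < 1" using t by (simp add: tempered_cmult[OF u S] norm_mult)
    then show ?thesis using Q(3) c by (simp add: t_def field_simps)
  qed
  show ?thesis
  proof (rule that[of "2 / \<delta>" N])
    show "0 \<le> 2 / \<delta>" using Q(3) by simp
    fix \<phi> c assume S: "\<phi> \<in> schwartz" and c: "0 \<le> c"
      and b: "\<And>b x. b \<le> N \<Longrightarrow> (1 + \<bar>x\<bar>) ^ N * norm (nderiv b \<phi> x) \<le> c"
    show "norm (u \<phi>) \<le> 2 / \<delta> * c"
    proof (rule field_le_epsilon)
      fix e :: real assume e: "0 < e"
      have "norm (u \<phi>) \<le> 2 / \<delta> * (c + e * \<delta> / 2)"
        by (rule pos[OF S]) (use c e Q(3) order_trans[OF b] in \<open>auto intro!: add_nonneg_pos\<close>)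
      then show "norm (u \<phi>) \<le> 2 / \<delta> * c + e" using Q(3) by (simp add: field_simps)
    qed
  qed
qed

text \<open>Derivatives of integrals and of convolutions are identified through second order
  remainders, which are bounded uniformly.\<close>

lemma has_vector_derivative_quadratic:
  fixes f :: "real \<Rightarrow> complex"
  assumes "\<And>h. \<bar>h\<bar> \<le> 1 \<Longrightarrow> norm (f (x + h) - f x - of_real h * f') \<le> M * h\<^sup>2"
  shows "(f has_vector_derivative f') (at x)"
  unfolding has_vector_derivative_def has_derivative_at
proof (intro conjI bounded_linear_scaleR_left)
  have t0: "((\<lambda>h::real. \<bar>M\<bar> * \<bar>h\<bar>) \<longlongrightarrow> \<bar>M\<bar> * \<bar>0\<bar>) (at 0)" by (intro tendsto_intros)
  have ev: "eventually (\<lambda>h::real. norm (norm (f (x + h) - f x - h *\<^sub>R f') / norm h) \<le> \<bar>M\<bar> * \<bar>h\<bar>) (at 0)"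
  proof -
    have "eventually (\<lambda>h::real. \<bar>h\<bar> \<le> 1 \<and> h \<noteq> 0) (at 0)"
      unfolding eventually_at by (intro exI[of _ 1]) (auto simp: dist_real_def)
    then show ?thesis
    proof eventually_elim
      case (elim h)
      have "norm (f (x + h) - f x - h *\<^sub>R f') \<le> \<bar>M\<bar> * h\<^sup>2"
      proof -
        have "norm (f (x + h) - f x - h *\<^sub>R f') \<le> M * h\<^sup>2"
          using assms[of h] elim by (simp add: scaleR_conv_of_real)
        also have "\<dots> \<le> \<bar>M\<bar> * h\<^sup>2" by (intro mult_right_mono) auto
        finally show ?thesis .
      qed
      then have "norm (f (x + h) - f x - h *\<^sub>R f') / \<bar>h\<bar> \<le> \<bar>M\<bar> * h\<^sup>2 / \<bar>h\<bar>"
        by (intro divide_right_mono) auto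
      also have "\<dots> = \<bar>M\<bar> * \<bar>h\<bar>"
        using elim by (cases "h > 0") (simp_all add: power2_eq_square)
      finally show ?case by simp
    qed
  qed
  from Lim_null_comparison[OF ev] t0
  show "(\<lambda>h. norm (f (x + h) - f x - h *\<^sub>R f') / norm h) \<midarrow>0\<rightarrow> 0" by simp
qed

lemma second_order_remainder:
  fixes f :: "real \<Rightarrow> complex"
  assumes f: "\<And>t. (f has_vector_derivative f' t) (at t)" and f': "\<And>t. (f' has_vector_derivative f'' t) (at t)"
    and M: "\<And>t. t \<in> closed_segment x (x + h) \<Longrightarrow> norm (f'' t) \<le> M"
  shows "norm (f (x + h) - f x - of_real h * f' x) \<le> M * h\<^sup>2"
proof -
  let ?S = "closed_segment x (x + h)"
  define g where "g t = f t - of_real t * f' x" for t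
  have M0: "0 \<le> M" using M[of x] norm_ge_zero order_trans by blast
  have "norm (g (x + h) - g x) \<le> M * \<bar>h\<bar> * \<bar>(x + h) - x\<bar>"
  proof (rule vector_derivative_bound[of ?S _ "\<lambda>t. f' t - f' x"])
    fix t assume t: "t \<in> ?S"
    have "(g has_vector_derivative f' t - of_real 1 * f' x) (at t)"
      unfolding g_def by (intro has_vector_derivative_diff f has_vector_derivative_mult_left
          has_vector_derivative_of_real) (auto intro!: derivative_eq_intros)
    then show "(g has_vector_derivative f' t - f' x) (at t within ?S)"
      by (simp add: has_vector_derivative_at_within)
    have "norm (f' t - f' x) \<le> M * \<bar>t - x\<bar>"
      by (rule vector_derivative_bound[of ?S _ f'']) (use t f' M in \<open>auto intro: has_vector_derivative_at_within\<close>)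
    also have "\<dots> \<le> M * \<bar>h\<bar>"
      using t M0 by (intro mult_left_mono) (auto simp: closed_segment_eq_real_ivl split: if_splits)
    finally show "norm (f' t - f' x) \<le> M * \<bar>h\<bar>" .
  qed auto
  moreover have "g (x + h) - g x = f (x + h) - f x - of_real h * f' x"
    by (simp add: g_def algebra_simps)
  moreover have "M * \<bar>h\<bar> * \<bar>(x + h) - x\<bar> = M * h\<^sup>2" by (simp add: power2_eq_square)
  ultimately show ?thesis by (simp only:)
qed

text \<open>A Schwartz function is translated along a curve that is differentiable in every seminorm.\<close>

lemma convolution_has_derivative:
  assumes u: "tempered_distribution u" and \<psi>: "\<psi> \<in> schwartz"
  shows "(Defs.convolution (nderiv l \<psi>) u has_vector_derivative Defs.convolution (nderiv (Suc l) \<psi>) u x) (at x)"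
proof -
  obtain C N where C: "0 \<le> C" "\<And>\<phi> c. \<phi> \<in> schwartz \<Longrightarrow> 0 \<le> c \<Longrightarrow>
    (\<And>b x. b \<le> N \<Longrightarrow> (1 + \<bar>x\<bar>) ^ N * norm (nderiv b \<phi> x) \<le> c) \<Longrightarrow> norm (u \<phi>) \<le> C * c"
    using tempered_bound[OF u] by blast
  obtain K where K: "0 \<le> K" "\<And>b x. b \<le> N + l + 2 \<Longrightarrow> (1 + \<bar>x\<bar>) ^ N * norm (nderiv b \<psi> x) \<le> K"
    using schwartz_bound[OF \<psi>, of "N + l + 2" N] by blast
  note S = schwartz_nderiv[OF \<psi>]
  show ?thesis
  proof (rule has_vector_derivative_quadratic)
    fix h :: real assume h: "\<bar>h\<bar> \<le> 1"
    define D where "D y = nderiv l \<psi> (x + h - y) - nderiv l \<psi> (x - y) - of_real h * nderiv (Suc l) \<psi> (x - y)" for y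
    have D: "D \<in> schwartz"
      unfolding D_def by (intro schwartz_diff schwartz_cmult schwartz_reflect S)
    have nd: "nderiv b D y = (- 1) ^ b * (nderiv (b + l) \<psi> (x - y + h) - nderiv (b + l) \<psi> (x - y) -
        of_real h * nderiv (Suc (b + l)) \<psi> (x - y))" for b y
    proof -
      note R1 = schwartz_reflect[OF S(1)[of l], where x = "x + h"] schwartz_reflect[OF S(1)[of l], where x = x]
        schwartz_reflect[OF S(1)[of "Suc l"], where x = x]
      have "nderiv b D y = (- 1) ^ b * nderiv (b + l) \<psi> (x + h - y) - (- 1) ^ b * nderiv (b + l) \<psi> (x - y) -
          of_real h * ((- 1) ^ b * nderiv (b + Suc l) \<psi> (x - y))"
        unfolding D_def
          schwartz_diff(2)[OF schwartz_diff(1)[OF R1(1,3)] schwartz_cmult(1)[OF R1(5)]]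
          schwartz_diff(2)[OF R1(1,3)] schwartz_cmult(2)[OF R1(5)] R1(2,4,6) S(2) ..
      moreover have "x + h - y = x - y + h" by simp
      ultimately show ?thesis by (simp only: right_diff_distrib mult.left_commute add_Suc_right)
    qed
    have "norm (u D) \<le> C * ((2 + \<bar>x\<bar>) ^ N * K * h\<^sup>2)"
    proof (rule C(2)[OF D])
      fix b y assume b: "b \<le> N"
      have "norm (nderiv b D y) = norm (nderiv (b + l) \<psi> (x - y + h) - nderiv (b + l) \<psi> (x - y) -
          of_real h * nderiv (Suc (b + l)) \<psi> (x - y))"
        unfolding nd by (simp add: norm_mult norm_power)
      also have "\<dots> \<le> ((2 + \<bar>x\<bar>) ^ N * K / (1 + \<bar>y\<bar>) ^ N) * h\<^sup>2"
      proof (rule second_order_remainder)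
        show "(nderiv (b + l) \<psi> has_vector_derivative nderiv (Suc (b + l)) \<psi> t) (at t)"
          "(nderiv (Suc (b + l)) \<psi> has_vector_derivative nderiv (Suc (Suc (b + l))) \<psi> t) (at t)" for t
          by (rule schwartz_has_derivative[OF \<psi>])+
        fix t assume "t \<in> closed_segment (x - y) (x - y + h)"
        then have t: "\<bar>t - (x - y)\<bar> \<le> 1"
          using h by (auto simp: closed_segment_eq_real_ivl split: if_splits)
        have "(1 + \<bar>y\<bar>) ^ N * norm (nderiv (Suc (Suc (b + l))) \<psi> t) \<le>
            (1 + \<bar>t + y\<bar>) ^ N * (1 + \<bar>t + y - y\<bar>) ^ N * norm (nderiv (Suc (Suc (b + l))) \<psi> t)"
          by (intro mult_right_mono weight_mult_power) auto
        also have "\<dots> = (1 + \<bar>t + y\<bar>) ^ N * ((1 + \<bar>t\<bar>) ^ N * norm (nderiv (Suc (Suc (b + l))) \<psi> t))" by simp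
        also have "\<dots> \<le> (2 + \<bar>x\<bar>) ^ N * K"
          using t b by (intro mult_mono power_mono K) auto
        finally show "norm (nderiv (Suc (Suc (b + l))) \<psi> t) \<le> (2 + \<bar>x\<bar>) ^ N * K / (1 + \<bar>y\<bar>) ^ N"
          by (simp add: pos_le_divide_eq add_pos_nonneg mult.commute)
      qed
      finally have "(1 + \<bar>y\<bar>) ^ N * norm (nderiv b D y) \<le> (1 + \<bar>y\<bar>) ^ N * (((2 + \<bar>x\<bar>) ^ N * K / (1 + \<bar>y\<bar>) ^ N) * h\<^sup>2)"
        by (rule mult_left_mono) auto
      also have "\<dots> = (2 + \<bar>x\<bar>) ^ N * K * h\<^sup>2" by (simp add: add_nonneg_eq_0_iff)
      finally show "(1 + \<bar>y\<bar>) ^ N * norm (nderiv b D y) \<le> (2 + \<bar>x\<bar>) ^ N * K * h\<^sup>2" .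
    qed (use K in auto)
    moreover have "u D = Defs.convolution (nderiv l \<psi>) u (x + h) - Defs.convolution (nderiv l \<psi>) u x -
        of_real h * Defs.convolution (nderiv (Suc l) \<psi>) u x"
      unfolding D_def Defs.convolution_def
      by (simp add: tempered_diff[OF u] tempered_cmult[OF u] schwartz_diff schwartz_cmult schwartz_reflect S)
    ultimately show "norm (Defs.convolution (nderiv l \<psi>) u (x + h) - Defs.convolution (nderiv l \<psi>) u x -
        of_real h * Defs.convolution (nderiv (Suc l) \<psi>) u x) \<le> (C * (2 + \<bar>x\<bar>) ^ N * K) * h\<^sup>2"
      by (simp add: mult_ac)
  qed
qed

lemma convolution_Ck:
  assumes "tempered_distribution u" "\<psi> \<in> schwartz"
  shows "Defs.convolution \<psi> u \<in> Ck k" "nderiv l (Defs.convolution \<psi> u) = Defs.convolution (nderiv l \<psi>) u"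
proof -
  let ?F = "\<lambda>l. Defs.convolution (nderiv l \<psi>) u"
  have d: "(?F n has_vector_derivative ?F (Suc n) x) (at x)" for n x
    by (rule convolution_has_derivative[OF assms])
  have c: "continuous_on UNIV (?F n)" for n
    by (intro continuous_at_imp_continuous_on ballI has_vector_derivative_continuous[OF d])
  show "Defs.convolution \<psi> u \<in> Ck k" by (rule CkI[of ?F]) (use d c in auto)
  show "nderiv l (Defs.convolution \<psi> u) = ?F l" by (rule nderiv_eqI[of ?F _ l]) (use d in auto)
qed

lemma convolution_growth:
  assumes u: "tempered_distribution u" and \<psi>: "\<psi> \<in> schwartz"
  shows "\<exists>C N. \<forall>x. norm (Defs.convolution \<psi> u x) \<le> C * (1 + \<bar>x\<bar>) ^ N"
proof -
  obtain C N where C: "0 \<le> C" "\<And>\<phi> c. \<phi> \<in> schwartz \<Longrightarrow> 0 \<le> c \<Longrightarrow>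
    (\<And>b x. b \<le> N \<Longrightarrow> (1 + \<bar>x\<bar>) ^ N * norm (nderiv b \<phi> x) \<le> c) \<Longrightarrow> norm (u \<phi>) \<le> C * c"
    using tempered_bound[OF u] by blast
  obtain K where K: "0 \<le> K" "\<And>b x. b \<le> N \<Longrightarrow> (1 + \<bar>x\<bar>) ^ N * norm (nderiv b \<psi> x) \<le> K"
    using schwartz_bound[OF \<psi>, of N N] by blast
  have "norm (Defs.convolution \<psi> u x) \<le> C * ((1 + \<bar>x\<bar>) ^ N * K)" for x
    unfolding Defs.convolution_def
  proof (rule C(2)[OF schwartz_reflect(1)[OF \<psi>]])
    fix b y assume b: "b \<le> N"
    have "(1 + \<bar>y\<bar>) ^ N * norm (nderiv b (\<lambda>y. \<psi> (x - y)) y) \<le>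
        (1 + \<bar>x\<bar>) ^ N * (1 + \<bar>x - y\<bar>) ^ N * norm (nderiv b \<psi> (x - y))"
      unfolding schwartz_reflect(2)[OF \<psi>] norm_mult norm_power
      by (simp, intro mult_right_mono weight_mult_power) auto
    also have "\<dots> = (1 + \<bar>x\<bar>) ^ N * ((1 + \<bar>x - y\<bar>) ^ N * norm (nderiv b \<psi> (x - y)))" by (simp only: mult.assoc)
    also have "\<dots> \<le> (1 + \<bar>x\<bar>) ^ N * K" by (intro mult_left_mono K b) auto
    finally show "(1 + \<bar>y\<bar>) ^ N * norm (nderiv b (\<lambda>y. \<psi> (x - y)) y) \<le> (1 + \<bar>x\<bar>) ^ N * K" .
  qed (use K in auto)
  then have "norm (Defs.convolution \<psi> u x) \<le> (C * K) * (1 + \<bar>x\<bar>) ^ N" for x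
    by (simp only: mult_ac)
  then show ?thesis by blast
qed

section \<open>Interchanging a tempered distribution with an integral\<close>

definition weight_integral :: real where
  "weight_integral = (\<integral>x. 1 / (1 + \<bar>x\<bar>) ^ 2 \<partial>lborel)"

lemma integrable_weight: "integrable lborel (\<lambda>x::real. 1 / (1 + \<bar>x\<bar>) ^ 2)"
proof (rule Bochner_Integration.integrable_bound)
  show "integrable lborel (\<lambda>x::real. inverse (1 + x\<^sup>2))"
    using integrable_inverse_1_plus_square by (simp add: set_integrable_def einterval_def)
  have "norm (1 / (1 + \<bar>x\<bar>) ^ 2) \<le> norm (inverse (1 + x\<^sup>2))" for x :: real
  proof -
    have "1 + x\<^sup>2 \<le> (1 + \<bar>x\<bar>) ^ 2" by (simp add: power2_sum)
    moreover have "0 < 1 + x\<^sup>2" by (simp add: add_pos_nonneg)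
    ultimately have "1 / (1 + \<bar>x\<bar>) ^ 2 \<le> 1 / (1 + x\<^sup>2)" by (intro divide_left_mono mult_pos_pos) auto
    then show ?thesis by (simp add: inverse_eq_divide)
  qed
  then show "AE x in lborel. norm (1 / (1 + \<bar>x\<bar>) ^ 2) \<le> norm (inverse (1 + x\<^sup>2 :: real))" by simp
qed simp

lemma weight_integral_nonneg: "0 \<le> weight_integral"
  unfolding weight_integral_def by (rule integral_nonneg_AE) simp

lemma integral_decay:
  fixes f :: "real \<Rightarrow> complex"
  assumes f: "f \<in> borel_measurable lborel" and b: "\<And>x. norm (f x) \<le> c / (1 + \<bar>x\<bar>) ^ 2"
  shows "integrable lborel f" "norm (\<integral>x. f x \<partial>lborel) \<le> c * weight_integral"
proof -
  have w: "integrable lborel (\<lambda>x. c * (1 / (1 + \<bar>x\<bar>) ^ 2))"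
    by (rule integrable_mult_right[OF integrable_weight])
  have b': "norm (f x) \<le> c * (1 / (1 + \<bar>x\<bar>) ^ 2)" for x using b by simp
  show i: "integrable lborel f"
  proof (rule Bochner_Integration.integrable_bound[OF w f])
    show "AE x in lborel. norm (f x) \<le> norm (c * (1 / (1 + \<bar>x\<bar>) ^ 2))"
      using order_trans[OF b' abs_ge_self] by simp
  qed
  have "norm (\<integral>x. f x \<partial>lborel) \<le> (\<integral>x. c * (1 / (1 + \<bar>x\<bar>) ^ 2) \<partial>lborel)"
    by (rule Bochner_Integration.integral_norm_bound_integral[OF i w]) (use b' in auto)
  then show "norm (\<integral>x. f x \<partial>lborel) \<le> c * weight_integral"
    unfolding weight_integral_def by (simp only: integral_mult_right_zero)
qed

lemma continuous_borel_measurable_lborel: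
  fixes f :: "real \<Rightarrow> complex"
  shows "continuous_on UNIV f \<Longrightarrow> f \<in> borel_measurable lborel"
  by (simp add: borel_measurable_continuous_onI)

text \<open>Riemann sums with mesh \<open>1 / n\<close> over \<open>[-n, n]\<close> converge at the rate \<open>1 / n\<close>, with a constant
  that depends only on the decay of the function and of its derivative.\<close>

lemma riemann_sum_error:
  fixes F F' :: "real \<Rightarrow> complex"
  assumes F: "\<And>x. (F has_vector_derivative F' x) (at x)"
    and b: "\<And>x. norm (F x) \<le> c / (1 + \<bar>x\<bar>) ^ 3" "\<And>x. norm (F' x) \<le> c / (1 + \<bar>x\<bar>) ^ 2"
    and n: "n > 0"
  shows "norm ((\<integral>x. F x \<partial>lborel) - (\<Sum>m\<in>{-int (n^2)..<int (n^2)}. F (of_int m / n) * of_real (1 / n)))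
     \<le> 4 * c / n * weight_integral"
proof -
  define M where "M = {-int (n^2)..<int (n^2)}"
  define J where "J m = {of_int m / real n..<(of_int m + 1) / real n}" for m :: int
  define G where "G x = (\<Sum>m\<in>M. indicator (J m) x *\<^sub>R F (of_int m / n))" for x
  have c0: "0 \<le> c" using order_trans[OF norm_ge_zero b(1)[of 0]] by simp
  have contF: "continuous_on UNIV F"
    by (intro continuous_at_imp_continuous_on ballI has_vector_derivative_continuous[OF F])
  have b2: "norm (F x) \<le> c / (1 + \<bar>x\<bar>) ^ 2" for x
  proof -
    have "c / (1 + \<bar>x\<bar>) ^ 3 \<le> c / (1 + \<bar>x\<bar>) ^ 2"
      using c0 by (intro divide_left_mono power_increasing mult_pos_pos) auto
    with b(1)[of x] show ?thesis by linarith
  qed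
  have intF: "integrable lborel F"
    by (rule integral_decay(1)[OF continuous_borel_measurable_lborel[OF contF] b2])
  have mJ: "emeasure lborel (J m) = ennreal (1 / n)" for m
    unfolding J_def using n by (subst emeasure_lborel_Ico) (auto simp: divide_simps)
  have intJ: "integrable lborel (\<lambda>x. indicator (J m) x *\<^sub>R F (of_int m / n))" for m
    by (intro integrable_scaleR_left integrable_real_indicator) (use mJ in \<open>auto simp: J_def\<close>)
  have intG: "integrable lborel G"
    unfolding G_def by (intro Bochner_Integration.integrable_sum intJ)
  have "measure lborel (J m) = 1 / n" for m
    unfolding measure_def mJ using n by simp
  then have "(\<integral>x. indicator (J m) x *\<^sub>R F (of_int m / n) \<partial>lborel) = F (of_int m / n) * of_real (1 / n)" for m
    using mJ[of m] by (subst integral_scaleR_left)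
      (auto simp: J_def scaleR_conv_of_real intro!: integrable_real_indicator)
  then have Gsum: "(\<integral>x. G x \<partial>lborel) = (\<Sum>m\<in>M. F (of_int m / n) * of_real (1 / n))"
    unfolding G_def by (subst Bochner_Integration.integral_sum) (use intJ in auto)
  have diff: "norm (F x - G x) \<le> (4 * c / n) / (1 + \<bar>x\<bar>) ^ 2" for x
  proof -
    define k where "k = \<lfloor>real n * x\<rfloor>"
    have k: "of_int k \<le> real n * x" "real n * x < of_int k + 1" unfolding k_def by linarith+
    have inJ: "x \<in> J m \<longleftrightarrow> m = k" for m
    proof -
      have "x \<in> J m \<longleftrightarrow> of_int m \<le> real n * x \<and> real n * x < of_int m + 1"
        using n by (simp add: J_def field_simps)
      also have "\<dots> \<longleftrightarrow> m = k" unfolding k_def by (metis floor_eq_iff)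
      finally show ?thesis .
    qed
    have G: "G x = (if k \<in> M then F (of_int k / n) else 0)"
    proof -
      have "G x = (\<Sum>m\<in>M. if m = k then F (of_int k / n) else 0)"
        unfolding G_def by (intro sum.cong refl) (simp add: indicator_def inJ)
      then show ?thesis by (simp add: M_def)
    qed
    show ?thesis
    proof (cases "k \<in> M")
      case True
      have xk: "of_int k / real n \<le> x" "x - of_int k / real n \<le> 1 / n"
      proof -
        show "of_int k / real n \<le> x" using k n by (simp add: pos_divide_le_eq mult.commute)
        have "x \<le> (of_int k + 1) / real n" using k n by (simp add: pos_le_divide_eq mult.commute)
        then show "x - of_int k / real n \<le> 1 / n" by (simp add: add_divide_distrib)
      qed
      have "norm (F x - F (of_int k / n)) \<le> (4 * c / (1 + \<bar>x\<bar>) ^ 2) * \<bar>x - of_int k / n\<bar>"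
      proof (rule vector_derivative_bound[of "{of_int k / real n..x}" _ F'])
        fix t assume t: "t \<in> {of_int k / real n..x}"
        show "(F has_vector_derivative F' t) (at t within {of_int k / real n..x})"
          by (rule has_vector_derivative_at_within[OF F])
        have "1 / real n \<le> 1" using n by simp
        then have "\<bar>x\<bar> \<le> \<bar>t\<bar> + 1" using t xk by auto
        then have "1 + \<bar>x\<bar> \<le> 2 * (1 + \<bar>t\<bar>)" by simp
        then have sq: "(1 + \<bar>x\<bar>) ^ 2 \<le> (2 * (1 + \<bar>t\<bar>)) ^ 2" by (intro power_mono) auto
        have "c / (1 + \<bar>t\<bar>) ^ 2 = 4 * c / (2 * (1 + \<bar>t\<bar>)) ^ 2" unfolding power_mult_distrib by simp
        also have "\<dots> \<le> 4 * c / (1 + \<bar>x\<bar>) ^ 2"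
          by (intro divide_left_mono sq mult_pos_pos) (use c0 in auto)
        finally have "c / (1 + \<bar>t\<bar>) ^ 2 \<le> 4 * c / (1 + \<bar>x\<bar>) ^ 2" .
        with b(2)[of t] show "norm (F' t) \<le> 4 * c / (1 + \<bar>x\<bar>) ^ 2" by linarith
      qed (use xk in auto)
      also have "\<dots> \<le> (4 * c / (1 + \<bar>x\<bar>) ^ 2) * (1 / n)"
        using xk c0 by (intro mult_left_mono) auto
      finally show ?thesis using True by (simp add: G mult_ac)
    next
      case False
      have "real n \<le> \<bar>x\<bar>"
      proof (rule ccontr)
        assume "\<not> real n \<le> \<bar>x\<bar>"
        then have "real n * \<bar>x\<bar> < real n * real n" using n by (intro mult_strict_left_mono) auto
        then have "\<bar>real n * x\<bar> < real (n ^ 2)" by (simp add: abs_mult power2_eq_square)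
        then have "- real (n ^ 2) < real n * x" "real n * x < real (n ^ 2)" by linarith+
        then have "- int (n ^ 2) \<le> k" "k < int (n ^ 2)"
          using k unfolding k_def by (simp_all add: le_floor_iff floor_less_iff)
        then show False using False by (simp add: M_def)
      qed
      have "norm (F x) \<le> c / ((1 + \<bar>x\<bar>) ^ 2 * (1 + \<bar>x\<bar>))" using b(1)[of x] by (simp add: power3_eq_cube power2_eq_square)
      also have "\<dots> \<le> c / ((1 + \<bar>x\<bar>) ^ 2 * real n)"
        using \<open>real n \<le> \<bar>x\<bar>\<close> c0 n by (intro divide_left_mono mult_left_mono mult_pos_pos) auto
      also have "\<dots> \<le> 4 * (c / ((1 + \<bar>x\<bar>) ^ 2 * real n))"
      proof -
        have "0 \<le> c / ((1 + \<bar>x\<bar>) ^ 2 * real n)" using c0 by simp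
        then show ?thesis by linarith
      qed
      finally show ?thesis using False by (simp add: G mult_ac)
    qed
  qed
  have "norm (\<integral>x. F x - G x \<partial>lborel) \<le> 4 * c / n * weight_integral"
    by (rule integral_decay(2)[OF _ diff]) (use intF intG in auto)
  then show ?thesis using intF intG by (simp add: Gsum M_def)
qed

text \<open>A form for products with a fixed Schwartz function: the constant is linear in the growth bound
  of the other factor.\<close>

lemma riemann_sum_schwartz:
  assumes \<phi>: "\<phi> \<in> schwartz"
  obtains K where "0 \<le> K"
    "\<And>f f' c. (\<And>x. (f has_vector_derivative f' x) (at x)) \<Longrightarrow>
       (\<And>x. norm (f x) \<le> c * (1 + \<bar>x\<bar>) ^ N) \<Longrightarrow> (\<And>x. norm (f' x) \<le> c * (1 + \<bar>x\<bar>) ^ N) \<Longrightarrow>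
       integrable lborel (\<lambda>x. f x * \<phi> x) \<and>
       (\<forall>n>0. norm ((\<integral>x. f x * \<phi> x \<partial>lborel) -
          (\<Sum>m\<in>{-int (n^2)..<int (n^2)}. f (of_int m / n) * \<phi> (of_int m / n) * of_real (1 / n))) \<le> K * c / n)"
proof -
  obtain L where L: "0 \<le> L" "\<And>b x. b \<le> 1 \<Longrightarrow> (1 + \<bar>x\<bar>) ^ (N + 3) * norm (nderiv b \<phi> x) \<le> L"
    using schwartz_bound[OF \<phi>, of 1 "N + 3"] by blast
  show ?thesis
  proof (rule that[of "8 * L * weight_integral"])
    show "0 \<le> 8 * L * weight_integral" using L weight_integral_nonneg by simp
    fix f f' :: "real \<Rightarrow> complex" and c
    assume d: "\<And>x. (f has_vector_derivative f' x) (at x)"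
      and b0: "\<And>x. norm (f x) \<le> c * (1 + \<bar>x\<bar>) ^ N" and b1: "\<And>x. norm (f' x) \<le> c * (1 + \<bar>x\<bar>) ^ N"
    have c0: "0 \<le> c" using order_trans[OF norm_ge_zero b0[of 0]] by simp
    have prod: "norm (g x * nderiv b \<phi> x) \<le> c * L / (1 + \<bar>x\<bar>) ^ 3"
      if "norm (g x) \<le> c * (1 + \<bar>x\<bar>) ^ N" "b \<le> 1" for g b x
    proof -
      have "norm (g x * nderiv b \<phi> x) \<le> (c * (1 + \<bar>x\<bar>) ^ N) * norm (nderiv b \<phi> x)"
        unfolding norm_mult by (intro mult_right_mono that) auto
      also have "\<dots> = c * ((1 + \<bar>x\<bar>) ^ (N + 3) * norm (nderiv b \<phi> x)) / (1 + \<bar>x\<bar>) ^ 3"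
      proof -
        have "(1 + \<bar>x\<bar>) ^ 3 \<noteq> 0" by (simp add: add_nonneg_eq_0_iff)
        then show ?thesis by (subst nonzero_eq_divide_eq, assumption) (simp only: power_add mult_ac)
      qed
      also have "\<dots> \<le> c * L / (1 + \<bar>x\<bar>) ^ 3"
        using c0 L(2)[OF that(2), of x] by (intro divide_right_mono mult_left_mono) auto
      finally show ?thesis .
    qed
    define F' where "F' x = f x * nderiv 1 \<phi> x + f' x * \<phi> x" for x
    have F: "((\<lambda>x. f x * \<phi> x) has_vector_derivative F' x) (at x)" for x
      unfolding F'_def using has_vector_derivative_mult[OF d schwartz_has_derivative[OF \<phi>, of 0]] by simp
    have B0: "norm (f x * \<phi> x) \<le> (2 * (c * L)) / (1 + \<bar>x\<bar>) ^ 3" for x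
    proof -
      have "norm (f x * \<phi> x) \<le> c * L / (1 + \<bar>x\<bar>) ^ 3" using prod[of f x 0] b0 by simp
      also have "\<dots> \<le> (2 * (c * L)) / (1 + \<bar>x\<bar>) ^ 3" using c0 L by (intro divide_right_mono) auto
      finally show ?thesis .
    qed
    have B1: "norm (F' x) \<le> (2 * (c * L)) / (1 + \<bar>x\<bar>) ^ 2" for x
    proof -
      have "norm (F' x) \<le> norm (f x * nderiv 1 \<phi> x) + norm (f' x * \<phi> x)"
        unfolding F'_def by (rule norm_triangle_ineq)
      also have "\<dots> \<le> c * L / (1 + \<bar>x\<bar>) ^ 3 + c * L / (1 + \<bar>x\<bar>) ^ 3"
        using prod[of f x 1] prod[of f' x 0] b0 b1 by (intro add_mono) auto
      also have "\<dots> = (2 * (c * L)) / (1 + \<bar>x\<bar>) ^ 3" by simp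
      also have "\<dots> \<le> (2 * (c * L)) / (1 + \<bar>x\<bar>) ^ 2"
        using c0 L by (intro divide_left_mono power_increasing mult_pos_pos) auto
      finally show ?thesis .
    qed
    have B2: "norm (f x * \<phi> x) \<le> (2 * (c * L)) / (1 + \<bar>x\<bar>) ^ 2" for x
    proof -
      have "(2 * (c * L)) / (1 + \<bar>x\<bar>) ^ 3 \<le> (2 * (c * L)) / (1 + \<bar>x\<bar>) ^ 2"
        using c0 L by (intro divide_left_mono power_increasing mult_pos_pos) auto
      with B0[of x] show ?thesis by linarith
    qed
    have "continuous_on UNIV (\<lambda>x. f x * \<phi> x)"
      by (intro continuous_at_imp_continuous_on ballI has_vector_derivative_continuous[OF F])
    then have int: "integrable lborel (\<lambda>x. f x * \<phi> x)"
      by (rule integral_decay(1)[OF continuous_borel_measurable_lborel B2])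
    have "norm ((\<integral>x. f x * \<phi> x \<partial>lborel) -
          (\<Sum>m\<in>{-int (n^2)..<int (n^2)}. f (of_int m / n) * \<phi> (of_int m / n) * of_real (1 / n))) \<le>
          8 * L * weight_integral * c / n" if n: "n > 0" for n :: nat
      using riemann_sum_error[OF F B0 B1 n] by (simp add: mult_ac)
    with int show "integrable lborel (\<lambda>x. f x * \<phi> x) \<and>
       (\<forall>n>0. norm ((\<integral>x. f x * \<phi> x \<partial>lborel) -
          (\<Sum>m\<in>{-int (n^2)..<int (n^2)}. f (of_int m / n) * \<phi> (of_int m / n) * of_real (1 / n))) \<le>
          8 * L * weight_integral * c / n)" by blast
  qed
qed

text \<open>A dominated second derivative makes the second order remainder integrable.\<close>

lemma has_vector_derivative_parameter_integral:
  fixes G G' G'' :: "real \<Rightarrow> real \<Rightarrow> complex"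
  assumes d: "\<And>y x. ((\<lambda>y. G y x) has_vector_derivative G' y x) (at y)"
      "\<And>y x. ((\<lambda>y. G' y x) has_vector_derivative G'' y x) (at y)"
    and w: "\<And>y x. norm (G'' y x) \<le> w x" "integrable lborel w"
    and int: "\<And>y. integrable lborel (G y)" "\<And>y. integrable lborel (G' y)"
  shows "((\<lambda>y. \<integral>x. G y x \<partial>lborel) has_vector_derivative (\<integral>x. G' y x \<partial>lborel)) (at y)"
proof (rule has_vector_derivative_quadratic)
  fix h :: real
  have "norm (\<integral>x. G (y + h) x - G y x - of_real h * G' y x \<partial>lborel) \<le> (\<integral>x. w x * h\<^sup>2 \<partial>lborel)"
  proof (rule Bochner_Integration.integral_norm_bound_integral)
    show "norm (G (y + h) x - G y x - of_real h * G' y x) \<le> w x * h\<^sup>2" for x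
      by (rule second_order_remainder[OF d]) (rule w)
  qed (use int w in auto)
  then show "norm ((\<integral>x. G (y + h) x \<partial>lborel) - (\<integral>x. G y x \<partial>lborel) - of_real h * (\<integral>x. G' y x \<partial>lborel)) \<le>
      (\<integral>x. w x \<partial>lborel) * h\<^sup>2"
    using int w by simp
qed

lemma schwartz_integrable:
  assumes \<phi>: "\<phi> \<in> schwartz" and f: "continuous_on UNIV f" "\<And>x. norm (f x) \<le> c * (1 + \<bar>x\<bar>) ^ N"
  shows "integrable lborel (\<lambda>x. f x * \<phi> x)"
proof -
  obtain L where L: "0 \<le> L" "\<And>b x. b \<le> 0 \<Longrightarrow> (1 + \<bar>x\<bar>) ^ (N + 2) * norm (nderiv b \<phi> x) \<le> L"
    using schwartz_bound[OF \<phi>, of 0 "N + 2"] by blast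
  have c0: "0 \<le> c" using order_trans[OF norm_ge_zero f(2)[of 0]] by simp
  have "norm (f x * \<phi> x) \<le> c * L / (1 + \<bar>x\<bar>) ^ 2" for x
  proof -
    have "norm (f x * \<phi> x) \<le> (c * (1 + \<bar>x\<bar>) ^ N) * norm (\<phi> x)"
      unfolding norm_mult by (intro mult_right_mono f) auto
    also have "\<dots> = c * ((1 + \<bar>x\<bar>) ^ (N + 2) * norm (\<phi> x)) / (1 + \<bar>x\<bar>) ^ 2"
    proof -
      have "(1 + \<bar>x\<bar>) ^ 2 \<noteq> 0" by (simp add: add_nonneg_eq_0_iff)
      then show ?thesis by (subst nonzero_eq_divide_eq, assumption) (simp only: power_add mult_ac)
    qed
    also have "\<dots> \<le> c * L / (1 + \<bar>x\<bar>) ^ 2"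
      using c0 L(2)[of 0 x] by (intro divide_right_mono mult_left_mono) auto
    finally show ?thesis .
  qed
  moreover have "continuous_on UNIV \<phi>" using schwartz_continuous[OF \<phi>, of UNIV 0] by simp
  ultimately show ?thesis
    by (intro integral_decay(1) continuous_borel_measurable_lborel continuous_on_mult f)
qed

lemma schwartz_weighted_integrable:
  assumes \<phi>: "\<phi> \<in> schwartz"
  shows "integrable lborel (\<lambda>x. (1 + \<bar>x\<bar>) ^ N * norm (\<phi> x))"
proof -
  have "integrable lborel (\<lambda>x. of_real ((1 + \<bar>x\<bar>) ^ N) * \<phi> x)"
  proof (rule schwartz_integrable[OF \<phi>, of _ 1 N])
    show "continuous_on UNIV (\<lambda>x. of_real ((1 + \<bar>x\<bar>) ^ N) :: complex)" by (intro continuous_intros)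
    show "norm (of_real ((1 + \<bar>x\<bar>) ^ N) :: complex) \<le> 1 * (1 + \<bar>x\<bar>) ^ N" for x :: real
      by (simp add: norm_of_real del: of_real_power of_real_add)
  qed
  from integrable_norm[OF this] show ?thesis
    by (simp add: norm_mult norm_power del: of_real_power of_real_add)
qed

text \<open>The distribution commutes with Riemann sums. Those of the left-hand integral converge in every
  Schwartz seminorm, and \<open>u\<close> turns them into Riemann sums of the right-hand integral.\<close>

lemma tempered_interchange:
  assumes u: "tempered_distribution u" and \<psi>: "\<psi> \<in> schwartz" and \<phi>: "\<phi> \<in> schwartz"
  shows "(\<lambda>y. \<integral>x. \<psi> (x - y) * \<phi> x \<partial>lborel) \<in> schwartz"
    and "integrable lborel (\<lambda>x. Defs.convolution \<psi> u x * \<phi> x)"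
    and "u (\<lambda>y. \<integral>x. \<psi> (x - y) * \<phi> x \<partial>lborel) = (\<integral>x. Defs.convolution \<psi> u x * \<phi> x \<partial>lborel)"
proof -
  define T where "T b y = (\<integral>x. (- 1) ^ b * nderiv b \<psi> (x - y) * \<phi> x \<partial>lborel)" for b y
  have dr: "((\<lambda>y. nderiv b \<psi> (x - y)) has_vector_derivative - nderiv (Suc b) \<psi> (x - y)) (at y)" for b x y
  proof -
    have "((\<lambda>y. x - y) has_vector_derivative (- 1)) (at y)" by (auto intro!: derivative_eq_intros)
    from vector_diff_chain_at[OF this schwartz_has_derivative[OF \<psi>, of b "x - y"]]
    show ?thesis by (simp add: o_def)
  qed
  have cont: "continuous_on UNIV (\<lambda>x. nderiv b \<psi> (x - y))" for b y
    by (rule continuous_on_compose2[OF schwartz_continuous[OF \<psi>]]) (auto intro!: continuous_intros)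
  have bnd: "\<exists>K\<ge>0. \<forall>x. norm (nderiv b \<psi> x) \<le> K" for b
    using schwartz_bound[OF \<psi>, of b 0] by force
  have int: "integrable lborel (\<lambda>x. (- 1) ^ b * nderiv b' \<psi> (x - y) * \<phi> x)" for b b' y
  proof -
    obtain K where "\<And>x. norm (nderiv b' \<psi> x) \<le> K" using bnd[of b'] by blast
    then show ?thesis
      by (intro schwartz_integrable[OF \<phi>, of _ K 0] continuous_intros cont) (auto simp: norm_mult norm_power)
  qed
  have T: "(T b has_vector_derivative T (Suc b) y) (at y)" for b y
  proof -
    obtain K where K: "0 \<le> K" "\<And>x. norm (nderiv (Suc (Suc b)) \<psi> x) \<le> K" using bnd[of "Suc (Suc b)"] by blast
    show ?thesis unfolding T_def
    proof (rule has_vector_derivative_parameter_integral[where G'' = "\<lambda>y x. (- 1) ^ Suc (Suc b) * nderiv (Suc (Suc b)) \<psi> (x - y) * \<phi> x"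
          and w = "\<lambda>x. K * norm (\<phi> x)"])
      have step: "((\<lambda>y. (- 1) ^ b * nderiv b \<psi> (x - y) * \<phi> x) has_vector_derivative
          (- 1) ^ Suc b * nderiv (Suc b) \<psi> (x - y) * \<phi> x) (at y)" for b x y
        using has_vector_derivative_mult_left[OF has_vector_derivative_mult_right[OF dr[of b x y], where a = "(- 1) ^ b"], where a = "\<phi> x"]
        by simp
      show "((\<lambda>y. (- 1) ^ b * nderiv b \<psi> (x - y) * \<phi> x) has_vector_derivative
          (- 1) ^ Suc b * nderiv (Suc b) \<psi> (x - y) * \<phi> x) (at y)"
        "((\<lambda>y. (- 1) ^ Suc b * nderiv (Suc b) \<psi> (x - y) * \<phi> x) has_vector_derivative
          (- 1) ^ Suc (Suc b) * nderiv (Suc (Suc b)) \<psi> (x - y) * \<phi> x) (at y)" for x y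
        by (rule step)+
      show "norm ((- 1) ^ Suc (Suc b) * nderiv (Suc (Suc b)) \<psi> (x - y) * \<phi> x) \<le> K * norm (\<phi> x)" for x y
        using mult_right_mono[OF K(2)[of "x - y"], of "norm (\<phi> x)"] by (simp add: norm_mult norm_power)
      show "integrable lborel (\<lambda>x. K * norm (\<phi> x))"
        using schwartz_weighted_integrable[OF \<phi>, of 0] by simp
    qed (rule int)+
  qed
  have Tb: "\<exists>c. \<forall>y. (1 + \<bar>y\<bar>) ^ a * norm (T b y) \<le> c" for a b
  proof -
    obtain K where K: "0 \<le> K" "\<And>x. (1 + \<bar>x\<bar>) ^ a * norm (nderiv b \<psi> x) \<le> K"
      using schwartz_bound[OF \<psi>, of b a] by blast
    have "(1 + \<bar>y\<bar>) ^ a * norm (T b y) \<le> (\<integral>x. K * ((1 + \<bar>x\<bar>) ^ a * norm (\<phi> x)) \<partial>lborel)" for y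
    proof -
      have "(1 + \<bar>y\<bar>) ^ a * norm (T b y) = norm (\<integral>x. of_real ((1 + \<bar>y\<bar>) ^ a) * ((- 1) ^ b * nderiv b \<psi> (x - y) * \<phi> x) \<partial>lborel)"
        unfolding T_def by (subst integral_mult_right_zero) (simp add: norm_mult norm_power del: of_real_power of_real_add)
      also have "\<dots> \<le> (\<integral>x. K * ((1 + \<bar>x\<bar>) ^ a * norm (\<phi> x)) \<partial>lborel)"
      proof (rule Bochner_Integration.integral_norm_bound_integral)
        show "integrable lborel (\<lambda>x. K * ((1 + \<bar>x\<bar>) ^ a * norm (\<phi> x)))"
          by (intro integrable_mult_right schwartz_weighted_integrable \<phi>)
        show "norm (of_real ((1 + \<bar>y\<bar>) ^ a) * ((- 1) ^ b * nderiv b \<psi> (x - y) * \<phi> x)) \<le> K * ((1 + \<bar>x\<bar>) ^ a * norm (\<phi> x))" for x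
        proof -
          have "norm (of_real ((1 + \<bar>y\<bar>) ^ a) * ((- 1) ^ b * nderiv b \<psi> (x - y) * \<phi> x)) =
              (1 + \<bar>y\<bar>) ^ a * (norm (nderiv b \<psi> (x - y)) * norm (\<phi> x))"
            by (simp add: norm_mult norm_power del: of_real_power of_real_add)
          also have "\<dots> \<le> ((1 + \<bar>x\<bar>) ^ a * (1 + \<bar>x - y\<bar>) ^ a) * (norm (nderiv b \<psi> (x - y)) * norm (\<phi> x))"
            by (intro mult_right_mono weight_mult_power) auto
          also have "\<dots> = ((1 + \<bar>x - y\<bar>) ^ a * norm (nderiv b \<psi> (x - y))) * ((1 + \<bar>x\<bar>) ^ a * norm (\<phi> x))"
            by (simp only: mult_ac)
          also have "\<dots> \<le> K * ((1 + \<bar>x\<bar>) ^ a * norm (\<phi> x))" by (intro mult_right_mono K) auto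
          finally show ?thesis .
        qed
      qed (intro integrable_mult_right int)
      finally show ?thesis .
    qed
    then show ?thesis by blast
  qed
  define \<Theta> where "\<Theta> y = (\<integral>x. \<psi> (x - y) * \<phi> x \<partial>lborel)" for y
  have T0: "T 0 = \<Theta>" by (simp add: T_def \<Theta>_def fun_eq_iff)
  have \<Theta>: "\<Theta> \<in> schwartz" by (rule schwartzI(1)[of T, OF T0 T Tb])
  have nd: "nderiv b \<Theta> = T b" for b by (rule schwartzI(2)[of T, OF T0 T Tb])
  show "(\<lambda>y. \<integral>x. \<psi> (x - y) * \<phi> x \<partial>lborel) \<in> schwartz" using \<Theta> unfolding \<Theta>_def .
  note S = schwartz_nderiv[OF \<psi>]
  obtain C N where C: "0 \<le> C" "\<And>\<phi> c. \<phi> \<in> schwartz \<Longrightarrow> 0 \<le> c \<Longrightarrow>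
    (\<And>b x. b \<le> N \<Longrightarrow> (1 + \<bar>x\<bar>) ^ N * norm (nderiv b \<phi> x) \<le> c) \<Longrightarrow> norm (u \<phi>) \<le> C * c"
    using tempered_bound[OF u] by blast
  obtain K1 where K1: "0 \<le> K1" "\<And>b x. b \<le> Suc N \<Longrightarrow> (1 + \<bar>x\<bar>) ^ N * norm (nderiv b \<psi> x) \<le> K1"
    using schwartz_bound[OF \<psi>, of "Suc N" N] by blast
  obtain K where K: "0 \<le> K"
    "\<And>f f' c. (\<And>x. (f has_vector_derivative f' x) (at x)) \<Longrightarrow>
       (\<And>x. norm (f x) \<le> c * (1 + \<bar>x\<bar>) ^ N) \<Longrightarrow> (\<And>x. norm (f' x) \<le> c * (1 + \<bar>x\<bar>) ^ N) \<Longrightarrow>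
       integrable lborel (\<lambda>x. f x * \<phi> x) \<and>
       (\<forall>n>0. norm ((\<integral>x. f x * \<phi> x \<partial>lborel) -
          (\<Sum>m\<in>{-int (n^2)..<int (n^2)}. f (of_int m / n) * \<phi> (of_int m / n) * of_real (1 / n))) \<le> K * c / n)"
    using riemann_sum_schwartz[OF \<phi>, of N] by blast
  obtain C1 N1 C2 N2 where g: "\<And>x. norm (Defs.convolution \<psi> u x) \<le> C1 * (1 + \<bar>x\<bar>) ^ N1"
    "\<And>x. norm (Defs.convolution (nderiv 1 \<psi>) u x) \<le> C2 * (1 + \<bar>x\<bar>) ^ N2"
    using convolution_growth[OF u \<psi>] convolution_growth[OF u S(1)[of 1]] by blast
  have g0: "0 \<le> C1" "0 \<le> C2" using order_trans[OF norm_ge_zero g(1)[of 0]] order_trans[OF norm_ge_zero g(2)[of 0]] by auto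
  define N' where "N' = max N1 N2"
  have g': "norm (Defs.convolution \<psi> u x) \<le> (C1 + C2) * (1 + \<bar>x\<bar>) ^ N'"
    "norm (Defs.convolution (nderiv 1 \<psi>) u x) \<le> (C1 + C2) * (1 + \<bar>x\<bar>) ^ N'" for x
    by (rule order_trans[OF g(1)] order_trans[OF g(2)], intro mult_mono power_increasing; use g0 in \<open>simp add: N'_def\<close>)+
  obtain K' where K': "0 \<le> K'"
    "\<And>f f' c. (\<And>x. (f has_vector_derivative f' x) (at x)) \<Longrightarrow>
       (\<And>x. norm (f x) \<le> c * (1 + \<bar>x\<bar>) ^ N') \<Longrightarrow> (\<And>x. norm (f' x) \<le> c * (1 + \<bar>x\<bar>) ^ N') \<Longrightarrow>
       integrable lborel (\<lambda>x. f x * \<phi> x) \<and>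
       (\<forall>n>0. norm ((\<integral>x. f x * \<phi> x \<partial>lborel) -
          (\<Sum>m\<in>{-int (n^2)..<int (n^2)}. f (of_int m / n) * \<phi> (of_int m / n) * of_real (1 / n))) \<le> K' * c / n)"
    using riemann_sum_schwartz[OF \<phi>, of N'] by blast
  have cv: "integrable lborel (\<lambda>x. Defs.convolution \<psi> u x * \<phi> x) \<and>
     (\<forall>n>0. norm ((\<integral>x. Defs.convolution \<psi> u x * \<phi> x \<partial>lborel) -
        (\<Sum>m\<in>{-int (n^2)..<int (n^2)}. Defs.convolution \<psi> u (of_int m / n) * \<phi> (of_int m / n) * of_real (1 / n))) \<le> K' * (C1 + C2) / n)"
    by (rule K'(2)[OF _ g']) (use convolution_has_derivative[OF u \<psi>, of 0] in simp)
  then show "integrable lborel (\<lambda>x. Defs.convolution \<psi> u x * \<phi> x)" by blast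
  have main: "norm (u \<Theta> - (\<integral>x. Defs.convolution \<psi> u x * \<phi> x \<partial>lborel)) \<le> (C * (K * K1) + K' * (C1 + C2)) / n"
    if n: "n > 0" for n :: nat
  proof -
    define M where "M = {-int (n^2)..<int (n^2)}"
    define t where "t m = of_int m / real n" for m :: int
    define c where "c m = \<phi> (t m) * of_real (1 / n)" for m
    define H where "H y = (\<Sum>m\<in>M. c m * \<psi> (t m - y))" for y
    have rs: "(\<lambda>y. c m * \<psi> (t m - y)) \<in> schwartz" for m
      by (intro schwartz_cmult schwartz_reflect \<psi>)
    have finM: "finite M" by (simp add: M_def)
    note sum = schwartz_sum[OF finM, of "\<lambda>m y. c m * \<psi> (t m - y)", OF rs]
    have H: "H \<in> schwartz" unfolding H_def by (rule conjunct1[OF sum])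
    have ndH: "nderiv b H y = (\<Sum>m\<in>M. c m * ((- 1) ^ b * nderiv b \<psi> (t m - y)))" for b y
      unfolding H_def conjunct2[OF sum, rule_format] schwartz_cmult(2)[OF schwartz_reflect(1)[OF \<psi>]] schwartz_reflect(2)[OF \<psi>] ..
    have uH: "u H = (\<Sum>m\<in>M. Defs.convolution \<psi> u (t m) * \<phi> (t m) * of_real (1 / n))"
    proof -
      have "u H = (\<Sum>m\<in>M. c m * Defs.convolution \<psi> u (t m))"
        unfolding H_def tempered_sum[OF u finM, of "\<lambda>m y. c m * \<psi> (t m - y)", OF rs]
          tempered_cmult[OF u schwartz_reflect(1)[OF \<psi>]] Defs.convolution_def ..
      also have "\<dots> = (\<Sum>m\<in>M. Defs.convolution \<psi> u (t m) * \<phi> (t m) * of_real (1 / n))"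
        by (intro sum.cong refl) (simp only: c_def mult_ac)
      finally show ?thesis .
    qed
    have "norm (u (\<lambda>y. \<Theta> y - H y)) \<le> C * (K * K1 / n)"
    proof (rule C(2)[OF schwartz_diff(1)[OF \<Theta> H]])
      fix b y assume bN: "b \<le> N"
      define f where "f x = of_real ((1 + \<bar>y\<bar>) ^ N) * ((- 1) ^ b * nderiv b \<psi> (x - y))" for x
      define f' where "f' x = of_real ((1 + \<bar>y\<bar>) ^ N) * ((- 1) ^ b * nderiv (Suc b) \<psi> (x - y))" for x
      have df: "(f has_vector_derivative f' x) (at x)" for x
      proof -
        have "((\<lambda>x. x - y) has_vector_derivative 1) (at x)" by (auto intro!: derivative_eq_intros)
        from vector_diff_chain_at[OF this schwartz_has_derivative[OF \<psi>, of b "x - y"]]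
        have "((\<lambda>x. nderiv b \<psi> (x - y)) has_vector_derivative nderiv (Suc b) \<psi> (x - y)) (at x)" by (simp add: o_def)
        then show ?thesis unfolding f_def f'_def by (intro has_vector_derivative_mult_right)
      qed
      have bd: "norm (of_real ((1 + \<bar>y\<bar>) ^ N) * ((- 1) ^ b * nderiv j \<psi> (x - y))) \<le> K1 * (1 + \<bar>x\<bar>) ^ N" if "j \<le> Suc N" for j x
      proof -
        have "norm (of_real ((1 + \<bar>y\<bar>) ^ N) * ((- 1) ^ b * nderiv j \<psi> (x - y))) = (1 + \<bar>y\<bar>) ^ N * norm (nderiv j \<psi> (x - y))"
          by (simp add: norm_mult norm_power del: of_real_power of_real_add)
        also have "\<dots> \<le> ((1 + \<bar>x\<bar>) ^ N * (1 + \<bar>x - y\<bar>) ^ N) * norm (nderiv j \<psi> (x - y))"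
          by (intro mult_right_mono weight_mult_power) auto
        also have "\<dots> = (1 + \<bar>x\<bar>) ^ N * ((1 + \<bar>x - y\<bar>) ^ N * norm (nderiv j \<psi> (x - y)))" by (simp only: mult.assoc)
        also have "\<dots> \<le> (1 + \<bar>x\<bar>) ^ N * K1" by (intro mult_left_mono K1(2) that) auto
        finally show ?thesis by (simp only: mult.commute)
      qed
      have "norm ((\<integral>x. f x * \<phi> x \<partial>lborel) - (\<Sum>m\<in>M. f (t m) * \<phi> (t m) * of_real (1 / n))) \<le> K * K1 / n"
        using K(2)[of f f' K1] df bd bN n unfolding f_def f'_def M_def t_def by simp
      moreover have "(\<integral>x. f x * \<phi> x \<partial>lborel) = of_real ((1 + \<bar>y\<bar>) ^ N) * T b y"
        unfolding T_def by (subst integral_mult_right_zero[symmetric]) (simp only: f_def mult.assoc)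
      moreover have "(\<Sum>m\<in>M. f (t m) * \<phi> (t m) * of_real (1 / n)) = of_real ((1 + \<bar>y\<bar>) ^ N) * nderiv b H y"
        unfolding ndH sum_distrib_left by (intro sum.cong refl) (simp only: f_def c_def mult_ac)
      ultimately have "norm (of_real ((1 + \<bar>y\<bar>) ^ N) * (T b y - nderiv b H y)) \<le> K * K1 / n"
        by (simp only: right_diff_distrib)
      then show "(1 + \<bar>y\<bar>) ^ N * norm (nderiv b (\<lambda>y. \<Theta> y - H y) y) \<le> K * K1 / n"
        unfolding schwartz_diff(2)[OF \<Theta> H] nd by (simp add: norm_mult norm_power del: of_real_power of_real_add)
    qed (use K K1 in auto)
    then have 1: "norm (u \<Theta> - u H) \<le> C * (K * K1 / n)" by (simp add: tempered_diff[OF u \<Theta> H])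
    have 2: "norm ((\<integral>x. Defs.convolution \<psi> u x * \<phi> x \<partial>lborel) - u H) \<le> K' * (C1 + C2) / n"
      using cv n unfolding uH M_def t_def by blast
    have "norm (u \<Theta> - (\<integral>x. Defs.convolution \<psi> u x * \<phi> x \<partial>lborel)) \<le> C * (K * K1 / n) + K' * (C1 + C2) / n"
      using norm_triangle_ineq4[of "u \<Theta> - u H" "(\<integral>x. Defs.convolution \<psi> u x * \<phi> x \<partial>lborel) - u H"] 1 2 by simp
    then show ?thesis by (simp add: add_divide_distrib)
  qed
  have "(\<lambda>n. (C * (K * K1) + K' * (C1 + C2)) / real (Suc n)) \<longlonglongrightarrow> 0"
    by (rule tendsto_divide_0[OF tendsto_const]) (rule filterlim_compose[OF filterlim_at_top_imp_at_infinity filterlim_Suc, OF filterlim_real_sequentially])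
  then have "norm (u \<Theta> - (\<integral>x. Defs.convolution \<psi> u x * \<phi> x \<partial>lborel)) \<le> 0"
    by (rule LIMSEQ_le_const) (intro exI[of _ 0] allI impI main, simp)
  then have "u \<Theta> = (\<integral>x. Defs.convolution \<psi> u x * \<phi> x \<partial>lborel)" by simp
  then show "u (\<lambda>y. \<integral>x. \<psi> (x - y) * \<phi> x \<partial>lborel) = (\<integral>x. Defs.convolution \<psi> u x * \<phi> x \<partial>lborel)"
    unfolding \<Theta>_def .
qed

section \<open>Approximate identities\<close>

lemma norm_weighted_integral_le:
  fixes f :: "real \<Rightarrow> complex"
  assumes f: "integrable lborel f" and w: "integrable lborel w"
    and b: "\<And>x. c * norm (f x) \<le> w x" and c: "0 \<le> c"
  shows "c * norm (\<integral>x. f x \<partial>lborel) \<le> (\<integral>x. w x \<partial>lborel)"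
proof -
  have "c * norm (\<integral>x. f x \<partial>lborel) \<le> c * (\<integral>x. norm (f x) \<partial>lborel)"
    by (intro mult_left_mono c integral_norm_bound)
  also have "\<dots> = (\<integral>x. c * norm (f x) \<partial>lborel)" by (rule integral_mult_right_zero[symmetric])
  also have "\<dots> \<le> (\<integral>x. w x \<partial>lborel)"
    by (intro integral_mono integrable_mult_right integrable_norm f w b)
  finally show ?thesis .
qed

lemma schwartz_dilate:
  assumes "\<phi> \<in> schwartz" "c \<noteq> 0"
  shows "(\<lambda>x. \<phi> (c * x)) \<in> schwartz"
proof (rule schwartzI(1)[of "\<lambda>n x. of_real (c ^ n) * nderiv n \<phi> (c * x)"])
  show "(\<lambda>x. of_real (c ^ 0) * nderiv 0 \<phi> (c * x)) = (\<lambda>x. \<phi> (c * x))" by simp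
  show "((\<lambda>x. of_real (c ^ n) * nderiv n \<phi> (c * x)) has_vector_derivative
      of_real (c ^ Suc n) * nderiv (Suc n) \<phi> (c * x)) (at x)" for n x
  proof -
    have "((\<lambda>x. c * x) has_vector_derivative c) (at x)" by (auto intro!: derivative_eq_intros)
    from vector_diff_chain_at[OF this schwartz_has_derivative[OF assms(1), of n "c * x"]]
    have "((\<lambda>x. nderiv n \<phi> (c * x)) has_vector_derivative of_real c * nderiv (Suc n) \<phi> (c * x)) (at x)"
      by (simp add: o_def scaleR_conv_of_real)
    from has_vector_derivative_mult_right[OF this, of "of_real (c ^ n)"] show ?thesis by (simp add: mult_ac)
  qed
  fix a b
  obtain K where K: "0 \<le> K" "\<And>x. (1 + \<bar>x\<bar>) ^ a * norm (nderiv b \<phi> x) \<le> K"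
    using schwartz_bound[OF assms(1), of b a] by blast
  have "(1 + \<bar>x\<bar>) ^ a * norm (of_real (c ^ b) * nderiv b \<phi> (c * x)) \<le> ((1 + 1 / \<bar>c\<bar>) ^ a * \<bar>c\<bar> ^ b) * K" for x
  proof -
    have "(1 + 1 / \<bar>c\<bar>) * (1 + \<bar>c * x\<bar>) = 1 + \<bar>x\<bar> + (\<bar>c * x\<bar> + 1 / \<bar>c\<bar>)"
      using assms(2) by (simp add: abs_mult distrib_left distrib_right)
    moreover have "0 \<le> \<bar>c * x\<bar> + 1 / \<bar>c\<bar>" by simp
    ultimately have "1 + \<bar>x\<bar> \<le> (1 + 1 / \<bar>c\<bar>) * (1 + \<bar>c * x\<bar>)" by linarith
    then have "(1 + \<bar>x\<bar>) ^ a \<le> ((1 + 1 / \<bar>c\<bar>) * (1 + \<bar>c * x\<bar>)) ^ a" by (intro power_mono) auto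
    then have "(1 + \<bar>x\<bar>) ^ a * norm (of_real (c ^ b) * nderiv b \<phi> (c * x)) \<le>
        ((1 + 1 / \<bar>c\<bar>) * (1 + \<bar>c * x\<bar>)) ^ a * norm (of_real (c ^ b) * nderiv b \<phi> (c * x))"
      by (rule mult_right_mono) simp
    also have "\<dots> = ((1 + 1 / \<bar>c\<bar>) ^ a * \<bar>c\<bar> ^ b) * ((1 + \<bar>c * x\<bar>) ^ a * norm (nderiv b \<phi> (c * x)))"
      unfolding power_mult_distrib norm_mult norm_of_real power_abs by (simp only: mult_ac)
    also have "\<dots> \<le> ((1 + 1 / \<bar>c\<bar>) ^ a * \<bar>c\<bar> ^ b) * K" by (intro mult_left_mono K) auto
    finally show ?thesis .
  qed
  then show "\<exists>k. \<forall>x. (1 + \<bar>x\<bar>) ^ a * norm (of_real (c ^ b) * nderiv b \<phi> (c * x)) \<le> k" by blast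
qed

text \<open>Pairing with \<open>\<phi>\<close> the convolution of \<open>u\<close> with a narrow bump amounts to applying \<open>u\<close> to an
  average of translates of \<open>\<phi>\<close>, which tends to \<open>\<phi>\<close> in every Schwartz seminorm.\<close>

lemma approximate_identity:
  assumes u: "tempered_distribution u" and \<psi>: "\<psi> \<in> schwartz" and one: "(\<integral>x. \<psi> x \<partial>lborel) = 1"
    and \<phi>: "\<phi> \<in> schwartz"
  shows "\<exists>B. \<forall>\<sigma>\<ge>1. norm ((\<integral>x. Defs.convolution (\<lambda>x. of_real \<sigma> * \<psi> (\<sigma> * x)) u x * \<phi> x \<partial>lborel) - u \<phi>) \<le> B / \<sigma>"
proof -
  obtain C N where C: "0 \<le> C" "\<And>\<phi> c. \<phi> \<in> schwartz \<Longrightarrow> 0 \<le> c \<Longrightarrow>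
    (\<And>b x. b \<le> N \<Longrightarrow> (1 + \<bar>x\<bar>) ^ N * norm (nderiv b \<phi> x) \<le> c) \<Longrightarrow> norm (u \<phi>) \<le> C * c"
    using tempered_bound[OF u] by blast
  obtain K where K: "0 \<le> K" "\<And>b x. b \<le> Suc N \<Longrightarrow> (1 + \<bar>x\<bar>) ^ N * norm (nderiv b \<phi> x) \<le> K"
    using schwartz_bound[OF \<phi>, of "Suc N" N] by blast
  define W where "W = (\<integral>s. (1 + \<bar>s\<bar>) ^ Suc N * norm (\<psi> s) \<partial>lborel)"
  have W0: "0 \<le> W" unfolding W_def by (rule integral_nonneg_AE) simp
  have shift: "(1 + \<bar>y\<bar>) ^ a * norm (nderiv b \<phi> t) \<le> (1 + \<bar>s\<bar>) ^ a * L"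
    if L: "\<And>x. (1 + \<bar>x\<bar>) ^ a * norm (nderiv b \<phi> x) \<le> L" "\<bar>t - y\<bar> \<le> \<bar>s\<bar>" for y a b t s L
  proof -
    have "(1 + \<bar>y\<bar>) ^ a * norm (nderiv b \<phi> t) \<le> ((1 + \<bar>t\<bar>) ^ a * (1 + \<bar>t - y\<bar>) ^ a) * norm (nderiv b \<phi> t)"
      by (intro mult_right_mono weight_mult_power) auto
    also have "\<dots> = (1 + \<bar>t - y\<bar>) ^ a * ((1 + \<bar>t\<bar>) ^ a * norm (nderiv b \<phi> t))" by (simp only: mult_ac)
    also have "\<dots> \<le> (1 + \<bar>s\<bar>) ^ a * L"
      by (intro mult_mono power_mono L) (use that in auto)
    finally show ?thesis .
  qed
  show ?thesis
  proof (intro exI[of _ "C * (K * W)"] allI impI)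
    fix \<sigma> :: real assume \<sigma>: "1 \<le> \<sigma>"
    have close: "\<bar>(y + s / \<sigma>) - y\<bar> \<le> \<bar>s\<bar>" for y s
    proof -
      have "\<bar>s\<bar> * 1 \<le> \<bar>s\<bar> * \<sigma>" using \<sigma> by (intro mult_left_mono) auto
      then have "\<bar>s\<bar> / \<sigma> \<le> \<bar>s\<bar>" using \<sigma> by (simp add: pos_divide_le_eq)
      then show ?thesis using \<sigma> by (simp add: abs_divide)
    qed
    define T where "T b y = (\<integral>s. nderiv b \<phi> (y + s / \<sigma>) * \<psi> s \<partial>lborel)" for b y
    have bnd: "\<exists>K\<ge>0. \<forall>x. norm (nderiv b \<phi> x) \<le> K" for b
      using schwartz_bound[OF \<phi>, of b 0] by force
    have cont: "continuous_on UNIV (\<lambda>s. nderiv b \<phi> (y + s / \<sigma>))" for b y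
      by (rule continuous_on_compose2[OF schwartz_continuous[OF \<phi>]]) (use \<sigma> in \<open>auto intro!: continuous_intros\<close>)
    have int: "integrable lborel (\<lambda>s. nderiv b \<phi> (y + s / \<sigma>) * \<psi> s)" for b y
    proof -
      obtain L where L: "\<And>x. norm (nderiv b \<phi> x) \<le> L" using bnd[of b] by blast
      show ?thesis by (rule schwartz_integrable[OF \<psi> cont, of _ _ L 0]) (simp add: L)
    qed
    have intw: "integrable lborel (\<lambda>s. (1 + \<bar>s\<bar>) ^ a * norm (\<psi> s))" for a
      by (rule schwartz_weighted_integrable[OF \<psi>])
    have dT: "(T b has_vector_derivative T (Suc b) y) (at y)" for b y
    proof -
      obtain L where L: "0 \<le> L" "\<And>x. norm (nderiv (Suc (Suc b)) \<phi> x) \<le> L" using bnd[of "Suc (Suc b)"] by blast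
      show ?thesis unfolding T_def
      proof (rule has_vector_derivative_parameter_integral[where w = "\<lambda>s. L * norm (\<psi> s)" and
            G'' = "\<lambda>y s. nderiv (Suc (Suc b)) \<phi> (y + s / \<sigma>) * \<psi> s"])
        have step: "((\<lambda>y. nderiv b \<phi> (y + s / \<sigma>) * \<psi> s) has_vector_derivative nderiv (Suc b) \<phi> (y + s / \<sigma>) * \<psi> s) (at y)" for b s y
        proof -
          have "((\<lambda>y. y + s / \<sigma>) has_vector_derivative 1) (at y)" by (auto intro!: derivative_eq_intros)
          from vector_diff_chain_at[OF this schwartz_has_derivative[OF \<phi>, of b "y + s / \<sigma>"]]
          have "((\<lambda>y. nderiv b \<phi> (y + s / \<sigma>)) has_vector_derivative nderiv (Suc b) \<phi> (y + s / \<sigma>)) (at y)" by (simp add: o_def)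
          then show ?thesis by (rule has_vector_derivative_mult_left)
        qed
        show "((\<lambda>y. nderiv b \<phi> (y + s / \<sigma>) * \<psi> s) has_vector_derivative nderiv (Suc b) \<phi> (y + s / \<sigma>) * \<psi> s) (at y)"
          "((\<lambda>y. nderiv (Suc b) \<phi> (y + s / \<sigma>) * \<psi> s) has_vector_derivative nderiv (Suc (Suc b)) \<phi> (y + s / \<sigma>) * \<psi> s) (at y)" for y s
          by (rule step)+
        show "norm (nderiv (Suc (Suc b)) \<phi> (y + s / \<sigma>) * \<psi> s) \<le> L * norm (\<psi> s)" for y s
          unfolding norm_mult by (intro mult_right_mono L) simp
        show "integrable lborel (\<lambda>s. L * norm (\<psi> s))" using intw[of 0] by simp
      qed (rule int)+
    qed
    have bT: "\<exists>c. \<forall>y. (1 + \<bar>y\<bar>) ^ a * norm (T b y) \<le> c" for a b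
    proof -
      obtain L where L: "0 \<le> L" "\<And>x. (1 + \<bar>x\<bar>) ^ a * norm (nderiv b \<phi> x) \<le> L"
        using schwartz_bound[OF \<phi>, of b a] by blast
      have "(1 + \<bar>y\<bar>) ^ a * norm (T b y) \<le> (\<integral>s. L * ((1 + \<bar>s\<bar>) ^ a * norm (\<psi> s)) \<partial>lborel)" for y
        unfolding T_def
      proof (rule norm_weighted_integral_le[OF int])
        fix s
        have "(1 + \<bar>y\<bar>) ^ a * norm (nderiv b \<phi> (y + s / \<sigma>)) * norm (\<psi> s) \<le> ((1 + \<bar>s\<bar>) ^ a * L) * norm (\<psi> s)"
          by (intro mult_right_mono shift[OF L(2) close]) auto
        then show "(1 + \<bar>y\<bar>) ^ a * norm (nderiv b \<phi> (y + s / \<sigma>) * \<psi> s) \<le> L * ((1 + \<bar>s\<bar>) ^ a * norm (\<psi> s))"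
          by (simp only: norm_mult mult_ac)
      qed (intro integrable_mult_right intw, simp)
      then show ?thesis by blast
    qed
    have T: "T 0 \<in> schwartz" by (rule schwartzI(1)[of T, OF refl dT bT])
    have nT: "nderiv b (T 0) = T b" for b by (rule schwartzI(2)[of T, OF refl dT bT])
    have "norm (u (\<lambda>y. T 0 y - \<phi> y)) \<le> C * (K * W / \<sigma>)"
    proof (rule C(2)[OF schwartz_diff(1)[OF T \<phi>]])
      show "0 \<le> K * W / \<sigma>" using K W0 \<sigma> by simp
      fix b y assume b: "b \<le> N"
      have int2: "integrable lborel (\<lambda>s. nderiv b \<phi> y * \<psi> s)"
        using schwartz_integrable[OF \<psi>, of "\<lambda>_. nderiv b \<phi> y" "norm (nderiv b \<phi> y)" 0] by simp
      have "T b y - nderiv b \<phi> y = (\<integral>s. nderiv b \<phi> (y + s / \<sigma>) * \<psi> s - nderiv b \<phi> y * \<psi> s \<partial>lborel)"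
        using one by (subst Bochner_Integration.integral_diff[OF int int2]) (simp add: T_def)
      also have "\<dots> = (\<integral>s. (nderiv b \<phi> (y + s / \<sigma>) - nderiv b \<phi> y) * \<psi> s \<partial>lborel)" by (simp only: left_diff_distrib)
      finally have eq: "T b y - nderiv b \<phi> y = \<dots>" .
      have "(1 + \<bar>y\<bar>) ^ N * norm (T b y - nderiv b \<phi> y) \<le> (\<integral>s. K / \<sigma> * ((1 + \<bar>s\<bar>) ^ Suc N * norm (\<psi> s)) \<partial>lborel)"
        unfolding eq
      proof (rule norm_weighted_integral_le)
        show "integrable lborel (\<lambda>s. (nderiv b \<phi> (y + s / \<sigma>) - nderiv b \<phi> y) * \<psi> s)"
          unfolding left_diff_distrib by (intro Bochner_Integration.integrable_diff int int2)
        fix s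
        define D where "D = (1 + \<bar>s\<bar>) ^ N * K / (1 + \<bar>y\<bar>) ^ N"
        have y0: "0 < (1 + \<bar>y\<bar>) ^ N" by (simp add: add_pos_nonneg)
        have "norm (nderiv b \<phi> (y + s / \<sigma>) - nderiv b \<phi> y) \<le> D * \<bar>(y + s / \<sigma>) - y\<bar>"
        proof (rule vector_derivative_bound[of "closed_segment y (y + s / \<sigma>)" _ "nderiv (Suc b) \<phi>"])
          fix t assume t: "t \<in> closed_segment y (y + s / \<sigma>)"
          show "(nderiv b \<phi> has_vector_derivative nderiv (Suc b) \<phi> t) (at t within closed_segment y (y + s / \<sigma>))"
            by (rule has_vector_derivative_at_within[OF schwartz_has_derivative[OF \<phi>]])
          have "\<bar>t - y\<bar> \<le> \<bar>(y + s / \<sigma>) - y\<bar>"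
            using segment_bound1[OF t] unfolding real_norm_def .
          then have "\<bar>t - y\<bar> \<le> \<bar>s\<bar>" using close[of y s] by linarith
          then have "(1 + \<bar>y\<bar>) ^ N * norm (nderiv (Suc b) \<phi> t) \<le> (1 + \<bar>s\<bar>) ^ N * K"
            by (intro shift K) (use b in auto)
          then show "norm (nderiv (Suc b) \<phi> t) \<le> D" unfolding D_def using y0 by (simp add: pos_le_divide_eq mult.commute)
        qed auto
        also have "\<dots> = D * (\<bar>s\<bar> / \<sigma>)" using \<sigma> by (simp add: abs_divide)
        also have "\<dots> \<le> D * ((1 + \<bar>s\<bar>) / \<sigma>)"
          by (intro mult_left_mono divide_right_mono) (use \<sigma> K y0 in \<open>auto simp: D_def\<close>)
        finally have "(1 + \<bar>y\<bar>) ^ N * norm (nderiv b \<phi> (y + s / \<sigma>) - nderiv b \<phi> y) \<le> (1 + \<bar>y\<bar>) ^ N * (D * ((1 + \<bar>s\<bar>) / \<sigma>))"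
          by (rule mult_left_mono) auto
        also have "\<dots> = ((1 + \<bar>y\<bar>) ^ N * D) * ((1 + \<bar>s\<bar>) / \<sigma>)" by (simp only: mult.assoc)
        also have "(1 + \<bar>y\<bar>) ^ N * D = (1 + \<bar>s\<bar>) ^ N * K" unfolding D_def using y0 by simp
        finally have "(1 + \<bar>y\<bar>) ^ N * norm (nderiv b \<phi> (y + s / \<sigma>) - nderiv b \<phi> y) * norm (\<psi> s) \<le>
            ((1 + \<bar>s\<bar>) ^ N * K) * ((1 + \<bar>s\<bar>) / \<sigma>) * norm (\<psi> s)" by (rule mult_right_mono) auto
        then show "(1 + \<bar>y\<bar>) ^ N * norm ((nderiv b \<phi> (y + s / \<sigma>) - nderiv b \<phi> y) * \<psi> s) \<le> K / \<sigma> * ((1 + \<bar>s\<bar>) ^ Suc N * norm (\<psi> s))"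
          by (simp only: norm_mult power_Suc times_divide_eq_left times_divide_eq_right mult_ac)
      qed (intro integrable_mult_right intw, simp)
      also have "\<dots> = K / \<sigma> * W" unfolding W_def by (rule integral_mult_right_zero)
      finally show "(1 + \<bar>y\<bar>) ^ N * norm (nderiv b (\<lambda>y. T 0 y - \<phi> y) y) \<le> K * W / \<sigma>"
        by (simp add: schwartz_diff(2)[OF T \<phi>] nT)
    qed
    moreover have "(\<integral>x. Defs.convolution (\<lambda>x. of_real \<sigma> * \<psi> (\<sigma> * x)) u x * \<phi> x \<partial>lborel) = u (T 0)"
    proof -
      have S: "(\<lambda>x. of_real \<sigma> * \<psi> (\<sigma> * x)) \<in> schwartz"
        by (intro schwartz_cmult schwartz_dilate \<psi>) (use \<sigma> in auto)
      have "(\<integral>x. of_real \<sigma> * \<psi> (\<sigma> * (x - y)) * \<phi> x \<partial>lborel) = T 0 y" for y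
      proof -
        have "(\<integral>x. of_real \<sigma> * \<psi> (\<sigma> * (x - y)) * \<phi> x \<partial>lborel) =
            \<bar>1 / \<sigma>\<bar> *\<^sub>R (\<integral>s. of_real \<sigma> * \<psi> (\<sigma> * ((y + 1 / \<sigma> * s) - y)) * \<phi> (y + 1 / \<sigma> * s) \<partial>lborel)"
          by (rule lborel_integral_real_affine) (use \<sigma> in simp)
        also have "\<dots> = \<bar>1 / \<sigma>\<bar> *\<^sub>R (\<integral>s. of_real \<sigma> * (\<phi> (y + s / \<sigma>) * \<psi> s) \<partial>lborel)"
          using \<sigma> by (simp add: mult_ac)
        also have "\<dots> = T 0 y"
          unfolding T_def integral_mult_right_zero using \<sigma> by (simp add: scaleR_conv_of_real)
        finally show ?thesis .
      qed
      then have "(\<lambda>y. \<integral>x. of_real \<sigma> * \<psi> (\<sigma> * (x - y)) * \<phi> x \<partial>lborel) = T 0" by blast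
      with tempered_interchange(3)[OF u S \<phi>] show ?thesis by simp
    qed
    ultimately show "norm ((\<integral>x. Defs.convolution (\<lambda>x. of_real \<sigma> * \<psi> (\<sigma> * x)) u x * \<phi> x \<partial>lborel) - u \<phi>) \<le> C * (K * W) / \<sigma>"
      by (simp add: tempered_diff[OF u T \<phi>])
  qed
qed

section \<open>The Fourier transform of Schwartz functions\<close>

text \<open>The multiplier whose inverse Fourier transform is the derivative.\<close>

definition frequency :: "(real \<Rightarrow> complex) \<Rightarrow> real \<Rightarrow> complex" where
  "frequency g \<xi> = \<i> * (of_real \<xi> * g \<xi>)"

lemma schwartz_times_id:
  assumes g: "g \<in> schwartz"
  shows "(\<lambda>\<xi>. of_real \<xi> * g \<xi>) \<in> schwartz"
proof (rule schwartzI(1)[of "\<lambda>n \<xi>. of_real \<xi> * nderiv n g \<xi> + of_nat n * nderiv (n - 1) g \<xi>"])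
  show "((\<lambda>\<xi>. of_real \<xi> * nderiv n g \<xi> + of_nat n * nderiv (n - 1) g \<xi>) has_vector_derivative
      of_real x * nderiv (Suc n) g x + of_nat (Suc n) * nderiv (Suc n - 1) g x) (at x)" for n x
  proof -
    have id: "((\<lambda>\<xi>. of_real \<xi> :: complex) has_vector_derivative 1) (at x)"
      using has_vector_derivative_of_real[OF DERIV_ident, where ?'a = complex] by simp
    have 1: "((\<lambda>\<xi>. of_real \<xi> * nderiv n g \<xi>) has_vector_derivative of_real x * nderiv (Suc n) g x + 1 * nderiv n g x) (at x)"
      by (intro has_vector_derivative_mult id schwartz_has_derivative g)
    have 2: "((\<lambda>\<xi>. of_nat n * nderiv (n - 1) g \<xi>) has_vector_derivative of_nat n * nderiv n g x) (at x)"
    proof (cases n)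
      case (Suc m)
      then show ?thesis using has_vector_derivative_mult_right[OF schwartz_has_derivative[OF g, of m x], of "of_nat n"] by simp
    qed simp
    have "of_real x * nderiv (Suc n) g x + 1 * nderiv n g x + of_nat n * nderiv n g x =
        of_real x * nderiv (Suc n) g x + of_nat (Suc n) * nderiv (Suc n - 1) g x"
      by (simp add: distrib_right)
    with has_vector_derivative_add[OF 1 2] show ?thesis by (simp only:)
  qed
  fix a b
  obtain K where K: "\<And>x. (1 + \<bar>x\<bar>) ^ Suc a * norm (nderiv b g x) \<le> K"
    using schwartz_bound[OF g, of b "Suc a"] by blast
  obtain L where L: "\<And>x. (1 + \<bar>x\<bar>) ^ a * norm (nderiv (b - 1) g x) \<le> L"
    using schwartz_bound[OF g, of "b - 1" a] by blast
  have "(1 + \<bar>x\<bar>) ^ a * norm (of_real x * nderiv b g x + of_nat b * nderiv (b - 1) g x) \<le> K + real b * L" for x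
  proof -
    have "norm (of_real x * nderiv b g x + of_nat b * nderiv (b - 1) g x) \<le>
        (1 + \<bar>x\<bar>) * norm (nderiv b g x) + real b * norm (nderiv (b - 1) g x)"
      by (rule order_trans[OF norm_triangle_ineq]) (simp add: norm_mult distrib_right)
    then have "(1 + \<bar>x\<bar>) ^ a * norm (of_real x * nderiv b g x + of_nat b * nderiv (b - 1) g x) \<le>
        (1 + \<bar>x\<bar>) ^ a * ((1 + \<bar>x\<bar>) * norm (nderiv b g x) + real b * norm (nderiv (b - 1) g x))"
      by (rule mult_left_mono) auto
    also have "\<dots> = (1 + \<bar>x\<bar>) ^ Suc a * norm (nderiv b g x) + real b * ((1 + \<bar>x\<bar>) ^ a * norm (nderiv (b - 1) g x))"
      by (simp only: distrib_left power_Suc mult_ac)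
    also have "\<dots> \<le> K + real b * L" by (intro add_mono mult_left_mono K L) auto
    finally show ?thesis .
  qed
  then show "\<exists>c. \<forall>x. (1 + \<bar>x\<bar>) ^ a * norm (of_real x * nderiv b g x + of_nat b * nderiv (b - 1) g x) \<le> c" by blast
qed simp

lemma schwartz_frequency: "g \<in> schwartz \<Longrightarrow> frequency g \<in> schwartz"
  unfolding frequency_def by (intro schwartz_cmult schwartz_times_id)

lemma norm_exp_kernel [simp]: "norm (exp (\<i> * of_real x * of_real \<xi>)) = 1"
  by (simp add: norm_exp_eq_Re)

lemma integrable_exp_kernel:
  assumes "g \<in> schwartz"
  shows "integrable lborel (\<lambda>\<xi>. exp (\<i> * of_real x * of_real \<xi>) * g \<xi>)"
  by (rule schwartz_integrable[OF assms, of _ 1 0]) (auto intro!: continuous_intros)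

lemma schwartz_integrable_norm: "g \<in> schwartz \<Longrightarrow> integrable lborel (\<lambda>x. norm (g x))"
  using schwartz_weighted_integrable[of g 0] by simp

lemma schwartz_integrable_self: "g \<in> schwartz \<Longrightarrow> integrable lborel g"
  using schwartz_integrable[of g "\<lambda>_. 1" 1 0] by simp

lemma exp_kernel_has_derivative:
  "((\<lambda>x. exp (\<i> * of_real x * of_real \<xi>)) has_vector_derivative
     \<i> * of_real \<xi> * exp (\<i> * of_real x * of_real \<xi>)) (at x)"
proof (rule has_vector_derivative_real_field)
  show "((\<lambda>w. exp (\<i> * w * of_real \<xi>)) has_field_derivative
      \<i> * of_real \<xi> * exp (\<i> * of_real x * of_real \<xi>)) (at (of_real x))"
    by (auto intro!: derivative_eq_intros)
qed

lemma inv_fourier_has_derivative: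
  assumes g: "g \<in> schwartz"
  shows "(inv_fourier g has_vector_derivative inv_fourier (frequency g) x) (at x)"
proof -
  let ?E = "\<lambda>x \<xi>. exp (\<i> * of_real x * of_real \<xi>)"
  have d: "((\<lambda>x. ?E x \<xi> * h \<xi>) has_vector_derivative ?E x \<xi> * frequency h \<xi>) (at x)" for h x \<xi>
    using has_vector_derivative_mult_left[OF exp_kernel_has_derivative[of \<xi> x], of "h \<xi>"]
    by (simp add: frequency_def mult_ac)
  have "((\<lambda>x. \<integral>\<xi>. ?E x \<xi> * g \<xi> \<partial>lborel) has_vector_derivative (\<integral>\<xi>. ?E x \<xi> * frequency g \<xi> \<partial>lborel)) (at x)"
  proof (rule has_vector_derivative_parameter_integral[where w = "\<lambda>\<xi>. norm (frequency (frequency g) \<xi>)"])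
    show "((\<lambda>x. ?E x \<xi> * g \<xi>) has_vector_derivative ?E x \<xi> * frequency g \<xi>) (at x)"
      "((\<lambda>x. ?E x \<xi> * frequency g \<xi>) has_vector_derivative ?E x \<xi> * frequency (frequency g) \<xi>) (at x)" for x \<xi>
      by (rule d)+
    show "integrable lborel (\<lambda>\<xi>. norm (frequency (frequency g) \<xi>))"
      by (intro schwartz_integrable_norm schwartz_frequency g)
  qed (simp_all add: norm_mult integrable_exp_kernel schwartz_frequency g)
  then show ?thesis unfolding inv_fourier_def by (rule has_vector_derivative_mult_right)
qed

lemma integral_derivative_eq_0:
  fixes H H' :: "real \<Rightarrow> complex"
  assumes d: "\<And>x. (H has_vector_derivative H' x) (at x)" and c: "continuous_on UNIV H'"
    and i: "integrable lborel H'" and b: "\<And>x. norm (H x) \<le> c / (1 + \<bar>x\<bar>)"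
  shows "(\<integral>x. H' x \<partial>lborel) = 0"
proof -
  have "((\<lambda>x::real. c / (1 + \<bar>x\<bar>)) \<longlongrightarrow> 0) at_top" "((\<lambda>x::real. c / (1 + \<bar>x\<bar>)) \<longlongrightarrow> 0) at_bot"
    by real_asymp+
  then have lim: "(H \<longlongrightarrow> 0) at_top" "(H \<longlongrightarrow> 0) at_bot"
    using b by (auto elim!: Lim_null_comparison[rotated])
  have "(LBINT x=-\<infinity>..\<infinity>. H' x) = 0 - 0"
  proof (rule interval_integral_FTC_integrable)
    show "isCont H' x" for x using c by (simp add: continuous_on_eq_continuous_at)
    show "set_integrable lborel (einterval (- \<infinity>) \<infinity>) H'" using i by (simp add: set_integrable_def einterval_def)
    show "((H \<circ> real_of_ereal) \<longlongrightarrow> 0) (at_right (- \<infinity>))" "((H \<circ> real_of_ereal) \<longlongrightarrow> 0) (at_left \<infinity>)"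
      using lim by (simp_all add: ereal_tendsto_simps)
  qed (use d in auto)
  then show ?thesis
    by (simp add: interval_lebesgue_integral_def set_lebesgue_integral_def einterval_def)
qed

text \<open>Integration by parts: the total derivative of \<open>exp (\<i> x \<xi>) g(\<xi>)\<close> has integral zero.\<close>

lemma inv_fourier_times_id:
  assumes g: "g \<in> schwartz"
  shows "\<i> * of_real x * inv_fourier g x = - inv_fourier (nderiv 1 g) x"
proof -
  let ?E = "\<lambda>\<xi>. exp (\<i> * of_real x * of_real \<xi>)"
  note g1 = schwartz_nderiv(1)[OF g, of 1]
  have dE: "(?E has_vector_derivative (\<i> * of_real x * ?E \<xi>)) (at \<xi>)" for \<xi>
    using exp_kernel_has_derivative[of x \<xi>] by (simp only: mult_ac)
  have d: "((\<lambda>\<xi>. ?E \<xi> * g \<xi>) has_vector_derivative ?E \<xi> * nderiv 1 g \<xi> + (\<i> * of_real x) * (?E \<xi> * g \<xi>)) (at \<xi>)" for \<xi>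
    using has_vector_derivative_mult[OF dE schwartz_has_derivative[OF g, of 0]] by (simp add: mult_ac)
  have cg: "continuous_on UNIV g" "continuous_on UNIV (nderiv 1 g)"
    using schwartz_continuous[OF g, of UNIV 0] schwartz_continuous[OF g, of UNIV 1] by simp_all
  obtain c where c: "\<And>x. (1 + \<bar>x\<bar>) ^ 1 * norm (nderiv 0 g x) \<le> c"
    using schwartz_bound[OF g, of 0 1] by blast
  have "(\<integral>\<xi>. ?E \<xi> * nderiv 1 g \<xi> + (\<i> * of_real x) * (?E \<xi> * g \<xi>) \<partial>lborel) = 0"
  proof (rule integral_derivative_eq_0[OF d])
    show "continuous_on UNIV (\<lambda>\<xi>. ?E \<xi> * nderiv 1 g \<xi> + (\<i> * of_real x) * (?E \<xi> * g \<xi>))"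
      by (intro continuous_intros cg)
    show "integrable lborel (\<lambda>\<xi>. ?E \<xi> * nderiv 1 g \<xi> + (\<i> * of_real x) * (?E \<xi> * g \<xi>))"
      by (intro Bochner_Integration.integrable_add integrable_mult_right integrable_exp_kernel g g1)
    show "norm (?E \<xi> * g \<xi>) \<le> c / (1 + \<bar>\<xi>\<bar>)" for \<xi>
      using c[of \<xi>] by (simp add: norm_mult pos_le_divide_eq mult.commute add_pos_nonneg)
  qed
  also have "(\<integral>\<xi>. ?E \<xi> * nderiv 1 g \<xi> + (\<i> * of_real x) * (?E \<xi> * g \<xi>) \<partial>lborel) =
      (\<integral>\<xi>. ?E \<xi> * nderiv 1 g \<xi> \<partial>lborel) + (\<i> * of_real x) * (\<integral>\<xi>. ?E \<xi> * g \<xi> \<partial>lborel)"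
    by (subst Bochner_Integration.integral_add[OF integrable_exp_kernel[OF g1] integrable_mult_right[OF integrable_exp_kernel[OF g]]])
      (simp only: integral_mult_right_zero)
  finally have "(\<i> * of_real x) * (\<integral>\<xi>. ?E \<xi> * g \<xi> \<partial>lborel) = - (\<integral>\<xi>. ?E \<xi> * nderiv 1 g \<xi> \<partial>lborel)"
    by (simp add: eq_neg_iff_add_eq_0 add.commute)
  then show ?thesis unfolding inv_fourier_def by (simp only: mult.left_commute[of "\<i> * of_real x"] mult_minus_right)
qed

lemma inv_fourier_decay:
  "g \<in> schwartz \<Longrightarrow> \<exists>c. \<forall>x. \<bar>x\<bar> ^ a * norm (inv_fourier g x) \<le> c"
proof (induction a arbitrary: g)
  case 0
  have "norm (inv_fourier g x) \<le> (1 / (2 * pi)) * (\<integral>\<xi>. norm (g \<xi>) \<partial>lborel)" for x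
  proof -
    have "1 * norm (\<integral>\<xi>. exp (\<i> * of_real x * of_real \<xi>) * g \<xi> \<partial>lborel) \<le> (\<integral>\<xi>. norm (g \<xi>) \<partial>lborel)"
      by (rule norm_weighted_integral_le[OF integrable_exp_kernel[OF 0] schwartz_integrable_norm[OF 0]]) (simp_all add: norm_mult)
    then have "(1 / (2 * pi)) * norm (\<integral>\<xi>. exp (\<i> * of_real x * of_real \<xi>) * g \<xi> \<partial>lborel) \<le> (1 / (2 * pi)) * (\<integral>\<xi>. norm (g \<xi>) \<partial>lborel)"
      by (intro mult_left_mono) auto
    then show ?thesis by (simp add: inv_fourier_def norm_mult norm_divide)
  qed
  then show ?case by auto
next
  case (Suc a)
  obtain c where c: "\<And>x. \<bar>x\<bar> ^ a * norm (inv_fourier (nderiv 1 g) x) \<le> c"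
    using Suc.IH[OF schwartz_nderiv(1)[OF Suc.prems, of 1]] by blast
  have "\<bar>x\<bar> ^ Suc a * norm (inv_fourier g x) \<le> c" for x
  proof -
    have "norm (\<i> * of_real x * inv_fourier g x) = norm (inv_fourier (nderiv 1 g) x)"
      unfolding inv_fourier_times_id[OF Suc.prems] by (rule norm_minus_cancel)
    then have "\<bar>x\<bar> * norm (inv_fourier g x) = norm (inv_fourier (nderiv 1 g) x)" by (simp add: norm_mult)
    then show ?thesis using c[of x] by (simp only: power_Suc mult.assoc mult.left_commute[of "\<bar>x\<bar>"])
  qed
  then show ?case by blast
qed

text \<open>Differentiation and multiplication by the variable are exchanged, so smoothness and decay are too.\<close>

lemma inv_fourier_schwartz:
  assumes g: "g \<in> schwartz"
  shows "inv_fourier g \<in> schwartz" "nderiv b (inv_fourier g) = inv_fourier ((frequency ^^ b) g)"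
proof -
  have S: "(frequency ^^ b) g \<in> schwartz" for b by (induction b) (simp_all add: g schwartz_frequency)
  let ?F = "\<lambda>b. inv_fourier ((frequency ^^ b) g)"
  have d: "(?F b has_vector_derivative ?F (Suc b) x) (at x)" for b x
    using inv_fourier_has_derivative[OF S[of b], of x] by simp
  have bd: "\<exists>c. \<forall>x. (1 + \<bar>x\<bar>) ^ a * norm (?F b x) \<le> c" for a b
  proof -
    obtain c0 where c0: "\<And>x. \<bar>x\<bar> ^ 0 * norm (?F b x) \<le> c0" using inv_fourier_decay[OF S[of b], of 0] by blast
    obtain c1 where c1: "\<And>x. \<bar>x\<bar> ^ a * norm (?F b x) \<le> c1" using inv_fourier_decay[OF S[of b], of a] by blast
    have "(1 + \<bar>x\<bar>) ^ a * norm (?F b x) \<le> 2 ^ a * (c0 + c1)" for x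
    proof -
      have "(1 + \<bar>x\<bar>) ^ a * norm (?F b x) \<le> 2 ^ a * (1 + \<bar>x\<bar> ^ a) * norm (?F b x)"
        by (intro mult_right_mono one_plus_power_le) auto
      also have "\<dots> = 2 ^ a * (\<bar>x\<bar> ^ 0 * norm (?F b x) + \<bar>x\<bar> ^ a * norm (?F b x))"
        by (simp add: distrib_right)
      also have "\<dots> \<le> 2 ^ a * (c0 + c1)" by (intro mult_left_mono add_mono c0 c1) simp
      finally show ?thesis .
    qed
    then show ?thesis by blast
  qed
  show "inv_fourier g \<in> schwartz" by (rule schwartzI(1)[of ?F, OF _ d bd]) simp
  show "nderiv b (inv_fourier g) = ?F b" by (rule schwartzI(2)[of ?F, OF _ d bd]) simp
qed

lemma fubini_bounded_kernel:
  fixes a b :: "real \<Rightarrow> complex" and k :: "real \<Rightarrow> real \<Rightarrow> complex"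
  assumes a: "integrable lborel a" and b: "integrable lborel b"
    and k: "continuous_on UNIV (\<lambda>p. k (fst p) (snd p))" "\<And>x y. norm (k x y) \<le> 1"
  shows "(\<integral>x. (\<integral>y. k x y * a x * b y \<partial>lborel) \<partial>lborel) = (\<integral>y. (\<integral>x. k x y * a x * b y \<partial>lborel) \<partial>lborel)"
proof -
  have [measurable]: "a \<in> borel_measurable borel" "b \<in> borel_measurable borel"
    using borel_measurable_integrable[OF a] borel_measurable_integrable[OF b] by simp_all
  have [measurable]: "(\<lambda>p. k (fst p) (snd p)) \<in> borel_measurable (lborel \<Otimes>\<^sub>M lborel)"
    unfolding lborel_prod using borel_measurable_continuous_onI[OF k(1)] by simp
  have ab: "integrable (lborel \<Otimes>\<^sub>M lborel) (\<lambda>p. a (fst p) * b (snd p))"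
  proof (rule lborel_pair.Fubini_integrable)
    show "(\<lambda>p. a (fst p) * b (snd p)) \<in> borel_measurable (lborel \<Otimes>\<^sub>M lborel)" by measurable
    show "integrable lborel (\<lambda>x. \<integral>y. norm (a (fst (x, y)) * b (snd (x, y))) \<partial>lborel)"
      using integrable_mult_left[OF integrable_norm[OF a]] by (simp add: norm_mult)
    show "AE x in lborel. integrable lborel (\<lambda>y. a (fst (x, y)) * b (snd (x, y)))"
      using integrable_mult_right[OF b] by simp
  qed
  have "integrable (lborel \<Otimes>\<^sub>M lborel) (\<lambda>p. k (fst p) (snd p) * a (fst p) * b (snd p))"
  proof (rule Bochner_Integration.integrable_bound[OF ab])
    show "(\<lambda>p. k (fst p) (snd p) * a (fst p) * b (snd p)) \<in> borel_measurable (lborel \<Otimes>\<^sub>M lborel)" by measurable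
    have "norm (k x y * a x * b y) \<le> norm (a x * b y)" for x y
      using mult_right_mono[OF k(2)[of x y], of "norm (a x * b y)"] by (simp add: norm_mult mult.assoc)
    then show "AE p in lborel \<Otimes>\<^sub>M lborel. norm (k (fst p) (snd p) * a (fst p) * b (snd p)) \<le> norm (a (fst p) * b (snd p))" by simp
  qed
  then have "integrable (lborel \<Otimes>\<^sub>M lborel) (case_prod (\<lambda>x y. k x y * a x * b y))" by (simp add: case_prod_beta')
  from lborel_pair.Fubini_integral[OF this] show ?thesis by simp
qed

lemma gaussian_transform:
  "(\<integral>y. exp (\<i> * of_real t * of_real y) * of_real (std_normal_density y) \<partial>lborel) = of_real (exp (- t\<^sup>2 / 2))"
proof -
  have "of_real (exp (- t\<^sup>2 / 2)) = (\<integral>y. iexp (t * y) \<partial>density lborel (\<lambda>x. ennreal (std_normal_density x)))"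
    using fun_cong[OF char_std_normal_distribution, of t] by (simp add: char_def)
  also have "\<dots> = (\<integral>y. std_normal_density y *\<^sub>R iexp (t * y) \<partial>lborel)"
    by (subst integral_density) auto
  also have "\<dots> = (\<integral>y. exp (\<i> * of_real t * of_real y) * of_real (std_normal_density y) \<partial>lborel)"
    by (intro Bochner_Integration.integral_cong refl) (simp add: scaleR_conv_of_real mult_ac)
  finally show ?thesis by simp
qed

text \<open>Inserting a Gaussian factor makes the inversion integral absolutely convergent; letting it
  widen to the constant function yields the value at the origin.\<close>

lemma inversion_at_0:
  assumes g: "integrable lborel g" "continuous_on UNIV g" "\<And>x. norm (g x) \<le> M"
    and gi: "integrable lborel (inv_fourier g)"
  shows "(\<integral>y. inv_fourier g y \<partial>lborel) = g 0"
proof -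
  define n where "n x = std_normal_density x" for x
  have n0: "n 0 = 1 / sqrt (2 * pi)" by (simp add: n_def std_normal_density_def)
  have n_exp: "n x = n 0 * exp (- x\<^sup>2 / 2)" for x by (simp add: n_def std_normal_density_def)
  have n0pos: "0 < n 0" unfolding n0 by simp
  have nn: "0 \<le> n x" "n x \<le> n 0" for x
  proof -
    show "0 \<le> n x" by (simp add: n_def)
    have "n 0 * exp (- x\<^sup>2 / 2) \<le> n 0 * 1" using n0pos by (intro mult_left_mono) auto
    then show "n x \<le> n 0" using n_exp[of x] by simp
  qed
  have n0sq: "of_real (n 0) * of_real (n 0) = 1 / (2 * of_real pi :: complex)"
  proof -
    have "n 0 * n 0 = 1 / (2 * pi)" by (simp add: n0)
    then show ?thesis by (metis of_real_mult of_real_divide of_real_1 of_real_numeral)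
  qed
  have int_n: "integrable lborel n" unfolding n_def by simp
  have contn: "continuous_on UNIV n" unfolding n_def std_normal_density_def by (intro continuous_intros) auto
  have smooth: "(\<integral>y. of_real (n (\<epsilon> * y)) * inv_fourier g y \<partial>lborel) = of_real (n 0) * (\<integral>s. of_real (n s) * g (\<epsilon> * s) \<partial>lborel)"
    if \<epsilon>: "\<epsilon> > 0" for \<epsilon> :: real
  proof -
    have int_ne: "integrable lborel (\<lambda>y. of_real (n (\<epsilon> * y)) :: complex)"
      using lborel_integrable_real_affine[OF int_n, of \<epsilon> 0] \<epsilon> by (intro integrable_of_real) simp
    \<comment> \<open>the Gaussian is its own Fourier transform up to scaling\<close>
    have inner: "(\<integral>y. exp (\<i> * of_real y * of_real \<eta>) * of_real (n (\<epsilon> * y)) \<partial>lborel) = of_real (n (\<eta> / \<epsilon>) / (\<epsilon> * n 0))" for \<eta>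
    proof -
      have "(\<integral>y. exp (\<i> * of_real y * of_real \<eta>) * of_real (n (\<epsilon> * y)) \<partial>lborel) =
          \<bar>1 / \<epsilon>\<bar> *\<^sub>R (\<integral>s. exp (\<i> * of_real (0 + 1 / \<epsilon> * s) * of_real \<eta>) * of_real (n (\<epsilon> * (0 + 1 / \<epsilon> * s))) \<partial>lborel)"
        by (rule lborel_integral_real_affine) (use \<epsilon> in simp)
      also have "\<dots> = \<bar>1 / \<epsilon>\<bar> *\<^sub>R (\<integral>s. exp (\<i> * of_real (\<eta> / \<epsilon>) * of_real s) * of_real (std_normal_density s) \<partial>lborel)"
        using \<epsilon> by (simp add: n_def mult_ac)
      also have "\<dots> = \<bar>1 / \<epsilon>\<bar> *\<^sub>R of_real (exp (- (\<eta> / \<epsilon>)\<^sup>2 / 2))" by (simp only: gaussian_transform)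
      also have "exp (- (\<eta> / \<epsilon>)\<^sup>2 / 2) = n (\<eta> / \<epsilon>) / n 0" using n_exp[of "\<eta> / \<epsilon>"] n0pos by simp
      finally show ?thesis using \<epsilon> by (simp add: scaleR_conv_of_real)
    qed
    have "(\<integral>y. of_real (n (\<epsilon> * y)) * inv_fourier g y \<partial>lborel) =
        (\<integral>y. 1 / (2 * of_real pi) * (\<integral>\<eta>. exp (\<i> * of_real y * of_real \<eta>) * of_real (n (\<epsilon> * y)) * g \<eta> \<partial>lborel) \<partial>lborel)"
    proof (intro Bochner_Integration.integral_cong refl)
      fix y
      have "(\<integral>\<eta>. exp (\<i> * of_real y * of_real \<eta>) * of_real (n (\<epsilon> * y)) * g \<eta> \<partial>lborel) =
          (\<integral>\<eta>. of_real (n (\<epsilon> * y)) * (exp (\<i> * of_real y * of_real \<eta>) * g \<eta>) \<partial>lborel)" by (simp only: mult_ac)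
      also have "\<dots> = of_real (n (\<epsilon> * y)) * (\<integral>\<eta>. exp (\<i> * of_real y * of_real \<eta>) * g \<eta> \<partial>lborel)"
        by (rule integral_mult_right_zero)
      finally show "of_real (n (\<epsilon> * y)) * inv_fourier g y =
          1 / (2 * of_real pi) * (\<integral>\<eta>. exp (\<i> * of_real y * of_real \<eta>) * of_real (n (\<epsilon> * y)) * g \<eta> \<partial>lborel)"
        unfolding inv_fourier_def by (simp only: mult_ac)
    qed
    also have "\<dots> = 1 / (2 * of_real pi) * (\<integral>y. (\<integral>\<eta>. exp (\<i> * of_real y * of_real \<eta>) * of_real (n (\<epsilon> * y)) * g \<eta> \<partial>lborel) \<partial>lborel)"
      by (rule integral_mult_right_zero)
    also have "(\<integral>y. (\<integral>\<eta>. exp (\<i> * of_real y * of_real \<eta>) * of_real (n (\<epsilon> * y)) * g \<eta> \<partial>lborel) \<partial>lborel) =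
        (\<integral>\<eta>. (\<integral>y. exp (\<i> * of_real y * of_real \<eta>) * of_real (n (\<epsilon> * y)) * g \<eta> \<partial>lborel) \<partial>lborel)"
      by (rule fubini_bounded_kernel[OF int_ne g(1)]) (auto intro!: continuous_intros)
    also have "\<dots> = (\<integral>\<eta>. of_real (1 / (\<epsilon> * n 0)) * (of_real (n (\<eta> / \<epsilon>)) * g \<eta>) \<partial>lborel)"
      unfolding integral_mult_left_zero inner by simp
    also have "\<dots> = of_real (1 / (\<epsilon> * n 0)) * (\<integral>\<eta>. of_real (n (\<eta> / \<epsilon>)) * g \<eta> \<partial>lborel)"
      by (rule integral_mult_right_zero)
    also have "(\<integral>\<eta>. of_real (n (\<eta> / \<epsilon>)) * g \<eta> \<partial>lborel) = \<bar>\<epsilon>\<bar> *\<^sub>R (\<integral>s. of_real (n ((0 + \<epsilon> * s) / \<epsilon>)) * g (0 + \<epsilon> * s) \<partial>lborel)"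
      by (rule lborel_integral_real_affine) (use \<epsilon> in simp)
    also have "\<dots> = of_real \<epsilon> * (\<integral>s. of_real (n s) * g (\<epsilon> * s) \<partial>lborel)" using \<epsilon> by (simp add: scaleR_conv_of_real)
    finally have "(\<integral>y. of_real (n (\<epsilon> * y)) * inv_fourier g y \<partial>lborel) =
        (of_real (n 0) * of_real (n 0)) * (of_real (1 / (\<epsilon> * n 0)) * (of_real \<epsilon> * (\<integral>s. of_real (n s) * g (\<epsilon> * s) \<partial>lborel)))"
      unfolding n0sq .
    also have "\<dots> = of_real (n 0) * (\<integral>s. of_real (n s) * g (\<epsilon> * s) \<partial>lborel)" using \<epsilon> n0pos by simp
    finally show ?thesis .
  qed
  define \<epsilon> where "\<epsilon> j = 1 / real (Suc j)" for j
  have \<epsilon>: "\<epsilon> j > 0" for j by (simp add: \<epsilon>_def)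
  have \<epsilon>0: "\<epsilon> \<longlonglongrightarrow> 0" unfolding \<epsilon>_def using LIMSEQ_Suc[OF lim_1_over_n[where 'a = real]] by simp
  have L1: "(\<lambda>j. \<integral>y. of_real (n (\<epsilon> j * y)) * inv_fourier g y \<partial>lborel) \<longlonglongrightarrow> (\<integral>y. of_real (n 0) * inv_fourier g y \<partial>lborel)"
  proof (rule integral_dominated_convergence[where w = "\<lambda>y. n 0 * norm (inv_fourier g y)"])
    show "AE y in lborel. (\<lambda>j. of_real (n (\<epsilon> j * y)) * inv_fourier g y) \<longlonglongrightarrow> of_real (n 0) * inv_fourier g y"
    proof (rule AE_I2)
      fix y
      have "(\<lambda>j. \<epsilon> j * y) \<longlonglongrightarrow> 0" using tendsto_mult_left_zero[OF \<epsilon>0] .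
      then have "(\<lambda>j. n (\<epsilon> j * y)) \<longlonglongrightarrow> n 0"
        using contn by (intro continuous_on_tendsto_compose[OF contn]) auto
      then show "(\<lambda>j. of_real (n (\<epsilon> j * y)) * inv_fourier g y) \<longlonglongrightarrow> of_real (n 0) * inv_fourier g y"
        by (intro tendsto_intros)
    qed
    show "AE y in lborel. norm (of_real (n (\<epsilon> j * y)) * inv_fourier g y) \<le> n 0 * norm (inv_fourier g y)" for j
      using nn by (auto simp: norm_mult intro!: mult_right_mono AE_I2)
    have [measurable]: "inv_fourier g \<in> borel_measurable borel" using borel_measurable_integrable[OF gi] by simp
    have [measurable]: "n \<in> borel_measurable borel" by (rule borel_measurable_continuous_onI[OF contn])
    show "(\<lambda>y. of_real (n (\<epsilon> j * y)) * inv_fourier g y) \<in> borel_measurable lborel" for j by simp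
    show "(\<lambda>y. of_real (n 0) * inv_fourier g y) \<in> borel_measurable lborel" by simp
    show "integrable lborel (\<lambda>y. n 0 * norm (inv_fourier g y))" by (intro integrable_mult_right integrable_norm gi)
  qed
  have L2: "(\<lambda>j. \<integral>s. of_real (n s) * g (\<epsilon> j * s) \<partial>lborel) \<longlonglongrightarrow> (\<integral>s. of_real (n s) * g 0 \<partial>lborel)"
  proof (rule integral_dominated_convergence[where w = "\<lambda>s. n s * M"])
    show "AE s in lborel. (\<lambda>j. of_real (n s) * g (\<epsilon> j * s)) \<longlonglongrightarrow> of_real (n s) * g 0"
    proof (rule AE_I2)
      fix s
      have "(\<lambda>j. \<epsilon> j * s) \<longlonglongrightarrow> 0" using tendsto_mult_left_zero[OF \<epsilon>0] .
      then have "(\<lambda>j. g (\<epsilon> j * s)) \<longlonglongrightarrow> g 0"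
        by (intro continuous_on_tendsto_compose[OF g(2)]) auto
      then show "(\<lambda>j. of_real (n s) * g (\<epsilon> j * s)) \<longlonglongrightarrow> of_real (n s) * g 0"
        by (intro tendsto_intros)
    qed
    show "AE s in lborel. norm (of_real (n s) * g (\<epsilon> j * s)) \<le> n s * M" for j
      using nn g(3) by (auto simp: norm_mult intro!: mult_left_mono AE_I2)
    have [measurable]: "g \<in> borel_measurable borel" "n \<in> borel_measurable borel"
      by (rule borel_measurable_continuous_onI[OF g(2)] borel_measurable_continuous_onI[OF contn])+
    show "(\<lambda>s. of_real (n s) * g (\<epsilon> j * s)) \<in> borel_measurable lborel" for j by simp
    show "(\<lambda>s. of_real (n s) * g 0) \<in> borel_measurable lborel" by simp
    show "integrable lborel (\<lambda>s. n s * M)" by (intro integrable_mult_left int_n)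
  qed
  have ng: "(\<integral>s. of_real (n s) * g 0 \<partial>lborel) = g 0"
  proof -
    have "(\<integral>s. of_real (n s) \<partial>lborel) = (of_real (\<integral>s. n s \<partial>lborel) :: complex)" by (rule integral_of_real[OF int_n])
    also have "\<dots> = 1" unfolding n_def by simp
    finally show ?thesis unfolding integral_mult_left_zero by simp
  qed
  have lim: "(\<lambda>j. \<integral>y. of_real (n (\<epsilon> j * y)) * inv_fourier g y \<partial>lborel) \<longlonglongrightarrow> of_real (n 0) * g 0"
    unfolding smooth[OF \<epsilon>] using tendsto_mult[OF tendsto_const L2, of "of_real (n 0)"] unfolding ng .
  from LIMSEQ_unique[OF L1 lim] have "of_real (n 0) * (\<integral>y. inv_fourier g y \<partial>lborel) = of_real (n 0) * g 0"
    unfolding integral_mult_right_zero .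
  then show ?thesis using n0pos by simp
qed

text \<open>A translation of \<open>g\<close> modulates its transform and moves \<open>\<xi>\<close> to the origin.\<close>

lemma inversion:
  assumes g: "g \<in> schwartz"
  shows "(\<integral>y. exp (- (\<i> * of_real y * of_real \<xi>)) * inv_fourier g y \<partial>lborel) = g \<xi>"
proof -
  define h where "h \<eta> = g (\<eta> + \<xi>)" for \<eta>
  have hE: "inv_fourier h y = exp (- (\<i> * of_real y * of_real \<xi>)) * inv_fourier g y" for y
  proof -
    have "(\<integral>\<eta>. exp (\<i> * of_real y * of_real \<eta>) * h \<eta> \<partial>lborel) =
        \<bar>1\<bar> *\<^sub>R (\<integral>\<eta>. exp (\<i> * of_real y * of_real (- \<xi> + 1 * \<eta>)) * h (- \<xi> + 1 * \<eta>) \<partial>lborel)"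
      by (rule lborel_integral_real_affine) simp
    also have "\<dots> = (\<integral>\<eta>. exp (- (\<i> * of_real y * of_real \<xi>)) * (exp (\<i> * of_real y * of_real \<eta>) * g \<eta>) \<partial>lborel)"
    proof -
      have "exp (\<i> * of_real y * of_real (- \<xi> + 1 * \<eta>)) = exp (- (\<i> * of_real y * of_real \<xi>)) * exp (\<i> * of_real y * of_real \<eta>)" for \<eta>
        unfolding exp_add[symmetric] by (simp add: algebra_simps)
      then show ?thesis by (simp add: h_def mult.assoc)
    qed
    also have "\<dots> = exp (- (\<i> * of_real y * of_real \<xi>)) * (\<integral>\<eta>. exp (\<i> * of_real y * of_real \<eta>) * g \<eta> \<partial>lborel)"
      by (rule integral_mult_right_zero)
    finally show ?thesis unfolding inv_fourier_def by (simp only: mult_ac)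
  qed
  obtain M where M: "\<And>x. norm (g x) \<le> M" using schwartz_bound[OF g, of 0 0] by auto
  have "(\<integral>y. inv_fourier h y \<partial>lborel) = h 0"
  proof (rule inversion_at_0)
    show "integrable lborel h"
      using lborel_integrable_real_affine[OF schwartz_integrable_self[OF g], of 1 \<xi>] by (simp add: h_def[abs_def] add.commute)
    show "continuous_on UNIV h" unfolding h_def
      by (rule continuous_on_compose2[OF schwartz_continuous[OF g, of UNIV 0, simplified]]) (auto intro!: continuous_intros)
    show "norm (h x) \<le> M" for x by (simp add: h_def M)
    show "integrable lborel (inv_fourier h)" unfolding hE
      by (rule schwartz_integrable[OF inv_fourier_schwartz(1)[OF g], of _ 1 0])
        (auto intro!: continuous_intros simp: norm_exp_eq_Re)
  qed
  then show ?thesis unfolding hE by (simp add: h_def)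
qed

text \<open>Insert the integral for the first factor and exchange the integrations; the inner integral is an
  inversion integral for \<open>h\<close>.\<close>

lemma inv_fourier_convolution:
  assumes g: "g \<in> schwartz" "h \<in> schwartz"
  shows "(\<integral>t. inv_fourier g (x - t) * inv_fourier h t \<partial>lborel) = inv_fourier (\<lambda>\<xi>. g \<xi> * h \<xi>) x"
proof -
  let ?k = "\<lambda>t \<xi>. exp (\<i> * of_real (x - t) * of_real \<xi>)"
  have "(\<integral>t. inv_fourier g (x - t) * inv_fourier h t \<partial>lborel) =
      (\<integral>t. 1 / (2 * of_real pi) * (\<integral>\<xi>. ?k t \<xi> * inv_fourier h t * g \<xi> \<partial>lborel) \<partial>lborel)"
  proof (intro Bochner_Integration.integral_cong refl)
    fix t
    have "(\<integral>\<xi>. ?k t \<xi> * inv_fourier h t * g \<xi> \<partial>lborel) = (\<integral>\<xi>. inv_fourier h t * (?k t \<xi> * g \<xi>) \<partial>lborel)"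
      by (simp only: mult_ac)
    also have "\<dots> = inv_fourier h t * (\<integral>\<xi>. ?k t \<xi> * g \<xi> \<partial>lborel)" by (rule integral_mult_right_zero)
    finally show "inv_fourier g (x - t) * inv_fourier h t = 1 / (2 * of_real pi) * (\<integral>\<xi>. ?k t \<xi> * inv_fourier h t * g \<xi> \<partial>lborel)"
      unfolding inv_fourier_def[of g] by (simp only: mult_ac)
  qed
  also have "\<dots> = 1 / (2 * of_real pi) * (\<integral>t. (\<integral>\<xi>. ?k t \<xi> * inv_fourier h t * g \<xi> \<partial>lborel) \<partial>lborel)"
    by (rule integral_mult_right_zero)
  also have "(\<integral>t. (\<integral>\<xi>. ?k t \<xi> * inv_fourier h t * g \<xi> \<partial>lborel) \<partial>lborel) =
      (\<integral>\<xi>. (\<integral>t. ?k t \<xi> * inv_fourier h t * g \<xi> \<partial>lborel) \<partial>lborel)"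
  proof (rule fubini_bounded_kernel)
    show "integrable lborel (inv_fourier h)" by (intro schwartz_integrable_self inv_fourier_schwartz g)
    show "integrable lborel g" by (intro schwartz_integrable_self g)
    show "norm (?k t \<xi>) \<le> 1" for t \<xi> by (simp only: norm_exp_kernel)
  qed (intro continuous_intros)
  also have "\<dots> = (\<integral>\<xi>. exp (\<i> * of_real x * of_real \<xi>) * (g \<xi> * h \<xi>) \<partial>lborel)"
  proof (intro Bochner_Integration.integral_cong refl)
    fix \<xi>
    have "?k t \<xi> = exp (\<i> * of_real x * of_real \<xi>) * exp (- (\<i> * of_real t * of_real \<xi>))" for t
      unfolding exp_add[symmetric] by (simp add: algebra_simps)
    then have "(\<integral>t. ?k t \<xi> * inv_fourier h t * g \<xi> \<partial>lborel) =
        (\<integral>t. (exp (\<i> * of_real x * of_real \<xi>) * g \<xi>) * (exp (- (\<i> * of_real t * of_real \<xi>)) * inv_fourier h t) \<partial>lborel)"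
      by (simp only: mult_ac)
    also have "\<dots> = (exp (\<i> * of_real x * of_real \<xi>) * g \<xi>) * h \<xi>"
      unfolding integral_mult_right_zero inversion[OF g(2)] ..
    finally show "(\<integral>t. ?k t \<xi> * inv_fourier h t * g \<xi> \<partial>lborel) = exp (\<i> * of_real x * of_real \<xi>) * (g \<xi> * h \<xi>)"
      by (simp only: mult.assoc)
  qed
  finally show ?thesis unfolding inv_fourier_def .
qed

lemma inv_fourier_dilate:
  assumes "\<sigma> > 0"
  shows "inv_fourier (\<lambda>\<xi>. g (\<xi> / \<sigma>)) x = of_real \<sigma> * inv_fourier g (\<sigma> * x)"
proof -
  have "(\<integral>\<xi>. exp (\<i> * of_real x * of_real \<xi>) * g (\<xi> / \<sigma>) \<partial>lborel) =
      \<bar>\<sigma>\<bar> *\<^sub>R (\<integral>\<xi>. exp (\<i> * of_real x * of_real (0 + \<sigma> * \<xi>)) * g ((0 + \<sigma> * \<xi>) / \<sigma>) \<partial>lborel)"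
    by (rule lborel_integral_real_affine) (use assms in simp)
  also have "\<dots> = of_real \<sigma> * (\<integral>\<xi>. exp (\<i> * of_real (\<sigma> * x) * of_real \<xi>) * g \<xi> \<partial>lborel)"
    using assms by (simp add: scaleR_conv_of_real mult_ac)
  finally show ?thesis unfolding inv_fourier_def by (simp only: mult_ac)
qed

section \<open>Bernstein's inequality\<close>

text \<open>If the multiplier \<open>\<kappa>\<close> is one wherever \<open>m\<close> lives, then differentiating the \<open>m\<close>-part of \<open>u\<close> is a
  convolution with a fixed integrable kernel, the derivative of the inverse transform of \<open>\<kappa>\<close>.\<close>

lemma bernstein:
  assumes u: "tempered_distribution u" and m: "m \<in> schwartz" and \<kappa>: "\<kappa> \<in> schwartz"
    and eq: "\<And>\<xi>. \<kappa> \<xi> * m \<xi> = m \<xi>"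
    and A: "\<And>x. norm (Defs.convolution (inv_fourier m) u x) \<le> A"
  shows "norm (Defs.convolution (inv_fourier (frequency m)) u x) \<le> A * (\<integral>t. norm (inv_fourier (frequency \<kappa>) t) \<partial>lborel)"
proof -
  define K where "K = inv_fourier (frequency \<kappa>)"
  have K: "K \<in> schwartz" unfolding K_def by (intro inv_fourier_schwartz schwartz_frequency \<kappa>)
  have mi: "inv_fourier m \<in> schwartz" by (rule inv_fourier_schwartz(1)[OF m])
  note Kx = schwartz_reflect(1)[OF K, of x]
  have "inv_fourier (frequency m) (x - y) = (\<integral>t. inv_fourier m (t - y) * K (x - t) \<partial>lborel)" for y
  proof -
    have "(\<integral>t. inv_fourier m (t - y) * K (x - t) \<partial>lborel) =
        \<bar>1\<bar> *\<^sub>R (\<integral>s. inv_fourier m ((y + 1 * s) - y) * K (x - (y + 1 * s)) \<partial>lborel)"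
      by (rule lborel_integral_real_affine) simp
    also have "\<dots> = (\<integral>s. K ((x - y) - s) * inv_fourier m s \<partial>lborel)"
      by (simp add: mult.commute diff_diff_eq)
    also have "\<dots> = inv_fourier (\<lambda>\<xi>. frequency \<kappa> \<xi> * m \<xi>) (x - y)"
      unfolding K_def by (rule inv_fourier_convolution[OF schwartz_frequency[OF \<kappa>] m])
    also have "(\<lambda>\<xi>. frequency \<kappa> \<xi> * m \<xi>) = frequency m"
      by (simp add: frequency_def fun_eq_iff mult.assoc eq)
    finally show ?thesis ..
  qed
  then have "Defs.convolution (inv_fourier (frequency m)) u x = (\<integral>t. Defs.convolution (inv_fourier m) u t * K (x - t) \<partial>lborel)"
    using tempered_interchange(3)[OF u mi Kx] by (simp add: Defs.convolution_def)
  moreover have "1 * norm (\<integral>t. Defs.convolution (inv_fourier m) u t * K (x - t) \<partial>lborel) \<le> (\<integral>t. A * norm (K (x - t)) \<partial>lborel)"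
  proof (rule norm_weighted_integral_le[OF tempered_interchange(2)[OF u mi Kx]])
    show "integrable lborel (\<lambda>t. A * norm (K (x - t)))" by (intro integrable_mult_right schwartz_integrable_norm Kx)
    show "1 * norm (Defs.convolution (inv_fourier m) u t * K (x - t)) \<le> A * norm (K (x - t))" for t
      unfolding norm_mult mult_1 by (intro mult_right_mono A) simp
  qed simp
  moreover have "(\<integral>t. A * norm (K (x - t)) \<partial>lborel) = A * (\<integral>t. norm (K t) \<partial>lborel)"
  proof -
    have "(\<integral>t. norm (K t) \<partial>lborel) = \<bar>- 1\<bar> *\<^sub>R (\<integral>t. norm (K (x + (- 1) * t)) \<partial>lborel)"
      by (rule lborel_integral_real_affine) simp
    then show ?thesis by simp
  qed
  ultimately show ?thesis unfolding K_def mult_1 by (simp only:)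
qed

lemma frequency_power_multiplier:
  "(\<And>\<xi>. \<kappa> \<xi> * m \<xi> = m \<xi>) \<Longrightarrow> \<kappa> \<xi> * (frequency ^^ l) m \<xi> = (frequency ^^ l) m \<xi>"
proof (induction l arbitrary: \<xi>)
  case (Suc l)
  have "\<kappa> \<xi> * (frequency ^^ Suc l) m \<xi> = \<i> * (of_real \<xi> * (\<kappa> \<xi> * (frequency ^^ l) m \<xi>))"
    by (simp add: frequency_def mult_ac)
  also have "\<dots> = (frequency ^^ Suc l) m \<xi>" unfolding Suc.IH[OF Suc.prems] by (simp add: frequency_def)
  finally show ?case .
qed simp

lemma schwartz_frequency_power: "g \<in> schwartz \<Longrightarrow> (frequency ^^ l) g \<in> schwartz"
  by (induction l) (simp_all add: schwartz_frequency)

text \<open>The multiplier \<open>\<kappa>\<close> is still one on the frequencies of the derivatives, so the inequality can be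
  iterated; the constant grows geometrically.\<close>

lemma bernstein_power:
  assumes u: "tempered_distribution u" and m: "m \<in> schwartz" and \<kappa>: "\<kappa> \<in> schwartz"
    and eq: "\<And>\<xi>. \<kappa> \<xi> * m \<xi> = m \<xi>"
    and A: "\<And>x. norm (Defs.convolution (inv_fourier m) u x) \<le> A"
  shows "norm (Defs.convolution (inv_fourier ((frequency ^^ l) m)) u x) \<le>
     A * (\<integral>t. norm (inv_fourier (frequency \<kappa>) t) \<partial>lborel) ^ l"
proof (induction l arbitrary: x)
  case (Suc l)
  have "norm (Defs.convolution (inv_fourier (frequency ((frequency ^^ l) m))) u x) \<le>
      A * (\<integral>t. norm (inv_fourier (frequency \<kappa>) t) \<partial>lborel) ^ l * (\<integral>t. norm (inv_fourier (frequency \<kappa>) t) \<partial>lborel)"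
    by (rule bernstein[OF u schwartz_frequency_power[OF m] \<kappa> frequency_power_multiplier[of \<kappa> m] Suc.IH]) (rule eq)
  then show ?case by (simp add: mult_ac)
qed (simp add: A)

section \<open>Functions with exponentially bounded derivatives\<close>

text \<open>The remainder after \<open>n + 1\<close> terms is at most \<open>A (B \<bar>x - a\<bar>)\<^sup>n\<^sup>+\<^sup>1 / n!\<close>.\<close>

lemma taylor_sums:
  fixes F :: "nat \<Rightarrow> real \<Rightarrow> complex"
  assumes d: "\<And>l x. (F l has_vector_derivative F (Suc l) x) (at x)"
    and b: "\<And>l x. norm (F l x) \<le> A * B ^ l" and B: "0 \<le> B"
  shows "(\<lambda>l. F l a / fact l * of_real (x - a) ^ l) sums F 0 x"
  unfolding sums_def_le
proof (rule LIM_zero_cancel, rule Lim_null_comparison)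
  have A: "0 \<le> A" using order_trans[OF norm_ge_zero b[of 0 0]] by simp
  show "\<forall>\<^sub>F n in sequentially. norm ((\<Sum>l\<le>n. F l a / fact l * of_real (x - a) ^ l) - F 0 x) \<le>
      (A * B * \<bar>x - a\<bar>) * ((B * \<bar>x - a\<bar>) ^ n / fact n)"
  proof (intro always_eventually allI)
    fix n
    define P where "P t = (\<Sum>l\<le>n. F l t * ((of_real x - of_real t) ^ l / fact l))" for t
    have "norm (P a - P x) \<le> (A * B ^ Suc n * (\<bar>x - a\<bar> ^ n / fact n)) * \<bar>a - x\<bar>"
    proof (rule vector_derivative_bound[of "closed_segment x a" _ "\<lambda>t. F (Suc n) t * ((of_real x - of_real t) ^ n / fact n)"])
      fix t assume t: "t \<in> closed_segment x a"
      show "(P has_vector_derivative F (Suc n) t * ((of_real x - of_real t) ^ n / fact n)) (at t within closed_segment x a)"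
        unfolding P_def by (rule has_vector_derivative_at_within[OF taylor_sum_derivative[where F = F, OF d]])
      have "norm (of_real x - of_real t :: complex) = \<bar>x - t\<bar>" by (simp flip: of_real_diff)
      moreover have "\<bar>x - t\<bar> \<le> \<bar>x - a\<bar>" using segment_bound1[OF t] by (simp add: abs_minus_commute)
      ultimately have "norm ((of_real x - of_real t) ^ n / fact n :: complex) \<le> \<bar>x - a\<bar> ^ n / fact n"
        by (simp add: norm_divide norm_power divide_right_mono power_mono)
      then show "norm (F (Suc n) t * ((of_real x - of_real t) ^ n / fact n)) \<le> A * B ^ Suc n * (\<bar>x - a\<bar> ^ n / fact n)"
        unfolding norm_mult using A B by (intro mult_mono b) auto
    qed auto
    moreover have "P x = F 0 x"
    proof -
      have "P x = (\<Sum>l\<le>n. if l = 0 then F 0 x else 0)" unfolding P_def by (intro sum.cong refl) (auto simp: power_0_left)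
      then show ?thesis by simp
    qed
    moreover have "P a = (\<Sum>l\<le>n. F l a / fact l * of_real (x - a) ^ l)" unfolding P_def by simp
    moreover have "(A * B ^ Suc n * (\<bar>x - a\<bar> ^ n / fact n)) * \<bar>a - x\<bar> = (A * B * \<bar>x - a\<bar>) * ((B * \<bar>x - a\<bar>) ^ n / fact n)"
      by (simp add: power_mult_distrib abs_minus_commute)
    ultimately show "norm ((\<Sum>l\<le>n. F l a / fact l * of_real (x - a) ^ l) - F 0 x) \<le>
      (A * B * \<bar>x - a\<bar>) * ((B * \<bar>x - a\<bar>) ^ n / fact n)" by (simp only:)
  qed
  have "(\<lambda>n. (B * \<bar>x - a\<bar>) ^ n / fact n) \<longlonglongrightarrow> 0"
    using summable_LIMSEQ_zero[OF summable_exp[of "B * \<bar>x - a\<bar>"]] by (simp add: divide_inverse mult.commute)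
  from tendsto_mult_right_zero[OF this]
  show "(\<lambda>n. (A * B * \<bar>x - a\<bar>) * ((B * \<bar>x - a\<bar>) ^ n / fact n)) \<longlonglongrightarrow> 0" .
qed

text \<open>Such functions satisfy the analytic criterion at the scale \<open>h = 1 / (12 B)\<close>.\<close>

lemma exponential_type_criterion:
  "\<exists>C\<ge>0. \<forall>r F A B I. finite I \<and> card I = Suc d \<and> 0 < B \<and>
     (\<forall>l x. (F l has_vector_derivative F (Suc l) x) (at x)) \<and> (\<forall>l x. norm (F l x) \<le> A * B ^ l) \<longrightarrow>
     tensor_bound r I (\<lambda>s. ddset (F 0) (s ` I)) (C * (A * B ^ d))"
proof -
  obtain C where C: "0 \<le> C \<and> (\<forall>r g A h I. finite I \<and> card I = Suc d \<and> 0 \<le> A \<and> 0 < h \<and>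
     (\<forall>a. \<bar>a\<bar> < r + h \<longrightarrow> (\<exists>c. (\<forall>l. norm (c l) \<le> A / (12 * h) ^ l) \<and>
       (\<forall>x\<in>{-r..r}. \<bar>x - a\<bar> \<le> 6 * h \<longrightarrow> (\<lambda>l. c l * of_real (x - a) ^ l) sums g x))) \<longrightarrow>
     tensor_bound r I (\<lambda>s. ddset g (s ` I)) (C * (A / h ^ d)))"
    using analytic_criterion[of d] ..
  have "tensor_bound r I (\<lambda>s. ddset (F 0) (s ` I)) ((C * 12 ^ d) * (A * B ^ d))"
    if I: "finite I" "card I = Suc d" and B: "0 < B"
      and d: "\<And>l x. (F l has_vector_derivative F (Suc l) x) (at x)"
      and b: "\<And>l x. norm (F l x) \<le> A * B ^ l" for r F A B I
  proof -
    have A: "0 \<le> A" using order_trans[OF norm_ge_zero b[of 0 0]] by simp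
    define h where "h = 1 / (12 * B)"
    have h: "0 < h" "12 * h = 1 / B" using B by (auto simp: h_def)
    have "tensor_bound r I (\<lambda>s. ddset (F 0) (s ` I)) (C * (A / h ^ d))"
    proof (rule conjunct2[OF C, rule_format], intro conjI allI impI)
      fix a assume "\<bar>a\<bar> < r + h"
      have "norm (F l a / fact l) \<le> A / (12 * h) ^ l" for l
      proof -
        have "norm (F l a / fact l) \<le> A * B ^ l" using norm_div_fact_le[of "F l a" l] b[of l a] by linarith
        also have "\<dots> = A / (12 * h) ^ l" unfolding h(2) by (simp add: power_divide)
        finally show ?thesis .
      qed
      then show "\<exists>c. (\<forall>l. norm (c l) \<le> A / (12 * h) ^ l) \<and>
          (\<forall>x\<in>{- r..r}. \<bar>x - a\<bar> \<le> 6 * h \<longrightarrow> (\<lambda>l. c l * of_real (x - a) ^ l) sums F 0 x)"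
        using taylor_sums[of F A B, OF d b] B by (intro exI[of _ "\<lambda>l. F l a / fact l"]) auto
    qed (use I A h in auto)
    also have "C * (A / h ^ d) = (C * 12 ^ d) * (A * B ^ d)"
      by (simp add: h_def power_divide power_mult_distrib)
    finally show ?thesis .
  qed
  then show ?thesis using conjunct1[OF C] by (intro exI[of _ "C * 12 ^ d"]) auto
qed

lemma series_continuous:
  fixes f :: "nat \<Rightarrow> real \<Rightarrow> complex"
  assumes c: "\<And>i. continuous_on UNIV (f i)" and b: "\<And>i x. norm (f i x) \<le> M i" and M: "summable M"
  shows "continuous_on UNIV (\<lambda>x. \<Sum>i. f i x)"
proof (rule uniform_limit_theorem[OF _ Weierstrass_m_test[OF _ M]])
  show "\<forall>\<^sub>F n in sequentially. continuous_on UNIV (\<lambda>x. \<Sum>i<n. f i x)"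
    by (intro always_eventually allI continuous_on_sum c)
qed (use b in auto)

lemma series_has_vector_derivative:
  fixes f f' :: "nat \<Rightarrow> real \<Rightarrow> complex"
  assumes d: "\<And>i x. (f i has_vector_derivative f' i x) (at x)"
    and b: "\<And>i x. norm (f i x) \<le> M i" and b': "\<And>i x. norm (f' i x) \<le> M i" and M: "summable M"
  shows "((\<lambda>x. \<Sum>i. f i x) has_vector_derivative (\<Sum>i. f' i x)) (at x)"
proof -
  have S: "summable (\<lambda>i. f i x)" for x by (rule summable_comparison_test'[OF M]) (rule b)
  have "\<exists>g. \<forall>x\<in>UNIV. (\<lambda>i. f i x) sums g x \<and> (g has_derivative (\<lambda>h. h *\<^sub>R (\<Sum>i. f' i x))) (at x within UNIV)"
  proof (rule has_derivative_series[where x = 0 and l = "\<Sum>i. f i 0"])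
    show "(f i has_derivative (\<lambda>h. h *\<^sub>R f' i x)) (at x within UNIV)" for i x
      using d[of i x] by (simp add: has_vector_derivative_def)
    show "(\<lambda>i. f i 0) sums (\<Sum>i. f i 0)" by (rule summable_sums[OF S])
    fix e :: real assume e: "0 < e"
    have "uniform_limit UNIV (\<lambda>n x. \<Sum>i<n. f' i x) (\<lambda>x. \<Sum>i. f' i x) sequentially"
      by (rule Weierstrass_m_test[OF _ M]) (rule b')
    then have "\<forall>\<^sub>F n in sequentially. \<forall>x\<in>UNIV. dist (\<Sum>i<n. f' i x) (\<Sum>i. f' i x) < e"
      using e by (simp add: uniform_limit_iff)
    then show "\<forall>\<^sub>F n in sequentially. \<forall>x\<in>UNIV. \<forall>h. norm ((\<Sum>i<n. h *\<^sub>R f' i x) - h *\<^sub>R (\<Sum>i. f' i x)) \<le> e * norm h"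
    proof eventually_elim
      case (elim n)
      show ?case
      proof (intro ballI allI)
        fix x h
        have "norm ((\<Sum>i<n. h *\<^sub>R f' i x) - h *\<^sub>R (\<Sum>i. f' i x)) = norm h * norm ((\<Sum>i<n. f' i x) - (\<Sum>i. f' i x))"
          unfolding scaleR_sum_right[symmetric] scaleR_diff_right[symmetric] by simp
        also have "\<dots> \<le> norm h * e" using elim[rule_format, of x] by (intro mult_left_mono) (simp_all add: dist_norm)
        finally show "norm ((\<Sum>i<n. h *\<^sub>R f' i x) - h *\<^sub>R (\<Sum>i. f' i x)) \<le> e * norm h" by (simp only: mult.commute)
      qed
    qed
  qed auto
  then obtain g where g: "\<And>x. (\<lambda>i. f i x) sums g x" "\<And>x. (g has_derivative (\<lambda>h. h *\<^sub>R (\<Sum>i. f' i x))) (at x)" by auto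
  have "(\<lambda>x. \<Sum>i. f i x) = g" using g(1) by (auto simp: sums_iff)
  with g(2)[of x] show ?thesis by (simp add: has_vector_derivative_def)
qed

section \<open>Littlewood-Paley decomposition\<close>

text \<open>A nonempty open set is not a null set, so an essential bound of a continuous function is a bound.\<close>

lemma norm_le_Linf_norm:
  assumes c: "continuous_on UNIV g" and fin: "Linf_norm g < \<infinity>"
  shows "norm (g x) \<le> enn2real (Linf_norm g)"
proof (rule ccontr)
  define L where "L = enn2real (Linf_norm g)"
  assume "\<not> norm (g x) \<le> enn2real (Linf_norm g)"
  then have x: "x \<in> {x. L < norm (g x)}" by (simp add: L_def)
  have op: "open {x. L < norm (g x)}"
    by (intro open_Collect_less continuous_intros c)
  have "Linf_norm g = ennreal L" using fin by (simp add: L_def)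
  with esssup_AE[of "\<lambda>x. ennreal (norm (g x))" lborel] have "AE x in lborel. ennreal (norm (g x)) \<le> ennreal L"
    by (simp add: Linf_norm_def)
  then have "AE x in lborel. x \<notin> {x. L < norm (g x)}"
  proof eventually_elim
    case (elim x)
    have "0 \<le> L" by (simp add: L_def)
    with elim show ?case by (simp add: ennreal_le_iff)
  qed
  then have "{x. L < norm (g x)} \<in> null_sets lborel"
    using op by (subst (asm) AE_iff_null_sets[symmetric]) auto
  then have "negligible {x. L < norm (g x)}"
    unfolding negligible_iff_null_sets by (rule null_sets_completionI)
  with open_not_negligible[OF op] x show False by blast
qed

text \<open>All derivatives vanish outside \<open>[-2, 2]\<close>.\<close>

lemma cutoff_schwartz:
  assumes \<eta>: "cutoff \<eta>"
  shows "(\<lambda>\<xi>. of_real (\<eta> \<xi>)) \<in> schwartz"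
proof (rule schwartzI(1)[of "\<lambda>n \<xi>. of_real (nderiv n \<eta> \<xi>)"])
  have Ck: "\<eta> \<in> Ck n" for n using \<eta> by (simp add: cutoff_def Cinf_def)
  have d: "(nderiv n \<eta> has_vector_derivative nderiv (Suc n) \<eta> x) (at x)" for n x
    by (rule Ck_has_derivative[OF Ck[of "Suc n"]]) simp
  show "((\<lambda>\<xi>. of_real (nderiv n \<eta> \<xi>)) has_vector_derivative (of_real (nderiv (Suc n) \<eta> x) :: complex)) (at x)" for n x
    by (rule has_vector_derivative_of_real) (use d in \<open>simp add: has_real_derivative_iff_has_vector_derivative\<close>)
  have op: "open {x::real. 2 < \<bar>x\<bar>}" by (intro open_Collect_less continuous_intros)
  have zero: "2 < \<bar>x\<bar> \<Longrightarrow> nderiv n \<eta> x = 0" for n x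
  proof (induction n arbitrary: x)
    case 0
    have "closure {\<xi>. \<eta> \<xi> \<noteq> 0} \<subseteq> {-2..2}" using \<eta> by (simp add: cutoff_def)
    then have "{\<xi>. \<eta> \<xi> \<noteq> 0} \<subseteq> {-2..2}" using closure_subset by (rule subset_trans[rotated])
    with 0 show ?case by (auto simp: subset_iff)
  next
    case (Suc n)
    have "(nderiv n \<eta> has_vector_derivative 0) (at x)"
    proof (rule has_vector_derivative_transform_within_open[OF _ op])
      show "((\<lambda>_. 0) has_vector_derivative 0) (at x)" by simp
      show "x \<in> {x. 2 < \<bar>x\<bar>}" using Suc.prems by simp
      show "0 = nderiv n \<eta> y" if "y \<in> {x. 2 < \<bar>x\<bar>}" for y using Suc.IH[of y] that by simp
    qed
    then show ?case unfolding nderiv_Suc by (rule vector_derivative_at)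
  qed
  fix a b
  have cont: "continuous_on {-2..2} (\<lambda>x. (1 + \<bar>x\<bar>) ^ a * norm (of_real (nderiv b \<eta> x) :: complex))"
    by (intro continuous_intros continuous_on_subset[OF Ck_continuous_nderiv[OF Ck[of b] order_refl]]) auto
  obtain y where y: "\<And>x. x \<in> {-2..2} \<Longrightarrow> (1 + \<bar>x\<bar>) ^ a * norm (of_real (nderiv b \<eta> x) :: complex) \<le>
      (1 + \<bar>y\<bar>) ^ a * norm (of_real (nderiv b \<eta> y) :: complex)"
    using continuous_attains_sup[OF compact_Icc _ cont] by fastforce
  have "(1 + \<bar>x\<bar>) ^ a * norm (of_real (nderiv b \<eta> x) :: complex) \<le> (1 + \<bar>y\<bar>) ^ a * norm (of_real (nderiv b \<eta> y) :: complex)" for x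
  proof (cases "x \<in> {-2..2}")
    case False
    then have "nderiv b \<eta> x = 0" by (intro zero) auto
    then show ?thesis by simp
  qed (rule y)
  then show "\<exists>c. \<forall>x. (1 + \<bar>x\<bar>) ^ a * norm (of_real (nderiv b \<eta> x) :: complex) \<le> c" by blast
qed simp

lemma Ck_Suc_subset_holder: "Ck (Suc k) \<subseteq> Ck_holder_loc k 1"
proof
  fix f :: "real \<Rightarrow> complex" assume f: "f \<in> Ck (Suc k)"
  have "\<exists>c. \<forall>x\<in>{-r..r}. \<forall>y\<in>{-r..r}. norm (nderiv k f x - nderiv k f y) \<le> c * \<bar>x - y\<bar> powr 1" if r: "0 < r" for r
  proof -
    have "bounded (nderiv (Suc k) f ` {-r..r})"
      by (intro compact_imp_bounded compact_continuous_image continuous_on_subset[OF Ck_continuous_nderiv[OF f order_refl]]) auto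
    then obtain c where "\<forall>y \<in> nderiv (Suc k) f ` {-r..r}. norm y \<le> c" unfolding bounded_iff ..
    then have c: "\<And>x. x \<in> {-r..r} \<Longrightarrow> norm (nderiv (Suc k) f x) \<le> c" by blast
    have "norm (nderiv k f x - nderiv k f y) \<le> c * \<bar>x - y\<bar>" if "x \<in> {-r..r}" "y \<in> {-r..r}" for x y
      by (rule vector_derivative_bound[OF _ _ c that])
        (auto intro: has_vector_derivative_at_within[OF Ck_has_derivative[OF f]])
    then show ?thesis by (intro exI[of _ c]) (auto simp: powr_one)
  qed
  with Ck_mono[OF f, of k] show "f \<in> Ck_holder_loc k 1" by (simp add: Ck_holder_loc_def)
qed

lemma inv_fourier_cmult: "inv_fourier (\<lambda>\<xi>. c * g \<xi>) x = c * inv_fourier g x"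
proof -
  have "(\<integral>\<xi>. exp (\<i> * of_real x * of_real \<xi>) * (c * g \<xi>) \<partial>lborel) = (\<integral>\<xi>. c * (exp (\<i> * of_real x * of_real \<xi>) * g \<xi>) \<partial>lborel)"
    by (simp only: mult_ac)
  also have "\<dots> = c * (\<integral>\<xi>. exp (\<i> * of_real x * of_real \<xi>) * g \<xi> \<partial>lborel)" by (rule integral_mult_right_zero)
  finally show ?thesis unfolding inv_fourier_def by (simp only: mult_ac)
qed

lemma inv_fourier_diff:
  "g \<in> schwartz \<Longrightarrow> h \<in> schwartz \<Longrightarrow> inv_fourier (\<lambda>\<xi>. g \<xi> - h \<xi>) x = inv_fourier g x - inv_fourier h x"
  unfolding inv_fourier_def right_diff_distrib
  by (subst Bochner_Integration.integral_diff) (simp_all add: integrable_exp_kernel right_diff_distrib)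

text \<open>The \<open>L\<^sup>1\<close> norm of the Bernstein kernel grows linearly with the frequency scale.\<close>

lemma bernstein_kernel_dilate:
  assumes \<sigma>: "\<sigma> > 0"
  shows "(\<integral>x. norm (inv_fourier (frequency (\<lambda>\<xi>. g (\<xi> / \<sigma>))) x) \<partial>lborel) =
     \<sigma> * (\<integral>x. norm (inv_fourier (frequency g) x) \<partial>lborel)"
proof -
  have "frequency (\<lambda>\<xi>. g (\<xi> / \<sigma>)) = (\<lambda>\<xi>. of_real \<sigma> * frequency g (\<xi> / \<sigma>))"
    using \<sigma> by (simp add: frequency_def fun_eq_iff)
  then have "inv_fourier (frequency (\<lambda>\<xi>. g (\<xi> / \<sigma>))) x = of_real \<sigma> * (of_real \<sigma> * inv_fourier (frequency g) (\<sigma> * x))" for x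
    by (simp only: inv_fourier_cmult inv_fourier_dilate[OF \<sigma>])
  then have "(\<integral>x. norm (inv_fourier (frequency (\<lambda>\<xi>. g (\<xi> / \<sigma>))) x) \<partial>lborel) =
      (\<integral>x. \<sigma> * \<sigma> * norm (inv_fourier (frequency g) (\<sigma> * x)) \<partial>lborel)"
    using \<sigma> by (simp add: norm_mult mult.assoc)
  also have "\<dots> = \<sigma> * (\<sigma> * (\<integral>x. norm (inv_fourier (frequency g) (\<sigma> * x)) \<partial>lborel))"
    by (simp only: integral_mult_right_zero mult.assoc)
  also have "\<sigma> * (\<integral>x. norm (inv_fourier (frequency g) (\<sigma> * x)) \<partial>lborel) = (\<integral>x. norm (inv_fourier (frequency g) x) \<partial>lborel)"
    using lborel_integral_real_affine[of \<sigma> "\<lambda>x. norm (inv_fourier (frequency g) x)" 0] \<sigma> by simp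
  finally show ?thesis .
qed

text \<open>The pieces of positive index carry the high frequencies; the shift by one starts their
  enumeration at \<open>0\<close>.\<close>

lemma besov_summable:
  assumes "besov_norm \<eta> k u < \<infinity>"
  defines "L \<equiv> \<lambda>i::nat. Linf_norm (Defs.convolution (inv_fourier (\<lambda>\<xi>. of_real (dyadic \<eta> (int (Suc i)) \<xi>))) u)"
  shows "L i < \<infinity>" "summable (\<lambda>i. 2 ^ (Suc i * k) * enn2real (L i))"
proof -
  define T where "T j = ennreal (2 powi (j * int k)) *
        Linf_norm (Defs.convolution (inv_fourier (\<lambda>\<xi>. of_real (dyadic \<eta> j \<xi>))) u)" for j
  have T: "T (int (Suc i)) = ennreal (2 ^ (Suc i * k)) * L i" for i
    unfolding T_def L_def by (simp only: flip: of_nat_mult) (simp only: power_int_of_nat)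
  have fin: "infsum T UNIV < \<infinity>" using assms(1) unfolding besov_norm_def T_def by simp
  have le: "sum T F \<le> infsum T UNIV" if "finite F" for F
    by (subst nonneg_infsum_complete) (use that in \<open>auto intro: SUP_upper\<close>)
  have Lfin: "L i < \<infinity>" for i
  proof -
    have "T j \<le> infsum T UNIV" for j using le[of "{j}"] by simp
    then have "T (int (Suc i)) < \<infinity>" using fin by (rule order.strict_trans1)
    then have "ennreal (2 ^ (Suc i * k)) * L i < \<infinity>" unfolding T .
    then show ?thesis by (auto simp: ennreal_mult_less_top)
  qed
  then show "L i < \<infinity>" .
  have T': "T (int (Suc i)) = ennreal (2 ^ (Suc i * k) * enn2real (L i))" for i
    unfolding T using Lfin[of i] by (simp add: ennreal_mult)
  show "summable (\<lambda>i. 2 ^ (Suc i * k) * enn2real (L i))"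
  proof (rule summableI_nonneg_bounded)
    fix n
    have "ennreal (\<Sum>i<n. 2 ^ (Suc i * k) * enn2real (L i)) = (\<Sum>i<n. T (int (Suc i)))"
      unfolding T' by (rule sum_ennreal[symmetric]) simp
    also have "\<dots> = sum T ((\<lambda>i. int (Suc i)) ` {..<n})"
      by (subst sum.reindex) (auto simp: inj_on_def)
    also have "\<dots> \<le> infsum T UNIV" by (rule le) simp
    also have "\<dots> = ennreal (enn2real (infsum T UNIV))" using fin by simp
    finally show "(\<Sum>i<n. 2 ^ (Suc i * k) * enn2real (L i)) \<le> enn2real (infsum T UNIV)"
      by (simp add: ennreal_le_iff)
  qed simp
qed

lemma dyadic_eq: "dyadic \<eta> (int (Suc i)) \<xi> = \<eta> (\<xi> / 2 ^ Suc i) - \<eta> (\<xi> / 2 ^ i)"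
proof -
  have "(2::real) powi (- int (Suc i)) = 1 / 2 ^ Suc i" "(2::real) powi (- int (Suc i) + 1) = 1 / 2 ^ i"
    by (simp_all add: power_int_minus divide_inverse del: power_Suc of_nat_Suc) (simp add: power_int_minus)
  then show ?thesis by (simp only: dyadic_def times_divide_eq_left mult_1)
qed

text \<open>The piece lives on \<open>\<bar>\<xi>\<bar> \<le> 2\<^sup>i\<^sup>+\<^sup>2\<close>, where the cutoff of the next larger scale is one.\<close>

lemma dyadic_multiplier:
  assumes \<eta>: "cutoff \<eta>"
  shows "\<eta> (\<xi> / 2 ^ Suc (Suc i)) * dyadic \<eta> (int (Suc i)) \<xi> = dyadic \<eta> (int (Suc i)) \<xi>"
proof (cases "\<bar>\<xi>\<bar> \<le> 2 ^ Suc (Suc i)")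
  case True
  then have "\<xi> / 2 ^ Suc (Suc i) \<in> {-1..1}" by (simp add: abs_le_iff pos_divide_le_eq pos_le_divide_eq)
  then show ?thesis using \<eta> unfolding cutoff_def by simp
next
  case False
  have zero: "\<eta> x = 0" if "2 < \<bar>x\<bar>" for x
  proof -
    have "{\<xi>. \<eta> \<xi> \<noteq> 0} \<subseteq> {-2..2}" using \<eta> closure_subset unfolding cutoff_def by (metis subset_trans)
    with that show ?thesis by (auto simp: subset_iff)
  qed
  have big: "2 * 2 ^ j < \<bar>\<xi>\<bar>" if "j \<le> Suc i" for j
  proof -
    have "(2::real) ^ Suc j \<le> 2 ^ Suc (Suc i)" using that by (intro power_increasing) auto
    with False show ?thesis by simp
  qed
  have vanish: "\<eta> (\<xi> / 2 ^ j) = 0" if "j \<le> Suc i" for j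
    by (rule zero) (use big[OF that] in \<open>simp add: abs_divide pos_less_divide_eq\<close>)
  show ?thesis unfolding dyadic_eq using vanish[of "Suc i"] vanish[of i] by simp
qed

lemma convolution_diff:
  assumes "tempered_distribution u" "\<psi> \<in> schwartz" "\<phi> \<in> schwartz"
  shows "Defs.convolution (\<lambda>x. \<psi> x - \<phi> x) u x = Defs.convolution \<psi> u x - Defs.convolution \<phi> u x"
  unfolding Defs.convolution_def by (intro tempered_diff schwartz_reflect assms)

text \<open>The low frequency part of \<open>u\<close> is smooth. By Bernstein's inequality and the criterion for functions of
  exponential type the dyadic pieces are summable, both in \<open>C\<^sup>k\<close> and as tensor expansions.\<close>

theorem besov_represented:
  assumes k: "1 \<le> k" and \<eta>: "cutoff \<eta>" and u: "u \<in> besov \<eta> k"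
  shows "\<exists>f \<in> VC k. represents f u"
proof -
  have temp: "tempered_distribution u" and bes: "besov_norm \<eta> k u < \<infinity>" using u by (auto simp: besov_def)
  define e where "e \<xi> = (of_real (\<eta> \<xi>) :: complex)" for \<xi>
  have e: "e \<in> schwartz" unfolding e_def by (rule cutoff_schwartz[OF \<eta>])
  define E where "E j \<xi> = e (\<xi> / 2 ^ j)" for j :: nat and \<xi>
  have E: "E j \<in> schwartz" for j
    using schwartz_dilate[OF e, of "1 / 2 ^ j"] by (simp add: E_def[abs_def])
  define m where "m i \<xi> = (of_real (dyadic \<eta> (int (Suc i)) \<xi>) :: complex)" for i \<xi>
  have m_eq: "m i = (\<lambda>\<xi>. E (Suc i) \<xi> - E i \<xi>)" for i
    by (rule ext) (simp only: m_def E_def e_def dyadic_eq of_real_diff)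
  have m: "m i \<in> schwartz" for i unfolding m_eq by (intro schwartz_diff E)
  have mult: "E (Suc (Suc i)) \<xi> * m i \<xi> = m i \<xi>" for i \<xi>
    using dyadic_multiplier[OF \<eta>, of \<xi> i] unfolding E_def e_def m_def of_real_mult[symmetric] by (simp only:)
  \<comment> \<open>adding one makes the constant at least one, so its powers increase\<close>
  define b where "b = (\<integral>x. norm (inv_fourier (frequency e) x) \<partial>lborel) + 1"
  have b0: "0 \<le> (\<integral>x. norm (inv_fourier (frequency e) x) \<partial>lborel)" by (rule integral_nonneg_AE) simp
  then have b1: "1 \<le> b" by (simp add: b_def)
  define a where "a i = enn2real (Linf_norm (Defs.convolution (inv_fourier (m i)) u))" for i
  have a0: "0 \<le> a i" for i by (simp add: a_def)
  define G where "G i l = Defs.convolution (inv_fourier ((frequency ^^ l) (m i))) u" for i l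
  have mi: "inv_fourier (m i) \<in> schwartz" for i by (rule inv_fourier_schwartz(1)[OF m])
  have G_eq: "G i l = Defs.convolution (nderiv l (inv_fourier (m i))) u" for i l
    by (simp add: G_def inv_fourier_schwartz(2)[OF m])
  have dG: "(G i l has_vector_derivative G i (Suc l) x) (at x)" for i l x
    unfolding G_eq by (rule convolution_has_derivative[OF temp mi])
  have cG: "continuous_on UNIV (G i l)" for i l
    by (intro continuous_at_imp_continuous_on ballI has_vector_derivative_continuous[OF dG])
  have Lm: "Linf_norm (G i 0) < \<infinity>" "a i = enn2real (Linf_norm (G i 0))" for i
    using besov_summable(1)[OF bes, of i] by (simp_all add: G_def a_def m_def[abs_def])
  have G0: "norm (G i 0 x) \<le> a i" for i x
    unfolding Lm(2) by (rule norm_le_Linf_norm[OF cG Lm(1)])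
  define B where "B i = 2 ^ Suc (Suc i) * b" for i :: nat
  have B0: "0 < B i" for i using b1 by (simp add: B_def)
  have Gb: "norm (G i l x) \<le> a i * B i ^ l" for i l x
  proof -
    have "norm (G i l x) \<le> a i * (\<integral>t. norm (inv_fourier (frequency (E (Suc (Suc i)))) t) \<partial>lborel) ^ l"
      unfolding G_def by (rule bernstein_power[OF temp m E mult]) (use G0 in \<open>simp add: G_def\<close>)
    also have "(\<integral>t. norm (inv_fourier (frequency (E (Suc (Suc i)))) t) \<partial>lborel) =
        2 ^ Suc (Suc i) * (\<integral>x. norm (inv_fourier (frequency e) x) \<partial>lborel)"
      unfolding E_def[abs_def] by (rule bernstein_kernel_dilate) simp
    also have "a i * (2 ^ Suc (Suc i) * (\<integral>x. norm (inv_fourier (frequency e) x) \<partial>lborel)) ^ l \<le> a i * B i ^ l"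
      unfolding B_def by (intro mult_left_mono power_mono mult_nonneg_nonneg b0 a0) (simp_all add: b_def b0)
    finally show ?thesis .
  qed
  define P where "P i = 2 ^ (Suc i * k) * a i" for i
  have P0: "0 \<le> P i" for i by (simp add: P_def a0)
  have sumP: "summable P"
    using besov_summable(2)[OF bes] by (simp add: P_def[abs_def] a_def m_def[abs_def])
  \<comment> \<open>bounds the ratio of the derivatives up to order \<open>k\<close> to the summands of the Besov norm\<close>
  define M where "M = (2 * b) ^ k"
  have M0: "0 \<le> M" using b1 by (simp add: M_def)
  have aB: "a i * B i ^ l \<le> M * P i" if l: "l \<le> k" for i l
  proof -
    have "B i = 2 ^ Suc i * (2 * b)" by (simp add: B_def)
    then have "B i ^ l = 2 ^ (Suc i * l) * (2 * b) ^ l" by (simp only: power_mult_distrib power_mult)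
    also have "\<dots> \<le> 2 ^ (Suc i * k) * M"
      unfolding M_def using b1 l by (intro mult_mono power_increasing) auto
    finally have "a i * B i ^ l \<le> a i * (2 ^ (Suc i * k) * M)" by (intro mult_left_mono a0)
    then show ?thesis by (simp add: P_def mult_ac)
  qed
  have Gl: "norm (G i l x) \<le> M * P i" if "l \<le> k" for i l x
    using Gb[of i l x] aB[OF that, of i] by linarith
  have sumMP: "summable (\<lambda>i. M * P i)" by (intro summable_mult sumP)
  have sumG: "summable (\<lambda>i. G i 0 x)" for x
    by (rule summable_comparison_test'[OF sumMP]) (use Gl in auto)
  define S where "S N = Defs.convolution (inv_fourier (E N)) u" for N
  have Ei: "inv_fourier (E N) \<in> schwartz" for N by (rule inv_fourier_schwartz(1)[OF E])
  have S_step: "S (Suc N) x = S N x + G N 0 x" for N x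
  proof -
    have "inv_fourier (m N) = (\<lambda>x. inv_fourier (E (Suc N)) x - inv_fourier (E N) x)"
      unfolding m_eq by (rule ext) (rule inv_fourier_diff[OF E E])
    then have "G N 0 x = S (Suc N) x - S N x"
      unfolding G_def S_def by (simp add: convolution_diff[OF temp Ei Ei])
    then show ?thesis by simp
  qed
  have S_sum: "S N x = S 0 x + (\<Sum>i<N. G i 0 x)" for N x by (induction N) (simp_all add: S_step)
  define f where "f x = S 0 x + (\<Sum>i. G i 0 x)" for x
  have tail: "(\<lambda>i. G (i + N) 0 x) sums (f x - S N x)" for N x
    using sums_split_initial_segment[OF summable_sums[OF sumG[of x]], of N]
    by (simp add: f_def S_sum[of N x])
  have S_Ck: "S N \<in> Ck j" for N j unfolding S_def by (rule convolution_Ck(1)[OF temp Ei])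
  have f_Ck: "f \<in> Ck k"
  proof (rule CkI[of "\<lambda>l x. nderiv l (S 0) x + (\<Sum>i. G i l x)"])
    show "(\<lambda>x. nderiv 0 (S 0) x + (\<Sum>i. G i 0 x)) = f" by (simp add: f_def[abs_def])
    show "((\<lambda>x. nderiv l (S 0) x + (\<Sum>i. G i l x)) has_vector_derivative
        nderiv (Suc l) (S 0) x + (\<Sum>i. G i (Suc l) x)) (at x)" if "l < k" for l x
    proof (rule has_vector_derivative_add)
      show "(nderiv l (S 0) has_vector_derivative nderiv (Suc l) (S 0) x) (at x)"
        by (rule Ck_has_derivative[OF S_Ck that])
      show "((\<lambda>x. \<Sum>i. G i l x) has_vector_derivative (\<Sum>i. G i (Suc l) x)) (at x)"
        by (rule series_has_vector_derivative[OF dG _ _ sumMP]) (use Gl that in auto)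
    qed
    show "continuous_on UNIV (\<lambda>x. nderiv k (S 0) x + (\<Sum>i. G i k x))"
      by (intro continuous_on_add Ck_continuous_nderiv[OF S_Ck order_refl] series_continuous[OF cG Gl sumMP]) simp
  qed
  have approx_S: "poly_approximable k (S N)" for N
  proof -
    obtain k' where k': "k = Suc k'" using k by (cases k) auto
    show ?thesis unfolding k' by (rule holder_poly_approximable[of _ _ 1]) (use S_Ck Ck_Suc_subset_holder in auto)
  qed
  have approx_f: "poly_approximable k f"
  proof (rule poly_approximable_close)
    fix r \<delta> :: real assume \<delta>: "0 < \<delta>"
    obtain C where C: "\<And>d. 0 \<le> C d" "\<And>d r F A B I. finite I \<Longrightarrow> card I = Suc d \<Longrightarrow> 0 < B \<Longrightarrow>
       (\<And>l x. (F l has_vector_derivative F (Suc l) x) (at x)) \<Longrightarrow> (\<And>l x. norm (F l x) \<le> A * B ^ l) \<Longrightarrow>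
       tensor_bound r I (\<lambda>s. ddset (F 0) (s ` I)) (C d * (A * B ^ d))"
      using exponential_type_criterion by metis
    define D where "D = (\<Sum>d\<le>k. C d) * M"
    have bound: "tensor_bound r {..d} (\<lambda>s. ddset (G i 0) (s ` {..d})) (D * P i)" if d: "d \<le> k" for d i
    proof (rule tensor_bound_mono)
      show "tensor_bound r {..d} (\<lambda>s. ddset (G i 0) (s ` {..d})) (C d * (a i * B i ^ d))"
        by (rule C(2)[OF _ _ B0 dG Gb]) auto
      have "C d \<le> (\<Sum>d\<le>k. C d)" by (rule member_le_sum) (use d C(1) in auto)
      then have "C d * (a i * B i ^ d) \<le> (\<Sum>d\<le>k. C d) * (M * P i)"
        by (rule mult_mono[OF _ aB[OF d]]) (use C(1) a0[of i] B0[of i] in \<open>auto intro!: sum_nonneg\<close>)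
      then show "C d * (a i * B i ^ d) \<le> D * P i" by (simp add: D_def mult.assoc)
    qed
    have sumDP: "summable (\<lambda>i. D * P i)" by (intro summable_mult sumP)
    obtain N where N: "\<And>n. N \<le> n \<Longrightarrow> norm (\<Sum>i. D * P (i + n)) < \<delta>"
      using suminf_exist_split[OF \<delta> sumDP] by blast
    have "tensor_bound r {..d} (\<lambda>s. ddset (\<lambda>x. f x - S N x) (s ` {..d})) \<delta>" if d: "d \<le> k" for d
    proof (rule tensor_bound_mono)
      show "tensor_bound r {..d} (\<lambda>s. ddset (\<lambda>x. f x - S N x) (s ` {..d})) (\<Sum>i. D * P (i + N))"
      proof (rule tensor_bound_sums[OF bound[OF d]])
        show "summable (\<lambda>i. D * P (i + N))" by (rule summable_ignore_initial_segment[OF sumDP])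
        show "(\<lambda>i. ddset (G (i + N) 0) (s ` {..d})) sums ddset (\<lambda>x. f x - S N x) (s ` {..d})" for s
          by (rule ddset_sums) (rule tail)
      qed
      show "(\<Sum>i. D * P (i + N)) \<le> \<delta>" using N[of N] by simp
    qed
    with approx_S[of N] show "\<exists>g. poly_approximable k g \<and>
        (\<forall>i\<le>k. tensor_bound r {..i} (\<lambda>s. ddset (\<lambda>x. f x - g x) (s ` {..i})) \<delta>)" by blast
  qed
  have f_VC: "f \<in> VC k" by (rule VC_criterion[OF f_Ck approx_f])
  have tail_bound: "norm (f x - S N x) \<le> (\<Sum>i. M * P (i + N))" for N x
  proof -
    have s: "summable (\<lambda>i. M * P (i + N))" by (rule summable_ignore_initial_segment[OF sumMP])
    have "norm (\<Sum>i. G (i + N) 0 x) \<le> (\<Sum>i. M * P (i + N))"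
      by (rule norm_suminf_le[OF _ s]) (rule Gl, simp)
    then show ?thesis using tail[of N x] by (simp add: sums_iff)
  qed
  have "represents f u"
    unfolding represents_def
  proof (intro ballI conjI)
    fix \<phi> assume \<phi>: "\<phi> \<in> schwartz"
    have cf: "continuous_on UNIV f" using Ck_continuous_nderiv[OF f_Ck, of 0] by simp
    have intS: "integrable lborel (\<lambda>x. S N x * \<phi> x)" for N
      unfolding S_def by (rule tempered_interchange(2)[OF temp Ei \<phi>])
    have cS: "continuous_on UNIV (S N)" for N using Ck_continuous_nderiv[OF S_Ck, of 0 0 N] by simp
    have intD: "integrable lborel (\<lambda>x. (f x - S N x) * \<phi> x)" for N
      by (rule schwartz_integrable[OF \<phi>, of _ "\<Sum>i. M * P (i + N)" 0])
        (use tail_bound in \<open>auto intro!: continuous_on_diff cf cS\<close>)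
    show int: "integrable lborel (\<lambda>x. f x * \<phi> x)"
      using Bochner_Integration.integrable_add[OF intD[of 0] intS[of 0]] by (simp add: left_diff_distrib)
    define \<psi> where "\<psi> = inv_fourier e"
    have \<psi>: "\<psi> \<in> schwartz" unfolding \<psi>_def by (rule inv_fourier_schwartz(1)[OF e])
    have "\<eta> 0 = 1" using \<eta> by (simp add: cutoff_def)
    then have one: "(\<integral>x. \<psi> x \<partial>lborel) = 1" using inversion[OF e, of 0] by (simp add: \<psi>_def e_def)
    have S_eq: "S N = Defs.convolution (\<lambda>x. of_real (2 ^ N) * \<psi> (2 ^ N * x)) u" for N
    proof -
      have "inv_fourier (E N) = (\<lambda>x. of_real (2 ^ N) * \<psi> (2 ^ N * x))"
        unfolding E_def[abs_def] \<psi>_def by (rule ext) (rule inv_fourier_dilate, simp)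
      then show ?thesis by (simp only: S_def)
    qed
    obtain Q where Q: "\<And>\<sigma>. 1 \<le> \<sigma> \<Longrightarrow>
        norm ((\<integral>x. Defs.convolution (\<lambda>x. of_real \<sigma> * \<psi> (\<sigma> * x)) u x * \<phi> x \<partial>lborel) - u \<phi>) \<le> Q / \<sigma>"
      using approximate_identity[OF temp \<psi> one \<phi>] by blast
    define W where "W = (\<integral>x. norm (\<phi> x) \<partial>lborel)"
    \<comment> \<open>the partial sums converge uniformly, and as an approximate identity they tend to \<open>u\<close>\<close>
    have le: "norm ((\<integral>x. f x * \<phi> x \<partial>lborel) - u \<phi>) \<le> (\<Sum>i. M * P (i + N)) * W + Q / 2 ^ N" for N
    proof -
      have "(\<integral>x. (f x - S N x) * \<phi> x \<partial>lborel) = (\<integral>x. f x * \<phi> x \<partial>lborel) - (\<integral>x. S N x * \<phi> x \<partial>lborel)"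
        unfolding left_diff_distrib by (rule Bochner_Integration.integral_diff[OF int intS])
      moreover have "1 * norm (\<integral>x. (f x - S N x) * \<phi> x \<partial>lborel) \<le> (\<integral>x. (\<Sum>i. M * P (i + N)) * norm (\<phi> x) \<partial>lborel)"
      proof (rule norm_weighted_integral_le[OF intD])
        show "integrable lborel (\<lambda>x. (\<Sum>i. M * P (i + N)) * norm (\<phi> x))"
          by (intro integrable_mult_right schwartz_integrable_norm \<phi>)
        show "1 * norm ((f x - S N x) * \<phi> x) \<le> (\<Sum>i. M * P (i + N)) * norm (\<phi> x)" for x
          unfolding norm_mult mult_1 by (intro mult_right_mono tail_bound) simp
      qed simp
      moreover have "(\<integral>x. (\<Sum>i. M * P (i + N)) * norm (\<phi> x) \<partial>lborel) = (\<Sum>i. M * P (i + N)) * W"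
        unfolding W_def by (rule integral_mult_right_zero)
      moreover have "norm ((\<integral>x. S N x * \<phi> x \<partial>lborel) - u \<phi>) \<le> Q / 2 ^ N"
        unfolding S_eq by (rule Q) simp
      ultimately have 1: "norm ((\<integral>x. f x * \<phi> x \<partial>lborel) - (\<integral>x. S N x * \<phi> x \<partial>lborel)) \<le> (\<Sum>i. M * P (i + N)) * W"
        and 2: "norm ((\<integral>x. S N x * \<phi> x \<partial>lborel) - u \<phi>) \<le> Q / 2 ^ N" by (simp_all only: mult_1)
      show ?thesis by (rule order_trans[OF norm_diff_triangle_le[OF 1 2] order_refl])
    qed
    have "(\<lambda>N. (\<Sum>i. M * P (i + N)) * W + Q / 2 ^ N) \<longlonglongrightarrow> 0 * W + 0"
    proof (intro tendsto_intros)
      show "(\<lambda>N. \<Sum>i. M * P (i + N)) \<longlonglongrightarrow> 0" 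
      proof (rule LIMSEQ_I)
        fix r :: real assume "0 < r"
        then show "\<exists>N. \<forall>n\<ge>N. norm ((\<Sum>i. M * P (i + n)) - 0) < r"
          using suminf_exist_split[OF _ sumMP, of r] by simp
      qed
      show "(\<lambda>N. Q / 2 ^ N) \<longlonglongrightarrow> 0" by real_asymp
    qed
    then have "norm ((\<integral>x. f x * \<phi> x \<partial>lborel) - u \<phi>) \<le> 0 * W + 0"
      by (rule LIMSEQ_le_const) (intro exI[of _ 0] allI impI le)
    then show "u \<phi> = (\<integral>x. f x * \<phi> x \<partial>lborel)" by simp
  qed
  with f_VC show ?thesis by blast
qed

theorem theorem1p12:
  fixes k :: nat
  assumes "k \<ge> 1"
  shows "(\<forall>\<eta>. cutoff \<eta> \<longrightarrow> (\<forall>u \<in> besov \<eta> k. \<exists>f \<in> VC k. represents f u)) \<and>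
    (\<forall>\<epsilon>>0. Ck_holder_loc k \<epsilon> \<subseteq> VC k)"
proof (intro conjI allI impI ballI subsetI)
  show "\<exists>f \<in> VC k. represents f u" if "cutoff \<eta>" "u \<in> besov \<eta> k" for \<eta> u
    using besov_represented[OF assms that] .
  show "f \<in> VC k" if \<epsilon>: "0 < \<epsilon>" and f: "f \<in> Ck_holder_loc k \<epsilon>" for \<epsilon> f
  proof (rule VC_criterion)
    show "f \<in> Ck k" using f by (simp add: Ck_holder_loc_def)
    obtain k' where k': "k = Suc k'" using assms by (cases k) auto
    show "poly_approximable k f" using f unfolding k' by (rule holder_poly_approximable[OF _ \<epsilon>])
  qed
qed

end
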